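(* Let $d\in\mathbb N$ and $\ell\in\{0,\ldots,d-1\}$ be both odd. Then $\mathbb E f_\ell(\mathcal V_d)=q\,\pi^{d-\ell}$ for some rational number $q$.
   Context: Let $P_1,P_2,\ldots$ be the points of a homogeneous Poisson point process in $\mathbb R^d$ with intensity $1$. The typical Poisson–Voronoi cell is $\mathcal V_d=\{x\in\mathbb R^d:\|x\|\le\|x-P_j\|\text{ for all }j\}$. $f_\ell(P)$ denotes the number of $\ell$-dimensional faces of a polytope $P$. *)

theory Defs
  imports "HOL-Probability.Probability"
begin

definition num_faces :: "nat \<Rightarrow> ('a::euclidean_space) set \<Rightarrow> nat" where
  "num_faces k P = card {F. F face_of P \<and> aff_dim F = int k}"

definition poisson_process :: "'w measure \<Rightarrow> ('w \<Rightarrow> ('a::euclidean_space) set) \<Rightarrow> bool" where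
  "poisson_process M Phi \<longleftrightarrow>
     prob_space M \<and>
     (\<forall>w\<in>space M. \<forall>B. bounded B \<longrightarrow> finite (Phi w \<inter> B)) \<and>
     (\<forall>B. B \<in> sets lborel \<and> bounded B \<longrightarrow>
        (\<lambda>w. card (Phi w \<inter> B)) \<in> measurable M (count_space UNIV) \<and>
        (\<forall>k::nat. measure M {w\<in>space M. card (Phi w \<inter> B) = k}
                 = (measure lborel B) ^ k / fact k * exp (- measure lborel B))) \<and>
     (\<forall>(I::nat set) B. finite I \<and> (\<forall>i\<in>I. B i \<in> sets lborel \<and> bounded (B i)) \<and>
        disjoint_family_on B I \<longrightarrow>
        prob_space.indep_vars M (\<lambda>_. count_space UNIV) (\<lambda>i w. card (Phi w \<inter> B i)) I)"

text \<open>The typical Poisson-Voronoi cell: the Voronoi cell of the origin w.r.t. the points of Phi.\<close>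
definition voronoi_cell0 :: "('a::euclidean_space) set \<Rightarrow> 'a set" where
  "voronoi_cell0 X = {x. \<forall>p\<in>X. norm x \<le> norm (x - p)}"

end

(* Almost surely every face of the cell Z has a unique vertex that is highest in a fixed generic
   direction u, and a vertex is the centre of an empty ball through the origin and d points. The
   mean number of l-faces is therefore an integral over d-tuples of points, one summand for each
   set J of l coordinates, in which the coefficients with index in J of u in the basis given by the
   tuple are positive. Averaging over a Gaussian u and repeatedly changing variables gives, up to a
   constant not depending on J, the integral of psi(t)^l (psi(t) + psi(-t))^(d-l) / (1 + t^2),
   where psi(t) is the integral over b, y > 0 of y^(d-1) exp(- (b^2 + y^2)/2 + i t b y).

   With d = 2 j + 1 and t = sinh x one finds psi(t) = const S(pi/2 + i x) / cosh(x)^d, where S is the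
   odd antiderivative of sin^(2j). Since S(w + pi) - S(w) is a rational multiple of pi, the sum
   psi(t) + psi(-t) contributes a rational multiple of pi, and what remains is the integral of
   S(pi/2 + i x)^l / cosh(x)^(d^2 + 1). For odd l it equals pi times the residue at 0 of
   S^l / sin^(d^2 + 1), by integrating around the strip |Re z| < pi/2, and that residue is rational.
   The constant is determined by the case l = d, in which the mean is 1. *)
theory Submission
  imports Defs "HOL-Complex_Analysis.Complex_Analysis"
begin

no_notation fps_nth (infixl "$" 75)

section \<open>Lebesgue measure on tuples\<close>

text \<open>Only ratios of means are computed. All integrals before the Fourier step live in
  \<open>ennreal\<close>, so the factor common to all l may a priori be 0 or infinite; the mean 1 at
  l = d excludes both. Since the residue evaluation is thus applied to l and to d, both must be odd.
  Oddness of l makes S^l / sin^(d^2 + 1) an odd function, and then the two vertical sides of the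
  contour add up instead of cancelling; oddness of d makes the exponent d^2 + 1 and the power d - 1
  = 2 j even.

  A random direction helps because the mean does not depend on u. Let the d points be the
  reflections of the origin in the hyperplanes G_i . x = s_i. With s = G x the centre of the ball is
  x, and with u = G^T a the positivity conditions read a_i > 0 for i in J, which factorizes over
  coordinates. The remaining integral over G depends on x through a power of its norm, and on a
  through the quadratic form I + a a^T. After these are removed, the coordinates are coupled only
  through an inner product b . y inside exp(-|b . y|), whose Fourier transform 1 / (1 + t^2) is the
  density in the final integral.\<close>

lemma vec_lambda_measurable [measurable]:
  "(\<lambda>f. vec_lambda f :: 'a::euclidean_space ^ 'n::finite) \<in> Pi\<^sub>M UNIV (\<lambda>_. lborel) \<rightarrow>\<^sub>M borel"
proof (subst borel_measurable_euclidean_space, rule ballI)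
  fix b :: "'a^'n" assume "b \<in> Basis"
  then obtain i u where b: "b = axis i u" by (auto simp: Basis_vec_def)
  have [measurable]: "(\<lambda>f :: 'n \<Rightarrow> 'a. f i) \<in> Pi\<^sub>M UNIV (\<lambda>_. lborel) \<rightarrow>\<^sub>M borel"
    using measurable_component_singleton[of i UNIV "\<lambda>_. lborel :: 'a measure"] by simp
  show "(\<lambda>f. vec_lambda f \<bullet> b) \<in> borel_measurable (Pi\<^sub>M UNIV (\<lambda>_. lborel))"
    unfolding b by (simp add: inner_axis)
qed

lemma vec_nth_measurable [measurable (raw)]:
  assumes "f \<in> borel_measurable M"
  shows "(\<lambda>x. (f x :: 'a::euclidean_space ^ 'n::finite) $ i) \<in> borel_measurable M"
proof -
  have "(\<lambda>x :: 'a ^ 'n. x $ i) \<in> borel_measurable borel"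
    by (intro borel_measurable_continuous_onI continuous_intros)
  from measurable_compose[OF assms this] show ?thesis .
qed

lemma vec_lambda_borel_measurable [measurable (raw)]:
  assumes "\<And>i. (\<lambda>x. f x i) \<in> borel_measurable M"
  shows "(\<lambda>x. (\<chi> i. f x i) :: 'a::euclidean_space ^ 'n::finite) \<in> borel_measurable M"
proof (subst borel_measurable_euclidean_space, rule ballI)
  fix b :: "'a^'n" assume "b \<in> Basis"
  then obtain i u where b: "b = axis i u" by (auto simp: Basis_vec_def)
  note assms[of i, measurable]
  show "(\<lambda>x. (\<chi> i. f x i) \<bullet> b) \<in> borel_measurable M"
    unfolding b by (simp add: inner_axis)
qed

lemma box_vec: "box l u = {x :: 'a::euclidean_space ^ 'n::finite. \<forall>i. x $ i \<in> box (l $ i) (u $ i)}"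
  by (auto simp: mem_box Basis_vec_def inner_axis)

lemma prod_Basis_vec:
  "(\<Prod>b\<in>(Basis :: ('a::euclidean_space ^ 'n::finite) set). g b) = (\<Prod>i\<in>UNIV. \<Prod>u\<in>Basis. g (axis i u))"
proof -
  have inj: "inj_on (\<lambda>(i :: 'n, u :: 'a). axis i u) (UNIV \<times> Basis)"
    by (auto simp: inj_on_def axis_eq_axis)
  have B: "(Basis :: ('a^'n) set) = (\<lambda>(i, u). axis i u) ` (UNIV \<times> Basis)"
    by (auto simp: Basis_vec_def)
  show ?thesis
    unfolding B by (subst prod.reindex[OF inj]) (simp add: prod.cartesian_product case_prod_unfold)
qed

lemma emeasure_box_vec:
  fixes l u :: "'a::euclidean_space ^ 'n::finite"
  shows "emeasure lborel (box l u) = (\<Prod>i\<in>UNIV. emeasure lborel (box (l $ i) (u $ i)))"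
proof (cases "\<forall>b\<in>Basis. l \<bullet> b \<le> u \<bullet> b")
  case True
  then have le: "l $ i \<bullet> b \<le> u $ i \<bullet> b" if "b \<in> Basis" for i b
    using that by (auto simp: Basis_vec_def inner_axis)
  have "emeasure lborel (box l u) = ennreal (\<Prod>i\<in>UNIV. \<Prod>b\<in>Basis. (u $ i - l $ i) \<bullet> b)"
    using True by (simp add: emeasure_lborel_box prod_Basis_vec inner_axis)
  also have "\<dots> = (\<Prod>i\<in>UNIV. ennreal (\<Prod>b\<in>Basis. (u $ i - l $ i) \<bullet> b))"
    using le by (intro prod_ennreal[symmetric] prod_nonneg) (auto simp: inner_diff_left)
  also have "\<dots> = (\<Prod>i\<in>UNIV. emeasure lborel (box (l $ i) (u $ i)))"
    using le by (intro prod.cong refl) (simp add: emeasure_lborel_box)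
  finally show ?thesis .
next
  case False
  then obtain i b where ib: "b \<in> Basis" "\<not> l $ i \<bullet> b \<le> u $ i \<bullet> b"
    by (auto simp: Basis_vec_def inner_axis)
  then have "box (l $ i) (u $ i) = {}" by (force simp: box_eq_empty)
  then have "emeasure lborel (box (l $ i) (u $ i)) = 0" by simp
  moreover have "box l u = {}"
    using \<open>box (l $ i) (u $ i) = {}\<close> by (auto simp: box_vec)
  moreover have "(\<Prod>i\<in>UNIV. emeasure lborel (box (l $ i) (u $ i))) = 0"
    using \<open>emeasure lborel (box (l $ i) (u $ i)) = 0\<close> by (intro prod_zero) auto
  ultimately show ?thesis by simp
qed

text \<open>Boxes determine Lebesgue measure, and on boxes both sides are products over the
  coordinates. A substitution on tuples therefore has to be checked only for products of indicators;
  splitting, coordinatewise maps, transposition and the passage to normals and offsets below are all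
  instances.\<close>

lemma nn_integral_vec_transfer:
  fixes t :: "'z \<Rightarrow> 'a::euclidean_space ^ 'n::finite"
  assumes [measurable]: "t \<in> borel_measurable N" "w \<in> borel_measurable N" "f \<in> borel_measurable borel"
  assumes box: "\<And>l u. (\<integral>\<^sup>+z. w z * (\<Prod>i\<in>UNIV. indicator (box (l i) (u i)) (t z $ i)) \<partial>N)
      = (\<Prod>i\<in>UNIV. emeasure lborel (box (l i) (u i)))"
  shows "(\<integral>\<^sup>+x. f x \<partial>lborel) = (\<integral>\<^sup>+z. w z * f (t z) \<partial>N)"
proof -
  have "lborel = distr (density N w) borel t"
  proof (rule lborel_eqI)
    fix l u :: "'a^'n" assume le: "\<And>b. b \<in> Basis \<Longrightarrow> l \<bullet> b \<le> u \<bullet> b"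
    have ind: "indicator (box l u) x = (\<Prod>i\<in>UNIV. indicator (box (l $ i) (u $ i)) (x $ i) :: ennreal)" for x
      by (auto simp: box_vec indicator_def)
    have "emeasure (distr (density N w) borel t) (box l u)
        = (\<integral>\<^sup>+x. indicator (box l u) x \<partial>distr (density N w) borel t)" by simp
    also have "\<dots> = (\<integral>\<^sup>+z. w z * indicator (box l u) (t z) \<partial>N)"
      by (simp add: nn_integral_distr nn_integral_density del: nn_integral_indicator)
    also have "\<dots> = (\<Prod>i\<in>UNIV. emeasure lborel (box (l $ i) (u $ i)))"
      unfolding ind by (rule box)
    also have "\<dots> = (\<Prod>b\<in>Basis. (u - l) \<bullet> b)"
      using le by (simp add: emeasure_box_vec[symmetric] emeasure_lborel_box)
    finally show "emeasure (distr (density N w) borel t) (box l u) = (\<Prod>b\<in>Basis. (u - l) \<bullet> b)" .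
  qed simp
  then have "(\<integral>\<^sup>+x. f x \<partial>lborel) = (\<integral>\<^sup>+x. f x \<partial>distr (density N w) borel t)"
    by (rule arg_cong)
  also have "\<dots> = (\<integral>\<^sup>+z. w z * f (t z) \<partial>N)"
    by (simp add: nn_integral_distr nn_integral_density)
  finally show ?thesis .
qed

interpretation lborel_fin: product_sigma_finite "\<lambda>_ :: 'n. lborel :: 'a::euclidean_space measure"
  by unfold_locales

lemma lborel_vec_eq_distr:
  "(lborel :: ('a::euclidean_space ^ 'n::finite) measure) = distr (Pi\<^sub>M UNIV (\<lambda>_. lborel)) borel vec_lambda"
proof (rule lborel_eqI)
  fix l u :: "'a^'n" assume le: "\<And>b. b \<in> Basis \<Longrightarrow> l \<bullet> b \<le> u \<bullet> b"
  have eq: "vec_lambda -` box l u \<inter> space (Pi\<^sub>M UNIV (\<lambda>_. lborel :: 'a measure)) = Pi\<^sub>E UNIV (\<lambda>i. box (l $ i) (u $ i))"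
    by (auto simp: box_vec space_PiM PiE_def)
  have "emeasure (distr (Pi\<^sub>M UNIV (\<lambda>_. lborel)) borel vec_lambda) (box l u)
     = emeasure (Pi\<^sub>M UNIV (\<lambda>_. lborel :: 'a measure)) (Pi\<^sub>E UNIV (\<lambda>i. box (l $ i) (u $ i)))"
    by (subst emeasure_distr) (auto simp: eq)
  also have "\<dots> = (\<Prod>i\<in>UNIV. emeasure lborel (box (l $ i) (u $ i)))"
    by (subst lborel_fin.emeasure_PiM) auto
  also have "\<dots> = (\<Prod>b\<in>Basis. (u - l) \<bullet> b)"
    using le by (simp add: emeasure_box_vec[symmetric] emeasure_lborel_box)
  finally show "emeasure (distr (Pi\<^sub>M UNIV (\<lambda>_. lborel)) borel vec_lambda) (box l u) = (\<Prod>b\<in>Basis. (u - l) \<bullet> b)" .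
qed simp

lemma nn_integral_vec_prod:
  fixes f :: "'n::finite \<Rightarrow> 'a::euclidean_space \<Rightarrow> ennreal"
  assumes [measurable]: "\<And>i. f i \<in> borel_measurable borel"
  shows "(\<integral>\<^sup>+x. (\<Prod>i\<in>UNIV. f i (x $ i)) \<partial>lborel) = (\<Prod>i\<in>UNIV. \<integral>\<^sup>+y. f i y \<partial>lborel)"
proof -
  have "(\<integral>\<^sup>+x. (\<Prod>i\<in>UNIV. f i (x $ i)) \<partial>lborel)
      = (\<integral>\<^sup>+x. (\<Prod>i\<in>UNIV. f i (x i)) \<partial>Pi\<^sub>M UNIV (\<lambda>_. lborel))"
    by (subst lborel_vec_eq_distr) (simp add: nn_integral_distr)
  also have "\<dots> = (\<Prod>i\<in>UNIV. \<integral>\<^sup>+y. f i y \<partial>lborel)"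
    by (rule lborel_fin.product_nn_integral_prod) auto
  finally show ?thesis .
qed

lemma emeasure_vec_prod:
  fixes B :: "'n::finite \<Rightarrow> 'a::euclidean_space set"
  assumes "\<And>i. B i \<in> sets borel"
  shows "emeasure lborel {x. \<forall>i. x $ i \<in> B i} = (\<Prod>i\<in>UNIV. emeasure lborel (B i))"
proof -
  note [measurable] = assms
  have "{x :: 'a ^ 'n. \<forall>i. x $ i \<in> B i} \<in> sets lborel" by measurable
  then have "emeasure lborel {x :: 'a ^ 'n. \<forall>i. x $ i \<in> B i} = (\<integral>\<^sup>+x. indicator {x. \<forall>i. x $ i \<in> B i} x \<partial>lborel)"
    by simp
  also have "\<dots> = (\<integral>\<^sup>+x. (\<Prod>i\<in>UNIV. indicator (B i) (x $ i)) \<partial>lborel)"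
    by (intro nn_integral_cong) (auto simp: indicator_def)
  also have "\<dots> = (\<Prod>i\<in>UNIV. emeasure lborel (B i))"
    by (subst nn_integral_vec_prod) auto
  finally show ?thesis .
qed

definition vec_upd :: "'a ^ 'n \<Rightarrow> 'n \<Rightarrow> 'a \<Rightarrow> 'a ^ 'n" where
  "vec_upd x m t = (\<chi> i. if i = m then t else x $ i)"

lemma vec_upd_nth: "vec_upd x m t $ i = (if i = m then t else x $ i)"
  by (simp add: vec_upd_def)

lemma vec_upd_measurable [measurable (raw)]:
  assumes [measurable]: "f \<in> borel_measurable M" "g \<in> borel_measurable M"
  shows "(\<lambda>x. vec_upd (f x :: 'a::euclidean_space ^ 'n::finite) m (g x)) \<in> borel_measurable M"
  unfolding vec_upd_def by measurable

text \<open>Splitting off one coordinate, with a weight of mass one keeping the now redundant coordinate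
  so that no lower-dimensional space is needed.\<close>

lemma nn_integral_vec_split:
  fixes f :: "'a::euclidean_space ^ 'n::finite \<Rightarrow> ennreal"
  assumes [measurable]: "f \<in> borel_measurable borel" "w \<in> borel_measurable borel"
  assumes w: "(\<integral>\<^sup>+y. w y \<partial>lborel) = 1"
  shows "(\<integral>\<^sup>+x. f x \<partial>lborel) = (\<integral>\<^sup>+t. \<integral>\<^sup>+x. w (x $ m) * f (vec_upd x m t) \<partial>lborel \<partial>lborel)"
proof -
  have "(\<integral>\<^sup>+x. f x \<partial>lborel) = (\<integral>\<^sup>+z. w (snd z $ m) * f (vec_upd (snd z) m (fst z)) \<partial>(lborel \<Otimes>\<^sub>M lborel))"
  proof (rule nn_integral_vec_transfer)
    fix l u :: "'n \<Rightarrow> 'a"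
    \<comment> \<open>Coordinate m carries the weight instead of a box, so that its integral
      contributes the factor 1 while the box for m is tested on t.\<close>
    let ?h = "\<lambda>i y. if i = m then w y else indicator (box (l i) (u i)) y :: ennreal"
    have [measurable]: "(\<lambda>z. indicator (box (l i) (u i)) (vec_upd (snd z) m (fst z) $ i) :: ennreal)
        \<in> borel_measurable (lborel \<Otimes>\<^sub>M lborel)" for i
      by (rule measurable_compose[OF _ borel_measurable_indicator[of _ borel]]) auto
    have "(\<integral>\<^sup>+z. w (snd z $ m) * (\<Prod>i\<in>UNIV. indicator (box (l i) (u i)) (vec_upd (snd z) m (fst z) $ i)) \<partial>(lborel \<Otimes>\<^sub>M lborel))
       = (\<integral>\<^sup>+t. \<integral>\<^sup>+x. w (x $ m) * (\<Prod>i\<in>UNIV. indicator (box (l i) (u i)) (vec_upd x m t $ i)) \<partial>lborel \<partial>lborel)"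
      by (subst lborel.nn_integral_fst[symmetric]) ((measurable)[1], simp)
    also have "\<dots> = (\<integral>\<^sup>+t. \<integral>\<^sup>+x. indicator (box (l m) (u m)) t * (\<Prod>i\<in>UNIV. ?h i (x $ i)) \<partial>lborel \<partial>lborel)"
    proof (intro nn_integral_cong)
      fix t x
      have "(\<Prod>i\<in>UNIV. indicator (box (l i) (u i)) (vec_upd x m t $ i) :: ennreal)
          = indicator (box (l m) (u m)) t * (\<Prod>i\<in>UNIV - {m}. ?h i (x $ i))"
      proof -
        have "(\<Prod>i\<in>UNIV - {m}. indicator (box (l i) (u i)) (vec_upd x m t $ i) :: ennreal)
            = (\<Prod>i\<in>UNIV - {m}. ?h i (x $ i))"
          by (rule prod.cong) (auto simp: vec_upd_nth)
        then show ?thesis by (subst prod.remove[of UNIV m]) (simp_all add: vec_upd_nth)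
      qed
      moreover have "(\<Prod>i\<in>UNIV. ?h i (x $ i)) = w (x $ m) * (\<Prod>i\<in>UNIV - {m}. ?h i (x $ i))"
        by (subst prod.remove[of UNIV m]) simp_all
      ultimately show "w (x $ m) * (\<Prod>i\<in>UNIV. indicator (box (l i) (u i)) (vec_upd x m t $ i))
          = indicator (box (l m) (u m)) t * (\<Prod>i\<in>UNIV. ?h i (x $ i))"
        by (simp add: mult_ac)
    qed
    also have "\<dots> = (\<integral>\<^sup>+t. indicator (box (l m) (u m)) t * (\<Prod>i\<in>UNIV. \<integral>\<^sup>+y. ?h i y \<partial>lborel) \<partial>lborel)"
    proof -
      have [measurable]: "?h i \<in> borel_measurable borel" for i by (cases "i = m") auto
      show ?thesis by (subst nn_integral_cmult) (auto simp: nn_integral_vec_prod[of ?h])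
    qed
    also have "\<dots> = emeasure lborel (box (l m) (u m)) * (\<Prod>i\<in>UNIV. \<integral>\<^sup>+y. ?h i y \<partial>lborel)"
      by (subst nn_integral_multc) simp_all
    also have "(\<Prod>i\<in>UNIV. \<integral>\<^sup>+y. ?h i y \<partial>lborel) = (\<Prod>i\<in>UNIV - {m}. emeasure lborel (box (l i) (u i)))"
    proof -
      have "(\<Prod>i\<in>UNIV - {m}. \<integral>\<^sup>+y. ?h i y \<partial>lborel) = (\<Prod>i\<in>UNIV - {m}. emeasure lborel (box (l i) (u i)))"
        by (rule prod.cong) auto
      then show ?thesis by (subst prod.remove[of UNIV m]) (simp_all add: w)
    qed
    also have "emeasure lborel (box (l m) (u m)) * \<dots> = (\<Prod>i\<in>UNIV. emeasure lborel (box (l i) (u i)))"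
      by (simp add: prod.remove[of UNIV m])
    finally show "(\<integral>\<^sup>+z. w (snd z $ m) * (\<Prod>i\<in>UNIV. indicator (box (l i) (u i)) (vec_upd (snd z) m (fst z) $ i)) \<partial>(lborel \<Otimes>\<^sub>M lborel))
       = (\<Prod>i\<in>UNIV. emeasure lborel (box (l i) (u i)))" .
  qed measurable
  also have "\<dots> = (\<integral>\<^sup>+t. \<integral>\<^sup>+x. w (x $ m) * f (vec_upd x m t) \<partial>lborel \<partial>lborel)"
    by (subst lborel.nn_integral_fst[symmetric]) ((measurable)[1], simp)
  finally show ?thesis .
qed

text \<open>Serves two kinds of maps: different scalings of real coordinates (diagonal matrices),
  and one linear map applied to every row of a matrix.\<close>

lemma nn_integral_vec_map:
  fixes L :: "'n::finite \<Rightarrow> 'a::euclidean_space \<Rightarrow> 'a" and c :: "'n \<Rightarrow> ennreal"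
  assumes [measurable]: "\<And>i. L i \<in> borel_measurable borel" "f \<in> borel_measurable borel"
  assumes L: "\<And>i A. A \<in> sets borel \<Longrightarrow> c i * (\<integral>\<^sup>+y. indicator A (L i y) \<partial>lborel) = emeasure lborel A"
  shows "(\<integral>\<^sup>+x. f x \<partial>lborel) = (\<Prod>i\<in>UNIV. c i) * (\<integral>\<^sup>+x. f (\<chi> i. L i (x $ i)) \<partial>lborel)"
proof -
  have "(\<integral>\<^sup>+x. f x \<partial>lborel) = (\<integral>\<^sup>+x. (\<Prod>i\<in>UNIV. c i) * f (\<chi> i. L i (x $ i)) \<partial>lborel)"
  proof (rule nn_integral_vec_transfer)
    fix l u :: "'n \<Rightarrow> 'a"
    have "(\<integral>\<^sup>+x. (\<Prod>i\<in>UNIV. c i) * (\<Prod>i\<in>UNIV. indicator (box (l i) (u i)) ((\<chi> i. L i (x $ i)) $ i)) \<partial>lborel)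
       = (\<Prod>i\<in>UNIV. c i) * (\<integral>\<^sup>+x. (\<Prod>i\<in>UNIV. indicator (box (l i) (u i)) (L i (x $ i))) \<partial>lborel)"
      by (subst nn_integral_cmult) auto
    also have "\<dots> = (\<Prod>i\<in>UNIV. c i) * (\<Prod>i\<in>UNIV. \<integral>\<^sup>+y. indicator (box (l i) (u i)) (L i y) \<partial>lborel)"
      by (subst nn_integral_vec_prod[where f="\<lambda>i y. indicator (box (l i) (u i)) (L i y)"]) auto
    also have "\<dots> = (\<Prod>i\<in>UNIV. emeasure lborel (box (l i) (u i)))"
      unfolding prod.distrib[symmetric] by (intro prod.cong refl L) auto
    finally show "(\<integral>\<^sup>+x. (\<Prod>i\<in>UNIV. c i) * (\<Prod>i\<in>UNIV. indicator (box (l i) (u i)) ((\<chi> i. L i (x $ i)) $ i)) \<partial>lborel)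
       = (\<Prod>i\<in>UNIV. emeasure lborel (box (l i) (u i)))" .
  qed measurable
  also have "\<dots> = (\<Prod>i\<in>UNIV. c i) * (\<integral>\<^sup>+x. f (\<chi> i. L i (x $ i)) \<partial>lborel)"
    by (subst nn_integral_cmult) auto
  finally show ?thesis .
qed

lemma prod_of_bool_UNIV: "(\<Prod>i\<in>UNIV. of_bool (P (i :: 'n::finite)) :: 'b::comm_semiring_1) = of_bool (\<forall>i. P i)"
  by (cases "\<forall>i. P i") (auto intro!: prod_zero)

text \<open>A box of matrices is a product of intervals over all entries, so only the order of two
  finite products changes. It is needed to turn a column \<open>G *v axis k 1\<close> into a row,
  which \<open>nn_integral_vec_split\<close> can separate.\<close>

lemma nn_integral_transpose:
  fixes f :: "real ^ 'm::finite ^ 'n::finite \<Rightarrow> ennreal"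
  assumes [measurable]: "f \<in> borel_measurable borel"
  shows "(\<integral>\<^sup>+x. f x \<partial>lborel) = (\<integral>\<^sup>+x. f (transpose x) \<partial>lborel)"
proof -
  have [measurable]: "transpose \<in> borel_measurable (borel :: (real^'n^'m) measure)"
    unfolding transpose_def by measurable
  have "(\<integral>\<^sup>+x. f x \<partial>lborel) = (\<integral>\<^sup>+x. 1 * f (transpose x) \<partial>lborel)"
  proof (rule nn_integral_vec_transfer)
    fix l u :: "'n \<Rightarrow> real ^ 'm"
    have "(\<integral>\<^sup>+x. 1 * (\<Prod>i\<in>UNIV. indicator (box (l i) (u i)) (transpose x $ i)) \<partial>(lborel :: (real^'n^'m) measure))
       = (\<integral>\<^sup>+x. (\<Prod>j\<in>UNIV. indicator {y. \<forall>i. l i $ j < y $ i \<and> y $ i < u i $ j} (x $ j)) \<partial>(lborel :: (real^'n^'m) measure))"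
      by (intro nn_integral_cong) (auto simp: indicator_def mem_box_cart transpose_def prod_of_bool_UNIV)
    also have "\<dots> = (\<Prod>j\<in>UNIV. emeasure lborel {y :: real^'n. \<forall>i. l i $ j < y $ i \<and> y $ i < u i $ j})"
      by (subst nn_integral_vec_prod) auto
    also have "\<dots> = (\<Prod>j\<in>UNIV. \<Prod>i\<in>UNIV. emeasure lborel (box (l i $ j) (u i $ j)))"
    proof (intro prod.cong refl)
      fix j :: 'm
      have "{y :: real^'n. \<forall>i. l i $ j < y $ i \<and> y $ i < u i $ j} = {y. \<forall>i. y $ i \<in> box (l i $ j) (u i $ j)}"
        by (auto simp: box_real)
      then show "emeasure lborel {y :: real^'n. \<forall>i. l i $ j < y $ i \<and> y $ i < u i $ j}
          = (\<Prod>i\<in>UNIV. emeasure lborel (box (l i $ j) (u i $ j)))"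
        by (simp only:) (rule emeasure_vec_prod, simp)
    qed
    also have "\<dots> = (\<Prod>i\<in>UNIV. \<Prod>j\<in>UNIV. emeasure lborel (box (l i $ j) (u i $ j)))"
      by (rule prod.swap)
    also have "\<dots> = (\<Prod>i\<in>UNIV. emeasure lborel (box (l i) (u i)))"
      by (simp add: emeasure_box_vec box_real)
    finally show "(\<integral>\<^sup>+x. 1 * (\<Prod>i\<in>UNIV. indicator (box (l i) (u i)) (transpose x $ i)) \<partial>(lborel :: (real^'n^'m) measure))
       = (\<Prod>i\<in>UNIV. emeasure lborel (box (l i) (u i)))" .
  qed measurable
  then show ?thesis by simp
qed

text \<open>Translation by t v preserves the measure of A, so this measure equals its average over t
  in [0, 1]; after exchanging the integrals the inner one runs over a countable set. It reduces all
  genericity statements to counting roots of polynomials in one variable.\<close>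

lemma null_sets_if_lines_countable:
  fixes A :: "'a::euclidean_space set"
  assumes [measurable]: "A \<in> sets borel"
  assumes v: "\<And>x. countable {t::real. x + t *\<^sub>R v \<in> A}"
  shows "A \<in> null_sets lborel"
proof -
  have "emeasure lborel A = (\<integral>\<^sup>+t. indicator {0..1::real} t * emeasure lborel A \<partial>lborel)"
    by (subst nn_integral_multc) auto
  also have "\<dots> = (\<integral>\<^sup>+t. \<integral>\<^sup>+x. indicator {0..1} t * indicator A (x + t *\<^sub>R v) \<partial>lborel \<partial>lborel)"
  proof (intro nn_integral_cong)
    fix t :: real
    have "emeasure lborel A = (\<integral>\<^sup>+x. indicator A x \<partial>distr lborel borel (\<lambda>x. t *\<^sub>R v + x))"
      by (subst lborel_distr_plus) simp
    also have "\<dots> = (\<integral>\<^sup>+x. indicator A (x + t *\<^sub>R v) \<partial>lborel)"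
      by (subst nn_integral_distr) (auto simp: add.commute)
    finally show "indicator {0..1} t * emeasure lborel A
        = (\<integral>\<^sup>+x. indicator {0..1} t * indicator A (x + t *\<^sub>R v) \<partial>lborel)"
      by (subst nn_integral_cmult) auto
  qed
  also have "\<dots> = (\<integral>\<^sup>+x. \<integral>\<^sup>+t. indicator {0..1} t * indicator A (x + t *\<^sub>R v) \<partial>lborel \<partial>lborel)"
    by (rule lborel_pair.Fubini') measurable
  also have "\<dots> = (\<integral>\<^sup>+x. 0 \<partial>(lborel :: 'a measure))"
  proof (intro nn_integral_cong)
    fix x :: 'a
    have "AE t in lborel. t \<notin> {t::real. x + t *\<^sub>R v \<in> A}"
      using v[of x] by (intro AE_not_in countable_imp_null_set_lborel)
    then have "(\<integral>\<^sup>+t. indicator {0..1} t * indicator A (x + t *\<^sub>R v) \<partial>lborel) = (\<integral>\<^sup>+t. 0 \<partial>(lborel :: real measure))"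
      by (intro nn_integral_cong_AE) (auto simp: indicator_def)
    then show "(\<integral>\<^sup>+t. indicator {0..1} t * indicator A (x + t *\<^sub>R v) \<partial>lborel) = 0" by simp
  qed
  finally show ?thesis by (intro null_setsI) auto
qed

section \<open>Linear substitutions by elementary matrices\<close>

lemma nn_integral_translate:
  fixes f :: "'a::euclidean_space \<Rightarrow> ennreal"
  assumes [measurable]: "f \<in> borel_measurable borel"
  shows "(\<integral>\<^sup>+x. f (x + c) \<partial>lborel) = (\<integral>\<^sup>+x. f x \<partial>lborel)"
proof -
  have "(\<integral>\<^sup>+x. f x \<partial>lborel) = (\<integral>\<^sup>+x. f x \<partial>distr lborel borel (\<lambda>x. c + x))"
    by (subst lborel_distr_plus) simp
  also have "\<dots> = (\<integral>\<^sup>+x. f (x + c) \<partial>lborel)"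
    by (subst nn_integral_distr) (auto simp: add.commute)
  finally show ?thesis ..
qed

lemma matrix_vector_mult_measurable [measurable (raw)]:
  fixes f :: "'z \<Rightarrow> real ^ 'm::finite ^ 'n::finite"
  assumes [measurable]: "f \<in> borel_measurable M" "g \<in> borel_measurable M"
  shows "(\<lambda>x. f x *v g x) \<in> borel_measurable M"
  unfolding matrix_vector_mult_def by measurable

text \<open>Every square matrix is a product of diagonal matrices, transpositions, shears and
  matrices with a zero row; the last kind is excluded by the determinant. The absolute determinants
  multiply along the product.\<close>

lemma nn_integral_linear:
  fixes A :: "real ^ 'n::finite ^ 'n"
  shows "det A \<noteq> 0 \<Longrightarrow> f \<in> borel_measurable borel \<Longrightarrow>
    (\<integral>\<^sup>+x. f x \<partial>lborel) = ennreal \<bar>det A\<bar> * (\<integral>\<^sup>+x. f (A *v x) \<partial>lborel)"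
proof (induction A arbitrary: f rule: induct_matrix_elementary_alt)
  case (1 A B)
  note 1(4)[measurable]
  have d: "det A \<noteq> 0" "det B \<noteq> 0" using 1(3) by (auto simp: det_mul)
  have "(\<integral>\<^sup>+x. f x \<partial>lborel) = ennreal \<bar>det A\<bar> * (\<integral>\<^sup>+x. f (A *v x) \<partial>lborel)"
    by (rule 1(1)) (use d in auto)
  also have "(\<integral>\<^sup>+x. f (A *v x) \<partial>lborel) = ennreal \<bar>det B\<bar> * (\<integral>\<^sup>+x. f (A *v (B *v x)) \<partial>lborel)"
    by (rule 1(2)) (use d in auto)
  finally show ?case
    by (simp add: det_mul abs_mult ennreal_mult mult_ac matrix_vector_mul_assoc)
next
  case (2 A i)
  then show ?case by (simp add: det_zero_row)
next
  case (3 A)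
  note 3(3)[measurable]
  have det: "det A = (\<Prod>i\<in>UNIV. A $ i $ i)"
    by (rule det_diagonal) (use 3 in auto)
  then have nz: "A $ i $ i \<noteq> 0" for i using 3(2) by auto
  have A: "A *v x = (\<chi> i. A $ i $ i * x $ i)" for x
  proof -
    have "(\<Sum>j\<in>UNIV. A $ i $ j * x $ j) = A $ i $ i * x $ i" for i
      using 3(1)[of i] by (subst sum.remove[of _ i]) (auto intro!: sum.neutral)
    then show ?thesis by (simp add: vec_eq_iff matrix_vector_mult_def)
  qed
  have "(\<integral>\<^sup>+x. f x \<partial>lborel) = (\<Prod>i\<in>UNIV. ennreal \<bar>A $ i $ i\<bar>) * (\<integral>\<^sup>+x. f (\<chi> i. A $ i $ i * x $ i) \<partial>lborel)"
  proof (rule nn_integral_vec_map)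
    fix i and S :: "real set" assume [measurable]: "S \<in> sets borel"
    show "ennreal \<bar>A $ i $ i\<bar> * (\<integral>\<^sup>+y. indicator S (A $ i $ i * y) \<partial>lborel) = emeasure lborel S"
      using nn_integral_real_affine[of "indicator S" "A $ i $ i" 0] nz[of i] by simp
  qed measurable
  then show ?case by (simp add: A det abs_prod prod_ennreal)
next
  case (4 m n)
  note 4(3)[measurable]
  let ?\<tau> = "Transposition.transpose m n"
  let ?S = "(\<chi> i j. mat 1 $ i $ ?\<tau> j) :: real^'n^'n"
  have S: "?S *v x = (\<chi> i. x $ ?\<tau> i)" for x
  proof -
    have "(\<Sum>j\<in>UNIV. ?S $ i $ j * x $ j) = x $ ?\<tau> i" for i
    proof -
      have "(\<Sum>j\<in>UNIV. ?S $ i $ j * x $ j) = (\<Sum>j\<in>UNIV. if j = ?\<tau> i then x $ j else 0)"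
        by (intro sum.cong refl) (auto simp: mat_def)
      then show ?thesis by simp
    qed
    then show ?thesis by (simp add: vec_eq_iff matrix_vector_mult_def)
  qed
  have "\<bar>det ?S\<bar> = 1"
    using det_permute_columns[of ?\<tau> "mat 1 :: real^'n^'n"] 4(1)
    by (simp add: permutes_swap_id sign_swap_id)
  moreover have "(\<integral>\<^sup>+x. f x \<partial>lborel) = (\<integral>\<^sup>+x. 1 * f (\<chi> i. x $ ?\<tau> i) \<partial>lborel)"
  proof (rule nn_integral_vec_transfer)
    fix l u :: "'n \<Rightarrow> real"
    have re: "(\<Prod>i\<in>UNIV. g (?\<tau> i)) = (\<Prod>i\<in>UNIV. g i)" for g :: "'n \<Rightarrow> ennreal"
      by (rule prod.reindex_bij_betw) (simp add: bij_betw_def)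
    have "(\<Prod>i\<in>UNIV. indicator (box (l i) (u i)) ((\<chi> i. x $ ?\<tau> i) $ i))
        = (\<Prod>i\<in>UNIV. indicator (box (l (?\<tau> i)) (u (?\<tau> i))) (x $ i) :: ennreal)" for x :: "real^'n"
      by (subst re[symmetric]) simp
    then have "(\<integral>\<^sup>+x. 1 * (\<Prod>i\<in>UNIV. indicator (box (l i) (u i)) ((\<chi> i. x $ ?\<tau> i) $ i)) \<partial>lborel)
       = (\<Prod>i\<in>UNIV. emeasure lborel (box (l (?\<tau> i)) (u (?\<tau> i))))"
      by (simp only: mult_1) (subst nn_integral_vec_prod, auto)
    also have "\<dots> = (\<Prod>i\<in>UNIV. emeasure lborel (box (l i) (u i)))" by (rule re)
    finally show "(\<integral>\<^sup>+x. 1 * (\<Prod>i\<in>UNIV. indicator (box (l i) (u i)) ((\<chi> i. x $ ?\<tau> i) $ i)) \<partial>lborel)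
       = (\<Prod>i\<in>UNIV. emeasure lborel (box (l i) (u i)))" .
  qed measurable
  ultimately show ?case by (simp add: S)
next
  case (5 m n)
  note 5(3)[measurable]
  let ?S = "(\<chi> i j. of_bool (i = m \<and> j = n \<or> i = j)) :: real^'n^'n"
  have S: "?S *v x = vec_upd x m (x $ m + x $ n)" for x
  proof -
    have "(\<Sum>j\<in>UNIV. ?S $ i $ j * x $ j) = (if i = m then x $ m + x $ n else x $ i)" for i
    proof -
      have "(\<Sum>j\<in>UNIV. ?S $ i $ j * x $ j)
          = (\<Sum>j\<in>UNIV. (if j = i then x $ j else 0) + (if j = n then (if i = m then x $ j else 0) else 0))"
        using 5(1) by (intro sum.cong refl) auto
      then show ?thesis by (simp add: sum.distrib)
    qed
    then show ?thesis by (simp add: vec_eq_iff matrix_vector_mult_def vec_upd_nth)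
  qed
  have "?S = (\<chi> k. if k = m then row m (mat 1) + 1 *s row n (mat 1) else row k (mat 1))"
    using 5(1) by (auto simp: vec_eq_iff row_def mat_def)
  then have "det ?S = 1"
    using det_row_operation[OF 5(1), of "mat 1 :: real^'n^'n" 1] by simp
  \<comment> \<open>A shear translates coordinate m by coordinate n. Once coordinate m is split off,
    the shift is a constant for the one-dimensional integral over t, and translation invariance
    applies.\<close>
  moreover have "(\<integral>\<^sup>+x. f (vec_upd x m (x $ m + x $ n)) \<partial>lborel) = (\<integral>\<^sup>+x. f x \<partial>lborel)"
  proof -
    let ?w = "indicator {0..1::real} :: real \<Rightarrow> ennreal"
    have w: "(\<integral>\<^sup>+y. ?w y \<partial>lborel) = 1" by simp
    have split: "(\<integral>\<^sup>+x. f x \<partial>lborel) = (\<integral>\<^sup>+t. \<integral>\<^sup>+x. ?w (x $ m) * f (vec_upd x m t) \<partial>lborel \<partial>lborel)"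
      by (rule nn_integral_vec_split[OF 5(3) _ w]) measurable
    have "(\<integral>\<^sup>+x. f (vec_upd x m (x $ m + x $ n)) \<partial>lborel)
       = (\<integral>\<^sup>+t. \<integral>\<^sup>+x. ?w (x $ m) * f (vec_upd (vec_upd x m t) m (vec_upd x m t $ m + vec_upd x m t $ n)) \<partial>lborel \<partial>lborel)"
      by (rule nn_integral_vec_split[OF _ _ w]) measurable
    also have "\<dots> = (\<integral>\<^sup>+t. \<integral>\<^sup>+x. ?w (x $ m) * f (vec_upd x m (t + x $ n)) \<partial>lborel \<partial>lborel)"
    proof -
      have "vec_upd (vec_upd x m t) m (vec_upd x m t $ m + vec_upd x m t $ n) = vec_upd x m (t + x $ n)" for x :: "real^'n" and t
        using 5(1) by (simp add: vec_eq_iff vec_upd_nth)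
      then show ?thesis by simp
    qed
    also have "\<dots> = (\<integral>\<^sup>+x. \<integral>\<^sup>+t. ?w (x $ m) * f (vec_upd x m (t + x $ n)) \<partial>lborel \<partial>lborel)"
      by (rule lborel_pair.Fubini') measurable
    also have "\<dots> = (\<integral>\<^sup>+x. \<integral>\<^sup>+t. ?w (x $ m) * f (vec_upd x m t) \<partial>lborel \<partial>lborel)"
    proof (rule nn_integral_cong)
      fix x :: "real^'n"
      show "(\<integral>\<^sup>+t. ?w (x $ m) * f (vec_upd x m (t + x $ n)) \<partial>lborel) = (\<integral>\<^sup>+t. ?w (x $ m) * f (vec_upd x m t) \<partial>lborel)"
        by (rule nn_integral_translate[where f="\<lambda>t. ?w (x $ m) * f (vec_upd x m t)"]) measurable
    qed
    also have "\<dots> = (\<integral>\<^sup>+t. \<integral>\<^sup>+x. ?w (x $ m) * f (vec_upd x m t) \<partial>lborel \<partial>lborel)"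
      by (rule lborel_pair.Fubini') measurable
    also have "\<dots> = (\<integral>\<^sup>+x. f x \<partial>lborel)"
      by (rule split[symmetric])
    finally show ?thesis .
  qed
  ultimately show ?case by (simp only: S abs_one ennreal_1 mult_1)
qed

section \<open>Tuples of distinct Poisson points\<close>

definition tuples :: "'a set \<Rightarrow> ('a ^ 'n::finite) set" where
  "tuples X = {f. inj (($) f) \<and> (\<forall>i. f $ i \<in> X)}"

text \<open>A count in \<open>ennreal\<close>, because the point set and hence its set of tuples is
  infinite in general and \<open>card\<close> would then be 0.\<close>

definition ntup :: "'a set \<Rightarrow> ('a ^ 'n::finite) set \<Rightarrow> ennreal" where
  "ntup X A = emeasure (count_space UNIV) (A \<inter> tuples X)"

lemma ntup_suminf:
  assumes "disjoint_family A"
  shows "ntup X (\<Union>n. A n) = (\<Sum>n. ntup X (A n :: ('a ^ 'n::finite) set))"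
proof -
  have "ntup X (\<Union>n. A n) = emeasure (count_space UNIV) (\<Union>n. A n \<inter> tuples X)"
    by (simp add: ntup_def)
  also have "\<dots> = (\<Sum>n. ntup X (A n))"
    unfolding ntup_def using assms by (intro suminf_emeasure[symmetric]) (auto simp: disjoint_family_on_def)
  finally show ?thesis .
qed

lemma ntup_mono: "A \<subseteq> B \<Longrightarrow> ntup X A \<le> ntup X B"
  unfolding ntup_def by (intro emeasure_mono) auto

lemma vec_set_eq_image: "{f. \<forall>i. f $ i \<in> S i} = vec_lambda ` Pi\<^sub>E UNIV S"
proof -
  have "f \<in> vec_lambda ` Pi\<^sub>E UNIV S" if "\<forall>i. f $ i \<in> S i" for f
    using that by (intro image_eqI[of _ _ "($) f"]) (auto simp: vec_eq_iff)
  then show ?thesis by auto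
qed

lemma card_vec_set:
  fixes S :: "'n::finite \<Rightarrow> 'a set"
  assumes "\<And>i. finite (S i)"
  shows "finite {f. \<forall>i. f $ i \<in> S i}" "card {f. \<forall>i. f $ i \<in> S i} = (\<Prod>i\<in>UNIV. card (S i))"
proof -
  show "finite {f. \<forall>i. f $ i \<in> S i}"
    unfolding vec_set_eq_image by (intro finite_imageI finite_PiE) (use assms in auto)
  have "inj vec_lambda" by (rule injI) (metis vec_lambda_inverse UNIV_I)
  then show "card {f. \<forall>i. f $ i \<in> S i} = (\<Prod>i\<in>UNIV. card (S i))"
    unfolding vec_set_eq_image by (subst card_image) (auto simp: card_PiE intro: inj_on_subset)
qed

text \<open>Pairwise disjoint sides force the entries of a tuple to be distinct, so injectivity
  costs nothing and the count factorizes.\<close>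

lemma ntup_rectangle:
  fixes B :: "'n::finite \<Rightarrow> 'a set"
  assumes "\<And>i. finite (X \<inter> B i)" "disjoint_family B"
  shows "ntup X {f. \<forall>i. f $ i \<in> B i} = (\<Prod>i\<in>UNIV. of_nat (card (X \<inter> B i)))"
proof -
  have "inj (($) f)" if "\<forall>i. f $ i \<in> B i" for f
  proof (rule injI)
    fix i j assume "f $ i = f $ j"
    then have "f $ i \<in> B i \<inter> B j" using that by (metis IntI)
    then show "i = j" using assms(2) by (auto simp: disjoint_family_on_def)
  qed
  then have "{f. \<forall>i. f $ i \<in> B i} \<inter> tuples X = {f. \<forall>i. f $ i \<in> X \<inter> B i}"
    unfolding tuples_def by blast
  then show ?thesis
    unfolding ntup_def using card_vec_set[of "\<lambda>i. X \<inter> B i", OF assms(1)]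
    by (simp add: emeasure_count_space)
qed

text \<open>Distinct entries have disjoint bounded neighbourhoods taken from a countable base, and
  only countably many families of base sets exist. Such rectangles are what the independence of
  counts in disjoint sets can handle.\<close>

lemma inj_tuples_cover:
  obtains R :: "nat \<Rightarrow> ('a::euclidean_space ^ 'n::finite) set"
  where "\<And>n. \<exists>B. (\<forall>i. B i \<in> sets borel \<and> bounded (B i)) \<and> disjoint_family B \<and> R n = {f. \<forall>i. f $ i \<in> B i}"
    "(\<Union>n. R n) = {f. inj (($) f)}"
proof -
  obtain \<B> :: "'a set set" where \<B>: "countable \<B>" "topological_basis \<B>"
    using ex_countable_basis by blast
  define F where "F = {B \<in> Pi\<^sub>E (UNIV :: 'n set) (\<lambda>_. \<B>). (\<forall>i. bounded (B i)) \<and> disjoint_family B}"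
  let ?rect = "\<lambda>B :: 'n \<Rightarrow> 'a set. {f :: 'a ^ 'n. \<forall>i. f $ i \<in> B i}"
  \<comment> \<open>The empty set makes the family visibly nonempty, as its enumeration by
    \<open>from_nat_into\<close> requires.\<close>
  define \<R> where "\<R> = insert {} (?rect ` F)"
  have "countable F"
    unfolding F_def by (rule countable_subset[OF _ countable_PiE[of UNIV "\<lambda>_. \<B>"]]) (use \<B> in auto)
  then have \<R>: "countable \<R>" "\<R> \<noteq> {}" by (auto simp: \<R>_def)
  have rect: "\<exists>B. (\<forall>i. B i \<in> sets borel \<and> bounded (B i)) \<and> disjoint_family B \<and> R = ?rect B" if "R \<in> \<R>" for R
  proof (cases "R = {}")
    case True
    then show ?thesis by (intro exI[of _ "\<lambda>_. {}"]) (auto simp: disjoint_family_on_def)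
  next
    case False
    then obtain B where B: "B \<in> F" "R = ?rect B" using \<open>R \<in> \<R>\<close> by (auto simp: \<R>_def)
    have "open (B i)" for i using B(1) \<B>(2) by (auto simp: F_def PiE_iff topological_basis_open)
    then show ?thesis using B by (intro exI[of _ B]) (auto simp: F_def)
  qed
  have "\<Union>\<R> = {f. inj (($) f)}"
  proof (intro subset_antisym subsetI)
    fix f assume "f \<in> \<Union>\<R>"
    then obtain R where R: "R \<in> \<R>" "f \<in> R" by blast
    obtain B where B: "disjoint_family B" "R = ?rect B" using rect[OF R(1)] by blast
    have "inj (($) f)"
    proof (rule injI)
      fix i j assume "f $ i = f $ j"
      then have "f $ i \<in> B i \<inter> B j" using R B by (metis (mono_tags, lifting) IntI mem_Collect_eq)
      then show "i = j" using B(1) by (auto simp: disjoint_family_on_def)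
    qed
    then show "f \<in> {f. inj (($) f)}" by simp
  next
    fix f :: "'a ^ 'n" assume "f \<in> {f. inj (($) f)}"
    then have inj: "inj (($) f)" by simp
    \<comment> \<open>The entry 1 keeps the minimum meaningful when there is only one index and
      hence no pair.\<close>
    let ?D = "insert 1 ((\<lambda>(i, j). dist (f $ i) (f $ j)) ` {(i, j). i \<noteq> j})"
    define e where "e = Min ?D"
    have fin: "finite ?D" by simp
    have "\<forall>d\<in>?D. d > 0" using inj by (auto simp: inj_eq)
    then have e0: "e > 0" unfolding e_def using fin by (subst Min_gr_iff) auto
    have e: "e \<le> dist (f $ i) (f $ j)" if "i \<noteq> j" for i j
      unfolding e_def by (rule Min_le[OF fin]) (use that in auto)
    have "\<exists>b\<in>\<B>. f $ i \<in> b \<and> b \<subseteq> ball (f $ i) (e / 2)" for i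
    proof -
      have "f $ i \<in> ball (f $ i) (e / 2)" using e0 by simp
      then show ?thesis by (rule topological_basisE[OF \<B>(2) open_ball]) blast
    qed
    then obtain b where b: "\<And>i. b i \<in> \<B>" "\<And>i. f $ i \<in> b i" "\<And>i. b i \<subseteq> ball (f $ i) (e / 2)"
      by metis
    have "b i \<inter> b j = {}" if "i \<noteq> j" for i j
    proof (rule ccontr)
      assume "b i \<inter> b j \<noteq> {}"
      then obtain y where "y \<in> ball (f $ i) (e / 2)" "y \<in> ball (f $ j) (e / 2)" using b(3) by blast
      then have "dist (f $ i) (f $ j) < e"
        by (metis dist_triangle_half_l mem_ball)
      then show False using e[OF that] by simp
    qed
    then have "disjoint_family b" by (auto simp: disjoint_family_on_def)
    moreover have "bounded (b i)" for i using b(3) bounded_ball bounded_subset by blast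
    ultimately have "b \<in> F" using b(1) by (auto simp: F_def)
    then show "f \<in> \<Union>\<R>" using b(2) by (auto simp: \<R>_def)
  qed
  moreover have "range (from_nat_into \<R>) = \<R>" by (rule range_from_nat_into) (use \<R> in auto)
  ultimately show ?thesis
    using rect[OF from_nat_into[OF \<R>(2)]] by (intro that[of "from_nat_into \<R>"]) simp_all
qed

lemma sets_inj_tuples [measurable]: "{f :: 'a::euclidean_space ^ 'n::finite. inj (($) f)} \<in> sets borel"
  unfolding inj_def by measurable

section \<open>Mean numbers of Poisson tuples that leave a given set empty\<close>

locale poisson =
  fixes M :: "'w measure" and Phi :: "'w \<Rightarrow> 'a::euclidean_space set"
  assumes poisson: "poisson_process M Phi"
begin

sublocale prob_space M using poisson by (simp add: poisson_process_def)

lemma finite_Phi: "w \<in> space M \<Longrightarrow> bounded B \<Longrightarrow> finite (Phi w \<inter> B)"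
  using poisson by (simp add: poisson_process_def)

lemma card_measurable [measurable]:
  "B \<in> sets borel \<Longrightarrow> bounded B \<Longrightarrow> (\<lambda>w. card (Phi w \<inter> B)) \<in> M \<rightarrow>\<^sub>M count_space UNIV"
  using poisson by (simp add: poisson_process_def)

lemma prob_card:
  "B \<in> sets borel \<Longrightarrow> bounded B \<Longrightarrow> prob {w \<in> space M. card (Phi w \<inter> B) = k}
    = (measure lborel B) ^ k / fact k * exp (- measure lborel B)"
  using poisson by (simp add: poisson_process_def)

lemma indep_card:
  "finite I \<Longrightarrow> (\<And>i. i \<in> I \<Longrightarrow> B i \<in> sets borel \<and> bounded (B i)) \<Longrightarrow> disjoint_family_on B I \<Longrightarrow>
    indep_vars (\<lambda>_. count_space UNIV) (\<lambda>i w. card (Phi w \<inter> B i)) (I :: nat set)"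
  using poisson by (simp add: poisson_process_def)

lemma prob_void:
  assumes "B \<in> sets borel" "bounded B"
  shows "prob {w \<in> space M. Phi w \<inter> B = {}} = exp (- measure lborel B)"
proof -
  have "{w \<in> space M. Phi w \<inter> B = {}} = {w \<in> space M. card (Phi w \<inter> B) = 0}"
    using finite_Phi[OF _ assms(2)] by (auto simp: card_eq_0_iff)
  then show ?thesis using prob_card[OF assms, of 0] by simp
qed

lemma sets_void [measurable]:
  assumes [measurable]: "B \<in> sets borel" and "bounded B"
  shows "{w \<in> space M. Phi w \<inter> B = {}} \<in> sets M"
proof -
  have [measurable]: "(\<lambda>w. card (Phi w \<inter> B)) \<in> M \<rightarrow>\<^sub>M count_space UNIV" by (rule card_measurable) fact+
  have "{w \<in> space M. Phi w \<inter> B = {}} = {w \<in> space M. card (Phi w \<inter> B) = 0}"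
    using finite_Phi[OF _ assms(2)] by (auto simp: card_eq_0_iff)
  also have "\<dots> \<in> sets M" by measurable
  finally show ?thesis .
qed

lemma emeasure_bounded_finite: "bounded B \<Longrightarrow> emeasure lborel (B :: 'b::euclidean_space set) < \<infinity>"
  by (rule emeasure_bounded_finite)

lemma mean_card:
  assumes B: "B \<in> sets borel" "bounded B"
  shows "(\<integral>\<^sup>+w. of_nat (card (Phi w \<inter> B)) \<partial>M) = emeasure lborel B"
proof -
  let ?v = "measure lborel B"
  note [measurable] = card_measurable[OF B]
  have "(\<integral>\<^sup>+w. of_nat (card (Phi w \<inter> B)) \<partial>M)
      = (\<integral>\<^sup>+w. (\<Sum>k. of_nat k * indicator {w \<in> space M. card (Phi w \<inter> B) = k} w) \<partial>M)"
  proof (rule nn_integral_cong)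
    fix w assume w: "w \<in> space M"
    have "(\<Sum>k. of_nat k * indicator {w \<in> space M. card (Phi w \<inter> B) = k} w :: ennreal)
        = (\<Sum>k\<in>{card (Phi w \<inter> B)}. of_nat k * indicator {w \<in> space M. card (Phi w \<inter> B) = k} w)"
      by (rule suminf_finite) (auto simp: indicator_def)
    then show "of_nat (card (Phi w \<inter> B)) = (\<Sum>k. of_nat k * indicator {w \<in> space M. card (Phi w \<inter> B) = k} w :: ennreal)"
      using w by simp
  qed
  also have "\<dots> = (\<Sum>k. \<integral>\<^sup>+w. of_nat k * indicator {w \<in> space M. card (Phi w \<inter> B) = k} w \<partial>M)"
    by (rule nn_integral_suminf) measurable
  also have "\<dots> = (\<Sum>k. ennreal (real k * (?v ^ k / fact k * exp (- ?v))))"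
  proof (rule suminf_cong)
    fix k
    have "(\<integral>\<^sup>+w. of_nat k * indicator {w \<in> space M. card (Phi w \<inter> B) = k} w \<partial>M)
        = of_nat k * emeasure M {w \<in> space M. card (Phi w \<inter> B) = k}"
      by (rule nn_integral_cmult_indicator) measurable
    also have "\<dots> = ennreal (real k) * ennreal (?v ^ k / fact k * exp (- ?v))"
      by (simp add: emeasure_eq_measure prob_card[OF B] ennreal_of_nat_eq_real_of_nat)
    finally show "(\<integral>\<^sup>+w. of_nat k * indicator {w \<in> space M. card (Phi w \<inter> B) = k} w \<partial>M)
        = ennreal (real k * (?v ^ k / fact k * exp (- ?v)))"
      by (subst ennreal_mult) auto
  qed
  also have "\<dots> = ennreal ?v"
  proof (rule suminf_ennreal_eq)
    have "(\<lambda>k. (?v ^ k /\<^sub>R fact k) * (?v * exp (- ?v))) sums (exp ?v * (?v * exp (- ?v)))"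
      by (intro sums_mult2 exp_converges)
    moreover have "exp ?v * (?v * exp (- ?v)) = ?v"
      by (simp add: exp_minus)
    moreover have "(?v ^ k /\<^sub>R fact k) * (?v * exp (- ?v)) = real (Suc k) * (?v ^ Suc k / fact (Suc k) * exp (- ?v))" for k
      by (simp add: field_simps del: of_nat_Suc)
    ultimately have "(\<lambda>k. real (Suc k) * (?v ^ Suc k / fact (Suc k) * exp (- ?v))) sums ?v" by simp
    then show "(\<lambda>k. real k * (?v ^ k / fact k * exp (- ?v))) sums ?v"
      by (subst (asm) sums_Suc_iff) simp
  qed simp
  also have "\<dots> = emeasure lborel B"
    using emeasure_bounded_finite[OF B(2)] by (simp add: emeasure_eq_ennreal_measure less_top)
  finally show ?thesis .
qed

definition vtup :: "'a set \<Rightarrow> ('a ^ 'n::finite) set \<Rightarrow> 'w \<Rightarrow> ennreal" where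
  "vtup C A w = (if Phi w \<inter> C = {} then ntup (Phi w) A else 0)"

text \<open>When C contains no points, each side \<open>B i\<close> may be replaced by
  \<open>B i - C\<close>. These sets and C are pairwise disjoint, so their counts are independent:
  the void event contributes the exponential and every side contributes its volume.\<close>

lemma mean_vtup_rectangle:
  fixes B :: "'n::finite \<Rightarrow> 'a set"
  assumes C: "C \<in> sets borel" "bounded C" and B: "\<And>i. B i \<in> sets borel" "\<And>i. bounded (B i)" "disjoint_family B"
  shows "vtup C {f. \<forall>i. f $ i \<in> B i} \<in> borel_measurable M"
    "(\<integral>\<^sup>+w. vtup C {f. \<forall>i. f $ i \<in> B i} w \<partial>M)
      = ennreal (exp (- measure lborel C)) * emeasure lborel {f. \<forall>i. f $ i \<in> B i - C}"
proof -
  let ?N = "CARD('n)"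
  obtain e where e: "bij_betw e {..<?N} (UNIV :: 'n set)"
    using ex_bij_betw_nat_finite[of "UNIV :: 'n set"] by (auto simp: atLeast0LessThan)
  \<comment> \<open>Independence is stated for families indexed by natural numbers. The coordinates
    are enumerated by e, and the index CARD('n), one past the last coordinate, is reserved for
    C.\<close>
  define D where "D j = (if j = ?N then C else B (e j) - C)" for j
  define Y :: "nat \<Rightarrow> nat \<Rightarrow> ennreal" where "Y j k = (if j = ?N then of_bool (k = 0) else of_nat k)" for j k
  have D: "D j \<in> sets borel" "bounded (D j)" for j
    using C B by (auto simp: D_def intro: bounded_subset)
  have disj: "disjoint_family_on D {..?N}"
    unfolding disjoint_family_on_def
  proof (intro ballI impI)
    fix i j assume ij: "i \<in> {..?N}" "j \<in> {..?N}" "i \<noteq> j"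
    show "D i \<inter> D j = {}"
    proof (cases "i = ?N \<or> j = ?N")
      case True then show ?thesis using ij by (auto simp: D_def)
    next
      case False
      then have "e i \<noteq> e j" using ij e by (auto simp: bij_betw_def inj_on_def)
      then have "B (e i) \<inter> B (e j) = {}" using B(3) by (auto simp: disjoint_family_on_def)
      then show ?thesis using False by (auto simp: D_def)
    qed
  qed
  have eq: "vtup C {f. \<forall>i. f $ i \<in> B i} w = (\<Prod>j\<in>{..?N}. Y j (card (Phi w \<inter> D j)))" if w: "w \<in> space M" for w
  proof -
    have "(\<Prod>j\<in>{..?N}. Y j (card (Phi w \<inter> D j)))
        = (\<Prod>j\<in>{..<?N}. of_nat (card (Phi w \<inter> (B (e j) - C)))) * of_bool (Phi w \<inter> C = {})"
      using finite_Phi[OF w C(2)]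
      by (simp add: lessThan_Suc_atMost[symmetric] Y_def D_def card_eq_0_iff)
    also have "(\<Prod>j\<in>{..<?N}. of_nat (card (Phi w \<inter> (B (e j) - C))) :: ennreal)
        = (\<Prod>i\<in>UNIV. of_nat (card (Phi w \<inter> (B i - C))))"
      by (rule prod.reindex_bij_betw[OF e])
    also have "\<dots> * of_bool (Phi w \<inter> C = {}) = vtup C {f. \<forall>i. f $ i \<in> B i} w"
    proof (cases "Phi w \<inter> C = {}")
      case True
      then have "Phi w \<inter> (B i - C) = Phi w \<inter> B i" for i by blast
      then show ?thesis using True by (simp add: vtup_def ntup_rectangle[OF finite_Phi[OF w B(2)] B(3)])
    qed (simp add: vtup_def)
    finally show ?thesis ..
  qed
  have Dm[measurable]: "(\<lambda>w. card (Phi w \<inter> D j)) \<in> M \<rightarrow>\<^sub>M count_space UNIV" for j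
    by (rule card_measurable) (rule D)+
  have Ym: "(\<lambda>w. Y j (card (Phi w \<inter> D j))) \<in> borel_measurable M" for j
    by (rule measurable_compose[OF Dm]) simp
  then have "(\<lambda>w. \<Prod>j\<in>{..?N}. Y j (card (Phi w \<inter> D j))) \<in> borel_measurable M" by measurable
  then show "vtup C {f. \<forall>i. f $ i \<in> B i} \<in> borel_measurable M"
    by (subst measurable_cong[OF eq])
  have "(\<integral>\<^sup>+w. vtup C {f. \<forall>i. f $ i \<in> B i} w \<partial>M) = (\<integral>\<^sup>+w. (\<Prod>j\<in>{..?N}. Y j (card (Phi w \<inter> D j))) \<partial>M)"
    by (intro nn_integral_cong eq)
  also have "\<dots> = (\<Prod>j\<in>{..?N}. \<integral>\<^sup>+w. Y j (card (Phi w \<inter> D j)) \<partial>M)"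
  proof (rule indep_vars_nn_integral)
    show "indep_vars (\<lambda>_. borel) (\<lambda>j w. Y j (card (Phi w \<inter> D j))) {..?N}"
      by (rule indep_vars_compose2[OF indep_card]) (use D disj in auto)
  qed auto
  also have "\<dots> = (\<Prod>j\<in>{..<?N}. \<integral>\<^sup>+w. of_nat (card (Phi w \<inter> (B (e j) - C))) \<partial>M) * (\<integral>\<^sup>+w. of_bool (card (Phi w \<inter> C) = 0) \<partial>M)"
    by (simp add: lessThan_Suc_atMost[symmetric] Y_def D_def)
  also have "(\<Prod>j\<in>{..<?N}. \<integral>\<^sup>+w. of_nat (card (Phi w \<inter> (B (e j) - C))) \<partial>M) = (\<Prod>i\<in>UNIV. \<integral>\<^sup>+w. of_nat (card (Phi w \<inter> (B i - C))) \<partial>M)"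
    by (rule prod.reindex_bij_betw[OF e])
  also have "\<dots> = emeasure lborel {f. \<forall>i. f $ i \<in> B i - C}"
    using B C by (subst emeasure_vec_prod) (auto intro!: prod.cong mean_card intro: bounded_subset)
  also have "(\<integral>\<^sup>+w. of_bool (card (Phi w \<inter> C) = 0) \<partial>M) = (\<integral>\<^sup>+w. indicator {w \<in> space M. card (Phi w \<inter> C) = 0} w \<partial>M)"
    by (rule nn_integral_cong) (auto simp: indicator_def)
  also have "\<dots> = ennreal (exp (- measure lborel C))"
    using card_measurable[OF C] prob_card[OF C, of 0] by (subst nn_integral_indicator) (auto simp: emeasure_eq_measure)
  finally show "(\<integral>\<^sup>+w. vtup C {f. \<forall>i. f $ i \<in> B i} w \<partial>M)
      = ennreal (exp (- measure lborel C)) * emeasure lborel {f. \<forall>i. f $ i \<in> B i - C}"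
    by (simp add: mult.commute)
qed

lemma vtup_suminf: "disjoint_family A \<Longrightarrow> vtup C (\<Union>n. A n) w = (\<Sum>n. vtup C (A n :: ('a ^ 'n::finite) set) w)"
  by (simp add: vtup_def ntup_suminf)

text \<open>Both sides are measures in A that agree on boxes, which are closed under intersection.
  Confining A to one bounded rectangle keeps both measures finite, so that the step to complements
  may subtract in \<open>ennreal\<close>.\<close>

lemma mean_vtup_in_rectangle:
  fixes B :: "'n::finite \<Rightarrow> 'a set" and A :: "('a ^ 'n) set"
  assumes C: "C \<in> sets borel" "bounded C" and B: "\<And>i. B i \<in> sets borel" "\<And>i. bounded (B i)" "disjoint_family B"
  assumes A: "A \<in> sets borel"
  defines "R \<equiv> {f. \<forall>i. f $ i \<in> B i}"
  shows "vtup C (A \<inter> R) \<in> borel_measurable M \<and>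
    (\<integral>\<^sup>+w. vtup C (A \<inter> R) w \<partial>M) = ennreal (exp (- measure lborel C)) * emeasure lborel (A \<inter> R \<inter> {f. \<forall>i. f $ i \<notin> C})"
    (is "?P A")
proof -
  let ?G = "range (\<lambda>(a, b). box a b :: ('a ^ 'n) set)"
  let ?V = "{f :: 'a ^ 'n. \<forall>i. f $ i \<notin> C}"
  note [measurable] = C(1) B(1)
  have R[measurable]: "R \<in> sets borel" unfolding R_def by measurable
  have V[measurable]: "?V \<in> sets borel" by measurable
  have G: "sets borel = sigma_sets UNIV ?G" by (subst borel_eq_box) simp
  have rect: "vtup C R \<in> borel_measurable M"
    "(\<integral>\<^sup>+w. vtup C R w \<partial>M) = ennreal (exp (- measure lborel C)) * emeasure lborel (R \<inter> ?V)"
  proof -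
    have "R \<inter> ?V = {f. \<forall>i. f $ i \<in> B i - C}" by (auto simp: R_def)
    then show "vtup C R \<in> borel_measurable M"
      "(\<integral>\<^sup>+w. vtup C R w \<partial>M) = ennreal (exp (- measure lborel C)) * emeasure lborel (R \<inter> ?V)"
      using mean_vtup_rectangle[of C B] C B unfolding R_def by simp_all
  qed
  have Rfin: "emeasure lborel (R \<inter> ?V) < \<infinity>"
  proof -
    have "emeasure lborel (R \<inter> ?V) \<le> emeasure lborel R" by (rule emeasure_mono) auto
    also have "\<dots> = (\<Prod>i\<in>UNIV. emeasure lborel (B i))" unfolding R_def by (rule emeasure_vec_prod) (rule B)
    also have "\<dots> < \<infinity>" using emeasure_bounded_finite[OF B(2)]
      by (simp add: less_top[symmetric] ennreal_prod_eq_top)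
    finally show ?thesis .
  qed
  show ?thesis
  proof (rule sigma_sets_induct_disjoint[of ?G UNIV A ?P])
    show "Int_stable ?G" by (auto simp: Int_stable_def box_Int_box)
    show "?G \<subseteq> Pow UNIV" by simp
    show "A \<in> sigma_sets UNIV ?G" using A G by simp
  next
    fix S assume "S \<in> ?G"
    then obtain a b where S: "S = box a b" by auto
    let ?B = "\<lambda>i. box (a $ i) (b $ i) \<inter> B i"
    have "S \<inter> R = {f. \<forall>i. f $ i \<in> ?B i}" "S \<inter> R \<inter> ?V = {f. \<forall>i. f $ i \<in> ?B i - C}"
      by (auto simp: S R_def box_vec)
    moreover have "disjoint_family ?B" using B(3) by (auto simp: disjoint_family_on_def)
    moreover have "?B i \<in> sets borel" "bounded (?B i)" for i using B by (auto intro: bounded_subset)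
    ultimately show "?P S" using mean_vtup_rectangle[of C ?B] C by simp
  next
    have "vtup C ({} :: ('a ^ 'n) set) = (\<lambda>_. 0)" by (auto simp: vtup_def ntup_def)
    then show "?P {}" by simp
  next
    fix S assume S: "S \<in> sigma_sets UNIV ?G" and P: "?P S"
    have Sb[measurable]: "S \<in> sets borel" using S G by simp
    note P1[measurable] = conjunct1[OF P]
    have le: "vtup C (S \<inter> R) w \<le> vtup C R w" for w by (simp add: vtup_def ntup_mono)
    have fin: "ntup (Phi w) R < \<infinity>" if w: "w \<in> space M" for w
      unfolding R_def by (subst ntup_rectangle[OF finite_Phi[OF w B(2)] B(3)])
        (simp add: less_top[symmetric] ennreal_prod_eq_top)
    have eq: "vtup C ((UNIV - S) \<inter> R) w = vtup C R w - vtup C (S \<inter> R) w" if w: "w \<in> space M" for w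
    proof (cases "Phi w \<inter> C = {}")
      case True
      have "ntup (Phi w) ((UNIV - S) \<inter> R) = emeasure (count_space UNIV) (R \<inter> tuples (Phi w) - S \<inter> R \<inter> tuples (Phi w))"
        unfolding ntup_def by (rule arg_cong[where f="emeasure _"]) blast
      also have "\<dots> = ntup (Phi w) R - ntup (Phi w) (S \<inter> R)"
        unfolding ntup_def using ntup_mono[of "S \<inter> R" R "Phi w"] fin[OF w]
        by (intro emeasure_Diff) (auto simp: ntup_def)
      finally show ?thesis using True by (simp add: vtup_def)
    qed (simp add: vtup_def)
    have m: "vtup C ((UNIV - S) \<inter> R) \<in> borel_measurable M"
      by (subst measurable_cong[OF eq]) (assumption, intro borel_measurable_minus_ennreal rect P1)
    have fI: "(\<integral>\<^sup>+w. vtup C (S \<inter> R) w \<partial>M) \<noteq> \<infinity>"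
    proof -
      have "(\<integral>\<^sup>+w. vtup C (S \<inter> R) w \<partial>M) \<le> (\<integral>\<^sup>+w. vtup C R w \<partial>M)" by (intro nn_integral_mono le)
      also have "\<dots> < \<infinity>" unfolding rect(2) using Rfin by (simp add: ennreal_mult_less_top)
      finally show ?thesis by simp
    qed
    have "(\<integral>\<^sup>+w. vtup C ((UNIV - S) \<inter> R) w \<partial>M) = (\<integral>\<^sup>+w. vtup C R w - vtup C (S \<inter> R) w \<partial>M)"
      by (intro nn_integral_cong eq)
    also have "\<dots> = (\<integral>\<^sup>+w. vtup C R w \<partial>M) - (\<integral>\<^sup>+w. vtup C (S \<inter> R) w \<partial>M)"
      by (intro nn_integral_diff rect P1 fI) (simp add: le)
    also have "\<dots> = ennreal (exp (- measure lborel C)) * (emeasure lborel (R \<inter> ?V) - emeasure lborel (S \<inter> R \<inter> ?V))"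
      unfolding rect(2) conjunct2[OF P] by (simp add: ennreal_right_diff_distrib)
    also have "emeasure lborel (R \<inter> ?V) - emeasure lborel (S \<inter> R \<inter> ?V) = emeasure lborel (R \<inter> ?V - S \<inter> R \<inter> ?V)"
    proof (rule emeasure_Diff[symmetric])
      have "emeasure lborel (S \<inter> R \<inter> ?V) \<le> emeasure lborel (R \<inter> ?V)" by (rule emeasure_mono) auto
      then show "emeasure lborel (S \<inter> R \<inter> ?V) \<noteq> \<infinity>" using Rfin by auto
    qed (auto intro!: sets.Int)
    also have "R \<inter> ?V - S \<inter> R \<inter> ?V = (UNIV - S) \<inter> R \<inter> ?V" by blast
    finally show "?P (UNIV - S)" using m by simp
  next
    fix S :: "nat \<Rightarrow> ('a ^ 'n) set"
    assume disj: "disjoint_family S" and S: "range S \<subseteq> sigma_sets UNIV ?G" and P: "\<And>i. ?P (S i)"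
    have Sb[measurable]: "S i \<in> sets borel" for i using S G by auto
    have m[measurable]: "vtup C (S i \<inter> R) \<in> borel_measurable M" for i using P by simp
    have eq: "vtup C (\<Union> (range S) \<inter> R) w = (\<Sum>i. vtup C (S i \<inter> R) w)" for w
    proof -
      have "\<Union> (range S) \<inter> R = (\<Union>i. S i \<inter> R)" by auto
      then show ?thesis using disj by (simp only:) (rule vtup_suminf, auto simp: disjoint_family_on_def)
    qed
    have "(\<integral>\<^sup>+w. vtup C (\<Union> (range S) \<inter> R) w \<partial>M) = (\<Sum>i. \<integral>\<^sup>+w. vtup C (S i \<inter> R) w \<partial>M)"
      unfolding eq by (rule nn_integral_suminf) (rule m)
    also have "\<dots> = (\<Sum>i. ennreal (exp (- measure lborel C)) * emeasure lborel (S i \<inter> R \<inter> ?V))"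
      using P by (simp only:)
    also have "\<dots> = ennreal (exp (- measure lborel C)) * (\<Sum>i. emeasure lborel (S i \<inter> R \<inter> ?V))"
      by (rule ennreal_suminf_cmult)
    also have "(\<Sum>i. emeasure lborel (S i \<inter> R \<inter> ?V)) = emeasure lborel (\<Union>i. S i \<inter> R \<inter> ?V)"
      by (rule suminf_emeasure) (use disj in \<open>auto simp: disjoint_family_on_def\<close>)
    also have "(\<Union>i. S i \<inter> R \<inter> ?V) = \<Union> (range S) \<inter> R \<inter> ?V" by auto
    finally have 1: "(\<integral>\<^sup>+w. vtup C (\<Union> (range S) \<inter> R) w \<partial>M)
      = ennreal (exp (- measure lborel C)) * emeasure lborel (\<Union> (range S) \<inter> R \<inter> ?V)" .
    have 2: "(\<lambda>w. \<Sum>i. vtup C (S i \<inter> R) w) \<in> borel_measurable M" by measurable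
    have "vtup C (\<Union> (range S) \<inter> R) = (\<lambda>w. \<Sum>i. vtup C (S i \<inter> R) w)" using eq by (rule ext)
    then show "?P (\<Union> (range S))" using 1 2 by (simp only: simp_thms)
  qed
qed

text \<open>The multivariate Mecke formula for a fixed void set: A is cut along disjoint pieces of
  the countable cover of the injective tuples by rectangles, and the pieces are summed.\<close>

proposition mean_vtup:
  fixes A :: "('a ^ 'n::finite) set"
  assumes C: "C \<in> sets borel" "bounded C" and A: "A \<in> sets borel"
  shows "vtup C A \<in> borel_measurable M"
    "(\<integral>\<^sup>+w. vtup C A w \<partial>M)
      = ennreal (exp (- measure lborel C)) * emeasure lborel {f \<in> A. inj (($) f) \<and> (\<forall>i. f $ i \<notin> C)}"
proof -
  let ?V = "{f :: 'a ^ 'n. \<forall>i. f $ i \<notin> C}"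
  note [measurable] = C(1) A
  have V[measurable]: "?V \<in> sets borel" by measurable
  obtain R :: "nat \<Rightarrow> ('a ^ 'n) set" where R: "\<And>n. \<exists>B. (\<forall>i. B i \<in> sets borel \<and> bounded (B i)) \<and> disjoint_family B \<and> R n = {f. \<forall>i. f $ i \<in> B i}"
    and UR: "(\<Union>n. R n) = {f. inj (($) f)}" by (rule inj_tuples_cover) blast
  have Rm[measurable]: "R n \<in> sets borel" for n
  proof -
    obtain B where B: "\<forall>i. B i \<in> sets borel \<and> bounded (B i)" "R n = {f. \<forall>i. f $ i \<in> B i}" using R[of n] by blast
    have [measurable]: "B i \<in> sets borel" for i using B by blast
    show ?thesis unfolding B(2) by measurable
  qed
  define S where "S n = A \<inter> disjointed R n" for n
  have dm[measurable]: "disjointed R n \<in> sets borel" for n unfolding disjointed_def by measurable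
  have Sm[measurable]: "S n \<in> sets borel" for n unfolding S_def by measurable
  have SR: "S n \<inter> R n = S n" for n using disjointed_subset[of R n] by (auto simp: S_def)
  have disj: "disjoint_family S" using disjoint_family_disjointed[of R] by (auto simp: S_def disjoint_family_on_def)
  have US: "(\<Union>n. S n) = A \<inter> {f. inj (($) f)}"
    using UN_disjointed_eq[of R] UR by (auto simp: S_def)
  have P: "vtup C (S n) \<in> borel_measurable M \<and> (\<integral>\<^sup>+w. vtup C (S n) w \<partial>M) = ennreal (exp (- measure lborel C)) * emeasure lborel (S n \<inter> ?V)" for n
  proof -
    obtain B where B: "\<And>i. B i \<in> sets borel" "\<And>i. bounded (B i)" "disjoint_family B" "R n = {f. \<forall>i. f $ i \<in> B i}"
      using R[of n] by blast
    show ?thesis using mean_vtup_in_rectangle[OF C B(1-3) Sm[of n]] unfolding B(4)[symmetric] SR .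
  qed
  have m[measurable]: "vtup C (S n) \<in> borel_measurable M" for n using P by blast
  have eq: "vtup C A w = (\<Sum>n. vtup C (S n) w)" for w
  proof -
    have "A \<inter> tuples (Phi w) = (\<Union>n. S n) \<inter> tuples (Phi w)" unfolding US by (auto simp: tuples_def)
    then have "vtup C A w = vtup C (\<Union>n. S n) w" by (simp add: vtup_def ntup_def)
    then show ?thesis using vtup_suminf[OF disj] by simp
  qed
  have "(\<lambda>w. \<Sum>n. vtup C (S n) w) \<in> borel_measurable M" by measurable
  moreover have "vtup C A = (\<lambda>w. \<Sum>n. vtup C (S n) w)" using eq by (rule ext)
  ultimately show "vtup C A \<in> borel_measurable M" by (simp only:)
  have "(\<integral>\<^sup>+w. vtup C A w \<partial>M) = (\<Sum>n. \<integral>\<^sup>+w. vtup C (S n) w \<partial>M)"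
    unfolding eq by (rule nn_integral_suminf) (rule m)
  also have "\<dots> = (\<Sum>n. ennreal (exp (- measure lborel C)) * emeasure lborel (S n \<inter> ?V))"
    using P by (simp only:)
  also have "\<dots> = ennreal (exp (- measure lborel C)) * (\<Sum>n. emeasure lborel (S n \<inter> ?V))"
    by (rule ennreal_suminf_cmult)
  also have "(\<Sum>n. emeasure lborel (S n \<inter> ?V)) = emeasure lborel (\<Union>n. S n \<inter> ?V)"
    by (rule suminf_emeasure) (use disj in \<open>auto simp: disjoint_family_on_def\<close>)
  also have "(\<Union>n. S n \<inter> ?V) = (\<Union>n. S n) \<inter> ?V" by auto
  also have "\<dots> = {f \<in> A. inj (($) f) \<and> (\<forall>i. f $ i \<notin> C)}" unfolding US by auto
  finally show "(\<integral>\<^sup>+w. vtup C A w \<partial>M)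
      = ennreal (exp (- measure lborel C)) * emeasure lborel {f \<in> A. inj (($) f) \<and> (\<forall>i. f $ i \<notin> C)}" .
qed

text \<open>The mean number of tuples in a null set is 0, by the formula with an empty void set. It
  transfers every degeneracy that is Lebesgue-null for tuples to the random points.\<close>

lemma AE_no_tuples:
  fixes A :: "('a ^ 'n::finite) set"
  assumes "A \<in> null_sets lborel"
  shows "AE w in M. A \<inter> tuples (Phi w) = {}"
proof -
  have A: "A \<in> sets borel" using assms by auto
  have "(\<integral>\<^sup>+w. vtup {} A w \<partial>M) = emeasure lborel {f \<in> A. inj (($) f)}"
    using mean_vtup(2)[of "{}" A] A by simp
  also have "\<dots> \<le> emeasure lborel A" by (rule emeasure_mono) (use A in auto)
  also have "\<dots> = 0" using assms by auto
  finally have "(\<integral>\<^sup>+w. vtup {} A w \<partial>M) = 0" by simp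
  then have "AE w in M. vtup {} A w = 0"
    using mean_vtup(1)[of "{}" A] A by (subst (asm) nn_integral_0_iff_AE) auto
  then show ?thesis
    by eventually_elim (auto simp: vtup_def ntup_def emeasure_count_space_eq_0)
qed

end

text \<open>The empty ball of a tuple depends on the tuple. Rounding its centre leaves countably many
  balls, and shrinking them by twice the rounding error makes them approximate the true one from
  inside.\<close>

definition grid :: "nat \<Rightarrow> 'a::euclidean_space \<Rightarrow> 'a" where
  "grid m x = (\<Sum>b\<in>Basis. (of_int \<lfloor>real (Suc m) * (x \<bullet> b)\<rfloor> / real (Suc m)) *\<^sub>R b)"

definition gerr :: "'a::euclidean_space itself \<Rightarrow> nat \<Rightarrow> real" where
  "gerr _ m = real DIM('a) / real (Suc m)"

lemma dist_grid: "dist (grid m x) (x :: 'a::euclidean_space) \<le> gerr TYPE('a) m"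
proof -
  have "norm (grid m x - x) \<le> (\<Sum>b\<in>Basis. \<bar>(grid m x - x) \<bullet> b\<bar>)" by (rule norm_le_l1)
  also have "\<dots> \<le> (\<Sum>b\<in>(Basis :: 'a set). 1 / real (Suc m))"
  proof (rule sum_mono)
    fix b :: 'a assume b: "b \<in> Basis"
    let ?t = "real (Suc m) * (x \<bullet> b)"
    have "(grid m x - x) \<bullet> b = (of_int \<lfloor>?t\<rfloor> - ?t) / real (Suc m)"
      using b by (simp add: grid_def inner_diff_left diff_divide_distrib del: of_nat_Suc)
    moreover have "\<bar>of_int \<lfloor>?t\<rfloor> - ?t\<bar> \<le> 1" by linarith
    ultimately show "\<bar>(grid m x - x) \<bullet> b\<bar> \<le> 1 / real (Suc m)"
      by (simp add: abs_divide divide_right_mono del: of_nat_Suc)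
  qed
  finally show ?thesis by (simp add: dist_norm gerr_def)
qed

lemma gerr_LIMSEQ: "gerr TYPE('a::euclidean_space) \<longlonglongrightarrow> 0"
proof -
  have "(\<lambda>m. real DIM('a) * (1 / real (Suc m))) \<longlonglongrightarrow> real DIM('a) * 0"
    by (intro tendsto_mult tendsto_const LIMSEQ_Suc[OF lim_1_over_n])
  then show ?thesis by (simp add: gerr_def[abs_def])
qed

lemma grid_LIMSEQ: "(\<lambda>m. grid m x) \<longlonglongrightarrow> (x :: 'a::euclidean_space)"
proof (rule tendsto_dist_iff[THEN iffD2])
  show "(\<lambda>m. dist (grid m x) x) \<longlonglongrightarrow> 0"
    by (rule tendsto_sandwich[OF _ _ tendsto_const gerr_LIMSEQ[where 'a='a]]) (auto simp: dist_grid)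
qed

lemma grid_measurable [measurable (raw)]:
  assumes [measurable]: "f \<in> borel_measurable M"
  shows "(\<lambda>x. grid m (f x) :: 'a::euclidean_space) \<in> borel_measurable M"
  unfolding grid_def by measurable

lemma countable_range_grid: "countable (range (grid m :: 'a::euclidean_space \<Rightarrow> 'a))"
proof -
  let ?h = "\<lambda>g :: 'a \<Rightarrow> int. \<Sum>b\<in>(Basis :: 'a set). (of_int (g b) / real (Suc m)) *\<^sub>R b"
  have "grid m x \<in> ?h ` Pi\<^sub>E Basis (\<lambda>_. UNIV)" for x :: 'a
    unfolding grid_def
    by (rule image_eqI[of _ _ "restrict (\<lambda>b. \<lfloor>real (Suc m) * (x \<bullet> b)\<rfloor>) Basis"]) auto
  then have "range (grid m :: 'a \<Rightarrow> 'a) \<subseteq> ?h ` Pi\<^sub>E Basis (\<lambda>_. UNIV)" by blast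
  moreover have "countable (?h ` Pi\<^sub>E Basis (\<lambda>_. UNIV :: int set))"
    by (intro countable_image countable_PiE) auto
  ultimately show ?thesis by (rule countable_subset)
qed

text \<open>Shrunken balls can have negative radius; with \<open>max 0\<close> the volume is one
  formula for all r, visibly continuous and measurable in the centre.\<close>

lemma measure_ball_max:
  "measure lborel (ball (z :: 'a::euclidean_space) r) = unit_ball_vol (real DIM('a)) * (max 0 r) ^ DIM('a)"
proof (cases "r \<ge> 0")
  case True then show ?thesis by (simp add: content_ball)
next
  case False
  then have "ball z r = {}" by simp
  then show ?thesis using False by (simp add: zero_power)
qed

context poisson
begin

text \<open>On each level set of x the void set is constant, so \<open>mean_vtup\<close> applies
  piece by piece. Since tuples in A are injective and avoid their own void set, the conditions in
  that formula hold on all of A.\<close>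

lemma mean_vtup_countable:
  fixes A :: "('a ^ 'n::finite) set" and x :: "'a ^ 'n \<Rightarrow> 'a" and C :: "'a \<Rightarrow> 'a set"
  assumes A[measurable]: "A \<in> sets borel" and x[measurable]: "x \<in> borel_measurable borel"
    and count: "countable (range x)" and C: "\<And>z. C z \<in> sets borel" "\<And>z. bounded (C z)"
    and AC: "\<And>f. f \<in> A \<Longrightarrow> inj (($) f)" "\<And>f i. f \<in> A \<Longrightarrow> f $ i \<notin> C (x f)"
    and meas: "(\<lambda>f. measure lborel (C (x f))) \<in> borel_measurable borel"
  shows "(\<lambda>w. emeasure (count_space UNIV) {f \<in> A \<inter> tuples (Phi w). Phi w \<inter> C (x f) = {}}) \<in> borel_measurable M"
    "(\<integral>\<^sup>+w. emeasure (count_space UNIV) {f \<in> A \<inter> tuples (Phi w). Phi w \<inter> C (x f) = {}} \<partial>M)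
      = (\<integral>\<^sup>+f. indicator A f * ennreal (exp (- measure lborel (C (x f)))) \<partial>lborel)"
proof -
  note meas[measurable]
  let ?g = "to_nat_on (range x)"
  let ?Z = "from_nat_into (range x)"
  define S where "S k = A \<inter> x -` {z \<in> range x. ?g z = k}" for k
  have xZ: "x f = ?Z k" if "f \<in> S k" for f k
    using that count by (auto simp: S_def)
  have Sm[measurable]: "S k \<in> sets borel" for k
  proof -
    have "{z \<in> range x. ?g z = k} \<in> sets borel"
      by (rule sets.countable) (auto intro: countable_subset[OF _ count])
    from measurable_sets[OF x this] have "x -` {z \<in> range x. ?g z = k} \<in> sets borel" by simp
    then show ?thesis unfolding S_def by (rule sets.Int[OF A])
  qed
  have disj: "disjoint_family S" by (auto simp: S_def disjoint_family_on_def)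
  have US: "A = (\<Union>k. S k)" by (auto simp: S_def)
  have N: "emeasure (count_space UNIV) {f \<in> A \<inter> tuples (Phi w). Phi w \<inter> C (x f) = {}} = (\<Sum>k. vtup (C (?Z k)) (S k) w)" for w
  proof -
    have v: "vtup (C (?Z k)) (S k) w = emeasure (count_space UNIV) {f \<in> S k \<inter> tuples (Phi w). Phi w \<inter> C (x f) = {}}" for k
    proof (cases "Phi w \<inter> C (?Z k) = {}")
      case True
      then have "{f \<in> S k \<inter> tuples (Phi w). Phi w \<inter> C (x f) = {}} = S k \<inter> tuples (Phi w)"
        using xZ by auto
      then show ?thesis using True by (simp add: vtup_def ntup_def)
    next
      case False
      then have "{f \<in> S k \<inter> tuples (Phi w). Phi w \<inter> C (x f) = {}} = {}" using xZ by auto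
      then show ?thesis by (simp only: vtup_def False if_False emeasure_empty)
    qed
    have "(\<Sum>k. vtup (C (?Z k)) (S k) w) = emeasure (count_space UNIV) (\<Union>k. {f \<in> S k \<inter> tuples (Phi w). Phi w \<inter> C (x f) = {}})"
      unfolding v using disj by (intro suminf_emeasure) (auto simp: disjoint_family_on_def)
    also have "(\<Union>k. {f \<in> S k \<inter> tuples (Phi w). Phi w \<inter> C (x f) = {}}) = {f \<in> A \<inter> tuples (Phi w). Phi w \<inter> C (x f) = {}}"
      unfolding US by blast
    finally show ?thesis ..
  qed
  have m[measurable]: "vtup (C (?Z k)) (S k) \<in> borel_measurable M" for k
    by (rule mean_vtup(1)) (use C Sm in auto)
  show "(\<lambda>w. emeasure (count_space UNIV) {f \<in> A \<inter> tuples (Phi w). Phi w \<inter> C (x f) = {}}) \<in> borel_measurable M"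
    unfolding N by measurable
  have "(\<integral>\<^sup>+w. emeasure (count_space UNIV) {f \<in> A \<inter> tuples (Phi w). Phi w \<inter> C (x f) = {}} \<partial>M)
      = (\<Sum>k. \<integral>\<^sup>+w. vtup (C (?Z k)) (S k) w \<partial>M)"
    unfolding N by (rule nn_integral_suminf) (rule m)
  also have "\<dots> = (\<Sum>k. \<integral>\<^sup>+f. indicator (S k) f * ennreal (exp (- measure lborel (C (x f)))) \<partial>lborel)"
  proof (rule suminf_cong)
    fix k
    have "{f \<in> S k. inj (($) f) \<and> (\<forall>i. f $ i \<notin> C (?Z k))} = S k"
    proof -
      have "inj (($) f) \<and> (\<forall>i. f $ i \<notin> C (?Z k))" if "f \<in> S k" for f
        using that AC[of f] xZ[OF that] by (simp add: S_def)
      then show ?thesis by blast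
    qed
    then have "(\<integral>\<^sup>+w. vtup (C (?Z k)) (S k) w \<partial>M) = ennreal (exp (- measure lborel (C (?Z k)))) * emeasure lborel (S k)"
      using mean_vtup(2)[OF C(1) C(2) Sm, of "?Z k" k] by simp
    also have "\<dots> = (\<integral>\<^sup>+f. ennreal (exp (- measure lborel (C (?Z k)))) * indicator (S k) f \<partial>lborel)"
      by (rule nn_integral_cmult_indicator[symmetric]) simp
    also have "\<dots> = (\<integral>\<^sup>+f. indicator (S k) f * ennreal (exp (- measure lborel (C (x f)))) \<partial>lborel)"
      by (rule nn_integral_cong) (auto simp: indicator_def xZ)
    finally show "(\<integral>\<^sup>+w. vtup (C (?Z k)) (S k) w \<partial>M)
      = (\<integral>\<^sup>+f. indicator (S k) f * ennreal (exp (- measure lborel (C (x f)))) \<partial>lborel)" .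
  qed
  also have "\<dots> = (\<integral>\<^sup>+f. (\<Sum>k. indicator (S k) f * ennreal (exp (- measure lborel (C (x f))))) \<partial>lborel)"
    by (rule nn_integral_suminf[symmetric]) measurable
  also have "\<dots> = (\<integral>\<^sup>+f. indicator A f * ennreal (exp (- measure lborel (C (x f)))) \<partial>lborel)"
  proof (rule nn_integral_cong)
    fix f
    have "(\<Sum>k. indicator (S k) f :: ennreal) = indicator A f"
      unfolding US by (rule suminf_indicator) (rule disj)
    then show "(\<Sum>k. indicator (S k) f * ennreal (exp (- measure lborel (C (x f)))))
        = indicator A f * ennreal (exp (- measure lborel (C (x f))))"
      by (simp add: ennreal_suminf_multc)
  qed
  finally show "(\<integral>\<^sup>+w. emeasure (count_space UNIV) {f \<in> A \<inter> tuples (Phi w). Phi w \<inter> C (x f) = {}} \<partial>M)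
      = (\<integral>\<^sup>+f. indicator A f * ennreal (exp (- measure lborel (C (x f)))) \<partial>lborel)" .
qed

definition bvoid :: "('a ^ 'n \<Rightarrow> 'a) \<Rightarrow> ('a ^ 'n::finite) set \<Rightarrow> 'w \<Rightarrow> ennreal" where
  "bvoid c A w = emeasure (count_space UNIV)
     {f \<in> A \<inter> tuples (Phi w). Phi w \<inter> ball (c f) (norm (c f)) = {}}"

text \<open>Dominated convergence along the rounded centres. Boundedness of A provides the
  dominating functions: the number of all tuples in A on the random side, which has finite mean, and
  the indicator of A on the other.\<close>

lemma mean_bvoid_bounded:
  fixes A :: "('a ^ 'n::finite) set" and c :: "'a ^ 'n \<Rightarrow> 'a"
  assumes A[measurable]: "A \<in> sets borel" and bdd: "bounded A" and c[measurable]: "c \<in> borel_measurable borel"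
    and AC: "\<And>f. f \<in> A \<Longrightarrow> inj (($) f)" "\<And>f i. f \<in> A \<Longrightarrow> f $ i \<notin> ball (c f) (norm (c f))"
  shows "bvoid c A \<in> borel_measurable M"
    "(\<integral>\<^sup>+w. bvoid c A w \<partial>M)
      = (\<integral>\<^sup>+f. indicator A f * ennreal (exp (- measure lborel (ball (c f) (norm (c f))))) \<partial>lborel)"
proof -
  let ?e = "gerr TYPE('a)"
  \<comment> \<open>One rounding error pays for the displacement of the centre, the other for the
    change of the radius \<open>norm z\<close>.\<close>
  define C where "C m z = ball z (norm z - 2 * ?e m)" for m and z :: 'a
  have C_sub: "C m (grid m z) \<subseteq> ball z (norm z)" for m z
  proof
    fix p assume "p \<in> C m (grid m z)"
    then have "dist (grid m z) p < norm (grid m z) - 2 * ?e m" by (simp add: C_def)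
    moreover have "norm (grid m z) \<le> norm z + ?e m"
      using dist_grid[of m z] norm_triangle_ineq2[of "grid m z" z] by (simp add: dist_norm)
    moreover have "dist z p \<le> dist (grid m z) z + dist (grid m z) p"
      by (metis dist_commute dist_triangle2 dist_triangle)
    ultimately show "p \<in> ball z (norm z)" using dist_grid[of m z] by simp
  qed
  have C_ev: "\<forall>\<^sub>F m in sequentially. p \<in> C m (grid m z)" if p: "p \<in> ball z (norm z)" for p z
  proof -
    have "(\<lambda>m. norm (grid m z) - 2 * ?e m - dist (grid m z) p) \<longlonglongrightarrow> norm z - 2 * 0 - dist z p"
      by (intro tendsto_intros grid_LIMSEQ gerr_LIMSEQ)
    moreover have "0 < norm z - 2 * 0 - dist z p" using p by simp
    ultimately have "\<forall>\<^sub>F m in sequentially. 0 < norm (grid m z) - 2 * ?e m - dist (grid m z) p"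
      by (rule order_tendstoD(1))
    then show ?thesis by eventually_elim (simp add: C_def)
  qed
  define N where "N m w = emeasure (count_space UNIV) {f \<in> A \<inter> tuples (Phi w). Phi w \<inter> C m (grid m (c f)) = {}}" for m w
  have meas[measurable]: "(\<lambda>f. measure lborel (C m (grid m (c f)))) \<in> borel_measurable borel" for m
    unfolding C_def measure_ball_max by measurable
  have cr: "countable (range (\<lambda>f. grid m (c f)))" for m
    by (rule countable_subset[OF _ countable_range_grid[of m]]) auto
  have AC': "f $ i \<notin> C m (grid m (c f))" if "f \<in> A" for f i m
    using AC(2)[OF that, of i] C_sub[of m "c f"] by blast
  have step: "N m \<in> borel_measurable M"
    "(\<integral>\<^sup>+w. N m w \<partial>M) = (\<integral>\<^sup>+f. indicator A f * ennreal (exp (- measure lborel (C m (grid m (c f))))) \<partial>lborel)" for m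
  proof -
    have g: "(\<lambda>f. grid m (c f)) \<in> borel_measurable borel" by measurable
    have Cm: "C m z \<in> sets borel" "bounded (C m z)" for z by (auto simp: C_def)
    note * = mean_vtup_countable[of A "\<lambda>f. grid m (c f)" "C m", OF A g cr Cm AC(1) AC' meas]
    show "N m \<in> borel_measurable M"
      "(\<integral>\<^sup>+w. N m w \<partial>M) = (\<integral>\<^sup>+f. indicator A f * ennreal (exp (- measure lborel (C m (grid m (c f))))) \<partial>lborel)"
      unfolding N_def by (rule *; assumption)+
  qed
  have Afin: "emeasure lborel A < \<infinity>" by (rule emeasure_bounded_finite[OF bdd])
  have fin: "finite (A \<inter> tuples (Phi w))" if w: "w \<in> space M" for w
  proof -
    obtain r where r: "\<And>f. f \<in> A \<Longrightarrow> norm f \<le> r" using bdd by (auto simp: bounded_iff)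
    have "f $ i \<in> Phi w \<inter> cball 0 r" if "f \<in> A \<inter> tuples (Phi w)" for f i
    proof -
      have "norm (f $ i) \<le> r"
        using r[of f] Finite_Cartesian_Product.norm_nth_le[of f i] that by simp
      then show ?thesis using that by (simp add: tuples_def)
    qed
    then have "A \<inter> tuples (Phi w) \<subseteq> {f. \<forall>i. f $ i \<in> Phi w \<inter> cball 0 r}" by blast
    then show ?thesis by (rule finite_subset) (intro card_vec_set finite_Phi w bounded_cball)
  qed
  \<comment> \<open>Only finitely many tuples lie in A, and for each the void condition is
    eventually constant: a point of the open ball belongs to the approximating balls from some m
    on.\<close>
  have lim: "(\<lambda>m. N m w) \<longlonglongrightarrow> bvoid c A w" if w: "w \<in> space M" for w
  proof -
    let ?Q = "\<lambda>f. Phi w \<inter> ball (c f) (norm (c f)) = {}"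
    have "\<forall>\<^sub>F m in sequentially. (Phi w \<inter> C m (grid m (c f)) = {}) = ?Q f" for f
    proof (cases "?Q f")
      case True
      then have "Phi w \<inter> C m (grid m (c f)) = {}" for m using C_sub[of m "c f"] by blast
      then show ?thesis using True by simp
    next
      case False
      then obtain p where p: "p \<in> Phi w" "p \<in> ball (c f) (norm (c f))" by blast
      show ?thesis using C_ev[OF p(2)] by eventually_elim (use p False in blast)
    qed
    then have "\<forall>\<^sub>F m in sequentially. \<forall>f\<in>A \<inter> tuples (Phi w). (Phi w \<inter> C m (grid m (c f)) = {}) = ?Q f"
      using fin[OF w] by (simp add: eventually_ball_finite_distrib)
    then have "\<forall>\<^sub>F m in sequentially. N m w = bvoid c A w"
    proof eventually_elim
      case (elim m)
      then have "{f \<in> A \<inter> tuples (Phi w). Phi w \<inter> C m (grid m (c f)) = {}} = {f \<in> A \<inter> tuples (Phi w). ?Q f}" by blast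
      then show ?case by (simp add: N_def bvoid_def)
    qed
    then show ?thesis by (rule tendsto_eventually)
  qed
  show "bvoid c A \<in> borel_measurable M"
    by (rule borel_measurable_LIMSEQ_order[where u=N]) (rule lim step, assumption?)+
  show "(\<integral>\<^sup>+w. bvoid c A w \<partial>M)
      = (\<integral>\<^sup>+f. indicator A f * ennreal (exp (- measure lborel (ball (c f) (norm (c f))))) \<partial>lborel)"
  proof (rule LIMSEQ_unique)
    have bm: "bvoid c A \<in> borel_measurable M"
      by (rule borel_measurable_LIMSEQ_order[where u=N]) (rule lim step, assumption?)+
    have vm: "vtup {} A \<in> borel_measurable M" by (rule mean_vtup(1)) auto
    have "(\<integral>\<^sup>+w. vtup {} A w \<partial>M) \<le> emeasure lborel A"
      using mean_vtup(2)[of "{}" A] by (auto intro!: emeasure_mono)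
    then have vfin: "(\<integral>\<^sup>+w. vtup {} A w \<partial>M) < \<infinity>" using Afin by (rule le_less_trans)
    have le: "N m w \<le> vtup {} A w" for m w
      unfolding N_def vtup_def ntup_def by (auto intro!: emeasure_mono)
    show "(\<lambda>m. \<integral>\<^sup>+w. N m w \<partial>M) \<longlonglongrightarrow> (\<integral>\<^sup>+w. bvoid c A w \<partial>M)"
      by (rule nn_integral_dominated_convergence[OF step(1) bm vm _ vfin]) (auto intro!: AE_I2 le lim)
    have "(\<lambda>m. \<integral>\<^sup>+f. indicator A f * ennreal (exp (- measure lborel (C m (grid m (c f))))) \<partial>lborel) \<longlonglongrightarrow>
       (\<integral>\<^sup>+f. indicator A f * ennreal (exp (- measure lborel (ball (c f) (norm (c f))))) \<partial>lborel)"
    proof (rule nn_integral_dominated_convergence[where w="indicator A"])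
      show "(\<lambda>f. indicator A f * ennreal (exp (- measure lborel (ball (c f) (norm (c f)))))) \<in> borel_measurable lborel"
        unfolding measure_ball_max by measurable
      show "AE f in lborel. (\<lambda>m. indicator A f * ennreal (exp (- measure lborel (C m (grid m (c f))))))
          \<longlonglongrightarrow> indicator A f * ennreal (exp (- measure lborel (ball (c f) (norm (c f)))))"
      proof (rule AE_I2)
        fix f
        have "(\<lambda>m. exp (- (unit_ball_vol (real DIM('a)) * (max 0 (norm (grid m (c f)) - 2 * ?e m)) ^ DIM('a))))
            \<longlonglongrightarrow> exp (- (unit_ball_vol (real DIM('a)) * (max 0 (norm (c f) - 2 * 0)) ^ DIM('a)))"
          by (intro tendsto_intros grid_LIMSEQ gerr_LIMSEQ)
        then have "(\<lambda>m. exp (- measure lborel (C m (grid m (c f))))) \<longlonglongrightarrow> exp (- measure lborel (ball (c f) (norm (c f))))"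
          by (simp add: C_def measure_ball_max)
        then have "(\<lambda>m. ennreal (exp (- measure lborel (C m (grid m (c f)))))) \<longlonglongrightarrow> ennreal (exp (- measure lborel (ball (c f) (norm (c f)))))"
          by (rule tendsto_ennrealI)
        then show "(\<lambda>m. indicator A f * ennreal (exp (- measure lborel (C m (grid m (c f))))))
          \<longlonglongrightarrow> indicator A f * ennreal (exp (- measure lborel (ball (c f) (norm (c f)))))"
          by (auto simp: indicator_def)
      qed
      show "AE f in lborel. indicator A f * ennreal (exp (- measure lborel (C m (grid m (c f))))) \<le> indicator A f" for m
        by (rule AE_I2) (auto simp: indicator_def)
    qed (use Afin in auto)
    then show "(\<lambda>m. \<integral>\<^sup>+w. N m w \<partial>M) \<longlonglongrightarrow>
       (\<integral>\<^sup>+f. indicator A f * ennreal (exp (- measure lborel (ball (c f) (norm (c f))))) \<partial>lborel)"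
      unfolding step(2) .
  qed
qed

text \<open>Tuples are sorted by the integer part of their norm, which gives countably many bounded
  pieces.\<close>

proposition mean_bvoid:
  fixes A :: "('a ^ 'n::finite) set" and c :: "'a ^ 'n \<Rightarrow> 'a"
  assumes A[measurable]: "A \<in> sets borel" and c[measurable]: "c \<in> borel_measurable borel"
    and AC: "\<And>f. f \<in> A \<Longrightarrow> inj (($) f)" "\<And>f i. f \<in> A \<Longrightarrow> f $ i \<notin> ball (c f) (norm (c f))"
  shows "bvoid c A \<in> borel_measurable M"
    "(\<integral>\<^sup>+w. bvoid c A w \<partial>M)
      = (\<integral>\<^sup>+f. indicator A f * ennreal (exp (- measure lborel (ball (c f) (norm (c f))))) \<partial>lborel)"
proof -
  define S where "S k = {f \<in> A. nat \<lfloor>norm f\<rfloor> = k}" for k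
  have Sm[measurable]: "S k \<in> sets borel" for k unfolding S_def by measurable
  have bdd: "bounded (S k)" for k
  proof -
    have "norm f \<le> real k + 1" if "f \<in> S k" for f
      using that norm_ge_zero[of f] unfolding S_def mem_Collect_eq by linarith
    then show ?thesis by (auto simp: bounded_iff)
  qed
  have disj: "disjoint_family S" by (auto simp: S_def disjoint_family_on_def)
  have US: "A = (\<Union>k. S k)" by (auto simp: S_def)
  have step: "bvoid c (S k) \<in> borel_measurable M"
     "(\<integral>\<^sup>+w. bvoid c (S k) w \<partial>M)
      = (\<integral>\<^sup>+f. indicator (S k) f * ennreal (exp (- measure lborel (ball (c f) (norm (c f))))) \<partial>lborel)" for k
  proof -
    have 1: "inj (($) f)" "f $ i \<notin> ball (c f) (norm (c f))" if "f \<in> S k" for f i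
      using AC that by (auto simp: S_def)
    show "bvoid c (S k) \<in> borel_measurable M" by (rule mean_bvoid_bounded(1)[OF Sm bdd c 1])
    show "(\<integral>\<^sup>+w. bvoid c (S k) w \<partial>M)
      = (\<integral>\<^sup>+f. indicator (S k) f * ennreal (exp (- measure lborel (ball (c f) (norm (c f))))) \<partial>lborel)"
      by (rule mean_bvoid_bounded(2)[OF Sm bdd c 1])
  qed
  note step(1)[measurable]
  have N: "bvoid c A w = (\<Sum>k. bvoid c (S k) w)" for w
  proof -
    have "(\<Sum>k. bvoid c (S k) w) = emeasure (count_space UNIV) (\<Union>k. {f \<in> S k \<inter> tuples (Phi w). Phi w \<inter> ball (c f) (norm (c f)) = {}})"
      unfolding bvoid_def using disj by (intro suminf_emeasure) (auto simp: disjoint_family_on_def)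
    also have "(\<Union>k. {f \<in> S k \<inter> tuples (Phi w). Phi w \<inter> ball (c f) (norm (c f)) = {}}) = {f \<in> A \<inter> tuples (Phi w). Phi w \<inter> ball (c f) (norm (c f)) = {}}"
      unfolding US by blast
    finally show ?thesis by (simp add: bvoid_def)
  qed
  have "(\<lambda>w. \<Sum>k. bvoid c (S k) w) \<in> borel_measurable M" by measurable
  moreover have "bvoid c A = (\<lambda>w. \<Sum>k. bvoid c (S k) w)" using N by (rule ext)
  ultimately show "bvoid c A \<in> borel_measurable M" by (simp only:)
  have "(\<integral>\<^sup>+w. bvoid c A w \<partial>M) = (\<Sum>k. \<integral>\<^sup>+w. bvoid c (S k) w \<partial>M)"
    unfolding N by (rule nn_integral_suminf) (rule step)
  also have "\<dots> = (\<Sum>k. \<integral>\<^sup>+f. indicator (S k) f * ennreal (exp (- measure lborel (ball (c f) (norm (c f))))) \<partial>lborel)"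
    unfolding step(2) ..
  also have "\<dots> = (\<integral>\<^sup>+f. (\<Sum>k. indicator (S k) f * ennreal (exp (- measure lborel (ball (c f) (norm (c f)))))) \<partial>lborel)"
    unfolding measure_ball_max by (rule nn_integral_suminf[symmetric]) measurable
  also have "\<dots> = (\<integral>\<^sup>+f. indicator A f * ennreal (exp (- measure lborel (ball (c f) (norm (c f))))) \<partial>lborel)"
  proof (rule nn_integral_cong)
    fix f
    have "(\<Sum>k. indicator (S k) f :: ennreal) = indicator A f"
      unfolding US by (rule suminf_indicator) (rule disj)
    then show "(\<Sum>k. indicator (S k) f * ennreal (exp (- measure lborel (ball (c f) (norm (c f))))))
        = indicator A f * ennreal (exp (- measure lborel (ball (c f) (norm (c f)))))"
      by (simp add: ennreal_suminf_multc)
  qed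
  finally show "(\<integral>\<^sup>+w. bvoid c A w \<partial>M)
      = (\<integral>\<^sup>+f. indicator A f * ennreal (exp (- measure lborel (ball (c f) (norm (c f))))) \<partial>lborel)" .
qed

end

section \<open>Counting the faces of a simple polytope by their highest vertex\<close>

text \<open>The component of p orthogonal to the span of the other vectors. At a vertex of the cell
  its negative is the direction of the edge on which the constraint p alone is released.\<close>

lemma independent_dual_vector:
  fixes B :: "'a::euclidean_space set"
  assumes "independent B" "p \<in> B"
  obtains g where "g \<bullet> p > 0" "\<And>q. q \<in> B - {p} \<Longrightarrow> g \<bullet> q = 0"
proof -
  obtain s g where s: "s \<in> span (B - {p})" and g: "\<And>w. w \<in> span (B - {p}) \<Longrightarrow> orthogonal g w" and p: "p = s + g"
    using orthogonal_subspace_decomp_exists[of "B - {p}" p] by metis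
  have "p \<notin> span (B - {p})" using assms by (auto simp: dependent_def)
  then have "g \<noteq> 0" using s p by auto
  moreover have "g \<bullet> p = g \<bullet> g" using g[OF s] by (simp add: p inner_add_right orthogonal_def)
  ultimately have "g \<bullet> p > 0" by simp
  moreover have "g \<bullet> q = 0" if "q \<in> B - {p}" for q
    using g[OF span_base[OF that]] by (simp add: orthogonal_def)
  ultimately show ?thesis by (rule that)
qed

lemma voronoi_cell0_altdef:
  "voronoi_cell0 X = {x :: 'a::euclidean_space. \<forall>p\<in>X. p \<bullet> x \<le> (norm p)\<^sup>2 / 2}"
proof -
  have "norm x \<le> norm (x - p) \<longleftrightarrow> p \<bullet> x \<le> (norm p)\<^sup>2 / 2" for x p :: 'a
  proof -
    have "norm x \<le> norm (x - p) \<longleftrightarrow> (norm x)\<^sup>2 \<le> (norm (x - p))\<^sup>2" by (simp add: power2_le_iff_abs_le)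
    also have "(norm (x - p))\<^sup>2 = (norm x)\<^sup>2 - 2 * (p \<bullet> x) + (norm p)\<^sup>2"
      by (simp add: power2_norm_eq_inner inner_diff_left inner_diff_right inner_commute)
    finally show ?thesis by linarith
  qed
  then show ?thesis by (simp add: voronoi_cell0_def)
qed

text \<open>The points whose bisecting hyperplane with the origin passes through x.\<close>

definition active :: "'a::euclidean_space set \<Rightarrow> 'a \<Rightarrow> 'a set" where
  "active X x = {p \<in> X. p \<bullet> x = (norm p)\<^sup>2 / 2}"

text \<open>These are the almost sure properties of the Poisson points. The conditions on
  independence and on \<open>active\<close> make the polytope simple. The last condition says that u
  is not constant on any face of positive dimension: the directions of a face are the orthogonal
  complement of its active points.\<close>

locale generic_cell =
  fixes X :: "'a::euclidean_space set" and u :: 'a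
  assumes locally_finite: "\<And>r. finite (X \<inter> cball 0 r)"
    and bounded_cell: "bounded (voronoi_cell0 X)"
    and indep: "\<And>A. A \<subseteq> X \<Longrightarrow> finite A \<Longrightarrow> card A \<le> DIM('a) \<Longrightarrow> independent A"
    and card_active_ne: "\<And>A x. A \<subseteq> active X x \<Longrightarrow> finite A \<Longrightarrow> card A \<noteq> Suc DIM('a)"
    and notin_span: "\<And>A. A \<subseteq> X \<Longrightarrow> finite A \<Longrightarrow> card A < DIM('a) \<Longrightarrow> u \<notin> span A"
begin

abbreviation "Z \<equiv> voronoi_cell0 X"
abbreviation "act \<equiv> active X"

lemma active_subset: "act x \<subseteq> X" by (auto simp: active_def)

lemma active_bound: "p \<in> act x \<Longrightarrow> norm p \<le> 2 * norm x"
proof -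
  assume "p \<in> act x"
  then have "(norm p)\<^sup>2 = 2 * (p \<bullet> x)" by (simp add: active_def)
  also have "\<dots> \<le> 2 * (norm p * norm x)" using norm_cauchy_schwarz[of p x] by simp
  finally have "norm p * norm p \<le> norm p * (2 * norm x)" by (simp add: power2_eq_square mult_ac)
  then show ?thesis by (cases "norm p = 0") auto
qed

lemma finite_active: "finite (act x)"
proof (rule finite_subset)
  show "act x \<subseteq> X \<inter> cball 0 (2 * norm x)" using active_bound active_subset by auto
qed (rule locally_finite)

lemma card_active_le: "card (act x) \<le> DIM('a)"
proof (rule ccontr)
  assume "\<not> card (act x) \<le> DIM('a)"
  then obtain A where "A \<subseteq> act x" "card A = Suc DIM('a)" "finite A"
    using obtain_subset_with_card_n[of "Suc DIM('a)" "act x"] by auto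
  then show False using card_active_ne by blast
qed

lemma independent_active: "independent (act x)"
  using indep active_subset finite_active card_active_le by blast

lemma in_Z: "x \<in> Z \<longleftrightarrow> (\<forall>p\<in>X. p \<bullet> x \<le> (norm p)\<^sup>2 / 2)"
  by (simp add: voronoi_cell0_altdef)

lemma convex_Z: "convex Z"
proof -
  have "Z = (\<Inter>p\<in>X. {x. p \<bullet> x \<le> (norm p)\<^sup>2 / 2})" by (auto simp: voronoi_cell0_altdef)
  then show ?thesis by (simp only:) (intro convex_INT convex_halfspace_le)
qed

lemma closed_Z: "closed Z"
proof -
  have "Z = (\<Inter>p\<in>X. {x. p \<bullet> x \<le> (norm p)\<^sup>2 / 2})" by (auto simp: voronoi_cell0_altdef)
  then show ?thesis by (simp only:) (intro closed_INT ballI closed_halfspace_le)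
qed

text \<open>A point p with \<open>norm p > 2 * (norm x + 1)\<close> cannot constrain the unit ball
  around x, and only finitely many points are closer. The finitely many strict inequalities
  therefore persist in one common neighbourhood although X may be infinite.\<close>

lemma eventually_inactive:
  assumes x: "x \<in> Z"
  shows "\<forall>\<^sub>F y in nhds x. \<forall>p\<in>X - act x. p \<bullet> y < (norm p)\<^sup>2 / 2"
proof -
  let ?r = "2 * (norm x + 1)"
  have "\<forall>\<^sub>F y in nhds x. y \<in> ball x 1" by (rule eventually_nhds_in_open) auto
  moreover have "\<forall>\<^sub>F y in nhds x. \<forall>p\<in>(X - act x) \<inter> cball 0 ?r. p \<bullet> y < (norm p)\<^sup>2 / 2"
  proof (rule eventually_ball_finite)
    show "finite ((X - act x) \<inter> cball 0 ?r)" by (rule finite_subset[OF _ locally_finite[of ?r]]) auto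
    show "\<forall>p\<in>(X - act x) \<inter> cball 0 ?r. \<forall>\<^sub>F y in nhds x. p \<bullet> y < (norm p)\<^sup>2 / 2"
    proof
      fix p assume p: "p \<in> (X - act x) \<inter> cball 0 ?r"
      then have "p \<bullet> x \<le> (norm p)\<^sup>2 / 2" "p \<bullet> x \<noteq> (norm p)\<^sup>2 / 2"
        using x by (auto simp: active_def in_Z)
      then have lt: "p \<bullet> x < (norm p)\<^sup>2 / 2" by simp
      have "((\<lambda>y. p \<bullet> y) \<longlongrightarrow> p \<bullet> x) (nhds x)"
        by (intro tendsto_intros) (simp add: filterlim_ident)
      then show "\<forall>\<^sub>F y in nhds x. p \<bullet> y < (norm p)\<^sup>2 / 2" using lt by (rule order_tendstoD(2))
    qed
  qed
  ultimately show ?thesis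
  proof eventually_elim
    case (elim y)
    show ?case
    proof
      fix p assume p: "p \<in> X - act x"
      show "p \<bullet> y < (norm p)\<^sup>2 / 2"
      proof (cases "norm p \<le> ?r")
        case True then show ?thesis using elim(2) p by simp
      next
        case False
        have "norm y < norm x + 1"
          using elim(1) norm_triangle_ineq2[of y x] by (simp add: dist_norm norm_minus_commute)
        then have "norm y < norm p / 2" using False by simp
        moreover have "norm p > 0"
          by (rule order.strict_trans[of _ ?r]) (use False in \<open>auto intro: add_nonneg_pos\<close>)
        ultimately have "norm p * norm y < norm p * (norm p / 2)" by (rule mult_strict_left_mono)
        then show ?thesis using norm_cauchy_schwarz[of p y] by (simp add: power2_eq_square)
      qed
    qed
  qed
qed

text \<open>For a small step along h, constraints with negative slope become strict, those with
  slope 0 stay tight, and the inactive ones stay inactive.\<close>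

lemma move:
  assumes x: "x \<in> Z" and h: "\<And>p. p \<in> act x \<Longrightarrow> p \<bullet> h \<le> 0"
  obtains e where "e > 0" "x + e *\<^sub>R h \<in> Z" "act (x + e *\<^sub>R h) = {p \<in> act x. p \<bullet> h = 0}"
proof -
  have "((\<lambda>e. x + e *\<^sub>R h) \<longlongrightarrow> x + 0 *\<^sub>R h) (at_right 0)"
    by (intro tendsto_intros)
  then have "filterlim (\<lambda>e. x + e *\<^sub>R h) (nhds x) (at_right 0)" by simp
  then have "\<forall>\<^sub>F e in at_right 0. \<forall>p\<in>X - act x. p \<bullet> (x + e *\<^sub>R h) < (norm p)\<^sup>2 / 2"
    using eventually_inactive[OF x] by (rule eventually_compose_filterlim[rotated])
  moreover have "\<forall>\<^sub>F e in at_right (0::real). e > 0" by (rule eventually_at_right_less)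
  ultimately have "\<forall>\<^sub>F e in at_right (0::real). e > 0 \<and> (\<forall>p\<in>X - act x. p \<bullet> (x + e *\<^sub>R h) < (norm p)\<^sup>2 / 2)"
    by eventually_elim blast
  then have "\<exists>e::real. e > 0 \<and> (\<forall>p\<in>X - act x. p \<bullet> (x + e *\<^sub>R h) < (norm p)\<^sup>2 / 2)"
    by (rule eventually_happens'[rotated]) simp
  then obtain e where e: "e > 0" "\<And>p. p \<in> X - act x \<Longrightarrow> p \<bullet> (x + e *\<^sub>R h) < (norm p)\<^sup>2 / 2"
    by blast
  have a: "p \<bullet> (x + e *\<^sub>R h) = (norm p)\<^sup>2 / 2 + e * (p \<bullet> h)" if "p \<in> act x" for p
    using that by (simp add: active_def inner_add_right)
  have "x + e *\<^sub>R h \<in> Z"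
    unfolding in_Z
  proof
    fix p assume p: "p \<in> X"
    show "p \<bullet> (x + e *\<^sub>R h) \<le> (norm p)\<^sup>2 / 2"
    proof (cases "p \<in> act x")
      case True
      have "e * (p \<bullet> h) \<le> 0" using h[OF True] e(1) by (simp add: mult_le_0_iff)
      then show ?thesis using a[OF True] by simp
    next
      case False then show ?thesis using e(2)[of p] p by simp
    qed
  qed
  moreover have "act (x + e *\<^sub>R h) = {p \<in> act x. p \<bullet> h = 0}"
  proof (intro subset_antisym subsetI)
    fix p assume p: "p \<in> act (x + e *\<^sub>R h)"
    then have "p \<in> act x" using e(2)[of p] by (auto simp: active_def)
    moreover have "p \<bullet> h = 0" using a[OF \<open>p \<in> act x\<close>] p e(1) by (simp add: active_def)
    ultimately show "p \<in> {p \<in> act x. p \<bullet> h = 0}" by simp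
  next
    fix p assume "p \<in> {p \<in> act x. p \<bullet> h = 0}"
    then show "p \<in> act (x + e *\<^sub>R h)" using a[of p] by (simp add: active_def inner_add_right)
  qed
  ultimately show ?thesis using e(1) by (intro that)
qed

text \<open>Despite its name a face of any dimension, namely the one cut out by making the
  constraints in A tight.\<close>

definition facet :: "'a set \<Rightarrow> 'a set" where
  "facet A = {x \<in> Z. A \<subseteq> act x}"

text \<open>The sum of the constraints in A is again a valid linear inequality, and equality in the
  sum forces equality in each of them. One supporting hyperplane thus suffices.\<close>

lemma facet_face_of:
  assumes A: "A \<subseteq> X" "finite A"
  shows "facet A face_of Z"
proof -
  let ?a = "\<Sum>p\<in>A. p" and ?b = "\<Sum>p\<in>A. (norm p)\<^sup>2 / 2"
  have le: "?a \<bullet> x \<le> ?b" if "x \<in> Z" for x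
    using that A(1) unfolding inner_sum_left by (intro sum_mono) (auto simp: in_Z)
  have "facet A = Z \<inter> {x. ?a \<bullet> x = ?b}"
  proof (intro subset_antisym subsetI)
    fix x assume "x \<in> facet A"
    then show "x \<in> Z \<inter> {x. ?a \<bullet> x = ?b}"
      by (auto simp: facet_def active_def inner_sum_left intro!: sum.cong)
  next
    fix x assume x: "x \<in> Z \<inter> {x. ?a \<bullet> x = ?b}"
    then have "(\<Sum>p\<in>A. (norm p)\<^sup>2 / 2 - p \<bullet> x) = 0" by (simp add: sum_subtractf inner_sum_left)
    moreover have "\<forall>p\<in>A. 0 \<le> (norm p)\<^sup>2 / 2 - p \<bullet> x" using x A(1) by (auto simp: in_Z)
    ultimately have "\<forall>p\<in>A. (norm p)\<^sup>2 / 2 - p \<bullet> x = 0"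
      using sum_nonneg_eq_0_iff[OF A(2), of "\<lambda>p. (norm p)\<^sup>2 / 2 - p \<bullet> x"] by simp
    then show "x \<in> facet A" using x A(1) by (auto simp: facet_def active_def)
  qed
  then show ?thesis using face_of_Int_supporting_hyperplane_le[OF convex_Z le] by simp
qed

text \<open>All constraints not active at y are strict near y, so near y the face coincides with the
  affine space H where the active ones are tight. Hence y is a relative interior point, and
  independence of the active points makes their number the codimension.\<close>

lemma facet_active:
  assumes y: "y \<in> Z"
  shows "y \<in> rel_interior (facet (act y))" "aff_dim (facet (act y)) = int (DIM('a) - card (act y))"
proof -
  let ?A = "act y"
  define H where "H = {x. \<forall>p\<in>?A. p \<bullet> x = (norm p)\<^sup>2 / 2}"
  have "H = (\<Inter>p\<in>?A. {x. p \<bullet> x = (norm p)\<^sup>2 / 2})" by (auto simp: H_def)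
  then have affH: "affine H" by (simp only:) (rule affine_Inter, use affine_hyperplane in blast)
  have yH: "y \<in> H" by (auto simp: H_def active_def)
  obtain T where T: "open T" "y \<in> T" "\<And>z p. z \<in> T \<Longrightarrow> p \<in> X - ?A \<Longrightarrow> p \<bullet> z < (norm p)\<^sup>2 / 2"
  proof -
    have "\<exists>T. open T \<and> y \<in> T \<and> (\<forall>z\<in>T. \<forall>p\<in>X - ?A. p \<bullet> z < (norm p)\<^sup>2 / 2)"
      using eventually_inactive[OF y] by (simp only: eventually_nhds)
    then show ?thesis using that by blast
  qed
  have sub1: "facet ?A \<subseteq> H" by (auto simp: facet_def H_def active_def)
  have sub2: "H \<inter> T \<subseteq> facet ?A"
  proof
    fix z assume z: "z \<in> H \<inter> T"
    have "p \<bullet> z \<le> (norm p)\<^sup>2 / 2" if "p \<in> X" for p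
    proof (cases "p \<in> ?A")
      case True then show ?thesis using z by (auto simp: H_def)
    next
      case False then show ?thesis using T(3)[of z p] z that by auto
    qed
    moreover have "?A \<subseteq> act z" using z active_subset by (auto simp: H_def active_def)
    ultimately show "z \<in> facet ?A" by (simp add: facet_def in_Z)
  qed
  have ah: "affine hull (facet ?A) = H"
  proof (rule subset_antisym)
    show "affine hull (facet ?A) \<subseteq> H" by (rule hull_minimal[of "facet ?A" H affine, OF sub1 affH])
    have "affine hull (H \<inter> T) = H"
      using affine_hull_affine_Int_open[OF affH T(1)] yH T(2) hull_same[of affine H] affH by blast
    then show "H \<subseteq> affine hull (facet ?A)" using hull_mono[OF sub2, of affine] by simp
  qed
  show "y \<in> rel_interior (facet ?A)"
    unfolding mem_rel_interior ah
  proof (intro exI conjI)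
    show "open T" by fact
    show "y \<in> T \<inter> facet ?A" using T(2) y by (simp add: facet_def)
    show "T \<inter> H \<subseteq> facet ?A" using sub2 by blast
  qed
  define L where "L = {x \<in> UNIV. \<forall>p\<in>span ?A. orthogonal p x}"
  have L: "L = {x. \<forall>p\<in>?A. p \<bullet> x = 0}"
  proof (intro subset_antisym subsetI)
    fix x assume "x \<in> L" then show "x \<in> {x. \<forall>p\<in>?A. p \<bullet> x = 0}"
      by (auto simp: L_def orthogonal_def span_base)
  next
    fix x assume x: "x \<in> {x. \<forall>p\<in>?A. p \<bullet> x = 0}"
    have "orthogonal x p" if "p \<in> span ?A" for p
      using that by (rule orthogonal_to_span) (use x in \<open>auto simp: orthogonal_def inner_commute\<close>)
    then show "x \<in> L" by (auto simp: L_def orthogonal_commute)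
  qed
  have "dim L + dim (span ?A) = DIM('a)"
    unfolding L_def using dim_subspace_orthogonal_to_vectors[of "span ?A" UNIV] by simp
  then have dimL: "dim L = DIM('a) - card ?A" by (simp add: dim_eq_card_independent[OF independent_active])
  have "H = (+) y ` L"
  proof (intro subset_antisym subsetI)
    fix x assume "x \<in> H"
    then have "p \<bullet> (x - y) = 0" if "p \<in> ?A" for p
    proof -
      have "p \<bullet> x = (norm p)\<^sup>2 / 2" "p \<bullet> y = (norm p)\<^sup>2 / 2"
        using that yH \<open>x \<in> H\<close> unfolding H_def by blast+
      then show ?thesis by (simp only: inner_diff_right)
    qed
    then have "x - y \<in> L" by (simp add: L)
    then show "x \<in> (+) y ` L" by (intro image_eqI[of _ _ "x - y"]) auto
  next
    fix x assume "x \<in> (+) y ` L"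
    then show "x \<in> H" using yH by (auto simp: L H_def inner_add_right)
  qed
  moreover have "subspace L" unfolding L by (auto simp: subspace_def inner_add_right)
  ultimately have "aff_dim H = int (dim L)" by (simp add: aff_dim_translation_eq aff_dim_subspace)
  then show "aff_dim (facet ?A) = int (DIM('a) - card ?A)"
    using aff_dim_affine_hull[of "facet ?A"] by (simp add: ah dimL)
qed

lemma facet_inj:
  assumes "y \<in> Z" "z \<in> Z" "facet (act y) = facet (act z)"
  shows "act y = act z"
proof -
  have "y \<in> facet (act z)" "z \<in> facet (act y)" using assms by (auto simp: facet_def)
  then show ?thesis by (auto simp: facet_def)
qed

text \<open>A face equals the \<open>facet\<close> of the active set at any of its relative interior
  points, because two faces whose relative interiors meet coincide. Faces of dimension l thus
  correspond to active sets of size d - l.\<close>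

lemma num_faces_eq_card_active:
  assumes l: "l \<le> DIM('a)"
  shows "num_faces l Z = card {A. card A = DIM('a) - l \<and> (\<exists>y\<in>Z. act y = A)}"
proof -
  let ?S = "{A. card A = DIM('a) - l \<and> (\<exists>y\<in>Z. act y = A)}"
  have "{F. F face_of Z \<and> aff_dim F = int l} = facet ` ?S"
  proof (intro subset_antisym subsetI)
    fix F assume "F \<in> {F. F face_of Z \<and> aff_dim F = int l}"
    then have F: "F face_of Z" "aff_dim F = int l" by auto
    then have "F \<noteq> {}" by auto
    then have "rel_interior F \<noteq> {}"
      by (simp add: rel_interior_eq_empty[OF face_of_imp_convex[OF F(1)]])
    then obtain y where y: "y \<in> rel_interior F" by blast
    then have yZ: "y \<in> Z" using subsetD[OF rel_interior_subset] subsetD[OF face_of_imp_subset[OF F(1)]] by blast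
    have "rel_interior F \<inter> rel_interior (facet (act y)) \<noteq> {}"
      using y facet_active(1)[OF yZ] by blast
    then have "F = facet (act y)"
      by (rule face_of_eq[OF F(1) facet_face_of[OF active_subset finite_active]])
    moreover have "card (act y) = DIM('a) - l"
    proof -
      have "int (DIM('a) - card (act y)) = int l"
        using F(2) facet_active(2)[OF yZ] \<open>F = facet (act y)\<close> by (simp only:)
      then show ?thesis using card_active_le[of y] l by linarith
    qed
    ultimately show "F \<in> facet ` ?S" by (intro image_eqI[of _ _ "act y"]) (use yZ in auto)
  next
    fix F assume "F \<in> facet ` ?S"
    then obtain y where y: "y \<in> Z" "F = facet (act y)" "card (act y) = DIM('a) - l" by blast
    then show "F \<in> {F. F face_of Z \<and> aff_dim F = int l}"
      using facet_face_of[OF active_subset finite_active, of y] facet_active(2)[OF y(1)] l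
      by (simp only: y(2,3) mem_Collect_eq) simp
  qed
  moreover have "inj_on facet ?S"
  proof (rule inj_onI)
    fix A B assume "A \<in> ?S" "B \<in> ?S" and eq: "facet A = facet B"
    then obtain y z where "y \<in> Z" "act y = A" "z \<in> Z" "act z = B" by blast
    then show "A = B" using facet_inj[of y z] eq by simp
  qed
  ultimately show ?thesis by (simp add: num_faces_def card_image)
qed

text \<open>\<open>(v, A)\<close> encodes the face on which the constraints in \<open>A\<close> are active, together with its highest
  vertex \<open>v\<close> in direction \<open>u\<close>.\<close>

definition tops :: "nat \<Rightarrow> ('a \<times> 'a set) set" where
  "tops l = {(v, A). v \<in> Z \<and> card (act v) = DIM('a) \<and> A \<subseteq> act v \<and> card A = DIM('a) - l \<and>
     (\<exists>a. u = (\<Sum>p\<in>act v. a p *\<^sub>R p) \<and> (\<forall>p\<in>act v - A. a p > 0))}"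

text \<open>Linear programming on a compact face: at a maximizer of u the optimality conditions
  express u by the active points, with positive multipliers for those not tight on the whole
  face.\<close>

lemma top_of_facet:
  assumes y: "y \<in> Z" and card: "card (act y) = DIM('a) - l"
  shows "\<exists>v. (v, act y) \<in> tops l"
proof -
  let ?A = "act y"
  have "compact Z" using closed_Z bounded_cell by (simp add: compact_eq_bounded_closed)
  then have "compact (facet ?A)"
    using face_of_imp_compact[OF convex_Z _ facet_face_of[OF active_subset finite_active]] by blast
  moreover have "facet ?A \<noteq> {}" using y by (auto simp: facet_def)
  ultimately obtain v where v: "v \<in> facet ?A" and max: "\<And>x. x \<in> facet ?A \<Longrightarrow> u \<bullet> x \<le> u \<bullet> v"
  proof -
    have "\<exists>v\<in>facet ?A. \<forall>x\<in>facet ?A. u \<bullet> x \<le> u \<bullet> v"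
      by (rule continuous_attains_sup[OF \<open>compact (facet ?A)\<close> \<open>facet ?A \<noteq> {}\<close>]) (intro continuous_intros)
    then show ?thesis using that by blast
  qed
  have vZ: "v \<in> Z" and Av: "?A \<subseteq> act v" using v by (auto simp: facet_def)
  \<comment> \<open>First-order optimality: a small step along such an h stays in the face, so it
    cannot increase u.\<close>
  have opt: "u \<bullet> h \<le> 0" if h: "\<And>p. p \<in> act v \<Longrightarrow> p \<bullet> h \<le> 0" "\<And>p. p \<in> ?A \<Longrightarrow> p \<bullet> h = 0" for h
  proof -
    obtain e where e: "e > 0" "v + e *\<^sub>R h \<in> Z" "act (v + e *\<^sub>R h) = {p \<in> act v. p \<bullet> h = 0}"
      using move[OF vZ h(1)] by blast
    then have "v + e *\<^sub>R h \<in> facet ?A" using Av h(2) by (auto simp: facet_def)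
    from max[OF this] have "e * (u \<bullet> h) \<le> 0" by (simp add: inner_add_right)
    then show ?thesis using e(1) by (simp add: mult_le_0_iff)
  qed
  \<comment> \<open>The component of u orthogonal to the active points is itself an admissible
    direction, and by optimality it vanishes. Genericity of u then forces d active points, so the
    maximizer is a vertex.\<close>
  have span: "u \<in> span (act v)"
  proof -
    obtain s h where s: "s \<in> span (act v)" and h: "\<And>w. w \<in> span (act v) \<Longrightarrow> orthogonal h w" and u: "u = s + h"
      using orthogonal_subspace_decomp_exists[of "act v" u] by metis
    have "p \<bullet> h = 0" if "p \<in> act v" for p
      using h[OF span_base[OF that]] by (simp add: orthogonal_def inner_commute)
    then have "u \<bullet> h \<le> 0" using Av by (intro opt) auto
    moreover have "s \<bullet> h = 0" using h[OF s] by (simp add: orthogonal_def inner_commute)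
    then have "u \<bullet> h = h \<bullet> h" by (simp add: u inner_add_left)
    ultimately have "h \<bullet> h = 0" using inner_ge_zero[of h] by linarith
    then have "h = 0" by simp
    then show ?thesis using s u by simp
  qed
  have cv: "card (act v) = DIM('a)"
    using notin_span[OF active_subset finite_active, of v] span card_active_le[of v] by linarith
  obtain a where a: "u = (\<Sum>p\<in>act v. a p *\<^sub>R p)"
    using span unfolding span_finite[OF finite_active] by blast
  \<comment> \<open>A zero multiplier would put u in the span of d - 1 points, against genericity; a
    negative one is refuted by the edge direction - g, along which u would increase.\<close>
  have "a p > 0" if p: "p \<in> act v - ?A" for p
  proof (rule ccontr)
    assume "\<not> a p > 0"
    have "a p \<noteq> 0"
    proof
      assume "a p = 0"
      then have "u = (\<Sum>q\<in>act v - {p}. a q *\<^sub>R q)"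
        unfolding a using p by (subst sum.remove[of _ p]) (auto simp: finite_active)
      then have "u \<in> span (act v - {p})" by (auto intro: span_sum span_scale span_base)
      moreover have "card (act v - {p}) < DIM('a)" using p cv by (simp add: finite_active)
      ultimately show False using notin_span[of "act v - {p}"] active_subset finite_active by blast
    qed
    then have neg: "a p < 0" using \<open>\<not> a p > 0\<close> by simp
    obtain g where g: "g \<bullet> p > 0" "\<And>q. q \<in> act v - {p} \<Longrightarrow> g \<bullet> q = 0"
      using independent_dual_vector[OF independent_active, of p v] p by blast
    have g': "q \<bullet> g = 0" if "q \<in> act v - {p}" for q
      using g(2)[OF that] by (simp only: inner_commute)
    have "u \<bullet> (- g) \<le> 0"
    proof (rule opt)
      fix q assume "q \<in> act v"
      then show "q \<bullet> (- g) \<le> 0" using g(1) g'[of q] by (cases "q = p") (simp_all add: inner_commute)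
    next
      fix q assume "q \<in> ?A"
      then have "q \<in> act v - {p}" using p Av by blast
      then show "q \<bullet> (- g) = 0" using g'[of q] by simp
    qed
    moreover have "u \<bullet> (- g) = - (a p * (g \<bullet> p))"
    proof -
      have "u \<bullet> g = (\<Sum>q\<in>act v. a q * (g \<bullet> q))" unfolding a inner_sum_left by (simp add: inner_commute)
      also have "\<dots> = a p * (g \<bullet> p)"
        using p g(2) by (subst sum.remove[of _ p]) (auto simp: finite_active intro!: sum.neutral)
      finally show ?thesis by simp
    qed
    ultimately show False using neg g(1) by (simp add: zero_le_mult_iff)
  qed
  then have "\<exists>a. u = (\<Sum>p\<in>act v. a p *\<^sub>R p) \<and> (\<forall>p\<in>act v - ?A. a p > 0)" using a by blast
  then have "(v, ?A) \<in> tops l" using vZ cv Av card by (simp add: tops_def)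
  then show ?thesis by blast
qed

text \<open>Simplicity of the vertex: the active points are independent, so the negated sum of dual
  vectors releases any prescribed subset of them at once and keeps the rest tight.\<close>

lemma tops_facet:
  assumes "(v, A) \<in> tops l"
  shows "\<exists>y\<in>Z. act y = A"
proof -
  have v: "v \<in> Z" "A \<subseteq> act v" using assms by (auto simp: tops_def)
  have "\<exists>g. g \<bullet> p > 0 \<and> (\<forall>q\<in>act v - {p}. g \<bullet> q = 0)" if "p \<in> act v" for p
    using independent_dual_vector[OF independent_active that] by metis
  then obtain g where g: "\<And>p. p \<in> act v \<Longrightarrow> g p \<bullet> p > 0" "\<And>p q. p \<in> act v \<Longrightarrow> q \<in> act v - {p} \<Longrightarrow> g p \<bullet> q = 0"
    by metis
  define h where "h = - (\<Sum>p\<in>act v - A. g p)"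
  have h: "q \<bullet> h = (if q \<in> A then 0 else - (g q \<bullet> q))" if q: "q \<in> act v" for q
  proof -
    have "q \<bullet> h = - (\<Sum>p\<in>act v - A. g p \<bullet> q)" by (simp add: h_def inner_sum_right inner_commute)
    also have "(\<Sum>p\<in>act v - A. g p \<bullet> q) = (\<Sum>p\<in>act v - A. if p = q then g q \<bullet> q else 0)"
      using g(2) q by (intro sum.cong) auto
    also have "\<dots> = (if q \<in> A then 0 else g q \<bullet> q)" using q by (simp add: finite_active)
    finally show ?thesis by simp
  qed
  have "q \<bullet> h \<le> 0" if "q \<in> act v" for q using h[OF that] g(1)[OF that] by simp
  then obtain e where e: "v + e *\<^sub>R h \<in> Z" "act (v + e *\<^sub>R h) = {p \<in> act v. p \<bullet> h = 0}"
    using move[OF v(1)] by blast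
  have "{p \<in> act v. p \<bullet> h = 0} = A"
  proof (intro subset_antisym subsetI)
    fix p assume "p \<in> {p \<in> act v. p \<bullet> h = 0}"
    then show "p \<in> A" using h[of p] g(1)[of p] by (auto split: if_splits)
  next
    fix p assume "p \<in> A"
    then show "p \<in> {p \<in> act v. p \<bullet> h = 0}" using h[of p] v(2) by auto
  qed
  then show ?thesis using e by blast
qed

text \<open>The multipliers certify that v and w both maximize u on the face. Because the
  multipliers outside A are positive, equality of the maxima makes every constraint active at v
  tight at w, and d independent equations have one solution.\<close>

lemma tops_unique:
  assumes "(v, A) \<in> tops l" "(w, A) \<in> tops l"
  shows "v = w"
proof -
  have le: "u \<bullet> (w - v) \<le> 0 \<and> (u \<bullet> (w - v) = 0 \<longrightarrow> v = w)"
    if t: "(v, A) \<in> tops l" "(w, A) \<in> tops l" for v w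
  proof -
    obtain a where v: "v \<in> Z" "A \<subseteq> act v" "card (act v) = DIM('a)" and a: "u = (\<Sum>p\<in>act v. a p *\<^sub>R p)" "\<And>p. p \<in> act v - A \<Longrightarrow> a p > 0"
    proof -
      have "v \<in> Z \<and> A \<subseteq> act v \<and> card (act v) = DIM('a) \<and> (\<exists>a. u = (\<Sum>p\<in>act v. a p *\<^sub>R p) \<and> (\<forall>p\<in>act v - A. a p > 0))"
        using t(1) by (simp add: tops_def)
      then show ?thesis using that by blast
    qed
    have w: "w \<in> Z" "A \<subseteq> act w" using t(2) by (auto simp: tops_def)
    have d: "p \<bullet> (w - v) \<le> 0" if "p \<in> act v" for p
      using that w(1) by (auto simp: active_def in_Z inner_diff_right)
    have d0: "p \<bullet> (w - v) = 0" if "p \<in> A" for p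
    proof -
      have "p \<in> act v" "p \<in> act w" using that v(2) w(2) by auto
      then show ?thesis by (simp add: active_def inner_diff_right)
    qed
    have u: "u \<bullet> (w - v) = (\<Sum>p\<in>act v. a p * (p \<bullet> (w - v)))" by (simp add: a(1) inner_sum_left)
    have t: "a p * (p \<bullet> (w - v)) \<le> 0" if "p \<in> act v" for p
      using d[OF that] d0[of p] a(2)[of p] that by (cases "p \<in> A") (simp_all add: mult_nonneg_nonpos)
    have "v = w" if z0: "u \<bullet> (w - v) = 0"
    proof -
      have "(\<Sum>p\<in>act v. - (a p * (p \<bullet> (w - v)))) = 0" using z0 by (simp add: u sum_negf)
      then have z: "\<forall>p\<in>act v. - (a p * (p \<bullet> (w - v))) = 0"
        using sum_nonneg_eq_0_iff[OF finite_active, of v "\<lambda>p. - (a p * (p \<bullet> (w - v)))"] t by simp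
      have o: "p \<bullet> (w - v) = 0" if p: "p \<in> act v" for p
      proof (cases "p \<in> A")
        case True then show ?thesis by (rule d0)
      next
        case False
        then have "a p > 0" using a(2)[of p] p by simp
        moreover have "a p * (p \<bullet> (w - v)) = 0" using bspec[OF z p] by simp
        ultimately show ?thesis by simp
      qed
      have "dim (act v) = DIM('a)" using v(3) by (simp add: dim_eq_card_independent[OF independent_active])
      then have "span (act v) = UNIV" by (simp add: dim_eq_full)
      then have "w - v \<in> span (act v)" by simp
      moreover have "orthogonal (w - v) p" if "p \<in> act v" for p
        using o[OF that] by (simp only: orthogonal_def inner_commute)
      ultimately have "orthogonal (w - v) (w - v)" by (rule orthogonal_to_span)
      then show ?thesis by (simp add: orthogonal_self)
    qed
    moreover have "u \<bullet> (w - v) \<le> 0" unfolding u by (rule sum_nonpos) (rule t)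
    ultimately show ?thesis by simp
  qed
  have "u \<bullet> (v - w) = - (u \<bullet> (w - v))" by (simp add: inner_diff_right)
  then have "u \<bullet> (w - v) = 0" using conjunct1[OF le[OF assms]] conjunct1[OF le[OF assms(2,1)]] by linarith
  then show ?thesis using conjunct2[OF le[OF assms]] by simp
qed

lemma num_faces_eq_card_tops:
  assumes l: "l \<le> DIM('a)"
  shows "num_faces l Z = card (tops l)"
proof -
  have "bij_betw snd (tops l) {A. card A = DIM('a) - l \<and> (\<exists>y\<in>Z. act y = A)}"
    unfolding bij_betw_def
  proof
    show "inj_on snd (tops l)" using tops_unique by (auto simp: inj_on_def)
    show "snd ` tops l = {A. card A = DIM('a) - l \<and> (\<exists>y\<in>Z. act y = A)}"
    proof (intro subset_antisym subsetI)
      fix A assume "A \<in> snd ` tops l"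
      then obtain v where "(v, A) \<in> tops l" by force
      then show "A \<in> {A. card A = DIM('a) - l \<and> (\<exists>y\<in>Z. act y = A)}"
        using tops_facet[of v A l] by (simp add: tops_def)
    next
      fix A assume "A \<in> {A. card A = DIM('a) - l \<and> (\<exists>y\<in>Z. act y = A)}"
      then obtain y where y: "y \<in> Z" "act y = A" "card (act y) = DIM('a) - l" by blast
      then obtain v where "(v, A) \<in> tops l" using top_of_facet[of y l] by auto
      then show "A \<in> snd ` tops l" by (intro image_eqI[of _ _ "(v, A)"]) simp_all
    qed
  qed
  then show ?thesis by (simp add: num_faces_eq_card_active[OF l] bij_betw_same_card)
qed

text \<open>A vertex is determined by its active points, and these lie within twice the radius of
  the bounded cell, where X is finite.\<close>

lemma finite_vertices: "finite {v \<in> Z. card (act v) = DIM('a)}"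
proof -
  obtain r where r: "\<And>x. x \<in> Z \<Longrightarrow> norm x \<le> r" using bounded_cell by (auto simp: bounded_iff)
  have "inj_on act {v \<in> Z. card (act v) = DIM('a)}"
  proof (rule inj_onI)
    fix v w assume v: "v \<in> {v \<in> Z. card (act v) = DIM('a)}" and eq: "act v = act w"
    have "dim (act v) = DIM('a)" using v by (simp add: dim_eq_card_independent[OF independent_active])
    then have "span (act v) = UNIV" by (simp add: dim_eq_full)
    then have "w - v \<in> span (act v)" by simp
    moreover have "orthogonal (w - v) p" if "p \<in> act v" for p
    proof -
      have "p \<in> act w" using that eq by simp
      then have "p \<bullet> w = (norm p)\<^sup>2 / 2" "p \<bullet> v = (norm p)\<^sup>2 / 2" using that by (simp_all add: active_def)
      then have "p \<bullet> (w - v) = 0" by (simp only: inner_diff_right)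
      then show ?thesis by (simp only: orthogonal_def inner_commute)
    qed
    ultimately have "orthogonal (w - v) (w - v)" by (rule orthogonal_to_span)
    then show "v = w" by (simp add: orthogonal_self)
  qed
  moreover have "act ` {v \<in> Z. card (act v) = DIM('a)} \<subseteq> Pow (X \<inter> cball 0 (2 * r))"
  proof (intro subsetI, elim imageE)
    fix A v assume A: "A = act v" "v \<in> {v \<in> Z. card (act v) = DIM('a)}"
    have "norm p \<le> 2 * r" if "p \<in> act v" for p
      using active_bound[OF that] r[of v] A(2) by simp
    then show "A \<in> Pow (X \<inter> cball 0 (2 * r))" using active_subset by (auto simp: A(1))
  qed
  ultimately show ?thesis
    by (rule inj_on_finite) (rule finite_Pow_iff[THEN iffD2], rule locally_finite)
qed

end

section \<open>Tuples of points as matrices, circumcentres and coordinates\<close>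

definition half_sq :: "real ^ 'n ^ 'n \<Rightarrow> real ^ 'n::finite" where
  "half_sq P = (\<chi> i. (norm (P $ i))\<^sup>2 / 2)"

text \<open>By Cramer's rule, \<open>ctr P\<close> is the point equidistant from the origin and the rows of \<open>P\<close>, and
  \<open>coef u P\<close> are the coordinates of \<open>u\<close> in the basis formed by the rows of \<open>P\<close>.\<close>

definition ctr :: "real ^ 'n ^ 'n \<Rightarrow> real ^ 'n::finite" where
  "ctr P = (\<chi> k. det (\<chi> i j. if j = k then half_sq P $ i else P $ i $ j) / det P)"

definition coef :: "real ^ 'n \<Rightarrow> real ^ 'n ^ 'n \<Rightarrow> 'n::finite \<Rightarrow> real" where
  "coef u P i = det (vec_upd P i u) / det P"

lemma ctr_iff: "det P \<noteq> 0 \<Longrightarrow> x = ctr P \<longleftrightarrow> P *v x = half_sq P"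
  unfolding ctr_def using cramer[of P x "half_sq P"] by simp

lemma matrix_vector_mult_nth: "(P *v x) $ i = P $ i \<bullet> (x :: real ^ 'n::finite)"
  by (simp add: matrix_vector_mult_def inner_vec_def)

lemma ctr_inner: "det P \<noteq> 0 \<Longrightarrow> P $ i \<bullet> ctr P = (norm (P $ i))\<^sup>2 / 2"
  using ctr_iff[of P "ctr P"] by (simp add: half_sq_def vec_eq_iff matrix_vector_mult_nth)

lemma coef_eqI:
  assumes "det P \<noteq> 0" "u = (\<Sum>i\<in>UNIV. a i *\<^sub>R P $ i)"
  shows "coef u P k = a k"
proof -
  have "det (\<chi> i. if i = k then (\<Sum>i\<in>UNIV. (\<chi> i. a i) $ i *s row i P) else row i P) = (\<chi> i. a i) $ k * det P"
    by (rule cramer_lemma_transpose)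
  moreover have "(\<chi> i. if i = k then (\<Sum>i\<in>UNIV. (\<chi> i. a i) $ i *s row i P) else row i P) = vec_upd P k u"
    by (simp add: vec_eq_iff vec_upd_nth row_def assms(2) scalar_mult_eq_scaleR)
  ultimately show ?thesis using assms(1) by (simp add: coef_def)
qed

lemma coef_sum:
  assumes "det P \<noteq> 0"
  shows "u = (\<Sum>i\<in>UNIV. coef u P i *\<^sub>R P $ i)"
proof -
  have "invertible (transpose P)" using assms by (simp add: invertible_det_nz)
  then obtain B where B: "transpose P ** B = mat 1" by (auto simp: invertible_def)
  let ?a = "B *v u"
  have "u = transpose P *v ?a" by (simp add: matrix_vector_mul_assoc B)
  also have "\<dots> = (\<Sum>i\<in>UNIV. ?a $ i *\<^sub>R P $ i)"
    by (simp add: vec_eq_iff matrix_vector_mult_def transpose_def mult.commute)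
  finally have u: "u = (\<Sum>i\<in>UNIV. ?a $ i *\<^sub>R P $ i)" .
  have "coef u P i = ?a $ i" for i by (rule coef_eqI[OF assms u])
  then show ?thesis using u by simp
qed

text \<open>Subtracting u, a combination of the other rows, clears row i without changing the
  determinant. Read contrapositively, nonvanishing determinants keep u out of spans of fewer than d
  points.\<close>

lemma vec_upd_span_det:
  fixes P :: "real ^ 'n::finite ^ 'n"
  assumes u: "u \<in> span A" and A: "A \<subseteq> {P $ j |j. j \<noteq> i}"
  shows "det (vec_upd P i u) = 0"
proof -
  let ?M = "vec_upd P i u"
  have "{row j ?M |j. j \<noteq> i} = {P $ j |j. j \<noteq> i}"
  proof -
    have "row j ?M = P $ j" if "j \<noteq> i" for j using that by (simp add: row_def vec_eq_iff vec_upd_nth)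
    then show ?thesis by (metis (no_types, lifting))
  qed
  then have "A \<subseteq> {row j ?M |j. j \<noteq> i}" using A by simp
  then have "- u \<in> span {row j ?M |j. j \<noteq> i}" using u span_mono span_neg by blast
  then have "- u \<in> vec.span {row j ?M |j. j \<noteq> i}" by (simp only: span_vec_eq)
  from det_row_span[OF this] have "det ?M = det (\<chi> k. if k = i then row i ?M + - u else row k ?M)" by simp
  also have "\<dots> = 0"
    by (rule det_zero_row(1)[of i]) (simp add: row_def vec_eq_iff vec_upd_nth)
  finally show ?thesis .
qed

text \<open>The assumptions mention only d-tuples and (d + 1)-tuples, the latter indexed by
  \<open>'d option\<close>, because null sets of tuples are what \<open>AE_no_tuples\<close> can
  exclude. Smaller sets of points are extended to full tuples.\<close>

lemma generic_cellI:
  fixes X :: "(real ^ 'd::finite) set"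
  assumes lf: "\<And>r. finite (X \<inter> cball 0 r)"
    and bdd: "bounded (voronoi_cell0 X)"
    and det: "\<And>f :: real ^ 'd ^ 'd. f \<in> tuples X \<Longrightarrow> det f \<noteq> 0"
    and det_upd: "\<And>(f :: real ^ 'd ^ 'd) i. f \<in> tuples X \<Longrightarrow> det (vec_upd f i u) \<noteq> 0"
    and sphere: "\<And>(f :: (real ^ 'd) ^ 'd option) x. f \<in> tuples X \<Longrightarrow> \<exists>i. f $ i \<bullet> x \<noteq> (norm (f $ i))\<^sup>2 / 2"
  shows "generic_cell X u"
proof
  \<comment> \<open>With fewer than d points some line is orthogonal to all of them; the cell would
    contain it and be unbounded. This supplies the points needed for extending smaller sets.\<close>
  have "\<exists>C\<subseteq>X. finite C \<and> card C \<ge> CARD('d)"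
  proof (cases "finite X \<and> card X < CARD('d)")
    case True
    then have "dim X < DIM(real ^ 'd)" using dim_le_card'[of X] by simp
    then have "span X \<noteq> UNIV" by (metis dim_UNIV dim_span less_irrefl)
    then obtain v where "v \<notin> span X" by blast
    obtain s h where s: "s \<in> span X" and h: "\<And>w. w \<in> span X \<Longrightarrow> orthogonal h w" and v: "v = s + h"
      using orthogonal_subspace_decomp_exists[of X v] by metis
    have "h \<noteq> 0" using s v \<open>v \<notin> span X\<close> by auto
    obtain B where B: "\<And>x. x \<in> voronoi_cell0 X \<Longrightarrow> norm x \<le> B" using bdd by (auto simp: bounded_iff)
    let ?x = "((\<bar>B\<bar> + 1) / norm h) *\<^sub>R h"
    have "p \<bullet> ?x \<le> (norm p)\<^sup>2 / 2" if "p \<in> X" for p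
    proof -
      have "p \<bullet> h = 0" using h[OF span_base[OF that]] by (simp only: orthogonal_def inner_commute)
      then show ?thesis by simp
    qed
    then have "norm ?x \<le> B" by (intro B) (simp add: voronoi_cell0_altdef)
    then show ?thesis using \<open>h \<noteq> 0\<close> by simp
  next
    case False
    show ?thesis
    proof (cases "finite X")
      case True then show ?thesis using False by (intro exI[of _ X]) simp
    next
      case False
      then obtain C where "finite C" "card C = CARD('d)" "C \<subseteq> X"
        using infinite_arbitrarily_large[of X "CARD('d)"] by blast
      then show ?thesis by (intro exI[of _ C]) simp
    qed
  qed
  then obtain C where C: "C \<subseteq> X" "finite C" "card C \<ge> CARD('d)" by blast
  have extend: "\<exists>f :: real ^ 'd ^ 'd. f \<in> tuples X \<and> A \<subseteq> range (($) f)"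
    if A: "A \<subseteq> X" "finite A" "card A \<le> CARD('d)" for A
  proof -
    have "CARD('d) \<le> card (A \<union> C)" using C A(2) card_mono[of "A \<union> C" C] by simp
    then obtain A' where A': "A \<subseteq> A'" "A' \<subseteq> A \<union> C" "card A' = CARD('d)"
      using exists_subset_between[of A "CARD('d)" "A \<union> C"] A C by auto
    then have "finite A'" using A(2) C(2) finite_subset by blast
    then obtain g where g: "bij_betw g (UNIV :: 'd set) A'"
      using finite_same_card_bij[of "UNIV :: 'd set" A'] A'(3) by auto
    let ?f = "(\<chi> i. g i) :: real ^ 'd ^ 'd"
    have "($) ?f = g" by (rule ext) simp
    then have "?f \<in> tuples X" "range (($) ?f) = A'"
      using g A' A(1) C(1) by (auto simp: tuples_def bij_betw_def)
    then show ?thesis using A'(1) by blast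
  qed
  show "independent A" if A: "A \<subseteq> X" "finite A" "card A \<le> DIM(real ^ 'd)" for A
  proof -
    obtain f :: "real ^ 'd ^ 'd" where f: "f \<in> tuples X" "A \<subseteq> range (($) f)" using extend[of A] A by auto
    have "rows f = range (($) f)" by (auto simp: rows_def row_def vec_nth_inverse)
    then have "independent (range (($) f))" using det_dependent_rows[of f] det[OF f(1)] by (auto simp: dependent_vec_eq)
    then show ?thesis using f(2) independent_mono by blast
  qed
  show "u \<notin> span A" if A: "A \<subseteq> X" "finite A" "card A < DIM(real ^ 'd)" for A
  proof
    assume u: "u \<in> span A"
    obtain f :: "real ^ 'd ^ 'd" where f: "f \<in> tuples X" "A \<subseteq> range (($) f)" using extend[of A] A by auto
    have "card (range (($) f)) = CARD('d)" using f(1) by (intro card_image) (simp add: tuples_def)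
    then have "A \<noteq> range (($) f)" using A(3) by auto
    then obtain i where i: "f $ i \<notin> A" using f(2) by auto
    have "A \<subseteq> {f $ j |j. j \<noteq> i}"
    proof
      fix p assume p: "p \<in> A"
      then obtain j where "p = f $ j" using f(2) by auto
      then show "p \<in> {f $ j |j. j \<noteq> i}" using i p by auto
    qed
    then show False using vec_upd_span_det[OF u] det_upd[OF f(1)] by blast
  qed
  show "card A \<noteq> Suc DIM(real ^ 'd)" if A: "A \<subseteq> active X x" "finite A" for A x
  proof
    assume "card A = Suc DIM(real ^ 'd)"
    then obtain g where g: "bij_betw g (UNIV :: 'd option set) A"
      using finite_same_card_bij[of "UNIV :: 'd option set" A] A(2) by auto
    let ?f = "(\<chi> i. g i) :: (real ^ 'd) ^ 'd option"
    have fg: "($) ?f = g" by (rule ext) simp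
    have gA: "g i \<in> active X x" for i using g A(1) by (auto simp: bij_betw_def)
    have "?f \<in> tuples X" using g gA by (auto simp: tuples_def bij_betw_def active_def fg)
    moreover have "?f $ i \<bullet> x = (norm (?f $ i))\<^sup>2 / 2" for i using gA[of i] by (simp add: active_def)
    ultimately show False using sphere by blast
  qed
qed (use lf bdd in auto)

text \<open>A tuple orders the d points active at a vertex, and J marks the positions that are
  released on the face; \<open>card J\<close> is therefore the dimension of the face.\<close>

definition top_tuples :: "(real ^ 'd) set \<Rightarrow> real ^ 'd \<Rightarrow> 'd set \<Rightarrow> (real ^ 'd::finite ^ 'd) set" where
  "top_tuples X u J = {f \<in> tuples X. det f \<noteq> 0 \<and> (\<forall>i\<in>J. coef u f i > 0) \<and> X \<inter> ball (ctr f) (norm (ctr f)) = {}}"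

lemma void_iff: "X \<inter> ball x (norm x) = {} \<longleftrightarrow> x \<in> voronoi_cell0 X"
  by (auto simp: voronoi_cell0_def dist_norm not_less disjoint_iff)

locale generic_cell_vec = generic_cell X u for X :: "(real ^ 'd::finite) set" and u
begin

lemma top_tuplesD:
  assumes f: "f \<in> top_tuples X u J" and J: "card J = l"
  shows "act (ctr f) = range (($) f)" "(ctr f, ($) f ` (- J)) \<in> tops l"
proof -
  have inj: "inj (($) f)" and X: "\<And>i. f $ i \<in> X" and d: "det f \<noteq> 0" and pos: "\<And>i. i \<in> J \<Longrightarrow> coef u f i > 0"
    and Z: "ctr f \<in> Z"
    using f by (auto simp: top_tuples_def tuples_def void_iff)
  have sub: "range (($) f) \<subseteq> act (ctr f)" using X ctr_inner[OF d] by (auto simp: active_def)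
  have c: "card (range (($) f)) = CARD('d)" using inj by (simp add: card_image)
  show act: "act (ctr f) = range (($) f)"
    using card_subset_eq[OF finite_active sub] card_mono[OF finite_active sub] card_active_le[of "ctr f"] c by simp
  define a where "a p = coef u f (inv (($) f) p)" for p
  have af: "a (f $ i) = coef u f i" for i by (simp add: a_def inv_f_f[OF inj])
  have "u = (\<Sum>i\<in>UNIV. coef u f i *\<^sub>R f $ i)" by (rule coef_sum[OF d])
  also have "\<dots> = (\<Sum>p\<in>range (($) f). a p *\<^sub>R p)"
    by (subst sum.reindex[OF inj]) (simp add: af)
  finally have ua: "u = (\<Sum>p\<in>act (ctr f). a p *\<^sub>R p)" by (simp add: act)
  have apos: "\<forall>p\<in>act (ctr f) - ($) f ` (- J). a p > 0"
  proof
    fix p assume "p \<in> act (ctr f) - ($) f ` (- J)"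
    then obtain i where "p = f $ i" "i \<in> J" unfolding act by blast
    then show "a p > 0" using pos af by simp
  qed
  have "card (($) f ` (- J)) = CARD('d) - l"
    using inj J by (subst card_image) (auto intro: inj_on_subset simp: Compl_eq_Diff_UNIV card_Diff_subset)
  then show "(ctr f, ($) f ` (- J)) \<in> tops l"
    unfolding tops_def using Z c ua apos by (auto simp: act)
qed

text \<open>Inverse to \<open>top_tuplesD\<close>: for any ordering g of the points active at v, the
  d independent bisector equations have v as their only solution, so the centre of the tuple is
  v.\<close>

lemma top_tuplesI:
  assumes t: "(v, A) \<in> tops l" and g: "bij_betw g UNIV (act v)" and l: "l \<le> CARD('d)"
  defines "J \<equiv> g -` (act v - A)" and "f \<equiv> \<chi> i. g i"
  shows "f \<in> top_tuples X u J" "card J = l" "ctr f = v" "g ` (- J) = A"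
proof -
  have v: "v \<in> Z" "card (act v) = CARD('d)" "A \<subseteq> act v" "card A = CARD('d) - l"
    and ex: "\<exists>a. u = (\<Sum>p\<in>act v. a p *\<^sub>R p) \<and> (\<forall>p\<in>act v - A. a p > 0)"
    using t by (simp_all add: tops_def)
  obtain a where a: "u = (\<Sum>p\<in>act v. a p *\<^sub>R p)" "\<And>p. p \<in> act v - A \<Longrightarrow> a p > 0" using ex by blast
  have inj: "inj g" and rg: "range g = act v" using g by (auto simp: bij_betw_def)
  have fg: "($) f = g" by (rule ext) (simp add: f_def)
  have gX: "g i \<in> act v" for i using rg by blast
  have d: "det f \<noteq> 0"
  proof -
    have "x = 0" if "f *v x = 0" for x
    proof -
      have "f $ i \<bullet> x = 0" for i using that matrix_vector_mult_nth[of f x i] by simp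
      then have o: "orthogonal x p" if "p \<in> act v" for p
        using that rg fg by (metis inner_commute orthogonal_def rangeE)
      have "dim (act v) = DIM(real ^ 'd)" using v(2) by (simp add: dim_eq_card_independent[OF independent_active])
      then have "span (act v) = UNIV" by (simp only: dim_eq_full)
      then have "x \<in> span (act v)" by simp
      then have "orthogonal x x" using o by (rule orthogonal_to_span)
      then show ?thesis by (simp add: orthogonal_self)
    qed
    then have "\<exists>B. B ** f = mat 1" by (simp add: matrix_left_invertible_ker)
    then show ?thesis by (simp add: invertible_det_nz[symmetric] invertible_left_inverse)
  qed
  have "f *v v = half_sq f"
    using gX by (simp add: vec_eq_iff matrix_vector_mult_nth half_sq_def f_def active_def)
  then show ctr: "ctr f = v" using ctr_iff[OF d, of v] by simp
  have "u = (\<Sum>i\<in>UNIV. a (g i) *\<^sub>R f $ i)"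
    unfolding a(1) rg[symmetric] by (subst sum.reindex[OF inj]) (simp add: f_def)
  then have "coef u f i = a (g i)" for i by (rule coef_eqI[OF d])
  then have "\<forall>i\<in>J. coef u f i > 0" using a(2) by (auto simp: J_def)
  moreover have "f \<in> tuples X" using inj gX active_subset by (auto simp: tuples_def fg)
  ultimately show "f \<in> top_tuples X u J" using d v(1) by (simp add: top_tuples_def ctr void_iff)
  have "card J = card (act v - A)"
    unfolding J_def by (rule card_vimage_inj[OF inj]) (use rg in blast)
  also have "\<dots> = l" using v l finite_subset[OF v(3) finite_active] by (simp add: card_Diff_subset)
  finally show "card J = l" .
  have "- J = g -` A" using gX by (auto simp: J_def)
  then show "g ` (- J) = A" using rg v(3) by (simp add: image_vimage_eq Int_absorb2)
qed

text \<open>Each pair in \<open>tops l\<close> gives rise to d! tuples, one for every ordering of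
  the points active at its vertex, and the position set J is determined by the ordering.\<close>

lemma fact_num_faces:
  assumes l: "l \<le> CARD('d)"
  shows "finite (SIGMA J:{J. card J = l}. top_tuples X u J)"
    "fact CARD('d) * num_faces l Z = card (SIGMA J:{J. card J = l}. top_tuples X u J)"
proof -
  let ?P = "SIGMA J:{J. card J = l}. top_tuples X u J"
  let ?S = "{p. p permutes (UNIV :: 'd set)}"
  have "\<exists>e. bij_betw e (UNIV :: 'd set) (act v)" if "card (act v) = CARD('d)" for v
    using finite_same_card_bij[OF _ finite_active, of "UNIV :: 'd set" v] that by simp
  then obtain e where e: "\<And>v. card (act v) = CARD('d) \<Longrightarrow> bij_betw (e v) (UNIV :: 'd set) (act v)" by metis
  \<comment> \<open>\<open>e v\<close> is one chosen ordering of the points active at v; composition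
    with the permutations p produces all others.\<close>
  define \<Psi> where "\<Psi> = (\<lambda>((v, A), p). ((e v \<circ> p) -` (act v - A), (\<chi> i. (e v \<circ> p) i) :: real ^ 'd ^ 'd))"
  have g: "bij_betw (e v \<circ> p) UNIV (act v)" if "(v, A) \<in> tops l" "p \<in> ?S" for v A p
    using that e[of v] by (intro bij_betw_trans[of p UNIV UNIV]) (auto simp: tops_def permutes_imp_bij)
  have \<Psi>: "bij_betw \<Psi> (tops l \<times> ?S) ?P"
    unfolding bij_betw_def
  proof
    show "inj_on \<Psi> (tops l \<times> ?S)"
    proof (rule inj_onI)
      fix x y assume x: "x \<in> tops l \<times> ?S" and y: "y \<in> tops l \<times> ?S" and eq: "\<Psi> x = \<Psi> y"
      obtain v A p where x': "x = ((v, A), p)" by (metis prod.exhaust)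
      obtain w B q where y': "y = ((w, B), q)" by (metis prod.exhaust)
      have tv: "(v, A) \<in> tops l" "p \<in> ?S" and tw: "(w, B) \<in> tops l" "q \<in> ?S" using x y by (auto simp: x' y')
      have eqs: "(e v \<circ> p) -` (act v - A) = (e w \<circ> q) -` (act w - B)"
        "(\<chi> i. (e v \<circ> p) i) = ((\<chi> i. (e w \<circ> q) i) :: real ^ 'd ^ 'd)"
        using eq by (simp_all add: \<Psi>_def x' y')
      have vw: "v = w" using top_tuplesI(3)[OF tv(1) g[OF tv] l] top_tuplesI(3)[OF tw(1) g[OF tw] l] eqs(2) by simp
      have ev: "e v \<circ> p = e v \<circ> q" using eqs(2) by (auto simp: vec_eq_iff fun_eq_iff vw)
      have "A = (e v \<circ> p) ` (- ((e v \<circ> p) -` (act v - A)))"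
        by (rule top_tuplesI(4)[OF tv(1) g[OF tv] l, symmetric])
      also have "\<dots> = (e w \<circ> q) ` (- ((e w \<circ> q) -` (act w - B)))"
        using eqs(1) ev vw by metis
      also have "\<dots> = B" by (rule top_tuplesI(4)[OF tw(1) g[OF tw] l])
      finally have AB: "A = B" .
      have "inj (e v)" using e[of v] tv(1) by (auto simp: tops_def bij_betw_def)
      then have "p = q" using ev by (auto simp: fun_eq_iff inj_eq)
      then show "x = y" using vw AB by (simp add: x' y')
    qed
    show "\<Psi> ` (tops l \<times> ?S) = ?P"
    proof (intro subset_antisym subsetI)
      fix z assume "z \<in> \<Psi> ` (tops l \<times> ?S)"
      then obtain v A p where t: "(v, A) \<in> tops l" "p \<in> ?S" and z: "z = \<Psi> ((v, A), p)" by auto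
      show "z \<in> ?P" using top_tuplesI(1,2)[OF t(1) g[OF t] l] by (simp add: z \<Psi>_def)
    next
      fix z assume "z \<in> ?P"
      then obtain J f where z: "z = (J, f)" and J: "card J = l" and f: "f \<in> top_tuples X u J" by auto
      note D = top_tuplesD[OF f J]
      have inj: "inj (($) f)" using f by (auto simp: top_tuples_def tuples_def)
      let ?v = "ctr f" and ?A = "($) f ` (- J)"
      have cv: "card (act ?v) = CARD('d)" using inj by (simp add: D(1) card_image)
      let ?p = "inv (e ?v) \<circ> ($) f"
      have be: "bij_betw (e ?v) UNIV (range (($) f))" using e[OF cv] by (simp add: D(1))
      have "bij_betw (inv (e ?v)) (range (($) f)) UNIV" using bij_betw_inv_into[OF be] by simp
      moreover have "bij_betw (($) f) UNIV (range (($) f))" using inj by (simp add: bij_betw_def)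
      ultimately have "bij ?p" by (rule bij_betw_trans[rotated])
      then have p: "?p \<in> ?S" by (simp add: permutes_def bij_iff)
      have ep: "e ?v \<circ> ?p = ($) f"
      proof
        fix i
        have "f $ i \<in> range (e ?v)" using be by (auto simp: bij_betw_def)
        then show "(e ?v \<circ> ?p) i = f $ i" by (simp add: f_inv_into_f)
      qed
      have "($) f -` (range (($) f) - ?A) = J" using inj by (auto simp: inj_eq)
      then have "\<Psi> ((?v, ?A), ?p) = z"
        unfolding \<Psi>_def prod.case ep by (simp add: z D(1) vec_nth_inverse)
      then show "z \<in> \<Psi> ` (tops l \<times> ?S)"
        using D(2) p by (intro image_eqI[of _ _ "((?v, ?A), ?p)"]) auto
    qed
  qed
  have "tops l \<subseteq> (SIGMA v:{v \<in> Z. card (act v) = DIM(real ^ 'd)}. Pow (act v))" by (auto simp: tops_def)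
  moreover have "finite (SIGMA v:{v \<in> Z. card (act v) = DIM(real ^ 'd)}. Pow (act v))"
    by (intro finite_SigmaI finite_vertices) (simp add: finite_active)
  ultimately have "finite (tops l)" by (rule finite_subset)
  then show "finite ?P" using bij_betw_finite[OF \<Psi>] by (simp add: finite_permutations)
  have "card ?P = card (tops l \<times> ?S)" using bij_betw_same_card[OF \<Psi>] by simp
  also have "\<dots> = num_faces l Z * fact CARD('d)"
    using l by (simp add: card_cartesian_product card_permutations num_faces_eq_card_tops)
  finally show "fact CARD('d) * num_faces l Z = card ?P" by simp
qed

end

section \<open>Genericity and the mean number of faces\<close>

lemma det_measurable [measurable (raw)]:
  fixes f :: "'z \<Rightarrow> real ^ 'n::finite ^ 'n"
  assumes [measurable]: "f \<in> borel_measurable M"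
  shows "(\<lambda>x. det (f x)) \<in> borel_measurable M"
  unfolding det_def by measurable

lemma ctr_measurable [measurable]: "ctr \<in> borel_measurable borel"
  unfolding ctr_def half_sq_def by measurable

lemma coef_measurable [measurable (raw)]:
  assumes [measurable]: "f \<in> borel_measurable M" "g \<in> borel_measurable M"
  shows "(\<lambda>x. coef (f x) (g x) i) \<in> borel_measurable M"
  unfolding coef_def by measurable

lemma det_scaleR_rows: "det (t *\<^sub>R (P :: real ^ 'n::finite ^ 'n)) = t ^ CARD('n) * det P"
proof -
  have "t *\<^sub>R P = (\<chi> i. t *s P $ i)" by (simp add: vec_eq_iff)
  then show ?thesis using det_rows_mul[of "\<lambda>_. t" "\<lambda>i. P $ i"] by (simp add: vec_lambda_eta)
qed

text \<open>The reversed pencil det (s P + B) is a polynomial in s with value \<open>det B\<close>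
  at s = 0, hence not the zero polynomial. Nonzero roots t of the original pencil are inverses of
  its roots.\<close>

lemma finite_det_roots:
  fixes P B :: "real ^ 'n::finite ^ 'n"
  assumes B: "det B \<noteq> 0"
  shows "finite {t. det (P + t *\<^sub>R B) = 0}"
proof -
  define q where "q = (\<Sum>\<pi>\<in>{\<pi>. \<pi> permutes (UNIV :: 'n set)}. [:of_int (sign \<pi>):] * (\<Prod>i\<in>UNIV. [:B $ i $ \<pi> i, P $ i $ \<pi> i:]))"
  have q: "poly q s = det (s *\<^sub>R P + B)" for s
    by (simp add: q_def poly_sum poly_prod det_def algebra_simps)
  have "poly q 0 \<noteq> 0" using B by (simp add: q)
  then have "q \<noteq> 0" by auto
  then have fin: "finite {s. poly q s = 0}" by (rule poly_roots_finite)
  have "{t. det (P + t *\<^sub>R B) = 0} \<subseteq> insert 0 (inverse ` {s. poly q s = 0})"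
  proof
    fix t assume t: "t \<in> {t. det (P + t *\<^sub>R B) = 0}"
    show "t \<in> insert 0 (inverse ` {s. poly q s = 0})"
    proof (cases "t = 0")
      case False
      have "P + t *\<^sub>R B = t *\<^sub>R (inverse t *\<^sub>R P + B)" using False by (simp add: scaleR_add_right)
      then have "poly q (inverse t) = 0" using t False by (simp add: det_scaleR_rows q)
      then show ?thesis using False by (intro insertI2 image_eqI[of _ _ "inverse t"]) auto
    qed simp
  qed
  then show ?thesis using fin by (meson finite_imageI finite_insert finite_subset)
qed

lemma null_det: "{P :: real ^ 'n::finite ^ 'n. det P = 0} \<in> null_sets lborel"
proof (rule null_sets_if_lines_countable[where v="mat 1"])
  show "{P :: real ^ 'n ^ 'n. det P = 0} \<in> sets borel" by measurable
  show "countable {t. x + t *\<^sub>R mat 1 \<in> {P :: real ^ 'n ^ 'n. det P = 0}}" for x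
    using finite_det_roots[of "mat 1 :: real ^ 'n ^ 'n" x] by (auto intro: countable_finite)
qed

lemma det_upd_mat_1: "det (vec_upd (mat 1) i u) = (u :: real ^ 'n::finite) $ i"
proof -
  have "u = (\<Sum>j\<in>UNIV. u $ j *\<^sub>R (mat 1 :: real ^ 'n ^ 'n) $ j)"
  proof -
    have "(\<Sum>j\<in>UNIV. u $ j * (mat 1 :: real ^ 'n ^ 'n) $ j $ k) = u $ k" for k
      by (simp add: mat_def if_distrib[of "\<lambda>y. _ * y"] cong: if_cong)
    then show ?thesis by (simp add: vec_eq_iff)
  qed
  then have "coef u (mat 1) i = u $ i" by (rule coef_eqI[rotated]) simp
  then show ?thesis by (simp add: coef_def)
qed

lemma det_vec_upd_scaleR: "det (vec_upd P i (t *\<^sub>R u)) = t * det (vec_upd P i (u :: real ^ 'n::finite))"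
proof -
  have "vec_upd P i (t *\<^sub>R u) = (\<chi> j. if j = i then t *s u else P $ j)"
    "vec_upd P i u = (\<chi> j. if j = i then u else P $ j)"
    by (simp_all add: vec_eq_iff vec_upd_nth)
  then show ?thesis using det_row_mul[of i t "\<lambda>_. u" "\<lambda>j. P $ j"] by simp
qed

text \<open>Row i is overwritten by u, so the lines run along the identity matrix with row i
  cleared. Scaling the new row i by t turns the restriction to a line into a pencil whose direction
  matrix has determinant u_i.\<close>

lemma null_det_upd:
  fixes u :: "real ^ 'n::finite"
  assumes u: "u $ i \<noteq> 0"
  shows "{P :: real ^ 'n ^ 'n. det (vec_upd P i u) = 0} \<in> null_sets lborel"
proof (rule null_sets_if_lines_countable[where v="vec_upd (mat 1) i 0"])
  show "{P :: real ^ 'n ^ 'n. det (vec_upd P i u) = 0} \<in> sets borel" by measurable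
  fix P :: "real ^ 'n ^ 'n"
  let ?D = "vec_upd (mat 1) i 0 :: real ^ 'n ^ 'n"
  let ?R = "vec_upd (mat 1) i u :: real ^ 'n ^ 'n"
  have "finite {t. det (vec_upd P i 0 + t *\<^sub>R ?R) = 0}"
    by (rule finite_det_roots) (simp add: det_upd_mat_1 u)
  moreover have "{t. P + t *\<^sub>R ?D \<in> {P. det (vec_upd P i u) = 0}} \<subseteq> {t. det (vec_upd P i 0 + t *\<^sub>R ?R) = 0} \<union> {0}"
  proof
    fix t assume "t \<in> {t. P + t *\<^sub>R ?D \<in> {P. det (vec_upd P i u) = 0}}"
    then have "t * det (vec_upd (P + t *\<^sub>R ?D) i u) = 0" by simp
    moreover have "vec_upd (P + t *\<^sub>R ?D) i (t *\<^sub>R u) = vec_upd P i 0 + t *\<^sub>R ?R"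
      by (simp add: vec_eq_iff vec_upd_nth)
    ultimately show "t \<in> {t. det (vec_upd P i 0 + t *\<^sub>R ?R) = 0} \<union> {0}"
      by (simp add: det_vec_upd_scaleR[symmetric])
  qed
  ultimately show "countable {t. P + t *\<^sub>R ?D \<in> {P. det (vec_upd P i u) = 0}}"
    by (meson countable_finite finite.emptyI finite.insertI finite_UnI finite_subset)
qed

text \<open>The \<open>Some\<close> entries fix the sphere through the origin, and the
  \<open>None\<close> entry moves along a line. Lying on the sphere is then a quadratic equation in
  t with leading coefficient 1/2, so it has at most two solutions.\<close>

lemma null_sphere:
  "{f :: (real ^ 'n::finite) ^ 'n option. f $ None \<bullet> ctr (\<chi> i. f $ Some i) = (norm (f $ None))\<^sup>2 / 2} \<in> null_sets lborel"
    (is "?A \<in> _")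
proof -
  let ?e = "axis undefined 1 :: real ^ 'n"
  let ?v = "axis None ?e :: (real ^ 'n) ^ 'n option"
  show ?thesis
  proof (rule null_sets_if_lines_countable[where v="?v"])
    have [measurable]: "(\<lambda>f :: (real ^ 'n) ^ 'n option. ctr (\<chi> i. f $ Some i)) \<in> borel_measurable borel"
      by (rule measurable_compose[OF _ ctr_measurable]) measurable
    show "?A \<in> sets borel" by measurable
    fix f :: "(real ^ 'n) ^ 'n option"
    let ?p = "f $ None" and ?x = "ctr (\<chi> i. f $ Some i)"
    have S: "(f + t *\<^sub>R ?v) $ Some i = f $ Some i" for t i by (simp add: axis_def)
    have N: "(f + t *\<^sub>R ?v) $ None = ?p + t *\<^sub>R ?e" for t by (simp add: axis_def)
    let ?q = "[: (norm ?p)\<^sup>2 / 2 - ?p \<bullet> ?x, ?p \<bullet> ?e - ?e \<bullet> ?x, 1 / 2 :]"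
    have "{t. f + t *\<^sub>R ?v \<in> ?A} \<subseteq> {t. poly ?q t = 0}"
    proof
      fix t assume "t \<in> {t. f + t *\<^sub>R ?v \<in> ?A}"
      then have "(?p + t *\<^sub>R ?e) \<bullet> ?x = (norm (?p + t *\<^sub>R ?e))\<^sup>2 / 2" unfolding mem_Collect_eq S N .
      moreover have "(norm (?p + t *\<^sub>R ?e))\<^sup>2 = (norm ?p)\<^sup>2 + 2 * t * (?p \<bullet> ?e) + t\<^sup>2"
      proof -
        have "?e \<bullet> ?e = 1" by (simp add: inner_axis_axis)
        then show ?thesis
          by (simp only: power2_norm_eq_inner inner_add_left inner_add_right inner_scaleR_left inner_scaleR_right
              inner_commute[of ?e ?p]) (simp add: power2_eq_square algebra_simps)
      qed
      ultimately have "?p \<bullet> ?x + t * (?e \<bullet> ?x) = ((norm ?p)\<^sup>2 + 2 * t * (?p \<bullet> ?e) + t\<^sup>2) / 2"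
        by (simp only: inner_add_left inner_scaleR_left)
      then show "t \<in> {t. poly ?q t = 0}" by (simp add: power2_eq_square algebra_simps add_divide_distrib)
    qed
    moreover have "finite {t. poly ?q t = 0}" by (rule poly_roots_finite) simp
    ultimately show "countable {t. f + t *\<^sub>R ?v \<in> ?A}" by (intro countable_finite[OF finite_subset])
  qed
qed

text \<open>If p lies in the open orthant whose closure contains x, then p . x is the sum of |p_i|
  |x_i|, and the constraint of p bounds it by half the squared norm of p. Finitely many orthants
  give a common bound.\<close>

lemma bounded_cell_if_orthants:
  fixes X :: "(real ^ 'd::finite) set"
  assumes X: "\<And>s. (\<And>i. s $ i = 1 \<or> s $ i = -1) \<Longrightarrow> \<exists>p\<in>X. \<forall>i. s $ i * p $ i > 0"
  shows "bounded (voronoi_cell0 X)"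
proof -
  let ?S = "{s :: real ^ 'd. \<forall>i. s $ i \<in> {1, -1}}"
  let ?Z = "\<lambda>s. {x \<in> voronoi_cell0 X. \<forall>i. s $ i * x $ i = \<bar>x $ i\<bar>}"
  have bd: "bounded (?Z s)" if s: "s \<in> ?S" for s
  proof -
    obtain p where p: "p \<in> X" "\<And>i. s $ i * p $ i > 0" using X[of s] s by auto
    define m where "m = Min (range (\<lambda>i. \<bar>p $ i\<bar>))"
    have "p $ i \<noteq> 0" for i using p(2)[of i] by auto
    then have m0: "m > 0" unfolding m_def by (subst Min_gr_iff) auto
    have m: "m \<le> \<bar>p $ i\<bar>" for i unfolding m_def by (rule Min_le) auto
    have "norm x \<le> (norm p)\<^sup>2 / 2 / m" if x: "x \<in> ?Z s" for x
    proof -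
      have pos: "p $ i * x $ i = \<bar>p $ i\<bar> * \<bar>x $ i\<bar>" for i
      proof -
        have "s $ i * s $ i = 1" using s by (auto dest!: spec[of _ i])
        then have "p $ i * x $ i = (s $ i * s $ i) * (p $ i * x $ i)" by simp
        also have "\<dots> = (s $ i * p $ i) * (s $ i * x $ i)" by (simp only: mult_ac)
        also have "s $ i * p $ i = \<bar>p $ i\<bar>"
        proof -
          have "\<bar>s $ i\<bar> = 1" using s by (auto dest!: spec[of _ i])
          then have "\<bar>s $ i * p $ i\<bar> = \<bar>p $ i\<bar>" by (simp add: abs_mult)
          then show ?thesis using p(2)[of i] by simp
        qed
        also have "s $ i * x $ i = \<bar>x $ i\<bar>" using x by simp
        finally show ?thesis .
      qed
      have "m * norm x \<le> m * (\<Sum>i\<in>UNIV. \<bar>x $ i\<bar>)" using m0 norm_le_l1_cart[of x] by simp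
      also have "\<dots> \<le> (\<Sum>i\<in>UNIV. \<bar>p $ i\<bar> * \<bar>x $ i\<bar>)"
        unfolding sum_distrib_left by (intro sum_mono mult_right_mono m) simp
      also have "\<dots> = p \<bullet> x" by (simp add: inner_vec_def pos)
      also have "\<dots> \<le> (norm p)\<^sup>2 / 2" using x p(1) by (simp add: voronoi_cell0_altdef)
      finally have "m * norm x \<le> (norm p)\<^sup>2 / 2" .
      then show ?thesis using pos_le_divide_eq[OF m0] by (simp only: mult.commute)
    qed
    then show ?thesis unfolding bounded_iff by blast
  qed
  have "finite ?S" using card_vec_set(1)[of "\<lambda>_ :: 'd. {1, -1 :: real}"] by simp
  then have "bounded (\<Union>s\<in>?S. ?Z s)" using bd by (intro bounded_UN) blast+
  moreover have "voronoi_cell0 X \<subseteq> (\<Union>s\<in>?S. ?Z s)"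
  proof
    fix x assume x: "x \<in> voronoi_cell0 X"
    then have "x \<in> ?Z (\<chi> i. if x $ i \<ge> 0 then 1 else -1)" by simp
    moreover have "(\<chi> i. if x $ i \<ge> 0 then 1 else -1) \<in> ?S" by simp
    ultimately show "x \<in> (\<Union>s\<in>?S. ?Z s)" by blast
  qed
  ultimately show ?thesis by (rule bounded_subset)
qed

section \<open>Almost sure genericity and the mean for a fixed direction\<close>

definition Wvoid :: "real ^ 'd::finite \<Rightarrow> ennreal" where
  "Wvoid x = ennreal (exp (- measure lborel (ball x (norm x))))"

definition pos_tuples :: "real ^ 'd::finite \<Rightarrow> 'd set \<Rightarrow> (real ^ 'd ^ 'd) set" where
  "pos_tuples u J = {P. det P \<noteq> 0 \<and> (\<forall>i\<in>J. coef u P i > 0)}"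

lemma pos_tuples_measurable [measurable]: "pos_tuples u J \<in> sets borel"
  unfolding pos_tuples_def by measurable

locale poisson_vec = poisson M Phi for M :: "'w measure" and Phi :: "'w \<Rightarrow> (real ^ 'd::finite) set"
begin

text \<open>The cubes \<open>B n\<close> exhaust the open orthant with signs s and have volume n^d,
  so the probability that all of them are empty is below every exp (- n).\<close>

lemma AE_orthant:
  fixes s :: "real ^ 'd"
  assumes s: "\<And>i. s $ i = 1 \<or> s $ i = -1"
  shows "AE w in M. \<exists>p\<in>Phi w. \<forall>i. s $ i * p $ i > 0"
proof -
  define B where "B n = {p :: real ^ 'd. \<forall>i. p $ i \<in> {y. 0 < s $ i * y \<and> s $ i * y < real n}}" for n :: nat
  have Bs: "B n \<in> sets borel" for n unfolding B_def by measurable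
  have Bb: "bounded (B n)" for n
  proof -
    have "norm p \<le> (\<Sum>i\<in>(UNIV :: 'd set). real n)" if "p \<in> B n" for p
    proof -
      have "norm p \<le> (\<Sum>i\<in>UNIV. \<bar>p $ i\<bar>)" by (rule norm_le_l1_cart)
      also have "\<dots> \<le> (\<Sum>i\<in>(UNIV :: 'd set). real n)"
      proof (rule sum_mono)
        fix i
        have "0 < s $ i * p $ i \<and> s $ i * p $ i < real n" using that by (simp add: B_def)
        then show "\<bar>p $ i\<bar> \<le> real n" using s[of i] by auto
      qed
      finally show ?thesis .
    qed
    then show ?thesis unfolding bounded_iff by blast
  qed
  have Bm: "measure lborel (B n) = real n ^ CARD('d)" for n
  proof -
    have "emeasure lborel {y. 0 < s $ i * y \<and> s $ i * y < real n} = ennreal (real n)" for i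
    proof -
      have "{y. 0 < s $ i * y \<and> s $ i * y < real n} = (if s $ i = 1 then {0<..<real n} else {- real n<..<0})"
        using s[of i] by auto
      then show ?thesis by simp
    qed
    then have "emeasure lborel (B n) = ennreal (real n) ^ CARD('d)"
      unfolding B_def by (subst emeasure_vec_prod) auto
    then show ?thesis by (simp add: measure_def ennreal_power)
  qed
  let ?V = "\<lambda>n. {w \<in> space M. Phi w \<inter> B n = {}}"
  have V: "?V n \<in> sets M" for n by (rule sets_void) (rule Bs Bb)+
  have N: "(\<Inter>n. ?V n) \<in> sets M" using V by (intro sets.countable_INT) auto
  have "prob (\<Inter>n. ?V n) \<le> exp (- real n)" if "n > 0" for n
  proof -
    have "prob (\<Inter>n. ?V n) \<le> prob (?V n)" by (intro finite_measure_mono V) auto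
    also have "\<dots> = exp (- (real n ^ CARD('d)))" by (simp add: prob_void[OF Bs Bb] Bm)
    also have "\<dots> \<le> exp (- real n)" using that self_le_power[of "real n" "CARD('d)"] by simp
    finally show ?thesis .
  qed
  moreover have "(\<lambda>n. exp (- real n)) \<longlonglongrightarrow> 0"
    by (rule filterlim_compose[OF exp_at_bot]) (simp add: filterlim_uminus_at_bot filterlim_real_sequentially)
  ultimately have "prob (\<Inter>n. ?V n) \<le> 0"
    by (intro LIMSEQ_le_const[of "\<lambda>n. exp (- real n)"]) (auto intro!: exI[of _ 1])
  then have "emeasure M (\<Inter>n. ?V n) = 0"
    using measure_nonneg[of M "\<Inter>n. ?V n"] by (simp add: emeasure_eq_measure)
  then have "(\<Inter>n. ?V n) \<in> null_sets M" using N by blast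
  then have "AE w in M. w \<notin> (\<Inter>n. ?V n)" by (rule AE_not_in)
  then show ?thesis using AE_space
  proof eventually_elim
    case (elim w)
    then obtain n p where "p \<in> Phi w" "p \<in> B n" by auto
    then show ?case by (intro bexI[of _ p]) (auto simp: B_def)
  qed
qed

text \<open>Each requirement of \<open>generic_cellI\<close> can fail only if a tuple of points
  falls into one of finitely many null sets or if one of finitely many orthants is empty.\<close>

lemma AE_generic:
  assumes u: "\<And>i. u $ i \<noteq> 0"
  shows "AE w in M. generic_cell (Phi w) u"
proof -
  have 1: "AE w in M. \<forall>s\<in>{s :: real ^ 'd. \<forall>i. s $ i \<in> {1, -1}}. \<exists>p\<in>Phi w. \<forall>i. s $ i * p $ i > 0"
  proof (rule AE_finite_allI)
    show "finite {s :: real ^ 'd. \<forall>i. s $ i \<in> {1, -1}}" by (rule card_vec_set) simp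
    show "AE w in M. \<exists>p\<in>Phi w. \<forall>i. s $ i * p $ i > 0" if "s \<in> {s :: real ^ 'd. \<forall>i. s $ i \<in> {1, -1}}" for s
      by (rule AE_orthant) (use that in auto)
  qed
  have 2: "AE w in M. \<forall>i\<in>UNIV. {P :: real ^ 'd ^ 'd. det (vec_upd P i u) = 0} \<inter> tuples (Phi w) = {}"
    by (rule AE_finite_allI) (auto intro!: AE_no_tuples null_det_upd u)
  show ?thesis
    using 1 2 AE_no_tuples[OF null_det] AE_no_tuples[OF null_sphere] AE_space
  proof eventually_elim
    case (elim w)
    show ?case
    proof (rule generic_cellI)
      show "finite (Phi w \<inter> cball 0 r)" for r by (rule finite_Phi) (use elim in auto)
      show "bounded (voronoi_cell0 (Phi w))" by (rule bounded_cell_if_orthants) (use elim(1) in auto)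
      show d: "det f \<noteq> 0" if "f \<in> tuples (Phi w)" for f :: "real ^ 'd ^ 'd" using elim(3) that by auto
      show "det (vec_upd f i u) \<noteq> 0" if "f \<in> tuples (Phi w)" for f :: "real ^ 'd ^ 'd" and i using elim(2) that by auto
      show "\<exists>i. f $ i \<bullet> x \<noteq> (norm (f $ i))\<^sup>2 / 2" if f: "f \<in> tuples (Phi w)" for f :: "(real ^ 'd) ^ 'd option" and x
      proof (rule ccontr)
        assume "\<not> ?thesis"
        then have e: "f $ i \<bullet> x = (norm (f $ i))\<^sup>2 / 2" for i by blast
        let ?g = "\<chi> i. f $ Some i"
        have "?g \<in> tuples (Phi w)" using f by (auto simp: tuples_def inj_def)
        from d[OF this] have dg: "det ?g \<noteq> 0" .
        have "?g *v x = half_sq ?g" by (simp add: vec_eq_iff matrix_vector_mult_nth half_sq_def e)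
        then have "x = ctr ?g" using ctr_iff[OF dg, of x] by simp
        then have "f \<in> {f. f $ None \<bullet> ctr (\<chi> i. f $ Some i) = (norm (f $ None))\<^sup>2 / 2}" using e[of None] by simp
        then show False using elim(4) f by blast
      qed
    qed
  qed
qed

text \<open>The factor \<open>1 / fact CARD('d)\<close> removes the orderings. A tuple with nonzero
  determinant has distinct rows, and these lie on the boundary of the open ball around
  \<open>ctr\<close>, so the side conditions of \<open>mean_bvoid\<close> hold.\<close>

proposition mean_num_faces:
  fixes u :: "real ^ 'd"
  assumes u: "\<And>i. u $ i \<noteq> 0" and l: "l \<le> CARD('d)"
  shows "(\<integral>\<^sup>+w. ennreal (real (num_faces l (voronoi_cell0 (Phi w)))) \<partial>M)
    = ennreal (1 / fact CARD('d)) * (\<Sum>J\<in>{J. card J = l}. \<integral>\<^sup>+P. indicator (pos_tuples u J) P * Wvoid (ctr P) \<partial>lborel)"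
proof -
  have inj: "inj (($) P)" if "P \<in> pos_tuples u J" for P J
  proof (rule injI, rule ccontr)
    fix i j assume "P $ i = P $ j" "i \<noteq> j"
    then have "det P = 0" by (intro det_identical_rows[of i j]) (simp_all add: row_def)
    then show False using that by (simp add: pos_tuples_def)
  qed
  have nb: "P $ i \<notin> ball (ctr P) (norm (ctr P))" if "P \<in> pos_tuples u J" for P J i
  proof -
    have "P $ i \<bullet> ctr P = (norm (P $ i))\<^sup>2 / 2" by (rule ctr_inner) (use that in \<open>simp add: pos_tuples_def\<close>)
    then have "(norm (ctr P - P $ i))\<^sup>2 = (norm (ctr P))\<^sup>2"
      by (simp add: power2_norm_eq_inner inner_diff_left inner_diff_right inner_commute)
    then show ?thesis by (simp add: dist_norm)
  qed
  note mb = mean_bvoid[OF pos_tuples_measurable ctr_measurable inj nb]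
  have "AE w in M. ennreal (real (num_faces l (voronoi_cell0 (Phi w))))
      = ennreal (1 / fact CARD('d)) * (\<Sum>J\<in>{J. card J = l}. bvoid ctr (pos_tuples u J) w)"
    using AE_generic[OF u]
  proof eventually_elim
    case (elim w)
    then interpret generic_cell "Phi w" u .
    interpret generic_cell_vec "Phi w" u ..
    have b: "bvoid ctr (pos_tuples u J) w = emeasure (count_space UNIV) (top_tuples (Phi w) u J)" for J
      unfolding bvoid_def top_tuples_def pos_tuples_def by (rule arg_cong[where f="emeasure _"]) auto
    have fin: "finite (top_tuples (Phi w) u J)" if "card J = l" for J
    proof -
      have "top_tuples (Phi w) u J \<subseteq> snd ` (SIGMA J:{J. card J = l}. top_tuples (Phi w) u J)"
        using that by force
      then show ?thesis using fact_num_faces(1)[OF l] finite_subset by blast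
    qed
    have "fact CARD('d) * num_faces l Z = (\<Sum>J\<in>{J. card J = l}. card (top_tuples (Phi w) u J))"
      unfolding fact_num_faces(2)[OF l] using fin by (intro card_SigmaI) auto
    then have "real (fact CARD('d) * num_faces l Z) = real (\<Sum>J\<in>{J. card J = l}. card (top_tuples (Phi w) u J))"
      by (simp only:)
    then have "fact CARD('d) * real (num_faces l Z) = (\<Sum>J\<in>{J. card J = l}. real (card (top_tuples (Phi w) u J)))"
      by (simp only: of_nat_mult of_nat_fact of_nat_sum)
    from this[symmetric] have "real (num_faces l Z) = (1 / fact CARD('d)) * (\<Sum>J\<in>{J. card J = l}. real (card (top_tuples (Phi w) u J)))"
      by (simp only:) simp
    moreover have "(\<Sum>J\<in>{J. card J = l}. bvoid ctr (pos_tuples u J) w) = ennreal (\<Sum>J\<in>{J. card J = l}. real (card (top_tuples (Phi w) u J)))"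
      using fin by (subst sum_ennreal[symmetric]) (auto simp: b ennreal_of_nat_eq_real_of_nat intro!: sum.cong)
    ultimately show ?case by (simp add: ennreal_mult[symmetric] sum_nonneg)
  qed
  then have "(\<integral>\<^sup>+w. ennreal (real (num_faces l (voronoi_cell0 (Phi w)))) \<partial>M)
    = (\<integral>\<^sup>+w. ennreal (1 / fact CARD('d)) * (\<Sum>J\<in>{J. card J = l}. bvoid ctr (pos_tuples u J) w) \<partial>M)"
    by (rule nn_integral_cong_AE)
  also have "\<dots> = ennreal (1 / fact CARD('d)) * (\<Sum>J\<in>{J. card J = l}. \<integral>\<^sup>+w. bvoid ctr (pos_tuples u J) w \<partial>M)"
    by (subst nn_integral_cmult) (auto intro!: mb(1) borel_measurable_sum simp: nn_integral_sum mb(1))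
  also have "(\<lambda>J. \<integral>\<^sup>+w. bvoid ctr (pos_tuples u J) w \<partial>M) = (\<lambda>J. \<integral>\<^sup>+P. indicator (pos_tuples u J) P * Wvoid (ctr P) \<partial>lborel)"
    unfolding Wvoid_def by (rule ext) (rule mb(2))
  finally show ?thesis .
qed

end

section \<open>Integral transformations\<close>

lemma nn_integral_scaleR:
  fixes f :: "real ^ 'n::finite \<Rightarrow> ennreal"
  assumes "r > 0" and [measurable]: "f \<in> borel_measurable borel"
  shows "(\<integral>\<^sup>+x. f x \<partial>lborel) = ennreal (r ^ CARD('n)) * (\<integral>\<^sup>+x. f (r *\<^sub>R x) \<partial>lborel)"
proof -
  have "det (r *\<^sub>R (mat 1 :: real ^ 'n ^ 'n)) = r ^ CARD('n)" by (simp add: det_scaleR_rows)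
  moreover have "(r *\<^sub>R (mat 1 :: real ^ 'n ^ 'n)) *v x = r *\<^sub>R x" for x
    by (simp add: scaleR_matrix_vector_assoc[symmetric])
  ultimately show ?thesis
    using nn_integral_linear[of "r *\<^sub>R (mat 1 :: real ^ 'n ^ 'n)" f] assms by simp
qed

lemma nn_integral_inverse_1_plus_square: "(\<integral>\<^sup>+x. ennreal (1 / (1 + x\<^sup>2)) \<partial>lborel) < \<infinity>"
proof -
  have *: "(\<integral>\<^sup>+x. ennreal (1 / (1 + x\<^sup>2)) * indicator {0..} x \<partial>lborel) = ennreal (pi / 2 - arctan 0)"
  proof (rule nn_integral_FTC_atLeast)
    show "(arctan has_real_derivative 1 / (1 + x\<^sup>2)) (at x)" for x
      using DERIV_arctan[of x] by (simp add: inverse_eq_divide)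
    show "(arctan \<longlongrightarrow> pi / 2) at_top" by (rule tendsto_arctan_at_top)
  qed (auto simp: add_nonneg_nonneg)
  have "(\<integral>\<^sup>+x. ennreal (1 / (1 + x\<^sup>2)) \<partial>lborel)
      \<le> (\<integral>\<^sup>+x. ennreal (1 / (1 + x\<^sup>2)) * indicator {0..} x + ennreal (1 / (1 + (- x)\<^sup>2)) * indicator {0..} (- x) \<partial>lborel)"
    by (intro nn_integral_mono) (auto simp: indicator_def)
  also have "\<dots> = (\<integral>\<^sup>+x. ennreal (1 / (1 + x\<^sup>2)) * indicator {0..} x \<partial>lborel)
     + (\<integral>\<^sup>+x. ennreal (1 / (1 + (- x)\<^sup>2)) * indicator {0..} (- x) \<partial>lborel)"
    by (rule nn_integral_add) measurable
  also have "(\<integral>\<^sup>+x. ennreal (1 / (1 + (- x)\<^sup>2)) * indicator {0..} (- x) \<partial>lborel) = (\<integral>\<^sup>+x. ennreal (1 / (1 + x\<^sup>2)) * indicator {0..} x \<partial>lborel)"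
    using nn_integral_real_affine[of "\<lambda>x. ennreal (1 / (1 + x\<^sup>2)) * indicator {0..} x" "-1" 0] by simp
  finally show ?thesis unfolding * by (rule le_less_trans) simp
qed

lemma nn_integral_gauss_1: "(\<integral>\<^sup>+x. ennreal (exp (- x\<^sup>2 / 2)) \<partial>lborel) = ennreal (sqrt (2 * pi))"
proof -
  interpret prob_space "density lborel std_normal_density" by (rule prob_space_normal_density) simp
  have "1 = (\<integral>\<^sup>+x. ennreal (std_normal_density x) \<partial>lborel)"
    using emeasure_space_1 by (simp add: emeasure_density)
  then have "ennreal (sqrt (2 * pi)) = ennreal (sqrt (2 * pi)) * (\<integral>\<^sup>+x. ennreal (std_normal_density x) \<partial>lborel)" by simp
  also have "\<dots> = (\<integral>\<^sup>+x. ennreal (sqrt (2 * pi)) * ennreal (std_normal_density x) \<partial>lborel)"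
    by (rule nn_integral_cmult[symmetric]) measurable
  also have "\<dots> = (\<integral>\<^sup>+x. ennreal (exp (- x\<^sup>2 / 2)) \<partial>lborel)"
    by (intro nn_integral_cong) (simp add: std_normal_density_def ennreal_mult[symmetric])
  finally show ?thesis ..
qed

definition gauss :: "'a::real_inner \<Rightarrow> real" where "gauss x = exp (- (x \<bullet> x) / 2)"

lemma gauss_measurable [measurable]: "gauss \<in> borel_measurable (borel :: 'a::euclidean_space measure)"
  unfolding gauss_def by (intro borel_measurable_continuous_onI continuous_intros) auto

lemma gauss_pos: "gauss x > 0" by (simp add: gauss_def)

lemma gauss_vec: "gauss (x :: 'a::euclidean_space ^ 'n::finite) = (\<Prod>i\<in>UNIV. gauss (x $ i))"
  by (simp add: gauss_def inner_vec_def exp_sum[symmetric] sum_negf sum_divide_distrib)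

lemma nn_integral_gauss: "(\<integral>\<^sup>+x. ennreal (gauss (x :: real ^ 'n::finite)) \<partial>lborel) = ennreal (sqrt (2 * pi) ^ CARD('n))"
proof -
  have "(\<integral>\<^sup>+x. ennreal (gauss (x :: real ^ 'n)) \<partial>lborel) = (\<integral>\<^sup>+x. (\<Prod>i\<in>UNIV. ennreal (gauss (x $ i))) \<partial>(lborel :: (real ^ 'n) measure))"
    by (simp add: gauss_vec prod_ennreal gauss_pos less_imp_le)
  also have "\<dots> = (\<Prod>i\<in>(UNIV :: 'n set). \<integral>\<^sup>+y. ennreal (gauss (y :: real)) \<partial>lborel)"
    by (rule nn_integral_vec_prod) measurable
  also have "\<dots> = ennreal (sqrt (2 * pi)) ^ CARD('n)"
    using nn_integral_gauss_1 by (simp add: gauss_def power2_eq_square)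
  finally show ?thesis by (simp add: ennreal_power)
qed

lemma nn_integral_pos_if_pos:
  fixes f :: "real \<Rightarrow> ennreal"
  assumes [measurable]: "f \<in> borel_measurable borel" and pos: "\<And>x. x > 0 \<Longrightarrow> f x > 0"
  shows "(\<integral>\<^sup>+x. f x \<partial>lborel) > 0"
proof (rule ccontr)
  assume "\<not> ?thesis"
  then have "(\<integral>\<^sup>+x. f x \<partial>lborel) = 0" by simp
  then have "AE x in lborel. f x = 0" by (subst (asm) nn_integral_0_iff_AE) simp_all
  then have "AE x in lborel. x \<notin> {0<..<1::real}" by eventually_elim (use pos in force)
  then have "{0<..<1::real} \<in> null_sets lborel" by (subst (asm) AE_iff_null_sets[symmetric]) auto
  then show False by (simp add: null_sets_def)
qed

lemma power_le_fact_exp: "(x::real) \<ge> 0 \<Longrightarrow> x ^ n \<le> fact n * exp x"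
proof -
  assume x: "x \<ge> 0"
  have "x ^ n /\<^sub>R fact n \<le> (\<Sum>i<Suc n. x ^ i /\<^sub>R fact i)"
    using x by (intro member_le_sum[of n "{..<Suc n}" "\<lambda>i. x ^ i /\<^sub>R fact i"]) auto
  also have "\<dots> \<le> (\<Sum>i. x ^ i /\<^sub>R fact i)"
    using x by (intro sum_le_suminf summable_exp_generic) auto
  finally show ?thesis by (simp add: exp_def field_simps)
qed

lemma nn_integral_moment_finite: "(\<integral>\<^sup>+x. ennreal (indicator {0<..} x * x ^ n * exp (- x\<^sup>2 / 2)) \<partial>lborel) < \<infinity>"
proof -
  define C :: real where "C = 1 + 4 ^ n * fact n"
  have C0: "C \<ge> 0" by (simp add: C_def)
  have le: "indicator {0<..} x * x ^ n * exp (- x\<^sup>2 / 2) \<le> C * exp (- (x\<^sup>2) / 4)" for x :: real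
  proof (cases "x > 0")
    case True
    have "(x\<^sup>2 / 4) ^ n \<le> fact n * exp (x\<^sup>2 / 4)" by (rule power_le_fact_exp) simp
    then have "x ^ n * x ^ n \<le> 4 ^ n * fact n * exp (x\<^sup>2 / 4)"
      by (simp add: power_divide power_mult_distrib power2_eq_square field_simps)
    moreover have "2 * x ^ n \<le> 1 + x ^ n * x ^ n"
      using zero_le_square[of "x ^ n - 1"] by (simp add: algebra_simps)
    moreover have "0 \<le> x ^ n" using True by simp
    moreover have "1 \<le> exp (x\<^sup>2 / 4)" by simp
    ultimately have "x ^ n \<le> exp (x\<^sup>2 / 4) + 4 ^ n * fact n * exp (x\<^sup>2 / 4)" by linarith
    then have "x ^ n \<le> C * exp (x\<^sup>2 / 4)" by (simp add: C_def algebra_simps)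
    then have "x ^ n * exp (- x\<^sup>2 / 2) \<le> C * exp (x\<^sup>2 / 4) * exp (- x\<^sup>2 / 2)" by (rule mult_right_mono) simp
    also have "\<dots> = C * exp (- (x\<^sup>2) / 4)" by (simp add: exp_add[symmetric])
    finally show ?thesis using True by simp
  qed (simp add: C_def)
  have "(\<integral>\<^sup>+x. ennreal (indicator {0<..} x * x ^ n * exp (- x\<^sup>2 / 2)) \<partial>lborel) \<le> (\<integral>\<^sup>+x. ennreal C * ennreal (exp (- (x\<^sup>2) / 4)) \<partial>lborel)"
    by (rule nn_integral_mono) (simp only: ennreal_mult[symmetric] C0 exp_ge_zero ennreal_leI[OF le])
  also have "\<dots> = ennreal C * (\<integral>\<^sup>+x. ennreal (exp (- (x\<^sup>2) / 4)) \<partial>lborel)" by (rule nn_integral_cmult) measurable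
  also have "(\<integral>\<^sup>+x. ennreal (exp (- (x\<^sup>2) / 4)) \<partial>lborel) = ennreal \<bar>sqrt 2\<bar> * (\<integral>\<^sup>+x. ennreal (exp (- ((0 + sqrt 2 * x)\<^sup>2) / 4)) \<partial>lborel)"
    by (rule nn_integral_real_affine) auto
  also have "(\<lambda>x. exp (- ((0 + sqrt 2 * x)\<^sup>2) / 4)) = (\<lambda>x. exp (- x\<^sup>2 / 2))" by (simp add: power_mult_distrib)
  finally show ?thesis unfolding nn_integral_gauss_1 by (rule le_less_trans) (simp add: ennreal_mult_less_top)
qed

text \<open>The value 0 at s \<le> 0 encodes the restriction to positive offsets; for n = 0 this is
  the indicator of the positive half-line, which covers d = 1.\<close>

definition pw :: "nat \<Rightarrow> real \<Rightarrow> real" where "pw n s = (if s > 0 then s ^ n else 0)"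

lemma pw_measurable [measurable]: "pw n \<in> borel_measurable borel" unfolding pw_def by measurable

lemma pw_nonneg: "pw n s \<ge> 0" by (simp add: pw_def)

lemma pw_mult: "r > 0 \<Longrightarrow> pw n (r * s) = r ^ n * pw n s"
  by (simp add: pw_def power_mult_distrib zero_less_mult_iff)

text \<open>This is the constant left by the radial integration in \<open>one_point_formula\<close>.
  At 0 the exponential beats the pole, and beyond 1 the integrand is at most 1 / (2 t^2).\<close>

lemma one_point_constant:
  obtains c :: real where "c > 0"
    "(\<integral>\<^sup>+t. ennreal (indicator {0<..} t * ((1 / (2 * t\<^sup>2)) * exp (- (1 / (2 * t\<^sup>2))) * (1 / (2 * t)) ^ (n - 1) / t ^ n)) \<partial>lborel) = ennreal c"
proof -
  let ?k = "\<lambda>t::real. indicator {0<..} t * ((1 / (2 * t\<^sup>2)) * exp (- (1 / (2 * t\<^sup>2))) * (1 / (2 * t)) ^ (n - 1) / t ^ n)"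
  define C :: real where "C = 2 * (2 ^ (n + 2) * fact (n + 2)) + 2"
  have C0: "C \<ge> 0" by (simp add: C_def)
  have le: "?k t \<le> C * (1 / (1 + t\<^sup>2))" for t
  proof (cases "t > 0")
    case True
    define z where "z = 1 / (2 * t\<^sup>2)"
    have z0: "z > 0" using True by (simp add: z_def)
    show ?thesis
    proof (cases "t \<le> 1")
      case t1: True
      \<comment> \<open>The exponent n + 2 is chosen so that the negative powers of z cancel the
        factors z and t^(-2 n) and still leave t^2.\<close>
      have e: "exp (- z) \<le> fact (n + 2) / z ^ (n + 2)"
        using power_le_fact_exp[of z "n + 2"] z0 by (simp add: exp_minus field_simps)
      have "(1 / (2 * t)) ^ (n - 1) \<le> (1 / t) ^ (n - 1)" using True by (intro power_mono) (auto simp: field_simps)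
      also have "\<dots> \<le> (1 / t) ^ n" using True t1 by (intro power_increasing) auto
      finally have p: "(1 / (2 * t)) ^ (n - 1) \<le> (1 / t) ^ n" .
      have "?k t = z * exp (- z) * (1 / (2 * t)) ^ (n - 1) / t ^ n" using True by (simp add: z_def)
      also have "\<dots> \<le> z * (fact (n + 2) / z ^ (n + 2)) * (1 / t) ^ n / t ^ n"
        using True z0 e p by (intro divide_right_mono mult_mono) auto
      also have "\<dots> = fact (n + 2) * (1 / z) ^ (n + 1) * (1 / t) ^ (2 * n)"
      proof -
        have "z * (fact (n + 2) / z ^ (n + 2)) = fact (n + 2) * (1 / z) ^ (n + 1)"
          using z0 by (simp add: power_one_over)
        moreover have "(1 / t) ^ n / t ^ n = (1 / t) ^ (2 * n)"
          by (simp add: power_one_over mult_2 power_add)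
        ultimately show ?thesis by (simp only: times_divide_eq_right[symmetric])
      qed
      also have "1 / z = 2 * t\<^sup>2" using True by (simp add: z_def)
      also have "fact (n + 2) * (2 * t\<^sup>2) ^ (n + 1) * (1 / t) ^ (2 * n) = fact (n + 2) * 2 ^ (n + 1) * t\<^sup>2"
        using True by (simp add: power_mult_distrib power_mult[symmetric] field_simps)
      also have "\<dots> \<le> fact (n + 2) * 2 ^ (n + 1) * 1"
        using True t1 by (intro mult_left_mono power_le_one) auto
      also have "\<dots> \<le> C / 2" by (simp add: C_def)
      also have "\<dots> \<le> C * (1 / (1 + t\<^sup>2))"
      proof -
        have "t\<^sup>2 \<le> 1" using True t1 by (intro power_le_one) auto
        then have "1 / 2 \<le> 1 / (1 + t\<^sup>2)" by (intro divide_left_mono) (auto simp: add_pos_nonneg)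
        then have "C * (1 / 2) \<le> C * (1 / (1 + t\<^sup>2))" by (rule mult_left_mono) (simp add: C_def)
        then show ?thesis by simp
      qed
      finally show ?thesis .
    next
      case t1: False
      have "?k t = z * exp (- z) * (1 / (2 * t)) ^ (n - 1) * (1 / t) ^ n" using True by (simp add: z_def power_one_over)
      also have "\<dots> \<le> z * 1 * 1 * 1"
        using True t1 z0 by (intro mult_mono power_le_one) (auto simp: field_simps)
      also have "\<dots> \<le> 2 * (1 / (1 + t\<^sup>2))"
      proof -
        have "1 \<le> t\<^sup>2" using t1 True by (simp add: one_le_power)
        then have "1 + t\<^sup>2 \<le> 4 * t\<^sup>2" by simp
        then show ?thesis using True by (simp add: z_def divide_simps add_pos_nonneg)
      qed
      also have "\<dots> \<le> C * (1 / (1 + t\<^sup>2))" by (intro mult_right_mono) (auto simp: C_def)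
      finally show ?thesis .
    qed
  qed (simp add: C_def)
  have "(\<integral>\<^sup>+t. ennreal (?k t) \<partial>lborel) \<le> (\<integral>\<^sup>+t. ennreal C * ennreal (1 / (1 + t\<^sup>2)) \<partial>lborel)"
  proof (rule nn_integral_mono)
    fix t :: real
    have "0 \<le> 1 / (1 + t\<^sup>2)" by simp
    then show "ennreal (?k t) \<le> ennreal C * ennreal (1 / (1 + t\<^sup>2))"
      by (simp only: ennreal_mult[symmetric] C0 ennreal_leI[OF le])
  qed
  also have "\<dots> = ennreal C * (\<integral>\<^sup>+t. ennreal (1 / (1 + t\<^sup>2)) \<partial>lborel)" by (rule nn_integral_cmult) measurable
  also have "\<dots> < \<infinity>" using nn_integral_inverse_1_plus_square by (simp add: ennreal_mult_less_top)
  finally have fin: "(\<integral>\<^sup>+t. ennreal (?k t) \<partial>lborel) < \<infinity>" .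
  have pos: "(\<integral>\<^sup>+t. ennreal (?k t) \<partial>lborel) > 0"
    by (rule nn_integral_pos_if_pos) auto
  obtain c where "(\<integral>\<^sup>+t. ennreal (?k t) \<partial>lborel) = ennreal c" "c \<ge> 0"
    using fin by (cases "\<integral>\<^sup>+t. ennreal (?k t) \<partial>lborel" rule: ennreal_cases) auto
  moreover from pos have "c > 0" unfolding calculation(1) by simp
  ultimately show ?thesis using that[of c] by blast
qed

text \<open>The point is the reflection of the origin in the hyperplane g . x = s. The pair (g, s)
  has one dimension too many, since only g up to scaling is determined by p; the Gaussian weight
  makes the integral over this scale finite. The power d - 1 of s is the one for which the result
  does not depend on p.\<close>

lemma one_point_formula:
  obtains k :: real where "k > 0"
    "\<And>h :: real ^ 'd::finite \<Rightarrow> ennreal. h \<in> borel_measurable borel \<Longrightarrow>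
      (\<integral>\<^sup>+p. h p \<partial>lborel) = (\<integral>\<^sup>+g. \<integral>\<^sup>+s. ennreal (k * gauss g * pw (CARD('d) - 1) s) * h ((2 * s / (g \<bullet> g)) *\<^sub>R g) \<partial>lborel \<partial>lborel)"
proof -
  let ?d = "CARD('d)"
  let ?kap = "\<lambda>t::real. indicator {0<..} t * ((1 / (2 * t\<^sup>2)) * exp (- (1 / (2 * t\<^sup>2))) * (1 / (2 * t)) ^ (?d - 1) / t ^ ?d)"
  obtain c :: real where c: "c > 0" "(\<integral>\<^sup>+t. ennreal (?kap t) \<partial>lborel) = ennreal c"
    by (rule one_point_constant[of ?d])
  have I: "(\<integral>\<^sup>+g. \<integral>\<^sup>+s. ennreal (gauss g * pw (?d - 1) s) * h ((2 * s / (g \<bullet> g)) *\<^sub>R g) \<partial>lborel \<partial>lborel) = ennreal c * (\<integral>\<^sup>+p. h p \<partial>lborel)"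
    if [measurable]: "h \<in> borel_measurable borel" for h :: "real ^ 'd \<Rightarrow> ennreal"
  proof -
    let ?G = "\<lambda>r (p :: real ^ 'd). indicator {0<..} r * ((p \<bullet> p / (2 * r\<^sup>2)) * exp (- (p \<bullet> p / (2 * r\<^sup>2))) * (p \<bullet> p / (2 * r)) ^ (?d - 1))"
    have "(\<integral>\<^sup>+g. \<integral>\<^sup>+s. ennreal (gauss g * pw (?d - 1) s) * h ((2 * s / (g \<bullet> g)) *\<^sub>R g) \<partial>lborel \<partial>lborel)
        = (\<integral>\<^sup>+g. \<integral>\<^sup>+r. ennreal (?G r (r *\<^sub>R g)) * h (r *\<^sub>R g) \<partial>lborel \<partial>lborel)"
    proof (rule nn_integral_cong_AE, use AE_lborel_singleton[of 0] in eventually_elim)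
      case (elim g)
      \<comment> \<open>With s = q r the reflected point becomes simply r g, and q is the
        Jacobian.\<close>
      let ?q = "g \<bullet> g / 2"
      have q: "?q > 0" using elim by simp
      have "(\<integral>\<^sup>+s. ennreal (gauss g * pw (?d - 1) s) * h ((2 * s / (g \<bullet> g)) *\<^sub>R g) \<partial>lborel)
         = ennreal \<bar>?q\<bar> * (\<integral>\<^sup>+r. ennreal (gauss g * pw (?d - 1) (0 + ?q * r)) * h ((2 * (0 + ?q * r) / (g \<bullet> g)) *\<^sub>R g) \<partial>lborel)"
        using q by (intro nn_integral_real_affine) auto
      also have "\<dots> = (\<integral>\<^sup>+r. ennreal ?q * (ennreal (gauss g * pw (?d - 1) (?q * r)) * h (r *\<^sub>R g)) \<partial>lborel)"
        using q by (subst nn_integral_cmult) (auto simp: field_simps)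
      also have "\<dots> = (\<integral>\<^sup>+r. ennreal (?G r (r *\<^sub>R g)) * h (r *\<^sub>R g) \<partial>lborel)"
      proof (rule nn_integral_cong)
        fix r :: real
        have "?q * (gauss g * pw (?d - 1) (?q * r)) = ?G r (r *\<^sub>R g)"
        proof (cases "r > 0")
          case True
          have a: "(r *\<^sub>R g) \<bullet> (r *\<^sub>R g) / (2 * r\<^sup>2) = ?q" "(r *\<^sub>R g) \<bullet> (r *\<^sub>R g) / (2 * r) = ?q * r"
            using True by (simp_all add: power2_eq_square)
          have "pw (?d - 1) (?q * r) = (?q * r) ^ (?d - 1)" using q True by (simp add: pw_def)
          moreover have "gauss g = exp (- ?q)" by (simp add: gauss_def)
          ultimately show ?thesis using True by (simp only: a) simp
        next
          case False
          then have "?q * r \<le> 0" using q by (intro mult_nonneg_nonpos) auto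
          then have "\<not> ?q * r > 0" by linarith
          then have "pw (?d - 1) (?q * r) = 0" by (simp only: pw_def if_False)
          then show ?thesis using False by simp
        qed
        moreover have "gauss g * pw (?d - 1) (?q * r) \<ge> 0" by (simp add: pw_nonneg gauss_pos less_imp_le)
        ultimately have "ennreal ?q * ennreal (gauss g * pw (?d - 1) (?q * r)) = ennreal (?G r (r *\<^sub>R g))"
          using q by (simp only: ennreal_mult[symmetric] less_imp_le)
        then show "ennreal ?q * (ennreal (gauss g * pw (?d - 1) (?q * r)) * h (r *\<^sub>R g)) = ennreal (?G r (r *\<^sub>R g)) * h (r *\<^sub>R g)"
          by (simp only: mult.assoc[symmetric])
      qed
      finally show ?case .
    qed
    also have "\<dots> = (\<integral>\<^sup>+r. \<integral>\<^sup>+g. ennreal (?G r (r *\<^sub>R g)) * h (r *\<^sub>R g) \<partial>lborel \<partial>lborel)"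
      by (rule lborel_pair.Fubini') measurable
    also have "\<dots> = (\<integral>\<^sup>+r. \<integral>\<^sup>+p. ennreal (?G r p / r ^ ?d) * h p \<partial>lborel \<partial>lborel)"
    proof (rule nn_integral_cong)
      fix r :: real
      show "(\<integral>\<^sup>+g. ennreal (?G r (r *\<^sub>R g)) * h (r *\<^sub>R g) \<partial>lborel) = (\<integral>\<^sup>+p. ennreal (?G r p / r ^ ?d) * h p \<partial>lborel)"
      proof (cases "r > 0")
        case True
        have "(\<integral>\<^sup>+p. ennreal (?G r p / r ^ ?d) * h p \<partial>lborel) = ennreal (r ^ ?d) * (\<integral>\<^sup>+g. ennreal (?G r (r *\<^sub>R g) / r ^ ?d) * h (r *\<^sub>R g) \<partial>lborel)"
          by (rule nn_integral_scaleR[OF True]) measurable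
        also have "\<dots> = (\<integral>\<^sup>+g. ennreal (r ^ ?d) * (ennreal (?G r (r *\<^sub>R g) / r ^ ?d) * h (r *\<^sub>R g)) \<partial>lborel)"
          by (rule nn_integral_cmult[symmetric]) measurable
        also have "\<dots> = (\<integral>\<^sup>+g. ennreal (?G r (r *\<^sub>R g)) * h (r *\<^sub>R g) \<partial>lborel)"
        proof (rule nn_integral_cong)
          fix g :: "real ^ 'd"
          have "?G r (r *\<^sub>R g) \<ge> 0" using True by simp
          then have "ennreal (r ^ ?d) * ennreal (?G r (r *\<^sub>R g) / r ^ ?d) = ennreal (?G r (r *\<^sub>R g))"
            using True by (subst ennreal_mult[symmetric]) auto
          then show "ennreal (r ^ ?d) * (ennreal (?G r (r *\<^sub>R g) / r ^ ?d) * h (r *\<^sub>R g)) = ennreal (?G r (r *\<^sub>R g)) * h (r *\<^sub>R g)"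
            by (simp only: mult.assoc[symmetric])
        qed
        finally show ?thesis ..
      qed simp
    qed
    also have "\<dots> = (\<integral>\<^sup>+p. \<integral>\<^sup>+r. ennreal (?G r p / r ^ ?d) * h p \<partial>lborel \<partial>lborel)"
      by (rule lborel_pair.Fubini') measurable
    also have "\<dots> = (\<integral>\<^sup>+p. ennreal c * h p \<partial>lborel)"
    proof (rule nn_integral_cong_AE, use AE_lborel_singleton[of 0] in eventually_elim)
      case (elim p)
      have n: "norm p > 0" using elim by simp
      have "(\<integral>\<^sup>+r. ennreal (?G r p / r ^ ?d) * h p \<partial>lborel) = (\<integral>\<^sup>+r. ennreal (?G r p / r ^ ?d) \<partial>lborel) * h p"
        by (rule nn_integral_multc) measurable
      \<comment> \<open>Substituting r = \<open>norm p * t\<close>: all powers of the norm cancel,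
        and the constant integral in t remains.\<close>
      also have "(\<integral>\<^sup>+r. ennreal (?G r p / r ^ ?d) \<partial>lborel) = ennreal \<bar>norm p\<bar> * (\<integral>\<^sup>+t. ennreal (?G (0 + norm p * t) p / (0 + norm p * t) ^ ?d) \<partial>lborel)"
        using n by (intro nn_integral_real_affine) auto
      also have "\<dots> = (\<integral>\<^sup>+t. ennreal (norm p) * ennreal (?G (norm p * t) p / (norm p * t) ^ ?d) \<partial>lborel)"
        by (subst nn_integral_cmult) auto
      also have "\<dots> = (\<integral>\<^sup>+t. ennreal (?kap t) \<partial>lborel)"
      proof (rule nn_integral_cong)
        fix t :: real
        have "?G (norm p * t) p / (norm p * t) ^ ?d \<ge> 0" using n by (auto simp: indicator_def zero_less_mult_iff)
        moreover have "norm p * (?G (norm p * t) p / (norm p * t) ^ ?d) = ?kap t"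
        proof (cases "t > 0")
          case True
          have pp: "p \<bullet> p = norm p * norm p" by (simp add: power2_norm_eq_inner[symmetric] power2_eq_square)
          have "?d = Suc (?d - 1)" by simp
          then have P: "(norm p) ^ ?d = norm p * norm p ^ (?d - 1)" by (metis power_Suc)
          have "p \<bullet> p / (2 * (norm p * t)\<^sup>2) = 1 / (2 * t\<^sup>2)" "p \<bullet> p / (2 * (norm p * t)) = norm p * (1 / (2 * t))"
            using n True by (simp_all add: pp power2_eq_square field_simps)
          then show ?thesis using n True
            by (simp only: power_mult_distrib P) (simp add: zero_less_mult_iff power_mult_distrib power_divide)
        next
          case False
          then show ?thesis using n by (simp add: zero_less_mult_iff)
        qed
        ultimately show "ennreal (norm p) * ennreal (?G (norm p * t) p / (norm p * t) ^ ?d) = ennreal (?kap t)"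
          using n by (simp only: ennreal_mult[symmetric] norm_ge_zero)
      qed
      finally show ?case by (simp only: c(2))
    qed
    also have "\<dots> = ennreal c * (\<integral>\<^sup>+p. h p \<partial>lborel)" by (rule nn_integral_cmult) measurable
    finally show ?thesis .
  qed
  show ?thesis
  proof (rule that[of "1 / c"])
    show "1 / c > 0" using c(1) by simp
    fix h :: "real ^ 'd \<Rightarrow> ennreal" assume [measurable]: "h \<in> borel_measurable borel"
    have "(\<integral>\<^sup>+g. \<integral>\<^sup>+s. ennreal (1 / c * gauss g * pw (?d - 1) s) * h ((2 * s / (g \<bullet> g)) *\<^sub>R g) \<partial>lborel \<partial>lborel)
       = (\<integral>\<^sup>+g. \<integral>\<^sup>+s. ennreal (1 / c) * (ennreal (gauss g * pw (?d - 1) s) * h ((2 * s / (g \<bullet> g)) *\<^sub>R g)) \<partial>lborel \<partial>lborel)"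
      using c(1) by (intro nn_integral_cong)
        (simp add: ennreal_mult[symmetric] mult.assoc[symmetric] pw_nonneg gauss_pos less_imp_le)
    also have "\<dots> = ennreal (1 / c) * (\<integral>\<^sup>+g. \<integral>\<^sup>+s. ennreal (gauss g * pw (?d - 1) s) * h ((2 * s / (g \<bullet> g)) *\<^sub>R g) \<partial>lborel \<partial>lborel)"
      by (simp add: nn_integral_cmult)
    also have "\<dots> = ennreal (1 / c) * (ennreal c * (\<integral>\<^sup>+p. h p \<partial>lborel))" by (simp only: I[OF \<open>h \<in> borel_measurable borel\<close>])
    also have "\<dots> = (\<integral>\<^sup>+p. h p \<partial>lborel)"
      using c(1) by (simp add: mult.assoc[symmetric] ennreal_mult[symmetric])
    finally show "(\<integral>\<^sup>+p. h p \<partial>lborel) = (\<integral>\<^sup>+g. \<integral>\<^sup>+s. ennreal (1 / c * gauss g * pw (?d - 1) s) * h ((2 * s / (g \<bullet> g)) *\<^sub>R g) \<partial>lborel \<partial>lborel)" ..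
  qed
qed

text \<open>Row \<open>i\<close> of \<open>tau G s\<close> is the point whose bisector with the origin is the hyperplane
  \<open>G $ i \<bullet> x = s $ i\<close>, so that \<open>ctr (tau G (G *v x)) = x\<close>.\<close>

definition tau :: "real ^ 'd ^ 'd \<Rightarrow> real ^ 'd \<Rightarrow> real ^ 'd::finite ^ 'd" where
  "tau G s = (\<chi> i. (2 * s $ i / (G $ i \<bullet> G $ i)) *\<^sub>R G $ i)"

lemma tau_measurable [measurable (raw)]:
  assumes [measurable]: "f \<in> borel_measurable M" "g \<in> borel_measurable M"
  shows "(\<lambda>x. tau (f x) (g x)) \<in> borel_measurable M"
  unfolding tau_def by measurable

lemma gauss_measurable' [measurable (raw)]:
  fixes f :: "'z \<Rightarrow> 'a::euclidean_space"
  shows "f \<in> borel_measurable M \<Longrightarrow> (\<lambda>x. gauss (f x)) \<in> borel_measurable M"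
  by (rule measurable_compose[OF _ gauss_measurable])

text \<open>The single-point formula in each row; the weights and the box indicators are products
  over rows, so the criterion by boxes applies.\<close>

lemma tuple_formula:
  obtains k :: real where "k > 0"
    "\<And>H :: real ^ 'd::finite ^ 'd \<Rightarrow> ennreal. H \<in> borel_measurable borel \<Longrightarrow>
      (\<integral>\<^sup>+P. H P \<partial>lborel) = (\<integral>\<^sup>+G. \<integral>\<^sup>+s. ennreal (k * gauss G * (\<Prod>i\<in>UNIV. pw (CARD('d) - 1) (s $ i))) * H (tau G s) \<partial>lborel \<partial>lborel)"
proof -
  let ?pw = "pw (CARD('d) - 1)"
  obtain k :: real where k: "k > 0" and opf: "\<And>h :: real ^ 'd \<Rightarrow> ennreal. h \<in> borel_measurable borel \<Longrightarrow>
      (\<integral>\<^sup>+p. h p \<partial>lborel) = (\<integral>\<^sup>+g. \<integral>\<^sup>+s. ennreal (k * gauss g * ?pw s) * h ((2 * s / (g \<bullet> g)) *\<^sub>R g) \<partial>lborel \<partial>lborel)"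
    using one_point_formula by blast
  show ?thesis
  proof (rule that[of "k ^ CARD('d)"])
    show "k ^ CARD('d) > 0" using k by simp
    fix H :: "real ^ 'd ^ 'd \<Rightarrow> ennreal" assume H[measurable]: "H \<in> borel_measurable borel"
    let ?w = "\<lambda>(G :: real ^ 'd ^ 'd) (s :: real ^ 'd). ennreal (k ^ CARD('d) * gauss G * (\<Prod>i\<in>UNIV. ?pw (s $ i)))"
    have w: "?w G s = (\<Prod>i\<in>UNIV. ennreal (k * gauss (G $ i) * ?pw (s $ i)))" for G s
    proof -
      have "k ^ CARD('d) * gauss G * (\<Prod>i\<in>UNIV. ?pw (s $ i)) = (\<Prod>i\<in>UNIV. k * gauss (G $ i) * ?pw (s $ i))"
        by (simp add: prod.distrib gauss_vec[of G])
      then show ?thesis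
        by (simp only:) (rule prod_ennreal[symmetric], use k in \<open>simp add: pw_nonneg gauss_pos less_imp_le\<close>)
    qed
    have "(\<integral>\<^sup>+P. H P \<partial>lborel) = (\<integral>\<^sup>+z. ?w (fst z) (snd z) * H (tau (fst z) (snd z)) \<partial>(lborel \<Otimes>\<^sub>M lborel))"
    proof (rule nn_integral_vec_transfer)
      fix l u :: "'d \<Rightarrow> real ^ 'd"
      let ?f = "\<lambda>i g s. ennreal (k * gauss g * ?pw s) * indicator (box (l i) (u i)) ((2 * s / (g \<bullet> g)) *\<^sub>R g)"
      have fm[measurable]: "(\<lambda>z. ?f i (fst z) (snd z)) \<in> borel_measurable (borel \<Otimes>\<^sub>M borel)" for i
        by measurable
      have fm1[measurable]: "(\<lambda>s. ?f i g s) \<in> borel_measurable borel" for i g by measurable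
      have fm2[measurable]: "(\<lambda>g. \<integral>\<^sup>+s. ?f i g s \<partial>lborel) \<in> borel_measurable borel" for i
        by measurable
      have "(\<integral>\<^sup>+z. ?w (fst z) (snd z) * (\<Prod>i\<in>UNIV. indicator (box (l i) (u i)) (tau (fst z) (snd z) $ i)) \<partial>(lborel \<Otimes>\<^sub>M lborel))
        = (\<integral>\<^sup>+G. \<integral>\<^sup>+s. ?w G s * (\<Prod>i\<in>UNIV. indicator (box (l i) (u i)) (tau G s $ i)) \<partial>lborel \<partial>lborel)"
        by (subst lborel.nn_integral_fst[symmetric]) ((measurable)[1], simp)
      also have "\<dots> = (\<integral>\<^sup>+G. \<integral>\<^sup>+s. (\<Prod>i\<in>UNIV. ?f i (G $ i) (s $ i)) \<partial>lborel \<partial>lborel)"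
        unfolding w by (intro nn_integral_cong) (simp add: prod.distrib tau_def)
      also have "\<dots> = (\<integral>\<^sup>+G. (\<Prod>i\<in>UNIV. \<integral>\<^sup>+s. ?f i (G $ i) s \<partial>lborel) \<partial>lborel)"
        by (rule nn_integral_cong, rule nn_integral_vec_prod) (rule fm1)
      also have "\<dots> = (\<Prod>i\<in>UNIV. \<integral>\<^sup>+g. \<integral>\<^sup>+s. ?f i g s \<partial>lborel \<partial>lborel)"
        by (rule nn_integral_vec_prod) (rule fm2)
      also have "\<dots> = (\<Prod>i\<in>UNIV. emeasure lborel (box (l i) (u i)))"
        by (intro prod.cong refl, subst opf[symmetric]) auto
      finally show "(\<integral>\<^sup>+z. ?w (fst z) (snd z) * (\<Prod>i\<in>UNIV. indicator (box (l i) (u i)) (tau (fst z) (snd z) $ i)) \<partial>(lborel \<Otimes>\<^sub>M lborel))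
        = (\<Prod>i\<in>UNIV. emeasure lborel (box (l i) (u i)))" .
    qed measurable
    also have "\<dots> = (\<integral>\<^sup>+G. \<integral>\<^sup>+s. ?w G s * H (tau G s) \<partial>lborel \<partial>lborel)"
      by (subst lborel.nn_integral_fst[symmetric]) ((measurable)[1], simp)
    finally show "(\<integral>\<^sup>+P. H P \<partial>lborel) = (\<integral>\<^sup>+G. \<integral>\<^sup>+s. ?w G s * H (tau G s) \<partial>lborel \<partial>lborel)" .
  qed
qed

lemma matrix_vector_transpose: "transpose G *v a = (\<Sum>i\<in>UNIV. a $ i *\<^sub>R (G :: real ^ 'n::finite ^ 'n) $ i)"
  by (simp add: vec_eq_iff matrix_vector_mult_def transpose_def mult.commute)

lemma det_tau: "det (tau G s) = (\<Prod>i\<in>UNIV. 2 * s $ i / (G $ i \<bullet> G $ i)) * det (G :: real ^ 'n::finite ^ 'n)"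
proof -
  have "tau G s = (\<chi> i. (2 * s $ i / (G $ i \<bullet> G $ i)) *s G $ i)" by (simp add: tau_def vec_eq_iff)
  then show ?thesis by (simp only: det_rows_mul) (simp add: vec_lambda_eta)
qed

lemma det_nz_row: "det (G :: real ^ 'n::finite ^ 'n) \<noteq> 0 \<Longrightarrow> G $ i \<noteq> 0"
  using det_zero_row(1)[of i G] by (auto simp: row_def vec_lambda_eta)

text \<open>With offsets \<open>G *v x\<close> all d bisectors pass through x, which is therefore
  the centre. The rows of \<open>tau\<close> are positive multiples of the rows of G, so the
  coefficients of \<open>transpose G *v a\<close> have the signs of a.\<close>

lemma tau_in_pos_tuples:
  fixes G :: "real ^ 'd::finite ^ 'd"
  assumes G: "det G \<noteq> 0" and pos: "\<And>i. (G *v x) $ i > 0"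
  shows "ctr (tau G (G *v x)) = x"
    "tau G (G *v x) \<in> pos_tuples (transpose G *v a) J \<longleftrightarrow> (\<forall>i\<in>J. a $ i > 0)"
proof -
  let ?P = "tau G (G *v x)"
  define r where "r i = 2 * (G *v x) $ i / (G $ i \<bullet> G $ i)" for i
  have g: "G $ i \<bullet> G $ i > 0" for i using det_nz_row[OF G, of i] by simp
  have r: "r i > 0" for i using pos[of i] g[of i] by (simp add: r_def)
  have P: "?P $ i = r i *\<^sub>R G $ i" for i by (simp add: tau_def r_def)
  have "(\<Prod>i\<in>UNIV. r i) > 0" using r by (intro prod_pos) auto
  then have "(\<Prod>i\<in>UNIV. r i) * det G \<noteq> 0" using G by (intro no_zero_divisors) linarith+
  then have d: "det ?P \<noteq> 0" by (simp only: det_tau r_def not_False_eq_True)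
  have "?P *v x = half_sq ?P"
  proof -
    have "r i * (G $ i \<bullet> x) = r i * r i * (G $ i \<bullet> G $ i) / 2" for i
      using g[of i] by (simp add: r_def matrix_vector_mult_nth)
    then have "?P $ i \<bullet> x = (norm (?P $ i))\<^sup>2 / 2" for i
      by (simp only: P power2_norm_eq_inner inner_scaleR_left inner_scaleR_right mult.assoc)
    then show ?thesis by (simp add: vec_eq_iff matrix_vector_mult_nth half_sq_def)
  qed
  then show "ctr ?P = x" using ctr_iff[OF d, of x] by simp
  have "transpose G *v a = (\<Sum>i\<in>UNIV. (a $ i / r i) *\<^sub>R ?P $ i)"
    unfolding matrix_vector_transpose using r by (intro sum.cong refl) (simp add: P less_imp_neq[symmetric])
  from coef_eqI[OF d this] have "coef (transpose G *v a) ?P i = a $ i / r i" for i .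
  then show "?P \<in> pos_tuples (transpose G *v a) J \<longleftrightarrow> (\<forall>i\<in>J. a $ i > 0)"
    using d r by (simp add: pos_tuples_def zero_less_divide_iff) (metis less_asym)
qed

text \<open>The square of the determinant collects the Jacobians of the two substitutions s = G x
  and u = G^T a.\<close>

definition Vker :: "real ^ 'd \<Rightarrow> real ^ 'd \<Rightarrow> real ^ 'd::finite ^ 'd \<Rightarrow> real" where
  "Vker x a G = (det G)\<^sup>2 * gauss G * gauss (transpose G *v a) * (\<Prod>i\<in>UNIV. pw (CARD('d) - 1) ((G *v x) $ i))"

lemma pw_measurable' [measurable (raw)]: "f \<in> borel_measurable M \<Longrightarrow> (\<lambda>x. pw n (f x)) \<in> borel_measurable M"
  by (rule measurable_compose[OF _ pw_measurable])

lemma transpose_measurable [measurable (raw)]: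
  fixes f :: "'z \<Rightarrow> real ^ 'm::finite ^ 'n::finite"
  assumes [measurable]: "f \<in> borel_measurable M"
  shows "(\<lambda>x. transpose (f x)) \<in> borel_measurable M"
  unfolding transpose_def by measurable

lemma Vker_measurable [measurable (raw)]:
  assumes [measurable]: "f \<in> borel_measurable M" "g \<in> borel_measurable M" "h \<in> borel_measurable M"
  shows "(\<lambda>x. Vker (f x) (g x) (h x)) \<in> borel_measurable M"
  unfolding Vker_def by measurable

lemma Vker_nonneg: "Vker x a G \<ge> 0"
  unfolding Vker_def by (intro mult_nonneg_nonneg prod_nonneg) (auto simp: gauss_pos less_imp_le pw_nonneg)

lemma pos_tuples_pred [measurable]: "Measurable.pred (borel \<Otimes>\<^sub>M borel) (\<lambda>z. snd z \<in> pos_tuples (fst z) J)"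
  unfolding pos_tuples_def mem_Collect_eq by measurable

text \<open>In the coordinates (x, a, G) the weight W depends on x alone and the condition on J on a
  alone. Singular G contribute nothing on either side, so the substitutions are made for invertible
  G only.\<close>

lemma direction_tuple_formula:
  obtains k :: real where "k > 0"
    "\<And>(W :: real ^ 'd::finite \<Rightarrow> ennreal) J. W \<in> borel_measurable borel \<Longrightarrow>
      (\<integral>\<^sup>+u. ennreal (gauss u) * (\<integral>\<^sup>+P. indicator (pos_tuples u J) P * W (ctr P) \<partial>lborel) \<partial>lborel)
      = ennreal k * (\<integral>\<^sup>+x. W x * (\<integral>\<^sup>+a. indicator {a. \<forall>i\<in>J. a $ i > 0} a * (\<integral>\<^sup>+G. ennreal (Vker x a G) \<partial>lborel) \<partial>lborel) \<partial>lborel)"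
proof -
  let ?pw = "pw (CARD('d) - 1)"
  obtain k :: real where k: "k > 0" and tf: "\<And>H :: real ^ 'd ^ 'd \<Rightarrow> ennreal. H \<in> borel_measurable borel \<Longrightarrow>
      (\<integral>\<^sup>+P. H P \<partial>lborel) = (\<integral>\<^sup>+G. \<integral>\<^sup>+s. ennreal (k * gauss G * (\<Prod>i\<in>UNIV. ?pw (s $ i))) * H (tau G s) \<partial>lborel \<partial>lborel)"
    using tuple_formula by blast
  show ?thesis
  proof (rule that[OF k])
    fix W :: "real ^ 'd \<Rightarrow> ennreal" and J :: "'d set"
    assume W[measurable]: "W \<in> borel_measurable borel"
    define w where "w G s = ennreal (k * gauss G * (\<Prod>i\<in>UNIV. ?pw (s $ i)))" for G :: "real ^ 'd ^ 'd" and s :: "real ^ 'd"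
    define H where "H u P = (if P \<in> pos_tuples u J then W (ctr P) else 0)" for u P
    define A where "A = {a :: real ^ 'd. \<forall>i\<in>J. a $ i > 0}"
    have [measurable]: "(\<lambda>x. w (f x) (g x)) \<in> borel_measurable M" if "f \<in> borel_measurable M" "g \<in> borel_measurable M" for f g and M :: "'z measure"
      using that unfolding w_def by measurable
    have [measurable]: "(\<lambda>x. W (ctr (f x))) \<in> borel_measurable M" if [measurable]: "f \<in> borel_measurable M" for f and M :: "'z measure"
      by (rule measurable_compose[OF that measurable_compose[OF ctr_measurable W]])
    have Hm: "(\<lambda>z. H (fst z) (snd z)) \<in> borel_measurable (borel \<Otimes>\<^sub>M borel)"
      unfolding H_def using measurable_compose[OF measurable_snd measurable_compose[OF ctr_measurable W]] by measurable
    have [measurable]: "(\<lambda>x. H (f x) (g x)) \<in> borel_measurable M" if [measurable]: "f \<in> borel_measurable M" "g \<in> borel_measurable M" for f g and M :: "'z measure"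
      using measurable_compose[of "\<lambda>x. (f x, g x)" M "borel \<Otimes>\<^sub>M borel", OF _ Hm] by simp
    have [measurable]: "A \<in> sets borel" unfolding A_def by measurable
    have "(\<integral>\<^sup>+u. ennreal (gauss u) * (\<integral>\<^sup>+P. indicator (pos_tuples u J) P * W (ctr P) \<partial>lborel) \<partial>lborel)
        = (\<integral>\<^sup>+u. ennreal (gauss u) * (\<integral>\<^sup>+P. H u P \<partial>lborel) \<partial>lborel)"
      by (intro nn_integral_cong arg_cong2[where f="(*)"] refl) (auto simp: H_def indicator_def)
    also have "\<dots> = (\<integral>\<^sup>+u. \<integral>\<^sup>+G. \<integral>\<^sup>+s. ennreal (gauss u) * (w G s * H u (tau G s)) \<partial>lborel \<partial>lborel \<partial>lborel)"
    proof (rule nn_integral_cong)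
      fix u :: "real ^ 'd"
      have "(\<integral>\<^sup>+P. H u P \<partial>lborel) = (\<integral>\<^sup>+G. \<integral>\<^sup>+s. w G s * H u (tau G s) \<partial>lborel \<partial>lborel)"
        unfolding w_def by (rule tf) measurable
      also have "ennreal (gauss u) * \<dots> = (\<integral>\<^sup>+G. ennreal (gauss u) * (\<integral>\<^sup>+s. w G s * H u (tau G s) \<partial>lborel) \<partial>lborel)"
        by (rule nn_integral_cmult[symmetric]) measurable
      also have "\<dots> = (\<integral>\<^sup>+G. \<integral>\<^sup>+s. ennreal (gauss u) * (w G s * H u (tau G s)) \<partial>lborel \<partial>lborel)"
        by (intro nn_integral_cong nn_integral_cmult[symmetric]) measurable
      finally show "ennreal (gauss u) * (\<integral>\<^sup>+P. H u P \<partial>lborel) = (\<integral>\<^sup>+G. \<integral>\<^sup>+s. ennreal (gauss u) * (w G s * H u (tau G s)) \<partial>lborel \<partial>lborel)" .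
    qed
    also have "\<dots> = (\<integral>\<^sup>+G. \<integral>\<^sup>+u. \<integral>\<^sup>+s. ennreal (gauss u) * (w G s * H u (tau G s)) \<partial>lborel \<partial>lborel \<partial>lborel)"
      by (rule lborel_pair.Fubini') measurable
    also have "\<dots> = (\<integral>\<^sup>+G. \<integral>\<^sup>+s. \<integral>\<^sup>+u. ennreal (gauss u) * (w G s * H u (tau G s)) \<partial>lborel \<partial>lborel \<partial>lborel)"
      by (rule nn_integral_cong, rule lborel_pair.Fubini') measurable
    also have "\<dots> = (\<integral>\<^sup>+G. \<integral>\<^sup>+x. \<integral>\<^sup>+a. ennreal k * (W x * (indicator A a * ennreal (Vker x a G))) \<partial>lborel \<partial>lborel \<partial>lborel)"
    proof (rule nn_integral_cong)
      fix G :: "real ^ 'd ^ 'd"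
      let ?F = "\<lambda>s u. ennreal (gauss u) * (w G s * H u (tau G s))"
      show "(\<integral>\<^sup>+s. \<integral>\<^sup>+u. ?F s u \<partial>lborel \<partial>lborel)
          = (\<integral>\<^sup>+x. \<integral>\<^sup>+a. ennreal k * (W x * (indicator A a * ennreal (Vker x a G))) \<partial>lborel \<partial>lborel)"
      proof (cases "det G = 0")
        case True
        then have "H u (tau G s) = 0" for u s by (simp add: H_def pos_tuples_def det_tau)
        moreover have "Vker x a G = 0" for x a using True by (simp add: Vker_def)
        ultimately show ?thesis by simp
      next
        case False
        let ?D = "ennreal \<bar>det G\<bar>"
        have T: "det (transpose G) \<noteq> 0" "\<bar>det (transpose G)\<bar> = \<bar>det G\<bar>" using False by (simp_all add: det_transpose)
        have "(\<integral>\<^sup>+s. \<integral>\<^sup>+u. ?F s u \<partial>lborel \<partial>lborel) = ?D * (\<integral>\<^sup>+x. \<integral>\<^sup>+u. ?F (G *v x) u \<partial>lborel \<partial>lborel)"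
          by (rule nn_integral_linear[OF False]) measurable
        also have "\<dots> = ?D * (\<integral>\<^sup>+x. ?D * (\<integral>\<^sup>+a. ?F (G *v x) (transpose G *v a) \<partial>lborel) \<partial>lborel)"
          by (subst nn_integral_linear[OF T(1), unfolded T(2)]) ((measurable)[1], rule refl)
        also have "\<dots> = ?D * (\<integral>\<^sup>+x. \<integral>\<^sup>+a. ?D * ?F (G *v x) (transpose G *v a) \<partial>lborel \<partial>lborel)"
          by (subst nn_integral_cmult) ((measurable)[1], rule refl)
        also have "\<dots> = (\<integral>\<^sup>+x. ?D * (\<integral>\<^sup>+a. ?D * ?F (G *v x) (transpose G *v a) \<partial>lborel) \<partial>lborel)"
          by (rule nn_integral_cmult[symmetric]) measurable
        also have "\<dots> = (\<integral>\<^sup>+x. \<integral>\<^sup>+a. ?D * (?D * ?F (G *v x) (transpose G *v a)) \<partial>lborel \<partial>lborel)"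
          by (intro nn_integral_cong nn_integral_cmult[symmetric]) measurable
        also have "\<dots> = (\<integral>\<^sup>+x. \<integral>\<^sup>+a. ennreal k * (W x * (indicator A a * ennreal (Vker x a G))) \<partial>lborel \<partial>lborel)"
        proof (intro nn_integral_cong)
          fix x a :: "real ^ 'd"
          show "?D * (?D * ?F (G *v x) (transpose G *v a)) = ennreal k * (W x * (indicator A a * ennreal (Vker x a G)))"
          proof (cases "\<forall>i. (G *v x) $ i > 0")
            case True
            have "H (transpose G *v a) (tau G (G *v x)) = indicator A a * W x"
              using tau_in_pos_tuples(1)[OF False, of x] tau_in_pos_tuples(2)[OF False, of x a J] True
              by (simp add: H_def A_def indicator_def)
            moreover have "?D * (?D * (ennreal (gauss (transpose G *v a)) * w G (G *v x))) = ennreal k * ennreal (Vker x a G)"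
            proof -
              have "\<bar>det G\<bar> * (\<bar>det G\<bar> * (gauss (transpose G *v a) * (k * gauss G * (\<Prod>i\<in>UNIV. ?pw ((G *v x) $ i))))) = k * Vker x a G"
                by (simp add: Vker_def power2_eq_square abs_mult_self_eq mult.assoc[symmetric])
              moreover have "k * gauss G * (\<Prod>i\<in>UNIV. ?pw ((G *v x) $ i)) \<ge> 0"
                using k by (intro mult_nonneg_nonneg prod_nonneg) (auto simp: gauss_pos less_imp_le pw_nonneg)
              ultimately show ?thesis
                unfolding w_def using k Vker_nonneg[of x a G] less_imp_le[OF gauss_pos[of "transpose G *v a"]]
                by (simp only: ennreal_mult[symmetric] abs_ge_zero mult_nonneg_nonneg less_imp_le)
            qed
            ultimately show ?thesis by (simp only: mult_ac)
          next
            \<comment> \<open>A nonpositive offset makes one factor \<open>pw\<close> vanish, hence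
              both sides.\<close>
            case F: False
            then obtain i where "\<not> (G *v x) $ i > 0" by blast
            then have "?pw ((G *v x) $ i) = 0" by (simp add: pw_def)
            then have z: "(\<Prod>i\<in>UNIV. ?pw ((G *v x) $ i)) = 0" by (intro prod_zero) auto
            show ?thesis by (simp only: w_def Vker_def z mult_zero_right mult_zero_left ennreal_0)
          qed
        qed
        finally show ?thesis .
      qed
    qed
    also have "\<dots> = (\<integral>\<^sup>+x. \<integral>\<^sup>+G. \<integral>\<^sup>+a. ennreal k * (W x * (indicator A a * ennreal (Vker x a G))) \<partial>lborel \<partial>lborel \<partial>lborel)"
      by (rule lborel_pair.Fubini') measurable
    also have "\<dots> = (\<integral>\<^sup>+x. \<integral>\<^sup>+a. \<integral>\<^sup>+G. ennreal k * (W x * (indicator A a * ennreal (Vker x a G))) \<partial>lborel \<partial>lborel \<partial>lborel)"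
      by (rule nn_integral_cong, rule lborel_pair.Fubini') measurable
    also have "\<dots> = ennreal k * (\<integral>\<^sup>+x. W x * (\<integral>\<^sup>+a. indicator A a * (\<integral>\<^sup>+G. ennreal (Vker x a G) \<partial>lborel) \<partial>lborel) \<partial>lborel)"
      by (simp add: nn_integral_cmult)
    finally show "(\<integral>\<^sup>+u. ennreal (gauss u) * (\<integral>\<^sup>+P. indicator (pos_tuples u J) P * W (ctr P) \<partial>lborel) \<partial>lborel)
      = ennreal k * (\<integral>\<^sup>+x. W x * (\<integral>\<^sup>+a. indicator {a. \<forall>i\<in>J. a $ i > 0} a * (\<integral>\<^sup>+G. ennreal (Vker x a G) \<partial>lborel) \<partial>lborel) \<partial>lborel)"
      unfolding A_def .
  qed
qed

section \<open>Elimination of G by rotations and a shrinking map\<close>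

lemma matrix_rows_map:
  fixes f :: "real ^ 'n::finite \<Rightarrow> real ^ 'n"
  assumes "linear f"
  shows "(\<chi> i. f (G $ i)) = G ** transpose (matrix f)"
proof -
  have "f (G $ i) $ j = (G ** transpose (matrix f)) $ i $ j" for i j
  proof -
    have "f (G $ i) = matrix f *v (G $ i)" using assms by (simp add: matrix_works)
    then show ?thesis by (simp add: matrix_matrix_mult_def matrix_vector_mult_def transpose_def mult.commute)
  qed
  then show ?thesis by (simp add: vec_eq_iff)
qed

lemma det_rows_map:
  fixes f :: "real ^ 'n::finite \<Rightarrow> real ^ 'n"
  assumes "linear f"
  shows "det (\<chi> i. f (G $ i)) = det G * det (matrix f)"
  by (simp add: matrix_rows_map[OF assms] det_mul det_transpose)

lemma linear_borel_measurable:
  fixes f :: "real ^ 'n::finite \<Rightarrow> real ^ 'n"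
  shows "linear f \<Longrightarrow> f \<in> borel_measurable borel"
  by (intro borel_measurable_continuous_onI linear_continuous_on linear_conv_bounded_linear[THEN iffD1])

lemma nn_integral_rows_map:
  fixes f :: "real ^ 'n::finite \<Rightarrow> real ^ 'n" and F :: "real ^ 'n ^ 'n \<Rightarrow> ennreal"
  assumes f: "linear f" and d: "det (matrix f) \<noteq> 0" and [measurable]: "F \<in> borel_measurable borel"
  shows "(\<integral>\<^sup>+G. F G \<partial>lborel) = ennreal (\<bar>det (matrix f)\<bar> ^ CARD('n)) * (\<integral>\<^sup>+G. F (\<chi> i. f (G $ i)) \<partial>lborel)"
proof -
  have "(\<integral>\<^sup>+G. F G \<partial>lborel) = (\<Prod>i\<in>(UNIV :: 'n set). ennreal \<bar>det (matrix f)\<bar>) * (\<integral>\<^sup>+G. F (\<chi> i. f (G $ i)) \<partial>lborel)"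
  proof (rule nn_integral_vec_map)
    show "f \<in> borel_measurable borel" by (rule linear_borel_measurable[OF f])
    fix A :: "(real ^ 'n) set" assume A: "A \<in> sets borel"
    have "emeasure lborel A = (\<integral>\<^sup>+y. indicator A y \<partial>lborel)" using A by simp
    also have "\<dots> = ennreal \<bar>det (matrix f)\<bar> * (\<integral>\<^sup>+y. indicator A (matrix f *v y) \<partial>lborel)"
      by (rule nn_integral_linear[OF d]) (use A in auto)
    finally show "ennreal \<bar>det (matrix f)\<bar> * (\<integral>\<^sup>+y. indicator A (f y) \<partial>lborel) = emeasure lborel A"
      using f by (simp add: matrix_works)
  qed measurable
  then show ?thesis by (simp add: ennreal_power)
qed

lemma orthogonal_to_axis:
  fixes x :: "real ^ 'n::finite" and k :: 'n
  obtains f :: "real ^ 'n \<Rightarrow> real ^ 'n" where "orthogonal_transformation f" "x = norm x *\<^sub>R f (axis k 1)"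
proof -
  have "norm (axis k (norm x) :: real ^ 'n) = norm x" by (simp add: norm_eq_sqrt_inner inner_axis_axis)
  then obtain f where f: "orthogonal_transformation f" "f (axis k (norm x)) = x"
    by (rule orthogonal_transformation_exists)
  have "axis k (norm x) = norm x *\<^sub>R (axis k 1 :: real ^ 'n)" by (simp add: axis_def vec_eq_iff)
  then have "x = norm x *\<^sub>R f (axis k 1)"
    using f orthogonal_transformation_linear[OF f(1)] by (simp add: linear_scale)
  then show ?thesis using that f(1) by blast
qed

lemma orthogonal_det:
  fixes f :: "real ^ 'n::finite \<Rightarrow> real ^ 'n"
  assumes "orthogonal_transformation f"
  shows "linear f" "det (matrix f) \<noteq> 0" "\<bar>det (matrix f)\<bar> = 1" "(det (matrix f))\<^sup>2 = 1" "f v \<bullet> f w = v \<bullet> w"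
proof -
  show "linear f" "f v \<bullet> f w = v \<bullet> w" using assms by (auto simp: orthogonal_transformation_def)
  have "orthogonal_matrix (matrix f)" using assms by (simp add: orthogonal_transformation_matrix)
  then have "det (matrix f) = 1 \<or> det (matrix f) = -1" by (rule det_orthogonal_matrix)
  then show "det (matrix f) \<noteq> 0" "\<bar>det (matrix f)\<bar> = 1" "(det (matrix f))\<^sup>2 = 1" by auto
qed

lemma gauss_rows_map:
  fixes f :: "real ^ 'n::finite \<Rightarrow> real ^ 'n"
  assumes "orthogonal_transformation f"
  shows "gauss (\<chi> i. f (G $ i)) = gauss G"
  by (simp add: gauss_def inner_vec_def[where 'a="real ^ 'n"] orthogonal_det(5)[OF assms])

text \<open>Rotating all rows of G at once preserves the Gaussian weights and the squared
  determinant, so x may be turned onto an axis. The norm of x comes out of d factors that are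
  homogeneous of degree d - 1, which decouples x from a.\<close>

lemma nn_integral_Vker_axis:
  fixes x a :: "real ^ 'd::finite"
  assumes x: "x \<noteq> 0"
  shows "(\<integral>\<^sup>+G. ennreal (Vker x a G) \<partial>lborel)
    = ennreal (norm x ^ (CARD('d) * (CARD('d) - 1))) * (\<integral>\<^sup>+G. ennreal (Vker (axis k 1) a G) \<partial>lborel)"
proof -
  let ?d = "CARD('d)"
  obtain f :: "real ^ 'd \<Rightarrow> real ^ 'd" where f: "orthogonal_transformation f" and xf: "x = norm x *\<^sub>R f (axis k 1)"
    using orthogonal_to_axis[of x k] by blast
  note oo = orthogonal_det[OF f]
  have n: "norm x > 0" using x by simp
  have V: "Vker x a (\<chi> i. f (G $ i)) = norm x ^ (?d * (?d - 1)) * Vker (axis k 1) a G" for G :: "real ^ 'd ^ 'd"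
  proof -
    let ?G = "\<chi> i. f (G $ i)"
    have "(det ?G)\<^sup>2 = (det G)\<^sup>2" by (simp add: det_rows_map[OF oo(1)] power_mult_distrib oo(4))
    moreover have "gauss (transpose ?G *v a) = gauss (transpose G *v a)"
    proof -
      have "transpose ?G *v a = f (transpose G *v a)"
        using oo(1) by (simp add: matrix_vector_transpose linear_sum linear_scale del: transpose_matrix_vector)
      then show ?thesis by (simp add: gauss_def oo(5) del: transpose_matrix_vector)
    qed
    moreover have "(\<Prod>i\<in>UNIV. pw (?d - 1) ((?G *v x) $ i)) = norm x ^ (?d * (?d - 1)) * (\<Prod>i\<in>UNIV. pw (?d - 1) ((G *v axis k 1) $ i))"
    proof -
      have "(?G *v x) $ i = norm x * ((G *v axis k 1) $ i)" for i
        by (subst xf) (simp add: matrix_vector_mult_nth oo(5))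
      then have "(\<Prod>i\<in>UNIV. pw (?d - 1) ((?G *v x) $ i)) = (\<Prod>i\<in>(UNIV :: 'd set). norm x ^ (?d - 1) * pw (?d - 1) ((G *v axis k 1) $ i))"
        using n by (simp only: pw_mult)
      then show ?thesis by (simp only: prod.distrib prod_constant power_mult[symmetric] mult.commute)
    qed
    ultimately show ?thesis by (simp only: Vker_def gauss_rows_map[OF f]) (simp only: mult_ac)
  qed
  have "(\<integral>\<^sup>+G. ennreal (Vker x a G) \<partial>lborel) = (\<integral>\<^sup>+G. ennreal (Vker x a (\<chi> i. f (G $ i))) \<partial>lborel)"
    using nn_integral_rows_map[OF oo(1,2), of "\<lambda>G. ennreal (Vker x a G)"] by (simp add: oo(3))
  also have "\<dots> = (\<integral>\<^sup>+G. ennreal (norm x ^ (?d * (?d - 1))) * ennreal (Vker (axis k 1) a G) \<partial>lborel)"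
    unfolding V by (simp add: ennreal_mult Vker_nonneg)
  also have "\<dots> = ennreal (norm x ^ (?d * (?d - 1))) * (\<integral>\<^sup>+G. ennreal (Vker (axis k 1) a G) \<partial>lborel)"
    by (rule nn_integral_cmult) measurable
  finally show ?thesis .
qed

lemma gauss_transpose: "gauss (transpose H) = gauss (H :: real ^ 'n::finite ^ 'n)"
proof -
  have "transpose H \<bullet> transpose H = (\<Sum>i\<in>UNIV. \<Sum>j\<in>UNIV. H $ j $ i * H $ j $ i)"
    by (simp add: inner_vec_def transpose_def)
  also have "\<dots> = (\<Sum>j\<in>UNIV. \<Sum>i\<in>UNIV. H $ j $ i * H $ j $ i)" by (rule sum.swap)
  also have "\<dots> = H \<bullet> H" by (simp add: inner_vec_def)
  finally show ?thesis by (simp add: gauss_def)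
qed

lemma Vker_transpose:
  "Vker (axis k 1) a (transpose H) = (det H)\<^sup>2 * gauss H * gauss (H *v a) * (\<Prod>i\<in>UNIV. pw (CARD('d) - 1) (H $ k $ i))"
  for H :: "real ^ 'd::finite ^ 'd"
proof -
  have "(transpose H *v axis k 1) $ i = H $ k $ i" for i
    by (simp add: matrix_vector_mult_nth inner_axis transpose_def del: transpose_matrix_vector)
  then show ?thesis
    by (simp only: Vker_def det_transpose gauss_transpose transpose_transpose)
qed

text \<open>\<open>shr a\<close> is the inverse square root of the quadratic form with matrix \<open>I + a a\<^sup>T\<close>.\<close>

definition shr :: "real ^ 'n \<Rightarrow> real ^ 'n \<Rightarrow> real ^ 'n::finite" where
  "shr a y = y - ((a \<bullet> y) / (sqrt (1 + a \<bullet> a) * (sqrt (1 + a \<bullet> a) + 1))) *\<^sub>R a"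

definition qf :: "real ^ 'n \<Rightarrow> real ^ 'n::finite \<Rightarrow> real" where
  "qf a y = y \<bullet> y + (a \<bullet> y)\<^sup>2"

lemma linear_shr: "linear (shr a)"
  by (rule linearI) (simp_all add: shr_def inner_add_right algebra_simps add_divide_distrib)

text \<open>The form I + a a^T has the eigenvalue s^2 in direction a and 1 on the orthogonal
  complement. The last identity says that \<open>shr a\<close> has the eigenvalue 1 / s in direction
  a.\<close>

lemma shr_factor:
  assumes "s = sqrt (1 + a \<bullet> (a :: real ^ 'n::finite))"
  shows "s > 0" "a \<bullet> a = s * s - 1" "1 - (a \<bullet> a) / (s * (s + 1)) = 1 / s"
proof -
  have p: "1 + a \<bullet> a > 0" by (simp add: add_pos_nonneg)
  then show s: "s > 0" by (simp add: assms)
  have "s * s = 1 + a \<bullet> a" using p by (simp add: assms)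
  then show a: "a \<bullet> a = s * s - 1" by simp
  have "s * s - 1 = (s - 1) * (s + 1)" by (simp add: algebra_simps)
  then have "(a \<bullet> a) / (s * (s + 1)) = (s - 1) / s" using s by (simp add: a)
  then show "1 - (a \<bullet> a) / (s * (s + 1)) = 1 / s" using s by (simp add: diff_divide_distrib)
qed

lemma inner_shr: "a \<bullet> shr a y = (a \<bullet> y) / sqrt (1 + a \<bullet> a)"
proof -
  let ?s = "sqrt (1 + a \<bullet> a)"
  note f = shr_factor[of ?s a, OF refl]
  have "a \<bullet> shr a y = (a \<bullet> y) * (1 - (a \<bullet> a) / (?s * (?s + 1)))"
    by (simp only: shr_def inner_diff_right inner_scaleR_right) (simp add: algebra_simps)
  then show ?thesis by (simp only: f(3)) simp
qed

lemma qf_shr: "qf a (shr a y) = y \<bullet> y"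
proof -
  define s where "s = sqrt (1 + a \<bullet> a)"
  note f = shr_factor[OF s_def]
  define t where "t = a \<bullet> y"
  define c where "c = 1 / (s * (s + 1))"
  have e: "shr a y = y - (c * t) *\<^sub>R a" by (simp add: shr_def c_def t_def s_def)
  have "(y - r *\<^sub>R a) \<bullet> (y - r *\<^sub>R a) = y \<bullet> y - 2 * r * (a \<bullet> y) + r * r * (a \<bullet> a)" for r
    by (simp add: inner_diff_left inner_diff_right inner_commute[of y a] algebra_simps)
  then have "shr a y \<bullet> shr a y = y \<bullet> y - 2 * (c * t) * t + (c * t) * (c * t) * (a \<bullet> a)"
    by (simp only: e t_def)
  moreover have "a \<bullet> shr a y = t / s" unfolding inner_shr by (simp add: t_def s_def)
  ultimately have q: "qf a (shr a y) = y \<bullet> y + t\<^sup>2 * (c * c * (s * s - 1) - 2 * c + 1 / (s * s))"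
    by (simp add: qf_def f(2) power2_eq_square algebra_simps)
  have "c * c * (s * s - 1) - 2 * c + 1 / (s * s) = 0"
  proof -
    have "c * (s * s - 1) = (s - 1) / s"
    proof -
      have "s * s - 1 = (s - 1) * (s + 1)" by (simp add: algebra_simps)
      then show ?thesis using f(1) by (simp add: c_def)
    qed
    then have "c * c * (s * s - 1) = (s - 1) / (s * s * (s + 1))"
      using f(1) by (simp add: mult.assoc) (simp add: c_def)
    also have "\<dots> - 2 * c + 1 / (s * s) = ((s - 1) - 2 * s + (s + 1)) / (s * s * (s + 1))"
    proof -
      have "2 * c = 2 * s / (s * s * (s + 1))" "1 / (s * s) = (s + 1) / (s * s * (s + 1))"
        using f(1) by (simp_all add: c_def)
      then show ?thesis by (simp only: diff_divide_distrib add_divide_distrib)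
    qed
    finally show ?thesis by simp
  qed
  then show ?thesis by (simp add: q)
qed

text \<open>Conjugation by a rotation that takes a coordinate axis to the direction of a makes the
  matrix diagonal, with a single entry different from 1 in general.\<close>

lemma det_shr: "det (matrix (shr a)) = 1 / sqrt (1 + a \<bullet> (a :: real ^ 'n::finite))"
proof -
  obtain k :: 'n where True by simp
  obtain f :: "real ^ 'n \<Rightarrow> real ^ 'n" where f: "orthogonal_transformation f" and af: "a = norm a *\<^sub>R f (axis k 1)"
    using orthogonal_to_axis[of a k] by blast
  note oo = orthogonal_det[OF f]
  let ?b = "norm a *\<^sub>R axis k 1 :: real ^ 'n" and ?s = "sqrt (1 + a \<bullet> a)"
  have ab: "a = f ?b" using af oo(1) by (simp add: linear_scale)
  have bb: "?b \<bullet> ?b = a \<bullet> a" by (subst (2) ab, subst (2) ab) (simp only: oo(5))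
  have "shr a (f y) = f (shr ?b y)" for y
  proof -
    have "a \<bullet> f y = ?b \<bullet> y" by (subst ab) (rule oo(5))
    then show ?thesis
      unfolding shr_def bb using oo(1) by (subst (5) ab) (simp only: linear_diff linear_scale)
  qed
  then have "shr a \<circ> f = f \<circ> shr ?b" by (simp add: fun_eq_iff)
  then have "matrix (shr a) ** matrix f = matrix f ** matrix (shr ?b)"
    by (simp add: matrix_compose[symmetric] oo(1) linear_shr)
  then have "det (matrix (shr a)) * det (matrix f) = det (matrix f) * det (matrix (shr ?b))"
    by (metis det_mul)
  then have "det (matrix (shr a)) = det (matrix (shr ?b))" using oo(2) by simp
  also have "\<dots> = (\<Prod>i\<in>UNIV. if i = k then 1 / ?s else 1)"
  proof -
    have ax: "(axis m 1 :: real ^ 'n) $ j = of_bool (j = m)" for m j by (simp add: axis_def)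
    have "?b \<bullet> axis j 1 = norm a * of_bool (j = k)" for j
      by (simp add: inner_axis ax)
    then have E: "matrix (shr ?b) $ i $ j = of_bool (i = j) - norm a * of_bool (j = k) / (?s * (?s + 1)) * (norm a * of_bool (i = k))" for i j
      by (simp only: matrix_def vec_lambda_beta shr_def bb vector_minus_component vector_scaleR_component ax real_scaleR_def)
    have na: "norm a * norm a = a \<bullet> a" by (simp add: power2_norm_eq_inner[symmetric] power2_eq_square)
    have "det (matrix (shr ?b)) = (\<Prod>i\<in>UNIV. matrix (shr ?b) $ i $ i)"
      by (rule det_diagonal) (auto simp: E)
    also have "\<dots> = (\<Prod>i\<in>UNIV. if i = k then 1 / ?s else 1)"
    proof (intro prod.cong refl)
      fix i
      have "matrix (shr ?b) $ i $ i = (if i = k then 1 - (norm a * norm a) / (?s * (?s + 1)) else 1)"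
        by (simp add: E)
      then show "matrix (shr ?b) $ i $ i = (if i = k then 1 / ?s else 1)"
        by (simp only: na shr_factor(3)[OF refl])
    qed
    finally show ?thesis .
  qed
  also have "\<dots> = 1 / sqrt (1 + a \<bullet> a)" by simp
  finally show ?thesis .
qed

definition Qdet :: "'n \<Rightarrow> real ^ 'n::finite \<Rightarrow> ennreal" where
  "Qdet k y = (\<integral>\<^sup>+H. ennreal ((det (vec_upd H k y))\<^sup>2 * gauss H) \<partial>lborel)"

text \<open>The determinant is linear in row k, and the Gaussian weight of the matrix is invariant
  under rotating all rows, so only the squared length of y can matter.\<close>

lemma Qdet_eq:
  fixes y :: "real ^ 'n::finite"
  shows "Qdet k y = ennreal (y \<bullet> y) * Qdet k (axis k 1)"
proof -
  obtain f :: "real ^ 'n \<Rightarrow> real ^ 'n" where f: "orthogonal_transformation f" and yf: "y = norm y *\<^sub>R f (axis k 1)"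
    using orthogonal_to_axis[of y k] by blast
  note oo = orthogonal_det[OF f]
  have D: "(det (vec_upd (\<chi> i. f (H $ i)) k y))\<^sup>2 * gauss ((\<chi> i. f (H $ i)) :: real ^ 'n ^ 'n) = (y \<bullet> y) * ((det (vec_upd H k (axis k 1)))\<^sup>2 * gauss H)" for H
  proof -
    have "vec_upd (\<chi> i. f (H $ i)) k (f (axis k 1)) = (\<chi> i. f (vec_upd H k (axis k 1) $ i))"
      by (simp add: vec_eq_iff vec_upd_nth)
    then have "(det (vec_upd (\<chi> i. f (H $ i)) k (f (axis k 1))))\<^sup>2 = (det (vec_upd H k (axis k 1)))\<^sup>2"
      by (simp add: det_rows_map[OF oo(1)] power_mult_distrib oo(4))
    moreover have "(det (vec_upd (\<chi> i. f (H $ i)) k y))\<^sup>2 = (norm y)\<^sup>2 * (det (vec_upd (\<chi> i. f (H $ i)) k (f (axis k 1))))\<^sup>2"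
      by (subst yf) (simp only: det_vec_upd_scaleR power_mult_distrib)
    ultimately show ?thesis by (simp only: gauss_rows_map[OF f] power2_norm_eq_inner mult.assoc)
  qed
  have "Qdet k y = (\<integral>\<^sup>+H. ennreal ((det (vec_upd (\<chi> i. f (H $ i)) k y))\<^sup>2 * gauss ((\<chi> i. f (H $ i)) :: real ^ 'n ^ 'n)) \<partial>lborel)"
    unfolding Qdet_def
    using nn_integral_rows_map[OF oo(1,2), of "\<lambda>H. ennreal ((det (vec_upd H k y))\<^sup>2 * gauss H)"] by (simp add: oo(3))
  also have "\<dots> = (\<integral>\<^sup>+H. ennreal (y \<bullet> y) * ennreal ((det (vec_upd H k (axis k 1)))\<^sup>2 * gauss H) \<partial>lborel)"
    unfolding D by (intro nn_integral_cong ennreal_mult) (auto simp: gauss_pos less_imp_le)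
  also have "\<dots> = ennreal (y \<bullet> y) * Qdet k (axis k 1)"
    unfolding Qdet_def by (rule nn_integral_cmult) measurable
  finally show ?thesis .
qed

lemma shr_measurable [measurable]: "shr a \<in> borel_measurable borel"
  by (rule linear_borel_measurable[OF linear_shr])

lemma shr_measurable' [measurable (raw)]: "f \<in> borel_measurable M \<Longrightarrow> (\<lambda>x. shr a (f x)) \<in> borel_measurable M"
  by (rule measurable_compose[OF _ shr_measurable])

lemma qf_measurable [measurable (raw)]:
  assumes [measurable]: "f \<in> borel_measurable M" "g \<in> borel_measurable M"
  shows "(\<lambda>x. qf (f x) (g x)) \<in> borel_measurable M"
  unfolding qf_def by measurable

lemma gauss_vec_upd: "gauss (H $ k) * gauss (vec_upd H k y) = gauss y * gauss (H :: 'a::euclidean_space ^ 'n::finite)"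
proof -
  have "gauss H = gauss (H $ k) * (\<Prod>i\<in>UNIV - {k}. gauss (H $ i))"
    unfolding gauss_vec[of H] by (subst prod.remove[of UNIV k]) simp_all
  moreover have "gauss (vec_upd H k y) = gauss y * (\<Prod>i\<in>UNIV - {k}. gauss (H $ i))"
  proof -
    have "(\<Prod>i\<in>UNIV - {k}. gauss (vec_upd H k y $ i)) = (\<Prod>i\<in>UNIV - {k}. gauss (H $ i))"
      by (rule prod.cong) (auto simp: vec_upd_nth)
    then show ?thesis unfolding gauss_vec[of "vec_upd H k y"]
      by (subst prod.remove[of UNIV k]) (simp_all add: vec_upd_nth)
  qed
  ultimately show ?thesis by simp
qed

definition pwp :: "real ^ 'd::finite \<Rightarrow> real" where
  "pwp y = (\<Prod>i\<in>UNIV. pw (CARD('d) - 1) (y $ i))"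

lemma pwp_nonneg: "pwp y \<ge> 0" by (simp add: pwp_def pw_nonneg prod_nonneg)

lemma pwp_measurable [measurable (raw)]:
  assumes [measurable]: "f \<in> borel_measurable M"
  shows "(\<lambda>x. pwp (f x)) \<in> borel_measurable M"
  unfolding pwp_def by measurable

lemma pwp_scaleR: "r > 0 \<Longrightarrow> pwp (r *\<^sub>R y) = r ^ (CARD('d) * (CARD('d) - 1)) * pwp (y :: real ^ 'd::finite)"
  by (simp add: pwp_def pw_mult prod.distrib power_mult[symmetric] mult.commute)

text \<open>After transposition the two Gaussian weights combine to exp of minus half the sum of
  \<open>qf a\<close> over the rows. Applying \<open>shr a\<close> to all rows makes this a standard
  Gaussian, at the cost of \<delta> per row and \<delta>^2 from the squared determinant. Only row k
  enters the powers; the other rows leave a multiple of its squared norm.\<close>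

lemma nn_integral_Vker_eq:
  fixes a :: "real ^ 'd::finite"
  defines "\<delta> \<equiv> 1 / sqrt (1 + a \<bullet> a)"
  shows "ennreal (sqrt (2 * pi) ^ CARD('d)) * (\<integral>\<^sup>+G. ennreal (Vker (axis k 1) a G) \<partial>lborel)
    = Qdet k (axis k 1) * (ennreal (\<delta> ^ (CARD('d) + 1)) * (\<integral>\<^sup>+y. ennreal (pwp y * qf a y * exp (- qf a y / 2)) \<partial>lborel))"
proof -
  let ?d = "CARD('d)"
  let ?c = "ennreal (sqrt (2 * pi) ^ ?d)"
  have dl: "det (matrix (shr a)) = \<delta>" by (simp add: \<delta>_def det_shr)
  have d0: "\<delta> > 0" by (simp add: \<delta>_def add_pos_nonneg)
  have c0: "sqrt (2 * pi) ^ ?d > 0" by simp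
  let ?U = "\<lambda>H :: real ^ 'd ^ 'd. (det H)\<^sup>2 * gauss H * gauss (H *v a) * pwp (H $ k)"
  have U: "?U (\<chi> i. shr a (H $ i)) = \<delta>\<^sup>2 * ((det H)\<^sup>2 * gauss H * pwp (shr a (H $ k)))" for H
  proof -
    let ?H = "\<chi> i. shr a (H $ i)"
    have "?H \<bullet> ?H + (?H *v a) \<bullet> (?H *v a) = (\<Sum>i\<in>UNIV. qf a (?H $ i))"
      by (simp add: inner_vec_def[of "?H"] inner_vec_def[of "?H *v a"] matrix_vector_mult_nth qf_def
          sum.distrib power2_eq_square inner_commute)
    also have "\<dots> = H \<bullet> H" by (simp add: qf_shr inner_vec_def[of H])
    finally have "gauss ?H * gauss (?H *v a) = gauss H"
      by (simp add: gauss_def exp_add[symmetric] add_divide_distrib[symmetric])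
    moreover have "(det ?H)\<^sup>2 = \<delta>\<^sup>2 * (det H)\<^sup>2"
      by (simp add: det_rows_map[OF linear_shr] dl power_mult_distrib mult.commute)
    ultimately show ?thesis by (simp only: mult.assoc) (simp add: mult_ac)
  qed
  have nn: "0 \<le> (det H)\<^sup>2 * gauss H * pwp y" for H :: "real ^ 'd ^ 'd" and y :: "real ^ 'd"
    by (simp add: gauss_pos less_imp_le pwp_nonneg)
  have "(\<integral>\<^sup>+G. ennreal (Vker (axis k 1) a G) \<partial>lborel) = (\<integral>\<^sup>+H. ennreal (?U H) \<partial>lborel)"
    by (subst nn_integral_transpose) ((measurable)[1], simp only: Vker_transpose pwp_def)
  also have "\<dots> = ennreal (\<bar>\<delta>\<bar> ^ ?d) * (\<integral>\<^sup>+H. ennreal (?U (\<chi> i. shr a (H $ i))) \<partial>lborel)"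
    using nn_integral_rows_map[OF linear_shr, of a "\<lambda>H. ennreal (?U H)"] d0 unfolding dl by simp
  also have "\<dots> = (\<integral>\<^sup>+H. ennreal (\<delta> ^ (?d + 2)) * ennreal ((det H)\<^sup>2 * gauss H * pwp (shr a (H $ k))) \<partial>lborel)"
    unfolding U using d0 nn
    by (subst nn_integral_cmult[symmetric])
      (simp_all add: ennreal_mult[symmetric] power_add power2_eq_square mult_ac)
  also have "\<dots> = ennreal (\<delta> ^ (?d + 2)) * (\<integral>\<^sup>+H. ennreal ((det H)\<^sup>2 * gauss H * pwp (shr a (H $ k))) \<partial>lborel)"
    by (rule nn_integral_cmult) measurable
  finally have 1: "(\<integral>\<^sup>+G. ennreal (Vker (axis k 1) a G) \<partial>lborel)
    = ennreal (\<delta> ^ (?d + 2)) * (\<integral>\<^sup>+H. ennreal ((det H)\<^sup>2 * gauss H * pwp (shr a (H $ k))) \<partial>lborel)" .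
  \<comment> \<open>With the normalized Gaussian as weight of the redundant row,
    \<open>gauss_vec_upd\<close> exchanges the weights of that row and of t, and \<open>Qdet\<close>
    appears with its full Gaussian.\<close>
  have wt: "(\<integral>\<^sup>+y. ennreal (gauss (y :: real ^ 'd) / sqrt (2 * pi) ^ ?d) \<partial>lborel) = 1"
  proof -
    have "(\<integral>\<^sup>+y. ennreal (gauss (y :: real ^ 'd) / sqrt (2 * pi) ^ ?d) \<partial>lborel) = (\<integral>\<^sup>+y. ennreal (gauss (y :: real ^ 'd)) * ennreal (1 / sqrt (2 * pi) ^ ?d) \<partial>lborel)"
      by (intro nn_integral_cong) (simp add: ennreal_mult[symmetric] gauss_pos less_imp_le)
    also have "\<dots> = ?c * ennreal (1 / sqrt (2 * pi) ^ ?d)"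
      by (subst nn_integral_multc) (simp_all add: nn_integral_gauss)
    also have "\<dots> = 1" using c0 by (simp add: ennreal_mult[symmetric])
    finally show ?thesis .
  qed
  have "?c * (\<integral>\<^sup>+H. ennreal ((det H)\<^sup>2 * gauss H * pwp (shr a (H $ k))) \<partial>lborel)
     = ?c * (\<integral>\<^sup>+t. \<integral>\<^sup>+H. ennreal (gauss (H $ k) / sqrt (2 * pi) ^ ?d) *
         ennreal ((det (vec_upd H k t))\<^sup>2 * gauss (vec_upd H k t) * pwp (shr a (vec_upd H k t $ k))) \<partial>lborel \<partial>lborel)"
    by (subst nn_integral_vec_split[OF _ _ wt, of _ k]) ((measurable)[2], rule refl)
  also have "\<dots> = ?c * (\<integral>\<^sup>+t. \<integral>\<^sup>+H. ennreal (1 / sqrt (2 * pi) ^ ?d * (gauss t * pwp (shr a t))) * ennreal ((det (vec_upd H k t))\<^sup>2 * gauss H) \<partial>lborel \<partial>lborel)"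
  proof (rule arg_cong[where f="(*) ?c"], intro nn_integral_cong)
    fix t :: "real ^ 'd" and H :: "real ^ 'd ^ 'd"
    have "gauss (H $ k) / sqrt (2 * pi) ^ ?d * ((det (vec_upd H k t))\<^sup>2 * gauss (vec_upd H k t) * pwp (shr a (vec_upd H k t $ k)))
       = (1 / sqrt (2 * pi) ^ ?d) * (gauss (H $ k) * gauss (vec_upd H k t)) * pwp (shr a t) * (det (vec_upd H k t))\<^sup>2"
      by (simp add: vec_upd_nth)
    also have "\<dots> = 1 / sqrt (2 * pi) ^ ?d * (gauss t * pwp (shr a t)) * ((det (vec_upd H k t))\<^sup>2 * gauss H)"
      unfolding gauss_vec_upd by simp
    finally show "ennreal (gauss (H $ k) / sqrt (2 * pi) ^ ?d) *
         ennreal ((det (vec_upd H k t))\<^sup>2 * gauss (vec_upd H k t) * pwp (shr a (vec_upd H k t $ k)))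
       = ennreal (1 / sqrt (2 * pi) ^ ?d * (gauss t * pwp (shr a t))) * ennreal ((det (vec_upd H k t))\<^sup>2 * gauss H)"
      by (subst (1 2) ennreal_mult[symmetric]) (auto simp: gauss_pos less_imp_le pwp_nonneg)
  qed
  also have "\<dots> = ?c * (\<integral>\<^sup>+t. ennreal (1 / sqrt (2 * pi) ^ ?d * (gauss t * pwp (shr a t))) * Qdet k t \<partial>lborel)"
    unfolding Qdet_def by (subst nn_integral_cmult) ((measurable)[1], rule refl)
  also have "\<dots> = ?c * (\<integral>\<^sup>+t. (ennreal (1 / sqrt (2 * pi) ^ ?d) * Qdet k (axis k 1)) * ennreal (pwp (shr a t) * qf a (shr a t) * exp (- qf a (shr a t) / 2)) \<partial>lborel)"
  proof (rule arg_cong[where f="(*) ?c"], rule nn_integral_cong)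
    fix t :: "real ^ 'd"
    have "ennreal (1 / sqrt (2 * pi) ^ ?d * (gauss t * pwp (shr a t))) * Qdet k t
       = (ennreal (1 / sqrt (2 * pi) ^ ?d * (gauss t * pwp (shr a t))) * ennreal (t \<bullet> t)) * Qdet k (axis k 1)"
      by (subst Qdet_eq) (simp only: mult.assoc)
    also have "ennreal (1 / sqrt (2 * pi) ^ ?d * (gauss t * pwp (shr a t))) * ennreal (t \<bullet> t)
        = ennreal (1 / sqrt (2 * pi) ^ ?d) * ennreal (pwp (shr a t) * (t \<bullet> t) * gauss t)"
      by (subst (1 2) ennreal_mult[symmetric]) (auto simp: gauss_pos less_imp_le pwp_nonneg mult_ac)
    finally show "ennreal (1 / sqrt (2 * pi) ^ ?d * (gauss t * pwp (shr a t))) * Qdet k t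
      = (ennreal (1 / sqrt (2 * pi) ^ ?d) * Qdet k (axis k 1)) * ennreal (pwp (shr a t) * qf a (shr a t) * exp (- qf a (shr a t) / 2))"
      unfolding qf_shr gauss_def by (simp only: mult_ac)
  qed
  also have "\<dots> = (?c * ennreal (1 / sqrt (2 * pi) ^ ?d)) * (Qdet k (axis k 1) * (\<integral>\<^sup>+t. ennreal (pwp (shr a t) * qf a (shr a t) * exp (- qf a (shr a t) / 2)) \<partial>lborel))"
    by (subst nn_integral_cmult) ((measurable)[1], simp only: mult_ac)
  also have "?c * ennreal (1 / sqrt (2 * pi) ^ ?d) = 1"
    using c0 by (simp add: ennreal_mult[symmetric])
  finally have 2: "?c * (\<integral>\<^sup>+H. ennreal ((det H)\<^sup>2 * gauss H * pwp (shr a (H $ k))) \<partial>lborel)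
     = Qdet k (axis k 1) * (\<integral>\<^sup>+t. ennreal (pwp (shr a t) * qf a (shr a t) * exp (- qf a (shr a t) / 2)) \<partial>lborel)" by (simp only: mult_1)
  \<comment> \<open>Undoing \<open>shr a\<close> on the separated row returns one factor \<delta>,
    which lowers the exponent from d + 2 to d + 1.\<close>
  have 3: "(\<integral>\<^sup>+y. ennreal (pwp y * qf a y * exp (- qf a y / 2)) \<partial>lborel) = ennreal \<delta> * (\<integral>\<^sup>+t. ennreal (pwp (shr a t) * qf a (shr a t) * exp (- qf a (shr a t) / 2)) \<partial>lborel)"
  proof -
    have "matrix (shr a) *v t = shr a t" for t by (simp add: matrix_works linear_shr)
    then show ?thesis
      using nn_integral_linear[of "matrix (shr a)" "\<lambda>y. ennreal (pwp y * qf a y * exp (- qf a y / 2))"] d0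
      by (simp add: dl)
  qed
  have "ennreal (\<delta> ^ (?d + 2)) = ennreal (\<delta> ^ (?d + 1)) * ennreal \<delta>"
    using d0 by (simp add: ennreal_mult[symmetric] mult.commute)
  then show ?thesis unfolding 1 3 using 2 by (simp only: mult_ac)
qed

section \<open>Removal of the remaining factors by homogeneity\<close>

lemma qf_pos: "y \<noteq> 0 \<Longrightarrow> qf a y > 0"
  by (simp add: qf_def add_pos_nonneg)

lemma qf_nonneg: "qf a y \<ge> 0" by (simp add: qf_def)

lemma qf_scaleR: "qf a (r *\<^sub>R y) = r\<^sup>2 * qf a y"
  by (simp add: qf_def power_mult_distrib power2_eq_square algebra_simps)

lemma exp_eq_nn_integral:
  assumes q: "q > 0"
  shows "(\<integral>\<^sup>+s. ennreal (s * q * exp (- (s\<^sup>2 * q) / 2)) * indicator {1..} s \<partial>lborel) = ennreal (exp (- q / 2))"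
proof -
  have "(\<integral>\<^sup>+s. ennreal (s * q * exp (- (s\<^sup>2 * q) / 2)) * indicator {1..} s \<partial>lborel) = ennreal (0 - (- exp (- (1\<^sup>2 * q) / 2)))"
  proof (rule nn_integral_FTC_atLeast)
    show "((\<lambda>s. - exp (- (s\<^sup>2 * q) / 2)) has_real_derivative s * q * exp (- (s\<^sup>2 * q) / 2)) (at s)" for s
      by (auto intro!: derivative_eq_intros)
    show "((\<lambda>s. - exp (- (s\<^sup>2 * q) / 2)) \<longlongrightarrow> 0) at_top"
    proof -
      have "filterlim (\<lambda>s::real. s\<^sup>2 * (q / 2)) at_top at_top"
        by (rule filterlim_at_top_mult_tendsto_pos[where c="q / 2", rotated 2])
          (use q in \<open>auto intro!: filterlim_pow_at_top filterlim_ident tendsto_const\<close>)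
      then have "((\<lambda>s. exp (- (s\<^sup>2 * (q / 2)))) \<longlongrightarrow> 0) at_top"
        by (intro filterlim_compose[OF exp_at_bot] filterlim_compose[OF filterlim_uminus_at_bot_at_top])
      then have "((\<lambda>s. - exp (- (s\<^sup>2 * (q / 2)))) \<longlongrightarrow> - 0) at_top" by (rule tendsto_minus)
      then show ?thesis by simp
    qed
    show "0 \<le> s * q * exp (- (s\<^sup>2 * q) / 2)" if "1 \<le> s" for s using that q by simp
  qed measurable
  then show ?thesis by simp
qed

text \<open>Writing the exponential as an integral over scales s \<ge> 1 produces exactly the factor
  \<open>qf a y\<close>. Since \<open>pwp\<close> and \<open>qf a\<close> are homogeneous, the scale
  separates from y, and the constant is independent of a.\<close>

lemma remove_qf:
  obtains kap :: real where "kap > 0"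
    "\<And>a :: real ^ 'd::finite. (\<integral>\<^sup>+y. ennreal (pwp y * exp (- qf a y / 2)) \<partial>lborel)
      = ennreal kap * (\<integral>\<^sup>+y. ennreal (pwp y * qf a y * exp (- qf a y / 2)) \<partial>lborel)"
proof -
  let ?d = "CARD('d)"
  \<comment> \<open>The exponents add up from the volume (d), from \<open>pwp\<close> (d (d - 1))
    and from the factor \<open>s * qf a y\<close> (1).\<close>
  define m where "m = ?d + ?d * (?d - 1) + 1"
  have m2: "m \<ge> 2" using zero_less_card_finite[where 'a='d] unfolding m_def by linarith
  let ?k = "\<lambda>s::real. indicator {1..} s * (1 / s) ^ m"
  have le: "?k s \<le> 2 * (1 / (1 + s\<^sup>2))" for s
  proof (cases "s \<ge> 1")
    case True
    have "(1 / s) ^ m \<le> (1 / s)\<^sup>2" using True m2 by (intro power_decreasing) auto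
    also have "\<dots> \<le> 2 * (1 / (1 + s\<^sup>2))"
    proof -
      have "1 \<le> s\<^sup>2" using True by simp
      then have "1 + s\<^sup>2 \<le> 2 * s\<^sup>2" "0 < 1 + s\<^sup>2" by auto
      then show ?thesis using True by (simp add: power_one_over divide_simps)
    qed
    finally show ?thesis using True by simp
  qed simp
  have "(\<integral>\<^sup>+s. ennreal (?k s) \<partial>lborel) \<le> (\<integral>\<^sup>+s. ennreal 2 * ennreal (1 / (1 + s\<^sup>2)) \<partial>lborel)"
  proof (rule nn_integral_mono)
    fix s :: real
    have "ennreal (?k s) \<le> ennreal (2 * (1 / (1 + s\<^sup>2)))" by (rule ennreal_leI[OF le])
    also have "\<dots> = ennreal 2 * ennreal (1 / (1 + s\<^sup>2))" by (rule ennreal_mult) auto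
    finally show "ennreal (?k s) \<le> ennreal 2 * ennreal (1 / (1 + s\<^sup>2))" .
  qed
  also have "\<dots> = ennreal 2 * (\<integral>\<^sup>+s. ennreal (1 / (1 + s\<^sup>2)) \<partial>lborel)" by (rule nn_integral_cmult) measurable
  also have "\<dots> < \<infinity>" using nn_integral_inverse_1_plus_square by (simp add: ennreal_mult_less_top)
  finally have fin: "(\<integral>\<^sup>+s. ennreal (?k s) \<partial>lborel) < \<infinity>" .
  have "(\<integral>\<^sup>+s. ennreal (?k s) \<partial>lborel) > 0"
  proof (rule ccontr)
    assume "\<not> ?thesis"
    then have "(\<integral>\<^sup>+s. ennreal (?k s) \<partial>lborel) = 0" by simp
    then have "AE s in lborel. ennreal (?k s) = 0" by (subst (asm) nn_integral_0_iff_AE) simp_all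
    then have "AE s in lborel. s \<notin> {1..2::real}"
    proof eventually_elim
      case (elim s)
      show ?case
      proof
        assume s: "s \<in> {1..2}"
        have "(1 / s) ^ m > 0" using s by (intro zero_less_power) auto
        moreover have "?k s = (1 / s) ^ m" using s by simp
        moreover have "?k s \<le> 0" using elim by (simp only: ennreal_eq_0_iff)
        ultimately show False by linarith
      qed
    qed
    then have "{1..2::real} \<in> null_sets lborel" by (subst (asm) AE_iff_null_sets[symmetric]) auto
    then show False by (simp add: null_sets_def)
  qed
  then obtain kap where kap: "(\<integral>\<^sup>+s. ennreal (?k s) \<partial>lborel) = ennreal kap" "kap > 0"
    using fin by (cases "\<integral>\<^sup>+s. ennreal (?k s) \<partial>lborel" rule: ennreal_cases) auto
  have "(\<integral>\<^sup>+y. ennreal (pwp y * exp (- qf a y / 2)) \<partial>lborel)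
      = ennreal kap * (\<integral>\<^sup>+y. ennreal (pwp y * qf a y * exp (- qf a y / 2)) \<partial>lborel)" for a :: "real ^ 'd"
  proof -
    let ?g = "\<lambda>s y. ennreal (pwp y) * (ennreal (s * qf a y * exp (- (s\<^sup>2 * qf a y) / 2)) * indicator {1..} s)"
    have "(\<integral>\<^sup>+y. ennreal (pwp y * exp (- qf a y / 2)) \<partial>lborel) = (\<integral>\<^sup>+y. \<integral>\<^sup>+s. ?g s y \<partial>lborel \<partial>lborel)"
    proof (rule nn_integral_cong_AE, use AE_lborel_singleton[of 0] in eventually_elim)
      case (elim y)
      have "ennreal (pwp y * exp (- qf a y / 2)) = ennreal (pwp y) * ennreal (exp (- qf a y / 2))"
        by (rule ennreal_mult) (auto simp: pwp_nonneg)
      also have "\<dots> = (\<integral>\<^sup>+s. ?g s y \<partial>lborel)"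
        unfolding exp_eq_nn_integral[OF qf_pos[OF elim], of a, symmetric]
        by (rule nn_integral_cmult[symmetric]) measurable
      finally show ?case .
    qed
    also have "\<dots> = (\<integral>\<^sup>+s. \<integral>\<^sup>+y. ?g s y \<partial>lborel \<partial>lborel)"
      by (rule lborel_pair.Fubini') measurable
    also have "\<dots> = (\<integral>\<^sup>+s. ennreal (?k s) * (\<integral>\<^sup>+y. ennreal (pwp y * qf a y * exp (- qf a y / 2)) \<partial>lborel) \<partial>lborel)"
    proof (rule nn_integral_cong)
      fix s :: real
      show "(\<integral>\<^sup>+y. ?g s y \<partial>lborel) = ennreal (?k s) * (\<integral>\<^sup>+y. ennreal (pwp y * qf a y * exp (- qf a y / 2)) \<partial>lborel)"
      proof (cases "s \<ge> 1")
        case True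
        let ?r = "1 / s"
        have r: "?r > 0" using True by simp
        have gm: "(\<lambda>y. ?g s y) \<in> borel_measurable borel" by measurable
        have "(\<integral>\<^sup>+y. ?g s y \<partial>lborel) = ennreal (?r ^ ?d) * (\<integral>\<^sup>+z. ?g s (?r *\<^sub>R z) \<partial>lborel)"
          by (rule nn_integral_scaleR[OF r gm])
        also have "\<dots> = ennreal (?r ^ ?d) * (\<integral>\<^sup>+z. ennreal (?r ^ (?d * (?d - 1) + 1)) * ennreal (pwp z * qf a z * exp (- qf a z / 2)) \<partial>lborel)"
        proof (rule arg_cong[where f="(*) (ennreal (?r ^ ?d))"], rule nn_integral_cong)
          fix z :: "real ^ 'd"
          have e: "s\<^sup>2 * qf a (?r *\<^sub>R z) = qf a z" "s * qf a (?r *\<^sub>R z) = ?r * qf a z"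
            using True by (simp_all add: qf_scaleR power2_eq_square)
          have "?g s (?r *\<^sub>R z) = ennreal (pwp (?r *\<^sub>R z)) * ennreal (?r * qf a z * exp (- qf a z / 2))"
            using True by (simp only: e) simp
          also have "\<dots> = ennreal (pwp (?r *\<^sub>R z) * (?r * qf a z * exp (- qf a z / 2)))"
            using r by (intro ennreal_mult[symmetric] mult_nonneg_nonneg) (auto simp: pwp_nonneg qf_nonneg)
          also have "pwp (?r *\<^sub>R z) * (?r * qf a z * exp (- qf a z / 2)) = ?r ^ (?d * (?d - 1) + 1) * (pwp z * qf a z * exp (- qf a z / 2))"
            unfolding pwp_scaleR[OF r] by simp
          also have "ennreal \<dots> = ennreal (?r ^ (?d * (?d - 1) + 1)) * ennreal (pwp z * qf a z * exp (- qf a z / 2))"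
            using r by (intro ennreal_mult mult_nonneg_nonneg zero_le_power) (auto simp: pwp_nonneg qf_nonneg)
          finally show "?g s (?r *\<^sub>R z) = ennreal (?r ^ (?d * (?d - 1) + 1)) * ennreal (pwp z * qf a z * exp (- qf a z / 2))" .
        qed
        also have "\<dots> = ennreal (?r ^ ?d) * (ennreal (?r ^ (?d * (?d - 1) + 1)) * (\<integral>\<^sup>+z. ennreal (pwp z * qf a z * exp (- qf a z / 2)) \<partial>lborel))"
          by (subst nn_integral_cmult) ((measurable)[1], rule refl)
        also have "\<dots> = (ennreal (?r ^ ?d) * ennreal (?r ^ (?d * (?d - 1) + 1))) * (\<integral>\<^sup>+z. ennreal (pwp z * qf a z * exp (- qf a z / 2)) \<partial>lborel)"
          by (simp only: mult.assoc)
        also have "ennreal (?r ^ ?d) * ennreal (?r ^ (?d * (?d - 1) + 1)) = ennreal (?r ^ m)"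
          using r by (subst ennreal_mult[symmetric]) (simp_all only: m_def power_add[symmetric] zero_le_power less_imp_le add.assoc)
        finally show ?thesis using True by simp
      qed simp
    qed
    also have "\<dots> = ennreal kap * (\<integral>\<^sup>+y. ennreal (pwp y * qf a y * exp (- qf a y / 2)) \<partial>lborel)"
      by (subst nn_integral_multc) ((measurable)[1], simp only: kap(1))
    finally show ?thesis .
  qed
  then show ?thesis using that kap(2) by blast
qed

text \<open>Expresses the power of 1 + |a|^2 as a Gaussian moment in an auxiliary scale s. The
  substitution b = s a will then leave a Gaussian in b.\<close>

lemma moment_scale:
  obtains cd :: real where "cd > 0"
    "\<And>a :: real ^ 'n::finite. ennreal cd * ennreal ((1 / sqrt (1 + a \<bullet> a)) ^ (m + 1))
      = (\<integral>\<^sup>+s. ennreal (indicator {0<..} s * s ^ m * exp (- (s\<^sup>2 * (1 + a \<bullet> a)) / 2)) \<partial>lborel)"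
proof -
  let ?f = "\<lambda>x::real. indicator {0<..} x * x ^ m * exp (- x\<^sup>2 / 2)"
  have "(\<integral>\<^sup>+x. ennreal (?f x) \<partial>lborel) > 0" by (rule nn_integral_pos_if_pos) auto
  then obtain cd where cd: "(\<integral>\<^sup>+x. ennreal (?f x) \<partial>lborel) = ennreal cd" "cd > 0"
    using nn_integral_moment_finite[of m] by (cases "\<integral>\<^sup>+x. ennreal (?f x) \<partial>lborel" rule: ennreal_cases) auto
  have "ennreal cd * ennreal ((1 / sqrt (1 + a \<bullet> a)) ^ (m + 1))
      = (\<integral>\<^sup>+s. ennreal (indicator {0<..} s * s ^ m * exp (- (s\<^sup>2 * (1 + a \<bullet> a)) / 2)) \<partial>lborel)" for a :: "real ^ 'n"
  proof -
    define r where "r = 1 / sqrt (1 + a \<bullet> a)"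
    have p: "1 + a \<bullet> a > 0" by (simp add: add_pos_nonneg)
    then have r: "r > 0" by (simp add: r_def)
    have r2: "r\<^sup>2 * (1 + a \<bullet> a) = 1" using p by (simp add: r_def power_divide)
    have "(\<integral>\<^sup>+s. ennreal (indicator {0<..} s * s ^ m * exp (- (s\<^sup>2 * (1 + a \<bullet> a)) / 2)) \<partial>lborel)
      = ennreal \<bar>r\<bar> * (\<integral>\<^sup>+x. ennreal (indicator {0<..} (0 + r * x) * (0 + r * x) ^ m * exp (- ((0 + r * x)\<^sup>2 * (1 + a \<bullet> a)) / 2)) \<partial>lborel)"
      by (rule nn_integral_real_affine) (use r in auto)
    also have "\<dots> = ennreal r * (\<integral>\<^sup>+x. ennreal (r ^ m) * ennreal (?f x) \<partial>lborel)"
    proof -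
      have "ennreal (indicator {0<..} (0 + r * x) * (0 + r * x) ^ m * exp (- ((0 + r * x)\<^sup>2 * (1 + a \<bullet> a)) / 2)) = ennreal (r ^ m) * ennreal (?f x)" for x
      proof -
        have "(r * x)\<^sup>2 * (1 + a \<bullet> a) = x\<^sup>2" using r2 by (simp add: power_mult_distrib mult_ac)
        moreover have "(indicator {0<..} (r * x) :: real) = indicator {0<..} x" using r by (simp add: indicator_def zero_less_mult_iff)
        ultimately have "indicator {0<..} (0 + r * x) * (0 + r * x) ^ m * exp (- ((0 + r * x)\<^sup>2 * (1 + a \<bullet> a)) / 2) = r ^ m * ?f x"
          by (simp add: power_mult_distrib)
        also have "ennreal \<dots> = ennreal (r ^ m) * ennreal (?f x)" using r by (intro ennreal_mult) (auto simp: indicator_def)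
        finally show ?thesis .
      qed
      then show ?thesis using r by simp
    qed
    also have "\<dots> = ennreal r * (ennreal (r ^ m) * ennreal cd)"
      by (subst nn_integral_cmult) ((measurable)[1], simp only: cd(1))
    also have "\<dots> = ennreal cd * ennreal (r ^ (m + 1))"
      using r cd(2) by (simp add: ennreal_mult[symmetric] mult_ac)
    finally show ?thesis by (simp add: r_def)
  qed
  then show ?thesis using that cd(2) by blast
qed

text \<open>All that still depends on J when the constants have been stripped. Here b is s a, with s
  the auxiliary scale of \<open>moment_scale\<close>.\<close>

definition Yint :: "'d::finite set \<Rightarrow> ennreal" where
  "Yint J = (\<integral>\<^sup>+s. ennreal (indicator {0<..} s * exp (- s\<^sup>2 / 2)) *
     (\<integral>\<^sup>+b. ennreal (indicator {b. \<forall>i\<in>J. b $ i > 0} b * gauss b) *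
       (\<integral>\<^sup>+y. ennreal (pwp y * gauss y * exp (- (b \<bullet> y)\<^sup>2 / (2 * s\<^sup>2))) \<partial>(lborel :: (real ^ 'd) measure)) \<partial>lborel) \<partial>lborel)"

text \<open>The Jacobian of b = s a cancels s^d, the exponent splits into s^2 and |b|^2, and the
  quadratic form keeps the coupling (b . y)^2 / s^2. The sign conditions are invariant under s >
  0.\<close>

lemma Yint_eq:
  fixes J :: "'d::finite set"
  shows "(\<integral>\<^sup>+a. indicator {a. \<forall>i\<in>J. a $ i > 0} a *
      ((\<integral>\<^sup>+s. ennreal (indicator {0<..} s * s ^ CARD('d) * exp (- (s\<^sup>2 * (1 + a \<bullet> a)) / 2)) \<partial>lborel) *
       (\<integral>\<^sup>+y. ennreal (pwp y * exp (- qf a y / 2)) \<partial>(lborel :: (real ^ 'd) measure))) \<partial>lborel) = Yint J"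
proof -
  let ?d = "CARD('d)"
  define A where "A = {a :: real ^ 'd. \<forall>i\<in>J. a $ i > 0}"
  have [measurable]: "A \<in> sets borel" unfolding A_def by measurable
  define G where "G a = (\<integral>\<^sup>+y. ennreal (pwp y * exp (- qf a y / 2)) \<partial>(lborel :: (real ^ 'd) measure))" for a
  have [measurable]: "(\<lambda>x. G (f x)) \<in> borel_measurable M" if [measurable]: "f \<in> borel_measurable M" for f and M :: "'z measure"
    unfolding G_def by measurable
  let ?f = "\<lambda>a s. ennreal (indicator {0<..} s * s ^ ?d * exp (- (s\<^sup>2 * (1 + a \<bullet> a)) / 2))"
  have "(\<integral>\<^sup>+a. indicator A a * ((\<integral>\<^sup>+s. ?f a s \<partial>lborel) * G a) \<partial>lborel) = (\<integral>\<^sup>+a. \<integral>\<^sup>+s. indicator A a * (?f a s * G a) \<partial>lborel \<partial>lborel)"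
    by (simp add: nn_integral_cmult nn_integral_multc)
  also have "\<dots> = (\<integral>\<^sup>+s. \<integral>\<^sup>+a. indicator A a * (?f a s * G a) \<partial>lborel \<partial>lborel)"
    by (rule lborel_pair.Fubini') measurable
  also have "\<dots> = (\<integral>\<^sup>+s. ennreal (indicator {0<..} s * exp (- s\<^sup>2 / 2)) *
     (\<integral>\<^sup>+b. ennreal (indicator A b * gauss b) *
       (\<integral>\<^sup>+y. ennreal (pwp y * gauss y * exp (- (b \<bullet> y)\<^sup>2 / (2 * s\<^sup>2))) \<partial>lborel) \<partial>lborel) \<partial>lborel)"
  proof (rule nn_integral_cong)
    fix s :: real
    show "(\<integral>\<^sup>+a. indicator A a * (?f a s * G a) \<partial>lborel) = ennreal (indicator {0<..} s * exp (- s\<^sup>2 / 2)) *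
     (\<integral>\<^sup>+b. ennreal (indicator A b * gauss b) *
       (\<integral>\<^sup>+y. ennreal (pwp y * gauss y * exp (- (b \<bullet> y)\<^sup>2 / (2 * s\<^sup>2))) \<partial>lborel) \<partial>lborel)"
    proof (cases "s > 0")
      case True
      let ?r = "1 / s"
      have r: "?r > 0" using True by simp
      have m: "(\<lambda>a. indicator A a * (?f a s * G a)) \<in> borel_measurable borel" by measurable
      have "(\<integral>\<^sup>+a. indicator A a * (?f a s * G a) \<partial>lborel) = ennreal (?r ^ ?d) * (\<integral>\<^sup>+b. indicator A (?r *\<^sub>R b) * (?f (?r *\<^sub>R b) s * G (?r *\<^sub>R b)) \<partial>lborel)"
        by (rule nn_integral_scaleR[OF r m])
      also have "\<dots> = (\<integral>\<^sup>+b. ennreal (?r ^ ?d) * (indicator A (?r *\<^sub>R b) * (?f (?r *\<^sub>R b) s * G (?r *\<^sub>R b))) \<partial>lborel)"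
        by (rule nn_integral_cmult[symmetric]) measurable
      also have "\<dots> = (\<integral>\<^sup>+b. ennreal (exp (- s\<^sup>2 / 2)) * (ennreal (indicator A b * gauss b) *
         (\<integral>\<^sup>+y. ennreal (pwp y * gauss y * exp (- (b \<bullet> y)\<^sup>2 / (2 * s\<^sup>2))) \<partial>lborel)) \<partial>lborel)"
      proof (rule nn_integral_cong)
        fix b :: "real ^ 'd"
        have "G (?r *\<^sub>R b) = (\<integral>\<^sup>+y. ennreal (pwp y * gauss y * exp (- (b \<bullet> y)\<^sup>2 / (2 * s\<^sup>2))) \<partial>lborel)"
        proof -
          have "exp (- qf (?r *\<^sub>R b) y / 2) = gauss y * exp (- (b \<bullet> y)\<^sup>2 / (2 * s\<^sup>2))" for y
            using True by (simp add: qf_def gauss_def exp_add[symmetric] power_divide add_divide_distrib)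
          then show ?thesis unfolding G_def by (simp only: mult.assoc)
        qed
        moreover have "ennreal (?r ^ ?d) * (indicator A (?r *\<^sub>R b) * ?f (?r *\<^sub>R b) s) = ennreal (exp (- s\<^sup>2 / 2)) * ennreal (indicator A b * gauss b)"
        proof -
          have "indicator A (?r *\<^sub>R b) = (indicator A b :: real)"
            using True by (simp add: A_def indicator_def zero_less_divide_iff)
          moreover have "?r ^ ?d * (s ^ ?d * exp (- (s\<^sup>2 * (1 + (?r *\<^sub>R b) \<bullet> (?r *\<^sub>R b))) / 2)) = exp (- s\<^sup>2 / 2) * gauss b"
          proof -
            have "s\<^sup>2 * (1 + (?r *\<^sub>R b) \<bullet> (?r *\<^sub>R b)) = s\<^sup>2 + b \<bullet> b"
              using True by (simp add: power2_eq_square algebra_simps)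
            then have "exp (- (s\<^sup>2 * (1 + (?r *\<^sub>R b) \<bullet> (?r *\<^sub>R b))) / 2) = exp (- s\<^sup>2 / 2) * gauss b"
              by (simp only:) (simp add: gauss_def exp_add[symmetric] add_divide_distrib)
            moreover have "?r ^ ?d * s ^ ?d = 1" using True by (simp add: power_one_over)
            ultimately show ?thesis by (simp add: mult.assoc[symmetric])
          qed
          ultimately have "?r ^ ?d * (indicator A (?r *\<^sub>R b) * (indicator {0<..} s * s ^ ?d * exp (- (s\<^sup>2 * (1 + (?r *\<^sub>R b) \<bullet> (?r *\<^sub>R b))) / 2)))
             = exp (- s\<^sup>2 / 2) * (indicator A b * gauss b)"
            using True by (simp add: indicator_def)
          moreover have "(indicator A (?r *\<^sub>R b) :: ennreal) = ennreal (indicator A (?r *\<^sub>R b))" by (simp add: indicator_def)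
          ultimately show ?thesis
            using True by (simp only: ennreal_mult[symmetric] zero_le_power r less_imp_le indicator_pos_le mult_nonneg_nonneg exp_ge_zero gauss_pos)
        qed
        ultimately show "ennreal (?r ^ ?d) * (indicator A (?r *\<^sub>R b) * (?f (?r *\<^sub>R b) s * G (?r *\<^sub>R b)))
          = ennreal (exp (- s\<^sup>2 / 2)) * (ennreal (indicator A b * gauss b) *
         (\<integral>\<^sup>+y. ennreal (pwp y * gauss y * exp (- (b \<bullet> y)\<^sup>2 / (2 * s\<^sup>2))) \<partial>lborel))"
          by (simp only: mult.assoc[symmetric])
      qed
      also have "\<dots> = ennreal (exp (- s\<^sup>2 / 2)) * (\<integral>\<^sup>+b. ennreal (indicator A b * gauss b) *
         (\<integral>\<^sup>+y. ennreal (pwp y * gauss y * exp (- (b \<bullet> y)\<^sup>2 / (2 * s\<^sup>2))) \<partial>lborel) \<partial>lborel)"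
        by (rule nn_integral_cmult) measurable
      finally show ?thesis using True by simp
    qed simp
  qed
  finally show ?thesis by (simp only: Yint_def A_def G_def)
qed

text \<open>K2 collects the integral over x and the value of \<open>Qdet\<close>, neither of which
  is evaluated; K1 collects the constants that have to be divided out and is therefore kept positive
  and finite.\<close>

proposition proportional_to_Yint:
  fixes W :: "real ^ 'd::finite \<Rightarrow> ennreal"
  assumes W[measurable]: "W \<in> borel_measurable borel"
  obtains K1 :: real and K2 :: ennreal where "K1 > 0"
    "\<And>J. ennreal K1 * (\<integral>\<^sup>+u. ennreal (gauss u) * (\<integral>\<^sup>+P. indicator (pos_tuples u J) P * W (ctr P) \<partial>lborel) \<partial>lborel) = K2 * Yint J"
proof -
  let ?d = "CARD('d)"
  obtain k :: real where k: "k > 0" and dt: "\<And>(W :: real ^ 'd \<Rightarrow> ennreal) J. W \<in> borel_measurable borel \<Longrightarrow>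
      (\<integral>\<^sup>+u. ennreal (gauss u) * (\<integral>\<^sup>+P. indicator (pos_tuples u J) P * W (ctr P) \<partial>lborel) \<partial>lborel)
      = ennreal k * (\<integral>\<^sup>+x. W x * (\<integral>\<^sup>+a. indicator {a. \<forall>i\<in>J. a $ i > 0} a * (\<integral>\<^sup>+G. ennreal (Vker x a G) \<partial>lborel) \<partial>lborel) \<partial>lborel)"
    using direction_tuple_formula by blast
  obtain kap :: real where kap: "kap > 0" and rq: "\<And>a :: real ^ 'd. (\<integral>\<^sup>+y. ennreal (pwp y * exp (- qf a y / 2)) \<partial>lborel)
      = ennreal kap * (\<integral>\<^sup>+y. ennreal (pwp y * qf a y * exp (- qf a y / 2)) \<partial>lborel)"
    using remove_qf by blast
  obtain cd :: real where cd: "cd > 0" and ms: "\<And>a :: real ^ 'd. ennreal cd * ennreal ((1 / sqrt (1 + a \<bullet> a)) ^ (?d + 1))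
      = (\<integral>\<^sup>+s. ennreal (indicator {0<..} s * s ^ ?d * exp (- (s\<^sup>2 * (1 + a \<bullet> a)) / 2)) \<partial>lborel)"
    using moment_scale[of ?d] by blast
  define e where "e = (undefined :: 'd)"
  define V where "V a = (\<integral>\<^sup>+G. ennreal (Vker (axis e 1) a G) \<partial>lborel)" for a :: "real ^ 'd"
  have Vm[measurable]: "V \<in> borel_measurable borel" unfolding V_def by measurable
  define c where "c = sqrt (2 * pi) ^ ?d"
  have c: "c > 0" by (simp add: c_def)
  define Cw where "Cw = (\<integral>\<^sup>+x. W x * ennreal (norm x ^ (?d * (?d - 1))) \<partial>lborel)"
  show ?thesis
  proof (rule that[of "kap * cd * c" "ennreal k * Cw * Qdet e (axis e 1)"])
    show "kap * cd * c > 0" using kap cd c by simp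
    fix J :: "'d set"
    define A where "A = {a :: real ^ 'd. \<forall>i\<in>J. a $ i > 0}"
    have [measurable]: "A \<in> sets borel" unfolding A_def by measurable
    have "(\<integral>\<^sup>+x. W x * (\<integral>\<^sup>+a. indicator A a * (\<integral>\<^sup>+G. ennreal (Vker x a G) \<partial>lborel) \<partial>lborel) \<partial>lborel)
       = (\<integral>\<^sup>+x. W x * ennreal (norm x ^ (?d * (?d - 1))) * (\<integral>\<^sup>+a. indicator A a * V a \<partial>lborel) \<partial>lborel)"
    proof (rule nn_integral_cong_AE, use AE_lborel_singleton[of 0] in eventually_elim)
      case (elim x)
      have "(\<integral>\<^sup>+a. indicator A a * (\<integral>\<^sup>+G. ennreal (Vker x a G) \<partial>lborel) \<partial>lborel) = (\<integral>\<^sup>+a. ennreal (norm x ^ (?d * (?d - 1))) * (indicator A a * V a) \<partial>lborel)"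
        unfolding nn_integral_Vker_axis[OF elim, of _ e] V_def by (simp only: mult_ac)
      also have "\<dots> = ennreal (norm x ^ (?d * (?d - 1))) * (\<integral>\<^sup>+a. indicator A a * V a \<partial>lborel)"
        by (rule nn_integral_cmult) measurable
      finally show ?case by (simp only: mult.assoc)
    qed
    also have "\<dots> = Cw * (\<integral>\<^sup>+a. indicator A a * V a \<partial>lborel)"
      unfolding Cw_def by (rule nn_integral_multc) measurable
    finally have 1: "(\<integral>\<^sup>+x. W x * (\<integral>\<^sup>+a. indicator A a * (\<integral>\<^sup>+G. ennreal (Vker x a G) \<partial>lborel) \<partial>lborel) \<partial>lborel) = Cw * (\<integral>\<^sup>+a. indicator A a * V a \<partial>lborel)" .
    have "ennreal (kap * cd * c) * (\<integral>\<^sup>+a. indicator A a * V a \<partial>lborel) = (\<integral>\<^sup>+a. ennreal (kap * cd * c) * (indicator A a * V a) \<partial>lborel)"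
      by (rule nn_integral_cmult[symmetric]) measurable
    also have "\<dots> = (\<integral>\<^sup>+a. Qdet e (axis e 1) * (indicator A a *
      ((\<integral>\<^sup>+s. ennreal (indicator {0<..} s * s ^ ?d * exp (- (s\<^sup>2 * (1 + a \<bullet> a)) / 2)) \<partial>lborel) *
       (\<integral>\<^sup>+y. ennreal (pwp y * exp (- qf a y / 2)) \<partial>(lborel :: (real ^ 'd) measure)))) \<partial>lborel)"
    proof (rule nn_integral_cong)
      fix a :: "real ^ 'd"
      have "ennreal (kap * cd * c) = ennreal kap * ennreal cd * ennreal c" using kap cd c by (simp add: ennreal_mult)
      then have "ennreal (kap * cd * c) * (indicator A a * V a) = ennreal kap * ennreal cd * indicator A a * (ennreal c * V a)"
        by (simp only: mult_ac)
      also have "ennreal c * V a = Qdet e (axis e 1) * (ennreal ((1 / sqrt (1 + a \<bullet> a)) ^ (?d + 1)) * (\<integral>\<^sup>+y. ennreal (pwp y * qf a y * exp (- qf a y / 2)) \<partial>lborel))"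
        unfolding c_def V_def by (rule nn_integral_Vker_eq)
      finally show "ennreal (kap * cd * c) * (indicator A a * V a) = Qdet e (axis e 1) * (indicator A a *
      ((\<integral>\<^sup>+s. ennreal (indicator {0<..} s * s ^ ?d * exp (- (s\<^sup>2 * (1 + a \<bullet> a)) / 2)) \<partial>lborel) *
       (\<integral>\<^sup>+y. ennreal (pwp y * exp (- qf a y / 2)) \<partial>(lborel :: (real ^ 'd) measure))))"
        unfolding rq ms[symmetric] by (simp only: mult_ac)
    qed
    also have "\<dots> = Qdet e (axis e 1) * (\<integral>\<^sup>+a. indicator A a *
      ((\<integral>\<^sup>+s. ennreal (indicator {0<..} s * s ^ ?d * exp (- (s\<^sup>2 * (1 + a \<bullet> a)) / 2)) \<partial>lborel) *
       (\<integral>\<^sup>+y. ennreal (pwp y * exp (- qf a y / 2)) \<partial>(lborel :: (real ^ 'd) measure))) \<partial>lborel)"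
      by (rule nn_integral_cmult) measurable
    also have "\<dots> = Qdet e (axis e 1) * Yint J" unfolding A_def Yint_eq ..
    finally have 2: "ennreal (kap * cd * c) * (\<integral>\<^sup>+a. indicator A a * V a \<partial>lborel) = Qdet e (axis e 1) * Yint J" .
    have "ennreal (kap * cd * c) * (ennreal k * (Cw * (\<integral>\<^sup>+a. indicator A a * V a \<partial>lborel)))
       = ennreal k * Cw * (ennreal (kap * cd * c) * (\<integral>\<^sup>+a. indicator A a * V a \<partial>lborel))" by (simp only: mult_ac)
    also have "\<dots> = ennreal k * Cw * Qdet e (axis e 1) * Yint J" unfolding 2 by (simp only: mult.assoc)
    finally show "ennreal (kap * cd * c) * (\<integral>\<^sup>+u. ennreal (gauss u) * (\<integral>\<^sup>+P. indicator (pos_tuples u J) P * W (ctr P) \<partial>lborel) \<partial>lborel)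
        = ennreal k * Cw * Qdet e (axis e 1) * Yint J"
      unfolding dt[OF W, of J] 1[unfolded A_def] by (simp only: A_def)
  qed
qed

section \<open>Powers of iterated sine integrals and a rational residue\<close>

text \<open>\<open>Sf j\<close> is the odd antiderivative of \<open>sin ^ (2 * j)\<close>, computed by the reduction formula, and
  \<open>Wr j\<close> is its value at \<open>pi / 2\<close>.\<close>

fun Sf :: "nat \<Rightarrow> complex \<Rightarrow> complex" where
  "Sf 0 w = w"
| "Sf (Suc j) w = (of_nat (2 * j + 1) * Sf j w - cos w * sin w ^ (2 * j + 1)) / of_nat (2 * j + 2)"

fun Wr :: "nat \<Rightarrow> real" where
  "Wr 0 = pi / 2"
| "Wr (Suc j) = real (2 * j + 1) / real (2 * j + 2) * Wr j"

lemma Sf_minus: "Sf j (- w) = - Sf j w"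
proof (induction j)
  case (Suc j)
  have "of_nat (2 * j + 1) * Sf j (- w) - cos (- w) * sin (- w) ^ (2 * j + 1) = - (of_nat (2 * j + 1) * Sf j w - cos w * sin w ^ (2 * j + 1))"
    unfolding Suc.IH by simp
  then show ?case by (simp only: Sf.simps divide_minus_left)
qed simp

lemma sin_plus_pi_complex: "sin (w + complex_of_real pi) = - sin w"
  by (simp add: sin_add sin_of_real cos_of_real)

lemma cos_plus_pi_complex: "cos (w + complex_of_real pi) = - cos w"
  by (simp add: cos_add sin_of_real cos_of_real)

text \<open>The correction term cos w sin^(2 j + 1) w has period pi, so the increment of
  \<open>Sf\<close> over a period obeys the recursion of \<open>Wr\<close>.\<close>

lemma Sf_plus_pi: "Sf j (w + complex_of_real pi) = Sf j w + 2 * complex_of_real (Wr j)"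
proof (induction j)
  case (Suc j)
  have "cos (w + complex_of_real pi) * sin (w + complex_of_real pi) ^ (2 * j + 1) = cos w * sin w ^ (2 * j + 1)"
    by (simp add: sin_plus_pi_complex cos_plus_pi_complex)
  then show ?case
    unfolding Sf.simps(2) Suc.IH Wr.simps by (simp add: divide_simps) (simp add: algebra_simps)
qed simp

text \<open>A shift by pi followed by oddness. At imaginary w this evaluates psi (t) + psi (- t),
  the factor of the coordinates outside J, where no dependence on x remains in the
  numerator.\<close>

lemma Sf_reflect:
  fixes w :: complex
  shows "Sf j (pi / 2 + w) + Sf j (pi / 2 - w) = 2 * complex_of_real (Wr j)"
proof -
  have "Sf j (pi / 2 + w) = Sf j ((w - pi / 2) + complex_of_real pi)"
    by (rule arg_cong[of _ _ "Sf j"]) (simp add: field_simps)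
  also have "\<dots> = Sf j (- (pi / 2 - w)) + 2 * complex_of_real (Wr j)"
    by (subst Sf_plus_pi) simp
  finally show ?thesis unfolding Sf_minus by simp
qed

lemma Wr_rational: "\<exists>q\<in>\<rat>. Wr j = q * pi"
proof (induction j)
  case 0
  show ?case by (rule bexI[of _ "1/2"]) auto
next
  case (Suc j)
  then obtain q where q: "q \<in> \<rat>" "Wr j = q * pi" by blast
  have "Wr (Suc j) = (real (2 * j + 1) / real (2 * j + 2) * q) * pi"
    unfolding Wr.simps q(2) by simp
  moreover have "real (2 * j + 1) / real (2 * j + 2) * q \<in> \<rat>"
    by (intro Rats_mult Rats_divide q Rats_of_nat)
  ultimately show ?case by blast
qed

lemma Sf_holomorphic [holomorphic_intros]:
  "f holomorphic_on A \<Longrightarrow> (\<lambda>w. Sf j (f w)) holomorphic_on A"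
  by (induction j) (auto intro!: holomorphic_intros)

lemma Sf_continuous [continuous_intros]:
  "continuous_on A f \<Longrightarrow> continuous_on A (\<lambda>w. Sf j (f w))"
  by (rule continuous_on_compose2[OF holomorphic_on_imp_continuous_on[OF Sf_holomorphic[of "\<lambda>w. w" UNIV]]]) auto

lemma norm_sin_le_exp_Im: "norm (sin z) \<le> exp \<bar>Im z\<bar>"
proof -
  have "norm (sin z) = norm (exp (\<i> * z) - exp (- (\<i> * z))) / 2"
    by (simp add: sin_exp_eq norm_divide norm_mult)
  also have "\<dots> \<le> (norm (exp (\<i> * z)) + norm (exp (- (\<i> * z)))) / 2"
    by (intro divide_right_mono norm_triangle_ineq4) auto
  also have "\<dots> \<le> (exp \<bar>Im z\<bar> + exp \<bar>Im z\<bar>) / 2"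
    by (intro divide_right_mono add_mono) (auto simp: norm_exp)
  finally show ?thesis by simp
qed

lemma norm_cos_le_exp_Im: "norm (cos z) \<le> exp \<bar>Im z\<bar>"
proof -
  have "norm (cos z) = norm (exp (\<i> * z) + exp (- (\<i> * z))) / 2"
    by (simp add: cos_exp_eq norm_divide norm_mult)
  also have "\<dots> \<le> (norm (exp (\<i> * z)) + norm (exp (- (\<i> * z)))) / 2"
    by (intro divide_right_mono norm_triangle_ineq) auto
  also have "\<dots> \<le> (exp \<bar>Im z\<bar> + exp \<bar>Im z\<bar>) / 2"
    by (intro divide_right_mono add_mono) (auto simp: norm_exp)
  finally show ?thesis by simp
qed

text \<open>The linear growth stems from the term w in \<open>Sf 0\<close>, the exponential one from
  the products of cosines and sines, of total degree at most 2 j.\<close>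

lemma norm_Sf_le: "norm (Sf j w) \<le> (real j + norm w) * exp (2 * real j * \<bar>Im w\<bar>)"
proof (induction j)
  case (Suc j)
  let ?e = "exp (2 * real (Suc j) * \<bar>Im w\<bar>)"
  have e: "exp (2 * real j * \<bar>Im w\<bar>) \<le> ?e" by (simp add: mult_right_mono)
  have "norm (cos w * sin w ^ (2 * j + 1)) \<le> exp \<bar>Im w\<bar> * exp \<bar>Im w\<bar> ^ (2 * j + 1)"
    unfolding norm_mult norm_power
    by (intro mult_mono power_mono norm_cos_le_exp_Im norm_sin_le_exp_Im) auto
  also have "\<dots> = ?e" by (simp add: exp_of_nat_mult[symmetric] exp_add[symmetric] algebra_simps)
  finally have 1: "norm (cos w * sin w ^ (2 * j + 1)) \<le> ?e" .
  have 2: "norm (Sf j w) \<le> (real j + norm w) * ?e"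
    using Suc.IH e by (meson add_nonneg_nonneg mult_left_mono norm_ge_zero of_nat_0_le_iff order_trans)
  have "norm (Sf (Suc j) w) \<le> (real (2 * j + 1) * norm (Sf j w) + norm (cos w * sin w ^ (2 * j + 1))) / real (2 * j + 2)"
    unfolding Sf.simps norm_divide norm_of_nat
    by (intro divide_right_mono order.trans[OF norm_triangle_ineq4]) (simp_all only: norm_mult norm_of_nat order_refl of_nat_0_le_iff)
  also have "\<dots> \<le> (real (2 * j + 1) * ((real j + norm w) * ?e) + ?e) / real (2 * j + 2)"
    by (intro divide_right_mono add_mono mult_left_mono 1 2) auto
  also have "\<dots> \<le> ((real (2 * j + 2)) * ((real (Suc j) + norm w) * ?e)) / real (2 * j + 2)"
  proof (intro divide_right_mono)
    have a: "real (2 * j + 1) * (real j + norm w) + 1 \<le> real (2 * j + 2) * (real (Suc j) + norm w)"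
      by (simp add: algebra_simps)
    show "real (2 * j + 1) * ((real j + norm w) * ?e) + ?e \<le> real (2 * j + 2) * ((real (Suc j) + norm w) * ?e)"
      using mult_right_mono[OF a, of ?e] by (simp add: algebra_simps)
  qed simp
  also have "\<dots> = (real (Suc j) + norm w) * ?e" by simp
  finally show ?case .
qed simp

lemma norm_sin_ge_exp_Im:
  assumes "\<bar>Im z\<bar> \<ge> 1"
  shows "norm (sin z) \<ge> exp \<bar>Im z\<bar> / 4"
proof -
  define y where "y = \<bar>Im z\<bar>"
  let ?y = y
  have y1: "y \<ge> 1" using assms by (simp add: y_def)
  have e1: "exp ?y \<ge> 2" using exp_ge_add_one_self[of ?y] y1 by linarith
  have e2: "exp (2 * ?y) = exp ?y * exp ?y" by (simp add: exp_add[symmetric])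
  have e4: "exp (2 * ?y) \<ge> 4" unfolding e2 using mult_mono[OF e1 e1] by simp
  have "norm (sin z) ^ 2 = (exp (2 * ?y) + inverse (exp (2 * ?y)) - 2 * cos (2 * Re z)) / 4"
    unfolding norm_sin_squared by (cases "Im z \<ge> 0") (auto simp: exp_minus y_def)
  also have "\<dots> \<ge> (exp (2 * ?y) - 2) / 4"
  proof -
    have "inverse (exp (2 * ?y)) \<ge> 0" by simp
    moreover have "(E - 2) / 4 \<le> (E + i - 2 * c) / 4" if "i \<ge> 0" "c \<le> 1" for E i c :: real
      using that by simp
    ultimately show ?thesis using cos_le_one by blast
  qed
  finally have "norm (sin z) ^ 2 \<ge> (exp (2 * ?y) - 2) / 4" .
  moreover have "(exp ?y / 4) ^ 2 = exp (2 * ?y) / 16" by (simp add: power2_eq_square e2)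
  ultimately have "(exp ?y / 4) ^ 2 \<le> norm (sin z) ^ 2" using e4 by (simp only: power_divide) simp
  then show ?thesis unfolding y_def by (rule power2_le_imp_le) simp
qed

text \<open>On the vertical sides cos (2 Re z) = -1 strengthens the bound, so that it holds down to
  the real axis.\<close>

lemma norm_sin_ge_exp_Im':
  assumes "Re z = pi / 2"
  shows "norm (sin z) \<ge> exp \<bar>Im z\<bar> / 4"
proof -
  define y where "y = \<bar>Im z\<bar>"
  let ?y = y
  have e2: "exp (2 * ?y) = exp ?y * exp ?y" by (simp add: exp_add[symmetric])
  have "norm (sin z) ^ 2 = (exp (2 * ?y) + inverse (exp (2 * ?y)) - 2 * cos (2 * Re z)) / 4"
    unfolding norm_sin_squared by (cases "Im z \<ge> 0") (auto simp: exp_minus y_def)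
  also have "\<dots> \<ge> exp (2 * ?y) / 4"
  proof -
    have "cos (2 * Re z) = -1" unfolding assms by simp
    moreover have "inverse (exp (2 * ?y)) \<ge> 0" by simp
    ultimately show ?thesis by simp
  qed
  finally have "norm (sin z) ^ 2 \<ge> exp (2 * ?y) / 4" .
  moreover have "(exp ?y / 4) ^ 2 = exp (2 * ?y) / 16" by (simp add: power2_eq_square e2)
  moreover have "exp (2 * ?y) \<ge> 0" by simp
  ultimately have "(exp ?y / 4) ^ 2 \<le> norm (sin z) ^ 2" by linarith
  then show ?thesis unfolding y_def by (rule power2_le_imp_le) simp
qed

text \<open>The numerator grows at most like a polynomial times exp (2 j l |y|) and the denominator
  at least like exp (n |y|), so an exponential decay is left. The weaker form C / (1 + y^2) is
  integrable along the vertical sides and vanishes in the limit on the horizontal ones.\<close>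

lemma Sf_quotient_bound:
  assumes "2 * j * l < n"
  obtains C where "C \<ge> 0"
    "\<And>z. \<bar>Re z\<bar> \<le> 2 \<Longrightarrow> norm (sin z) \<ge> exp \<bar>Im z\<bar> / 4 \<Longrightarrow>
       norm (Sf j z ^ l / sin z ^ n) \<le> C / (1 + (Im z)\<^sup>2)"
proof
  \<comment> \<open>\<open>a + \<bar>Im z\<bar>\<close> dominates both
    \<open>real j + norm z\<close> in the strip and the square root of
    \<open>1 + (Im z)\<^sup>2\<close>. Two extra powers for the latter explain the l + 2 in
    C.\<close>
  define a where "a = real j + 3"
  define C where "C = 4 ^ n * (fact (l + 2) * exp a)"
  show "C \<ge> 0" by (simp add: C_def)
  fix z assume re: "\<bar>Re z\<bar> \<le> 2" and s: "norm (sin z) \<ge> exp \<bar>Im z\<bar> / 4"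
  let ?y = "\<bar>Im z\<bar>"
  have z: "norm z \<le> 2 + ?y" using cmod_le[of z] re by linarith
  have "norm (Sf j z) \<le> (a + ?y) * exp (2 * real j * ?y)"
    by (rule order.trans[OF norm_Sf_le]) (intro mult_right_mono, use z in \<open>auto simp: a_def\<close>)
  then have 1: "norm (Sf j z) ^ l \<le> ((a + ?y) * exp (2 * real j * ?y)) ^ l"
    by (rule power_mono) simp
  have 2: "(exp ?y / 4) ^ n \<le> norm (sin z) ^ n" by (rule power_mono[OF s]) simp
  have "norm (Sf j z ^ l / sin z ^ n) \<le> ((a + ?y) * exp (2 * real j * ?y)) ^ l / (exp ?y / 4) ^ n"
    unfolding norm_divide norm_power by (intro frac_le 1 2) (auto simp: a_def)
  also have "\<dots> = 4 ^ n * (a + ?y) ^ l * (exp (2 * real j * ?y) ^ l / exp ?y ^ n)"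
    by (simp add: power_mult_distrib power_divide)
  also have "exp (2 * real j * ?y) ^ l / exp ?y ^ n = exp (real (2 * j * l) * ?y - real n * ?y)"
    by (simp add: exp_of_nat_mult[symmetric] exp_diff[symmetric] algebra_simps)
  also have "4 ^ n * (a + ?y) ^ l * exp (real (2 * j * l) * ?y - real n * ?y) \<le> 4 ^ n * (a + ?y) ^ l * exp (- ?y)"
  proof -
    have "real (2 * j * l) + 1 \<le> real n" using assms by linarith
    then have "(real (2 * j * l) + 1) * ?y \<le> real n * ?y" by (intro mult_right_mono) auto
    then have "real (2 * j * l) * ?y - real n * ?y \<le> - ?y" by (simp add: algebra_simps)
    then show ?thesis by (intro mult_left_mono) (auto simp: a_def)
  qed
  also have "\<dots> \<le> C / (1 + (Im z)\<^sup>2)"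
  proof -
    have "(a + ?y) ^ l * (1 + (Im z)\<^sup>2) \<le> (a + ?y) ^ l * (a + ?y) ^ 2"
    proof (intro mult_left_mono)
      have "1 + ?y * ?y \<le> (a + ?y) * (a + ?y)"
      proof -
        have "1 * 1 \<le> a * a" by (intro mult_mono) (auto simp: a_def)
        moreover have "a * ?y \<ge> 0" by (auto simp: a_def)
        ultimately show ?thesis by (simp add: algebra_simps)
      qed
      then show "1 + (Im z)\<^sup>2 \<le> (a + ?y) ^ 2" by (simp add: power2_eq_square)
    qed (simp add: a_def)
    also have "\<dots> = (a + ?y) ^ (l + 2)" by (simp add: power_add power2_eq_square)
    also have "\<dots> \<le> fact (l + 2) * exp (a + ?y)" by (rule power_le_fact_exp) (simp add: a_def)
    finally have "(a + ?y) ^ l * (1 + (Im z)\<^sup>2) \<le> fact (l + 2) * exp (a + ?y)" .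
    then have "(4 ^ n * exp (- ?y)) * ((a + ?y) ^ l * (1 + (Im z)\<^sup>2)) \<le> (4 ^ n * exp (- ?y)) * (fact (l + 2) * exp (a + ?y))"
      by (rule mult_left_mono) simp
    also have "\<dots> = C * (exp (- ?y) * exp ?y)" by (simp add: C_def exp_add)
    also have "\<dots> = C" by (simp add: exp_add[symmetric])
    finally have "4 ^ n * (a + ?y) ^ l * exp (- ?y) * (1 + (Im z)\<^sup>2) \<le> C" by (simp add: mult_ac)
    moreover have "1 + (Im z)\<^sup>2 > 0" by (simp add: add_pos_nonneg)
    ultimately show ?thesis by (simp add: pos_le_divide_eq)
  qed
  finally show "norm (Sf j z ^ l / sin z ^ n) \<le> C / (1 + (Im z)\<^sup>2)" .
qed

subsection \<open>Rationality of the residue\<close>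

definition rational_fps :: "complex fps \<Rightarrow> bool" where
  "rational_fps F \<longleftrightarrow> (\<forall>n. fps_nth F n \<in> \<rat>)"

lemma Rats_sum_complex: "(\<And>x. x \<in> A \<Longrightarrow> f x \<in> \<rat>) \<Longrightarrow> (sum f A :: complex) \<in> \<rat>"
  by (induction A rule: infinite_finite_induct) (auto intro: Rats_add)

lemma rational_fps_mult: "rational_fps F \<Longrightarrow> rational_fps G \<Longrightarrow> rational_fps (F * G)"
  by (auto simp: rational_fps_def fps_mult_nth intro!: Rats_sum_complex Rats_mult)

lemma rational_fps_diff: "rational_fps F \<Longrightarrow> rational_fps G \<Longrightarrow> rational_fps (F - G)"
  by (auto simp: rational_fps_def intro!: Rats_diff)

lemma rational_fps_const: "c \<in> \<rat> \<Longrightarrow> rational_fps (fps_const c)"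
  by (auto simp: rational_fps_def)

lemma rational_fps_one: "rational_fps 1"
  by (auto simp: rational_fps_def)

lemma rational_fps_power: "rational_fps F \<Longrightarrow> rational_fps (F ^ n)"
  by (induction n) (auto intro: rational_fps_mult rational_fps_one)

lemma Rats_fact: "(fact n :: complex) \<in> \<rat>"
  by (metis Rats_of_nat of_nat_fact)

lemma rational_fps_sin: "rational_fps (fps_sin 1)"
  unfolding rational_fps_def fps_sin_def
  by (auto intro!: Rats_divide Rats_power Rats_fact simp: Rats_minus_iff)

lemma rational_fps_cos: "rational_fps (fps_cos 1)"
  unfolding rational_fps_def fps_cos_def
  by (auto intro!: Rats_divide Rats_power Rats_fact simp: Rats_minus_iff)

text \<open>With constant coefficient 1 the recursion for the inverse series involves no
  division.\<close>

lemma rational_fps_inverse: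
  assumes F: "rational_fps F" and F0: "fps_nth F 0 = 1"
  shows "rational_fps (inverse F)"
proof -
  have inv: "F * inverse F = 1" using F0 by (simp add: inverse_mult_eq_1')
  have "fps_nth (inverse F) n \<in> \<rat>" for n
  proof (induction n rule: less_induct)
    case (less n)
    have "fps_nth (F * inverse F) n = (\<Sum>i=0..n. fps_nth F i * fps_nth (inverse F) (n - i))"
      by (rule fps_mult_nth)
    also have "\<dots> = fps_nth (inverse F) n + (\<Sum>i=1..n. fps_nth F i * fps_nth (inverse F) (n - i))"
      using F0 by (simp add: sum.atLeast_Suc_atMost)
    finally have "fps_nth (inverse F) n = fps_nth 1 n - (\<Sum>i=1..n. fps_nth F i * fps_nth (inverse F) (n - i))"
      unfolding inv by simp
    also have "\<dots> \<in> \<rat>"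
      using less F by (intro Rats_diff Rats_sum_complex Rats_mult) (auto simp: rational_fps_def)
    finally show ?case .
  qed
  then show ?thesis by (simp add: rational_fps_def)
qed

fun Sfps :: "nat \<Rightarrow> complex fps" where
  "Sfps 0 = fps_X"
| "Sfps (Suc j) = fps_const (1 / of_nat (2 * j + 2)) * (fps_const (of_nat (2 * j + 1)) * Sfps j - fps_cos 1 * fps_sin 1 ^ (2 * j + 1))"

lemma rational_Sfps: "rational_fps (Sfps j)"
proof (induction j)
  case 0
  show ?case by (auto simp: rational_fps_def fps_X_def)
next
  case (Suc j)
  have "1 / of_nat (2 * j + 2) \<in> (\<rat> :: complex set)" "of_nat (2 * j + 1) \<in> (\<rat> :: complex set)"
    by (intro Rats_divide Rats_1 Rats_of_nat)+
  then show ?case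
    unfolding Sfps.simps
    by (intro rational_fps_mult rational_fps_diff rational_fps_const rational_fps_power
        rational_fps_sin rational_fps_cos Suc.IH)
qed

lemma Sf_has_fps_expansion: "Sf j has_fps_expansion Sfps j"
proof (induction j)
  case 0
  show ?case using has_fps_expansion_fps_X by (simp add: Sf.simps(1)[abs_def])
next
  case (Suc j)
  have "(\<lambda>w. 1 / of_nat (2 * j + 2) * (of_nat (2 * j + 1) * Sf j w - cos w * sin w ^ (2 * j + 1))) has_fps_expansion Sfps (Suc j)"
    unfolding Sfps.simps by (intro fps_expansion_intros Suc.IH)
  moreover have "Sf (Suc j) = (\<lambda>w. 1 / of_nat (2 * j + 2) * (of_nat (2 * j + 1) * Sf j w - cos w * sin w ^ (2 * j + 1)))"
    by (rule HOL.ext) simp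
  ultimately show ?case by simp
qed

text \<open>sin w = w T(w), where T has rational coefficients and T(0) = 1. The residue is the
  coefficient of index n - 1 in S^l / T^n, a series with rational coefficients.\<close>

lemma residue_Sf_rational: "residue (\<lambda>w. Sf j w ^ l / sin w ^ n) 0 \<in> \<rat>"
proof (cases "n = 0")
  \<comment> \<open>For n = 0 the index n - 1 would be truncated; here the function is entire and
    the residue is 0.\<close>
  case True
  have "residue (\<lambda>w. Sf j w ^ l / sin w ^ n) 0 = 0"
    by (rule residue_holo[of UNIV]) (auto simp: True intro!: holomorphic_intros)
  then show ?thesis by simp
next
  case False
  define T :: "complex fps" where "T = fps_shift 1 (fps_sin 1)"
  have sinT: "fps_sin 1 = fps_X * T"
    by (rule fps_ext) (auto simp: T_def fps_sin_def)
  have T0: "fps_nth T 0 = 1" by (simp add: T_def fps_sin_def)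
  have ratT: "rational_fps T"
    using rational_fps_sin by (auto simp: rational_fps_def T_def)
  define R where "R = Sfps j ^ l * inverse (T ^ n)"
  have ratR: "rational_fps R" unfolding R_def
    by (intro rational_fps_mult rational_fps_power rational_fps_inverse rational_Sfps ratT) (simp add: fps_nth_power_0 T0)
  define L where "L = fps_to_fls (Sfps j) ^ l / fps_to_fls (fps_sin 1) ^ n"
  have L: "(\<lambda>w. Sf j w ^ l / sin w ^ n) has_laurent_expansion L"
    unfolding L_def
    by (intro has_laurent_expansion_divide has_laurent_expansion_power has_laurent_expansion_fps
        Sf_has_fps_expansion has_fps_expansion_sin')
  have tt: "fps_to_fls (inverse (T ^ n)) * fps_to_fls T ^ n = 1"
  proof -
    have "inverse (T ^ n) * T ^ n = 1" by (rule inverse_mult_eq_1) (simp add: fps_nth_power_0 T0)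
    then show ?thesis by (metis fls_times_fps_to_fls fps_to_fls_power fps_one_to_fls)
  qed
  then have tn0: "fps_to_fls T ^ n \<noteq> 0" using T0 by auto
  have x0: "(fls_X :: complex fls) ^ n \<noteq> 0" by simp
  have "fls_X ^ n * L = fps_to_fls R"
  proof -
    have "fps_to_fls (fps_sin 1) ^ n = fls_X ^ n * fps_to_fls T ^ n"
      by (simp add: sinT fls_times_fps_to_fls power_mult_distrib)
    then have "fls_X ^ n * L = fps_to_fls (Sfps j) ^ l / fps_to_fls T ^ n"
      unfolding L_def using x0 by simp
    also have "\<dots> = fps_to_fls (Sfps j) ^ l * fps_to_fls (inverse (T ^ n))"
      using tt tn0 by (simp add: divide_eq_eq mult.assoc)
    finally show ?thesis by (simp add: R_def fls_times_fps_to_fls fps_to_fls_power)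
  qed
  then have "fls_shift (- int n) L = fps_to_fls R" by (simp add: fls_X_power_times_conv_shift)
  then have "fls_nth (fls_shift (- int n) L) (int n - 1) = fls_nth (fps_to_fls R) (int n - 1)" by simp
  then have "fls_residue L = fps_nth R (n - 1)" using False by (simp add: nat_diff_distrib')
  then show ?thesis
    using has_laurent_expansion_residue_0[OF L] ratR by (simp add: rational_fps_def)
qed

lemma sin_zero_strip:
  assumes "\<bar>Re z\<bar> < pi" "sin z = 0"
  shows "z = (0 :: complex)"
proof -
  obtain n :: int where n: "z = complex_of_real (of_int n * pi)"
    using assms(2) unfolding sin_eq_0 by (auto simp: mult.commute)
  have "\<bar>real_of_int n\<bar> * pi < 1 * pi" using assms(1) unfolding n by (simp add: abs_mult)
  then have "\<bar>real_of_int n\<bar> < 1" by (simp only: mult_less_cancel_right_pos pi_gt_zero)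
  then have "n = 0" by linarith
  then show ?thesis using n by simp
qed

lemma sin_cos_half_pi:
  "sin (Complex (pi / 2) x) = of_real (cosh x)" "cos (Complex (pi / 2) x) = - \<i> * of_real (sinh x)"
proof -
  have c: "Complex (pi / 2) x = of_real (pi / 2) + \<i> * of_real x" by (simp add: complex_eq_iff)
  have 1: "cos (\<i> * of_real x) = complex_of_real (cosh x)"
    by (simp add: cosh_conv_cos[symmetric] cosh_def scaleR_conv_of_real exp_of_real[symmetric])
  have "- \<i> * sin (\<i> * of_real x) = complex_of_real (sinh x)"
    by (subst sinh_conv_sin[symmetric]) (simp add: sinh_def scaleR_conv_of_real exp_of_real[symmetric])
  then have 2: "sin (\<i> * of_real x) = \<i> * complex_of_real (sinh x)" by (auto simp: complex_eq_iff)
  have s: "sin (complex_of_real (pi / 2)) = 1" "cos (complex_of_real (pi / 2)) = 0"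
    by (simp_all only: sin_of_real cos_of_real sin_pi_half cos_pi_half of_real_1 of_real_0)
  show "sin (Complex (pi / 2) x) = of_real (cosh x)" unfolding c sin_add s 1 2 by simp
  show "cos (Complex (pi / 2) x) = - \<i> * of_real (sinh x)" unfolding c cos_add s 1 2 by simp
qed

text \<open>The rectangle of width pi encloses the only pole 0. Its two vertical sides contribute
  the same amount by parity, each \<open>\<i>\<close> times the integral of F over a bounded
  interval, while the horizontal sides vanish in the limit; dividing 2 pi \<open>\<i>\<close> times
  the residue by 2 \<open>\<i>\<close> leaves pi times a rational number.\<close>

lemma Sf_over_cosh_integral:
  fixes F :: "real \<Rightarrow> complex"
  assumes l: "odd l" and n: "even n" and ln: "2 * j * l < n"
  defines "F \<equiv> (\<lambda>x. Sf j (Complex (pi / 2) x) ^ l / complex_of_real (cosh x ^ n))"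
  shows "integrable lborel F"
    and "\<exists>q\<in>\<rat>. (\<integral>x. F x \<partial>lborel) = complex_of_real (q * pi)"
proof -
  define f where "f z = Sf j z ^ l / sin z ^ n" for z
  have Ff: "F x = f (Complex (pi / 2) x)" for x
    by (simp add: F_def f_def sin_cos_half_pi)
  obtain C where C: "C \<ge> 0" and bd: "\<And>z. \<bar>Re z\<bar> \<le> 2 \<Longrightarrow> norm (sin z) \<ge> exp \<bar>Im z\<bar> / 4 \<Longrightarrow> norm (f z) \<le> C / (1 + (Im z)\<^sup>2)"
    using Sf_quotient_bound[OF ln] unfolding f_def by metis
  have pi2: "pi / 2 \<le> 2" using pi_less_4 by simp
  have Fbd: "norm (F x) \<le> C / (1 + x\<^sup>2)" for x
    unfolding Ff using bd[of "Complex (pi / 2) x"] norm_sin_ge_exp_Im'[of "Complex (pi / 2) x"] pi2 by simp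
  have contF: "continuous_on UNIV F"
    unfolding F_def by (intro continuous_intros) (auto simp: Complex_eq intro!: continuous_intros)
  have [measurable]: "F \<in> borel_measurable borel" by (rule borel_measurable_continuous_onI[OF contF])
  have int1: "integrable lborel (\<lambda>x::real. C / (1 + x\<^sup>2))"
  proof -
    have "integrable lborel (\<lambda>x::real. 1 / (1 + x\<^sup>2))"
      by (rule integrableI_nonneg) (use nn_integral_inverse_1_plus_square in \<open>auto simp: add_nonneg_nonneg\<close>)
    from integrable_mult_right[OF this, of C] show ?thesis by simp
  qed
  show intF: "integrable lborel F"
    by (rule Bochner_Integration.integrable_bound[OF int1]) (use Fbd C in \<open>auto intro!: AE_I2 simp: add_nonneg_nonneg\<close>)
  define Res where "Res = residue f 0"
  \<comment> \<open>Doubling the strip gives an open domain that contains the rectangle with its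
    boundary and in which 0 is still the only zero of sin.\<close>
  have holo: "f holomorphic_on {z. \<bar>Re z\<bar> < pi} - {0}"
    unfolding f_def by (intro holomorphic_intros) (use sin_zero_strip in auto)
  have fodd: "f (- z) = - f z" for z
    using l n by (simp add: f_def Sf_minus power_minus_odd)
  have main: "norm (2 * \<i> * integral {- real N..real N} F - 2 * pi * \<i> * Res) \<le> 2 * pi * C / (1 + (real N)\<^sup>2)"
    if N: "N \<ge> 1" for N :: nat
  proof -
    let ?X = "real N"
    define a1 where "a1 = Complex (- pi / 2) (- ?X)"
    define a2 where "a2 = Complex (pi / 2) (- ?X)"
    define a3 where "a3 = Complex (pi / 2) ?X"
    define a4 where "a4 = Complex (- pi / 2) ?X"
    note a_def = a1_def a2_def a3_def a4_def
    have rp: "rectpath a1 a3 = linepath a1 a2 +++ linepath a2 a3 +++ linepath a3 a4 +++ linepath a4 a1"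
      by (simp add: rectpath_def a_def Let_def)
    have half_pi: "x * 2 = pi \<Longrightarrow> - (pi / 2) \<le> x" for x using pi_gt_zero by linarith
    have im: "path_image (rectpath a1 a3) \<subseteq> {z. \<bar>Re z\<bar> < pi} - {0}"
      proof (rule subsetI)
      fix z assume "z \<in> path_image (rectpath a1 a3)"
      then have "- (pi / 2) \<le> Re z \<and> Re z \<le> pi / 2 \<and> (Im z = ?X \<or> Im z = - ?X \<or> Re z = pi / 2 \<or> Re z = - (pi / 2))"
        by (subst (asm) path_image_rectpath) (auto simp: a_def intro: order.trans[of _ 0] dest: half_pi)
      then have "- (pi / 2) \<le> Re z" "Re z \<le> pi / 2" "z \<noteq> 0" using N by auto
      moreover from this have "\<bar>Re z\<bar> < pi" using pi_gt_zero by linarith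
      ultimately have "\<bar>Re z\<bar> < pi" "z \<noteq> 0" by auto
      then show "z \<in> {z. \<bar>Re z\<bar> < pi} - {0}" by simp
    qed
    have segs: "closed_segment a1 a2 \<subseteq> {z. \<bar>Re z\<bar> < pi} - {0}" "closed_segment a2 a3 \<subseteq> {z. \<bar>Re z\<bar> < pi} - {0}"
      "closed_segment a3 a4 \<subseteq> {z. \<bar>Re z\<bar> < pi} - {0}" "closed_segment a4 a1 \<subseteq> {z. \<bar>Re z\<bar> < pi} - {0}"
      using im unfolding rp by (auto simp: path_image_join)
    have cont: "continuous_on ({z. \<bar>Re z\<bar> < pi} - {0}) f" by (rule holomorphic_on_imp_continuous_on[OF holo])
    note ci = contour_integrable_continuous_linepath[OF continuous_on_subset[OF cont]]
    have "contour_integral (rectpath a1 a3) f = 2 * pi * \<i> * (\<Sum>p\<in>{0}. winding_number (rectpath a1 a3) p * residue f p)"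
    proof (rule Residue_theorem[of "{z. \<bar>Re z\<bar> < pi}"])
      have s: "{z. \<bar>Re z\<bar> < pi} = {z. Re z < pi} \<inter> {z. Re z > - pi}" by (auto simp: abs_less_iff)
      show "open {z. \<bar>Re z\<bar> < pi}"
        unfolding s by (intro open_Int open_halfspace_Re_lt open_halfspace_Re_gt)
      show "connected {z. \<bar>Re z\<bar> < pi}"
        unfolding s by (intro convex_connected convex_Int convex_halfspace_Re_lt convex_halfspace_Re_gt)
      show "\<forall>z. z \<notin> {z. \<bar>Re z\<bar> < pi} \<longrightarrow> winding_number (rectpath a1 a3) z = 0"
      proof (intro allI impI winding_number_rectpath_outside)
        fix z assume "z \<notin> {z. \<bar>Re z\<bar> < pi}"
        then have "\<not> \<bar>Re z\<bar> < pi" by simp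
        then have "\<not> (- (pi / 2) \<le> Re z \<and> Re z \<le> pi / 2)" using pi_gt_zero by linarith
        then show "z \<notin> cbox a1 a3" by (auto simp: a_def in_cbox_complex_iff)
      qed (auto simp: a_def)
    qed (use holo im in auto)
    moreover have "winding_number (rectpath a1 a3) 0 = 1"
      using N by (intro winding_number_rectpath) (auto simp: a_def in_box_complex_iff)
    ultimately have 1: "contour_integral (rectpath a1 a3) f = 2 * pi * \<i> * Res" by (simp add: Res_def)
    have 2: "contour_integral (rectpath a1 a3) f = contour_integral (linepath a1 a2) f + (contour_integral (linepath a2 a3) f
        + (contour_integral (linepath a3 a4) f + contour_integral (linepath a4 a1) f))"
      unfolding rp using ci segs by (simp add: contour_integrable_joinI)
    have 3: "contour_integral (linepath a2 a3) f = \<i> * integral {-?X..?X} F"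
      unfolding Ff by (rule contour_integral_linepath_same_Re) (use N in \<open>auto simp: a_def\<close>)
    \<comment> \<open>Two signs cancel: the side is traversed downwards, and f is odd.\<close>
    have 4: "contour_integral (linepath a4 a1) f = \<i> * integral {-?X..?X} F"
    proof -
      have "contour_integral (linepath a4 a1) f = - contour_integral (linepath a1 a4) f"
        by (rule contour_integral_reverse_linepath)
           (use segs(4) in \<open>intro continuous_on_subset[OF cont], simp add: closed_segment_commute\<close>)
      also have "contour_integral (linepath a1 a4) f = \<i> * integral {-?X..?X} (\<lambda>x. f (Complex (- pi / 2) x))"
        by (rule contour_integral_linepath_same_Re) (use N in \<open>auto simp: a_def\<close>)
      also have "(\<lambda>x. f (Complex (- pi / 2) x)) = (\<lambda>x. - F (- x))"
      proof (rule HOL.ext)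
        fix x show "f (Complex (- pi / 2) x) = - F (- x)"
          unfolding Ff fodd[symmetric] by (rule arg_cong[of _ _ f]) (simp add: complex_eq_iff)
      qed
      also have "integral {-?X..?X} (\<lambda>x. - F (- x)) = - integral {-?X..?X} F"
        using Henstock_Kurzweil_Integration.integral_reflect_real[of ?X "- ?X" F] by simp
      finally show ?thesis by simp
    qed
    have hor: "norm (contour_integral (linepath p q) f) \<le> C / (1 + ?X\<^sup>2) * norm (q - p)"
      if s: "closed_segment p q \<subseteq> {z. \<bar>Re z\<bar> < pi} - {0}" and y: "Im p = y" "Im q = y" "\<bar>y\<bar> = ?X"
        and x: "\<bar>Re p\<bar> \<le> 2" "\<bar>Re q\<bar> \<le> 2" for p q y
    proof (rule contour_integral_bound_linepath)
      show "f contour_integrable_on linepath p q" by (rule ci[OF s])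
      show "0 \<le> C / (1 + ?X\<^sup>2)" using C by (simp add: add_nonneg_nonneg)
      fix z assume "z \<in> closed_segment p q"
      then obtain t where t: "0 \<le> t" "t \<le> 1" "z = (1 - t) *\<^sub>R p + t *\<^sub>R q" by (auto simp: closed_segment_def)
      have imz: "Im z = y" unfolding t(3) by (simp add: y algebra_simps)
      have "\<bar>Re z\<bar> \<le> (1 - t) * \<bar>Re p\<bar> + t * \<bar>Re q\<bar>"
        unfolding t(3) using t(1,2) by (simp add: order.trans[OF abs_triangle_ineq] abs_mult)
      also have "\<dots> \<le> (1 - t) * 2 + t * 2" using t x by (intro add_mono mult_left_mono) auto
      finally have rez: "\<bar>Re z\<bar> \<le> 2" by simp
      have "\<bar>Im z\<bar> \<ge> 1" using imz y(3) N by simp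
      from bd[OF rez norm_sin_ge_exp_Im[OF this]] show "norm (f z) \<le> C / (1 + ?X\<^sup>2)"
        using imz y(3) by (metis power2_abs)
    qed
    have "norm (contour_integral (linepath a1 a2) f) \<le> C / (1 + ?X\<^sup>2) * norm (a2 - a1)"
      using pi2 by (intro hor[of _ _ "- ?X"] segs) (auto simp: a_def)
    moreover have "norm (contour_integral (linepath a3 a4) f) \<le> C / (1 + ?X\<^sup>2) * norm (a4 - a3)"
      using pi2 by (intro hor[of _ _ "?X"] segs) (auto simp: a_def)
    moreover have "norm (a2 - a1) = pi" "norm (a4 - a3) = pi"
      by (simp_all add: a_def cmod_def power2_eq_square)
    ultimately have "norm (contour_integral (linepath a1 a2) f + contour_integral (linepath a3 a4) f) \<le> C / (1 + ?X\<^sup>2) * pi + C / (1 + ?X\<^sup>2) * pi"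
      by (intro order.trans[OF norm_triangle_ineq] add_mono) auto
    also have "\<dots> = 2 * pi * C / (1 + ?X\<^sup>2)" by simp
    finally have 5: "norm (contour_integral (linepath a1 a2) f + contour_integral (linepath a3 a4) f) \<le> 2 * pi * C / (1 + ?X\<^sup>2)" .
    have "2 * \<i> * integral {- ?X..?X} F - 2 * pi * \<i> * Res = - (contour_integral (linepath a1 a2) f + contour_integral (linepath a3 a4) f)"
      using 1 2 3 4 by (simp add: algebra_simps)
    then show ?thesis using 5 by (simp only: norm_minus_cancel)
  qed
  have lim1: "(\<lambda>N. integral {- real N..real N} F) \<longlonglongrightarrow> (\<integral>x. F x \<partial>lborel)"
  proof -
    have eq: "integral {- real N..real N} F = (\<integral>x. indicator {- real N..real N} x *\<^sub>R F x \<partial>lborel)" for N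
    proof -
      have "set_integrable lborel {- real N..real N} F"
        unfolding set_integrable_def by (rule integrable_mult_indicator[OF _ intF]) simp
      from set_borel_integral_eq_integral(2)[OF this] show ?thesis by (simp add: set_lebesgue_integral_def)
    qed
    show ?thesis unfolding eq
    proof (rule integral_dominated_convergence[where w = "\<lambda>x. norm (F x)"])
      show "AE x in lborel. (\<lambda>N. indicator {- real N..real N} x *\<^sub>R F x) \<longlonglongrightarrow> F x"
      proof (rule AE_I2)
        fix x
        obtain N0 :: nat where N0: "\<bar>x\<bar> \<le> real N0" using real_arch_simple by blast
        show "(\<lambda>N. indicator {- real N..real N} x *\<^sub>R F x) \<longlonglongrightarrow> F x"
          by (rule tendsto_eventually, rule eventually_sequentiallyI[of N0]) (use N0 in \<open>auto simp: indicator_def abs_le_iff\<close>)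
      qed
      show "AE x in lborel. norm (indicator {- real N..real N} x *\<^sub>R F x) \<le> norm (F x)" for N
        by (rule AE_I2) (auto simp: indicator_def)
    qed (use intF in auto)
  qed
  have lim2: "(\<lambda>N. 2 * \<i> * integral {- real N..real N} F - 2 * pi * \<i> * Res) \<longlonglongrightarrow> 0"
  proof (rule Lim_null_comparison)
    show "\<forall>\<^sub>F N in sequentially. norm (2 * \<i> * integral {- real N..real N} F - 2 * pi * \<i> * Res) \<le> 2 * pi * C / (1 + (real N)\<^sup>2)"
      by (rule eventually_sequentiallyI[of 1]) (rule main)
    show "(\<lambda>N. 2 * pi * C / (1 + (real N)\<^sup>2)) \<longlonglongrightarrow> 0" by real_asymp
  qed
  have "(\<lambda>N. 2 * \<i> * integral {- real N..real N} F - 2 * pi * \<i> * Res) \<longlonglongrightarrow> 2 * \<i> * (\<integral>x. F x \<partial>lborel) - 2 * pi * \<i> * Res"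
    by (intro tendsto_intros lim1)
  from LIMSEQ_unique[OF this lim2] have "2 * \<i> * (\<integral>x. F x \<partial>lborel) = 2 * \<i> * (pi * Res)" by simp
  then have val: "(\<integral>x. F x \<partial>lborel) = pi * Res" by simp
  have "Res \<in> \<rat>" unfolding Res_def f_def by (rule residue_Sf_rational)
  then obtain r :: rat where r: "Res = of_rat r" by (rule Rats_cases)
  have "Res = complex_of_real (of_rat r)" unfolding r by (cases r) (simp add: of_rat_rat)
  then have "(\<integral>x. F x \<partial>lborel) = complex_of_real (of_rat r * pi)" unfolding val by simp
  then show "\<exists>q\<in>\<rat>. (\<integral>x. F x \<partial>lborel) = complex_of_real (q * pi)" by (intro bexI[of _ "of_rat r"]) auto
qed

subsection \<open>Closed form of a Gaussian double integral\<close>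

lemma half_line_FTC:
  fixes F f :: "real \<Rightarrow> complex"
  assumes F: "\<And>x. x \<ge> 0 \<Longrightarrow> (F has_vector_derivative f x) (at x)"
    and f: "\<And>x. x > 0 \<Longrightarrow> isCont f x"
    and int: "set_integrable lborel {0<..} f"
    and lim: "(F \<longlongrightarrow> B) at_top"
  shows "(LBINT x:{0<..}. f x) = B - F 0"
proof -
  have e: "einterval 0 \<infinity> = {0<..}" by (auto simp: einterval_def)
  have "(LBINT x=0..\<infinity>. f x) = B - F 0"
  proof (rule interval_integral_FTC_integrable)
    have "isCont F 0" using F[of 0] by (simp add: has_vector_derivative_continuous)
    then have "(F \<longlongrightarrow> F 0) (at_right 0)" by (simp add: isCont_def filterlim_at_split)
    then show "((F \<circ> real_of_ereal) \<longlongrightarrow> F 0) (at_right 0)"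
      unfolding zero_ereal_def ereal_tendsto_simps1 .
    show "((F \<circ> real_of_ereal) \<longlongrightarrow> B) (at_left \<infinity>)" unfolding ereal_tendsto_simps1 by (rule lim)
    show "set_integrable lborel (einterval 0 \<infinity>) f" unfolding e by (rule int)
  qed (use F f in \<open>auto simp: zero_ereal_def\<close>)
  then show ?thesis by (simp add: interval_lebesgue_integral_def e)
qed

lemma power_exp_square_tendsto_0:
  "((\<lambda>y::real. y ^ (2 * n) * exp (- (y\<^sup>2 / 2))) \<longlongrightarrow> 0) at_top"
proof -
  have "filterlim (\<lambda>y::real. y\<^sup>2 / 2) at_top at_top" by real_asymp
  from filterlim_compose[OF tendsto_power_div_exp_0[of n] this]
  have "((\<lambda>y::real. 2 ^ n * ((y\<^sup>2 / 2) ^ n / exp (y\<^sup>2 / 2))) \<longlongrightarrow> 2 ^ n * 0) at_top"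
    by (intro tendsto_intros)
  moreover have "(\<lambda>y::real. 2 ^ n * ((y\<^sup>2 / 2) ^ n / exp (y\<^sup>2 / 2))) = (\<lambda>y. y ^ (2 * n) * exp (- (y\<^sup>2 / 2)))"
  proof (rule HOL.ext)
    fix y :: real
    have "2 ^ n * ((y\<^sup>2 / 2) ^ n / exp (y\<^sup>2 / 2)) = (y\<^sup>2) ^ n / exp (y\<^sup>2 / 2)" by (simp add: power_divide)
    also have "\<dots> = y ^ (2 * n) * exp (- (y\<^sup>2 / 2))" by (simp only: exp_minus divide_inverse power_mult)
    finally show "2 ^ n * ((y\<^sup>2 / 2) ^ n / exp (y\<^sup>2 / 2)) = y ^ (2 * n) * exp (- (y\<^sup>2 / 2))" .
  qed
  ultimately show ?thesis by simp
qed

lemma moment_integrable: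
  assumes "Re z \<ge> 1"
  shows "set_integrable lborel {0<..} (\<lambda>y::real. of_real (y ^ n) * exp (- (of_real (y\<^sup>2) * z / 2)))"
proof -
  have "integrable lborel (\<lambda>x::real. indicator {0<..} x * x ^ n * exp (- x\<^sup>2 / 2))"
    by (rule integrableI_nonneg) (use nn_integral_moment_finite[of n] in \<open>auto simp: indicator_def\<close>)
  then show ?thesis unfolding set_integrable_def
  proof (rule Bochner_Integration.integrable_bound)
    show "AE x in lborel. norm (indicator {0<..} x *\<^sub>R (complex_of_real (x ^ n) * exp (- (of_real (x\<^sup>2) * z / 2)))) \<le>
        norm (indicator {0<..} x * x ^ n * exp (- x\<^sup>2 / 2))"
    proof (rule AE_I2)
      fix x :: real
      have "x\<^sup>2 * 1 \<le> x\<^sup>2 * Re z" by (intro mult_left_mono assms) simp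
      then have "norm (exp (- (complex_of_real (x\<^sup>2) * z / 2))) \<le> exp (- x\<^sup>2 / 2)"
        by (simp add: norm_exp)
      then show "norm (indicator {0<..} x *\<^sub>R (complex_of_real (x ^ n) * exp (- (of_real (x\<^sup>2) * z / 2)))) \<le>
        norm (indicator {0<..} x * x ^ n * exp (- x\<^sup>2 / 2))"
        by (auto simp: indicator_def norm_mult norm_power intro!: mult_left_mono)
    qed
  qed measurable
qed

text \<open>Integrating the derivative of y^(2 n) exp (- y^2 z / 2) / z relates consecutive odd
  moments by the factor 2 n / z. Complex z occurs because \<open>Dq\<close> will take its place; its
  real part is at least 1.\<close>

lemma odd_moment:
  assumes z: "Re z \<ge> 1"
  shows "(LBINT y:{0<..}. of_real (y ^ (2 * n + 1)) * exp (- (of_real (y\<^sup>2) * z / 2))) = 2 ^ n * fact n / z ^ (n + 1)"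
proof -
  have z0: "z \<noteq> 0" using z by auto
  have D: "((\<lambda>y::real. - (of_real (y ^ (2 * n)) * exp (- (of_real (y\<^sup>2) * z / 2)) / z)) has_vector_derivative
       (of_real (y ^ (2 * n + 1)) * exp (- (of_real (y\<^sup>2) * z / 2)) - of_nat (2 * n) / z * (of_real (y ^ (2 * n - 1)) * exp (- (of_real (y\<^sup>2) * z / 2))))) (at y)"
    for n and y :: real
  proof -
    have "((\<lambda>w. - (w ^ (2 * n) * exp (- (w\<^sup>2 * z / 2)) / z)) has_field_derivative
       (w ^ (2 * n + 1) * exp (- (w\<^sup>2 * z / 2)) - of_nat (2 * n) / z * (w ^ (2 * n - 1) * exp (- (w\<^sup>2 * z / 2))))) (at w)" for w
      using z0 by (auto intro!: derivative_eq_intros simp: field_simps)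
    from has_vector_derivative_real_field[OF this] show ?thesis by simp
  qed
  have lim: "((\<lambda>y::real. - (of_real (y ^ (2 * n)) * exp (- (of_real (y\<^sup>2) * z / 2)) / z)) \<longlongrightarrow> 0) at_top" for n
  proof (rule Lim_null_comparison)
    have "((\<lambda>y::real. y ^ (2 * n) * exp (- (y\<^sup>2 / 2)) / norm z) \<longlongrightarrow> 0 / norm z) at_top"
      using z0 by (intro tendsto_intros power_exp_square_tendsto_0) auto
    then show "((\<lambda>y::real. y ^ (2 * n) * exp (- (y\<^sup>2 / 2)) / norm z) \<longlongrightarrow> 0) at_top" by simp
    show "\<forall>\<^sub>F y in at_top. norm (- (complex_of_real (y ^ (2 * n)) * exp (- (of_real (y\<^sup>2) * z / 2)) / z)) \<le> y ^ (2 * n) * exp (- (y\<^sup>2 / 2)) / norm z"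
      using eventually_ge_at_top[of 0]
    proof eventually_elim
      case (elim y)
      have "y\<^sup>2 * 1 \<le> y\<^sup>2 * Re z" by (intro mult_left_mono z) simp
      then have "norm (exp (- (complex_of_real (y\<^sup>2) * z / 2))) \<le> exp (- (y\<^sup>2 / 2))"
        by (simp add: norm_exp)
      then show ?case
        using elim by (auto simp: norm_mult norm_divide norm_power intro!: divide_right_mono mult_left_mono)
    qed
  qed
  \<comment> \<open>At n = 0 the truncated exponent 2 n - 1 is multiplied by 0, and the boundary
    value at 0 is 1 / z; for n > 0 the boundary value vanishes.\<close>
  have FTC: "(LBINT y:{0<..}. (of_real (y ^ (2 * n + 1)) * exp (- (of_real (y\<^sup>2) * z / 2)) - of_nat (2 * n) / z * (of_real (y ^ (2 * n - 1)) * exp (- (of_real (y\<^sup>2) * z / 2)))))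
      = 0 - - (of_real (0 ^ (2 * n)) * exp (- (of_real (0\<^sup>2) * z / 2)) / z)" for n
  proof (rule half_line_FTC[OF D _ _ lim])
    show "set_integrable lborel {0<..} (\<lambda>y. complex_of_real (y ^ (2 * n + 1)) * exp (- (of_real (y\<^sup>2) * z / 2)) - of_nat (2 * n) / z * (of_real (y ^ (2 * n - 1)) * exp (- (of_real (y\<^sup>2) * z / 2))))"
      by (intro set_integral_diff set_integrable_mult_right moment_integrable z)
    show "isCont (\<lambda>y. complex_of_real (y ^ (2 * n + 1)) * exp (- (of_real (y\<^sup>2) * z / 2)) - of_nat (2 * n) / z * (of_real (y ^ (2 * n - 1)) * exp (- (of_real (y\<^sup>2) * z / 2)))) y" for y
      by (intro continuous_intros) (simp_all add: z0)
  qed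
  show ?thesis
  proof (induction n)
    case 0
    show ?case using FTC[of 0] by simp
  next
    case (Suc n)
    have "(LBINT y:{0<..}. of_real (y ^ (2 * Suc n + 1)) * exp (- (of_real (y\<^sup>2) * z / 2))) - of_nat (2 * Suc n) / z * (LBINT y:{0<..}. of_real (y ^ (2 * n + 1)) * exp (- (of_real (y\<^sup>2) * z / 2))) = 0"
      using FTC[of "Suc n"]
      by (subst (asm) set_integral_diff(2)) (auto intro!: set_integrable_mult_right moment_integrable z simp del: power_Suc of_real_power)
    then show ?case unfolding Suc.IH using z0 by (simp add: field_simps)
  qed
qed

text \<open>In the double integral for psi at y, writing b as z times the other variable v turns the
  exponent into - v^2 \<open>Dq y z\<close> / 2.\<close>

definition Dq :: "real \<Rightarrow> complex \<Rightarrow> complex" where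
  "Dq y z = 1 + z\<^sup>2 - 2 * \<i> * of_real y * z"

definition Iq :: "nat \<Rightarrow> real \<Rightarrow> complex" where
  "Iq j y = (LBINT t:{0<..}. 1 / Dq y (of_real t) ^ (j + 1))"

lemma Re_Dq: "Re (Dq y (of_real t)) = 1 + t\<^sup>2"
  by (simp add: Dq_def power2_eq_square)

lemma norm_Dq_ge: "norm (Dq y (of_real t)) \<ge> 1 + t\<^sup>2"
  using complex_Re_le_cmod[of "Dq y (of_real t)"] by (simp add: Re_Dq)

lemma Dq_nonzero: "Dq y (of_real t) \<noteq> 0"
  using Re_Dq[of y t] by (metis add_pos_nonneg less_irrefl zero_complex.simps(1) zero_le_power2 zero_less_one)

lemma Dq_continuous [continuous_intros]: "continuous F f \<Longrightarrow> continuous F (\<lambda>x. Dq y (f x))"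
  unfolding Dq_def by (intro continuous_intros)

lemma inverse_1_plus_square_integrable: "integrable lborel (\<lambda>x::real. 1 / (1 + x\<^sup>2))"
  by (rule integrableI_nonneg) (use nn_integral_inverse_1_plus_square in \<open>auto simp: add_nonneg_nonneg\<close>)

lemma Iq_integrable: "set_integrable lborel {0<..} (\<lambda>t. 1 / Dq y (of_real t) ^ (j + 1))"
  unfolding set_integrable_def
proof (rule Bochner_Integration.integrable_bound[OF inverse_1_plus_square_integrable])
  show "AE x in lborel. norm (indicator {0<..} x *\<^sub>R (1 / Dq y (of_real x) ^ (j + 1))) \<le> norm (1 / (1 + x\<^sup>2))"
  proof (rule AE_I2)
    fix x :: real
    have p: "1 + x\<^sup>2 \<ge> 1" by simp
    have "(1 + x\<^sup>2) ^ 1 \<le> (1 + x\<^sup>2) ^ (j + 1)" by (rule power_increasing) (use p in auto)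
    also have "\<dots> \<le> norm (Dq y (of_real x)) ^ (j + 1)" by (intro power_mono norm_Dq_ge) simp
    finally have "1 + x\<^sup>2 \<le> norm (Dq y (of_real x)) ^ (j + 1)" by simp
    then have "1 / norm (Dq y (of_real x)) ^ (j + 1) \<le> 1 / (1 + x\<^sup>2)" using p by (intro divide_left_mono) (auto intro!: mult_pos_pos simp: Dq_nonzero add_pos_nonneg)
    then show "norm (indicator {0<..} x *\<^sub>R (1 / Dq y (of_real x) ^ (j + 1))) \<le> norm (1 / (1 + x\<^sup>2))"
      by (auto simp: indicator_def norm_divide norm_power norm_mult)
  qed
  have "(\<lambda>x. 1 / Dq y (complex_of_real x) ^ (j + 1)) \<in> borel_measurable borel"
    unfolding Dq_def by measurable
  then show "(\<lambda>x. indicator {0<..} x *\<^sub>R (1 / Dq y (of_real x) ^ (j + 1))) \<in> borel_measurable lborel"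
    by measurable
qed

text \<open>At y = sinh x the quadratic has the roots \<open>\<i>\<close> exp x and
  \<open>- \<i>\<close> exp (- x), so partial fractions integrate to a difference of logarithms. For
  real t both linear factors stay off the branch cut, and the values at t = 0 produce pi / 2 +
  \<open>\<i>\<close> x.\<close>

lemma Iq_0: "Iq 0 (sinh x) = Complex (pi / 2) x / of_real (cosh x)"
proof -
  define p where "p t = of_real t - \<i> * of_real (exp x)" for t :: real
  define q where "q t = of_real t + \<i> * of_real (exp (- x))" for t :: real
  define G where "G t = (Ln (p t) - Ln (q t)) / (2 * \<i> * of_real (cosh x))" for t :: real
  have ch: "complex_of_real (cosh x) \<noteq> 0" using cosh_real_pos[of x] by auto
  have ee: "complex_of_real (exp x) * complex_of_real (exp (- x)) = 1"
    by (simp only: of_real_mult[symmetric] exp_minus_inverse of_real_1)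
  have Dpq: "Dq (sinh x) (of_real t) = p t * q t" for t
  proof -
    have "p t * q t = of_real t ^ 2 + complex_of_real (exp x) * complex_of_real (exp (- x)) - \<i> * of_real t * (of_real (exp x) - of_real (exp (- x)))"
      by (simp add: p_def q_def algebra_simps power2_eq_square)
    also have "complex_of_real (exp x) - of_real (exp (- x)) = 2 * of_real (sinh x)"
      by (simp add: sinh_field_def)
    finally show ?thesis unfolding ee by (simp add: Dq_def)
  qed
  have pq: "q t - p t = 2 * \<i> * of_real (cosh x)" for t
    by (simp add: p_def q_def cosh_field_def algebra_simps)
  have p0: "p t \<noteq> 0" "q t \<noteq> 0" for t using Dq_nonzero[of "sinh x" t] unfolding Dpq by auto
  have np: "p t \<notin> \<real>\<^sub>\<le>\<^sub>0" "q t \<notin> \<real>\<^sub>\<le>\<^sub>0" for t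
    by (auto simp: p_def q_def complex_nonpos_Reals_iff)
  have "Iq 0 (sinh x) = 0 - G 0"
    unfolding Iq_def
  proof (rule half_line_FTC)
    fix t :: real
    have "((\<lambda>w. (Ln (w - \<i> * of_real (exp x)) - Ln (w + \<i> * of_real (exp (- x)))) / (2 * \<i> * of_real (cosh x))) has_field_derivative
        (1 / p t - 1 / q t) / (2 * \<i> * of_real (cosh x))) (at (of_real t))"
      using np[of t] ch unfolding p_def q_def by (auto intro!: derivative_eq_intros simp: divide_simps)
    also have "(1 / p t - 1 / q t) / (2 * \<i> * of_real (cosh x)) = 1 / Dq (sinh x) (of_real t) ^ (0 + 1)"
    proof -
      have "1 / p t - 1 / q t = (q t - p t) / (p t * q t)" using p0[of t] by (simp add: field_simps)
      then show ?thesis unfolding pq Dpq using ch by simp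
    qed
    finally have "((\<lambda>w. (Ln (w - \<i> * of_real (exp x)) - Ln (w + \<i> * of_real (exp (- x)))) / (2 * \<i> * of_real (cosh x))) has_field_derivative
        1 / Dq (sinh x) (of_real t) ^ (0 + 1)) (at (of_real t))" .
    from has_vector_derivative_real_field[OF this]
    show "(G has_vector_derivative 1 / Dq (sinh x) (of_real t) ^ (0 + 1)) (at t)"
      unfolding G_def[abs_def] p_def q_def .
  next
    \<comment> \<open>Both logarithms grow like ln t. Factoring out the positive number t cancels
      the growth and leaves logarithms of quantities tending to 1.\<close>
    show "(G \<longlongrightarrow> 0) at_top"
    proof -
      have inv: "((\<lambda>t::real. complex_of_real (inverse t)) \<longlongrightarrow> of_real 0) at_top"
        by (intro tendsto_of_real) real_asymp
      have l1: "((\<lambda>t::real. Ln (1 - \<i> * of_real (exp x) * of_real (inverse t))) \<longlongrightarrow> Ln (1 - \<i> * of_real (exp x) * of_real 0)) at_top"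
        by (intro tendsto_Ln tendsto_intros inv) auto
      have l2: "((\<lambda>t::real. Ln (1 + \<i> * of_real (exp (- x)) * of_real (inverse t))) \<longlongrightarrow> Ln (1 + \<i> * of_real (exp (- x)) * of_real 0)) at_top"
        by (intro tendsto_Ln tendsto_intros inv) auto
      have "((\<lambda>t. (Ln (1 - \<i> * of_real (exp x) * of_real (inverse t)) - Ln (1 + \<i> * of_real (exp (- x)) * of_real (inverse t))) / (2 * \<i> * of_real (cosh x)))
          \<longlongrightarrow> (Ln (1 - \<i> * of_real (exp x) * of_real 0) - Ln (1 + \<i> * of_real (exp (- x)) * of_real 0)) / (2 * \<i> * of_real (cosh x))) at_top"
        using ch by (intro tendsto_intros l1 l2) auto
      then have "((\<lambda>t. (Ln (1 - \<i> * of_real (exp x) * of_real (inverse t)) - Ln (1 + \<i> * of_real (exp (- x)) * of_real (inverse t))) / (2 * \<i> * of_real (cosh x))) \<longlongrightarrow> 0) at_top"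
        by simp
      moreover have "\<forall>\<^sub>F t in at_top. (Ln (1 - \<i> * of_real (exp x) * of_real (inverse t)) - Ln (1 + \<i> * of_real (exp (- x)) * of_real (inverse t))) / (2 * \<i> * of_real (cosh x)) = G t"
        using eventually_gt_at_top[of 0]
      proof eventually_elim
        case (elim t)
        have 1: "p t = of_real t * (1 - \<i> * of_real (exp x) * of_real (inverse t))"
          using elim by (simp add: p_def field_simps)
        have 2: "q t = of_real t * (1 + \<i> * of_real (exp (- x)) * of_real (inverse t))"
          using elim by (simp add: q_def field_simps)
        have "Ln (p t) = of_real (ln t) + Ln (1 - \<i> * of_real (exp x) * of_real (inverse t))"
          using p0(1)[of t] elim unfolding 1 by (subst Ln_times_of_real) (auto simp: Ln_of_real)
        moreover have "Ln (q t) = of_real (ln t) + Ln (1 + \<i> * of_real (exp (- x)) * of_real (inverse t))"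
          using p0(2)[of t] elim unfolding 2 by (subst Ln_times_of_real) (auto simp: Ln_of_real)
        ultimately show ?case by (simp add: G_def)
      qed
      ultimately show ?thesis by (rule Lim_transform_eventually)
    qed
  next
    show "isCont (\<lambda>t. 1 / Dq (sinh x) (complex_of_real t) ^ (0 + 1)) t" for t
      by (intro continuous_intros) (simp add: Dq_nonzero)
  qed (rule Iq_integrable)
  also have "G 0 = - Complex (pi / 2) x / of_real (cosh x)"
  proof -
    have "Ln (p 0) = of_real x - \<i> * of_real (pi / 2)"
    proof -
      have p00: "p 0 = of_real (exp x) * (- \<i>)" by (simp add: p_def)
      then show ?thesis by (subst p00, subst Ln_times_of_real) (auto simp: Ln_of_real[of "exp x", simplified])
    qed
    moreover have "Ln (q 0) = of_real (- x) + \<i> * of_real (pi / 2)"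
    proof -
      have q00: "q 0 = of_real (exp (- x)) * \<i>" by (simp add: q_def)
      then show ?thesis by (subst q00, subst Ln_times_of_real) (auto simp: Ln_of_real[of "exp (- x)", simplified])
    qed
    ultimately have "Ln (p 0) - Ln (q 0) = 2 * \<i> * (- Complex (pi / 2) x)"
      by (simp add: complex_eq_iff)
    then show ?thesis using ch by (simp add: G_def)
  qed
  finally show ?thesis by simp
qed

text \<open>With s = t - \<open>\<i>\<close> y the quadratic is s^2 + 1 + y^2 with derivative 2 s.
  Hence the derivative of s / Dq^(j + 1) combines the powers j + 1 and j + 2 of 1 / Dq, and the
  boundary value at t = 0 contributes \<open>\<i>\<close> y.\<close>

lemma Iq_Suc: "of_nat (2 * j + 2) * of_real (1 + y\<^sup>2) * Iq (Suc j) y = \<i> * of_real y + of_nat (2 * j + 1) * Iq j y"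
proof -
  let ?d = "\<lambda>t. of_nat (2 * j + 2) * of_real (1 + y\<^sup>2) * (1 / Dq y (of_real t) ^ (Suc j + 1)) - of_nat (2 * j + 1) * (1 / Dq y (of_real t) ^ (j + 1))"
  let ?F = "\<lambda>w. (w - \<i> * of_real y) / Dq y w ^ (j + 1)"
  have "(LBINT t:{0<..}. ?d t) = 0 - ?F (of_real 0)"
  proof (rule half_line_FTC)
    fix t :: real
    let ?D = "Dq y (of_real t)"
    have D0: "?D \<noteq> 0" by (rule Dq_nonzero)
    have alg: "1 * X - s * (n * (2 * s * P)) = X - 2 * n * s\<^sup>2 * P" for X s n P :: complex
      by (simp add: power2_eq_square algebra_simps)
    have dD: "(Dq y has_field_derivative 2 * (of_real t - \<i> * of_real y)) (at (of_real t))"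
      unfolding Dq_def[abs_def] by (auto intro!: derivative_eq_intros simp: algebra_simps)
    have sq: "(of_real t - \<i> * of_real y) ^ 2 = ?D - of_real (1 + y\<^sup>2)"
      by (simp add: Dq_def algebra_simps power2_eq_square)
    have "(?F has_field_derivative (1 * ?D ^ (j + 1) - (of_real t - \<i> * of_real y) * (of_nat (j + 1) * (2 * (of_real t - \<i> * of_real y) * ?D ^ (j + 1 - 1)))) / (?D ^ (j + 1) * ?D ^ (j + 1))) (at (of_real t))"
    proof -
      have d1: "((\<lambda>w. w - \<i> * of_real y) has_field_derivative 1) (at (of_real t))"
        by (auto intro!: derivative_eq_intros)
      have d2: "((\<lambda>w. Dq y w ^ (j + 1)) has_field_derivative of_nat (j + 1) * (2 * (of_real t - \<i> * of_real y) * ?D ^ (j + 1 - 1))) (at (of_real t))"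
        using DERIV_power[OF dD, of "j + 1"] by simp
      show ?thesis by (rule DERIV_divide[OF d1 d2]) (use D0 in simp)
    qed
    also have "(1 * ?D ^ (j + 1) - (of_real t - \<i> * of_real y) * (of_nat (j + 1) * (2 * (of_real t - \<i> * of_real y) * ?D ^ (j + 1 - 1)))) / (?D ^ (j + 1) * ?D ^ (j + 1))
        = (?D ^ (j + 1) - 2 * of_nat (j + 1) * (of_real t - \<i> * of_real y)^2 * ?D ^ j) / (?D ^ (j + 1) * ?D ^ (j + 1))"
      unfolding alg by simp
    also have "\<dots> = (of_nat (2 * j + 2) * of_real (1 + y\<^sup>2) * ?D ^ j - of_nat (2 * j + 1) * ?D ^ (j + 1)) / (?D ^ (j + 1) * ?D ^ (j + 1))"
      unfolding sq by (rule arg_cong[of _ _ "\<lambda>u. u / _"]) (simp add: algebra_simps)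
    also have "\<dots> = ?d t"
    proof -
      have alg2: "(a * P - b * (P * D)) / (P * D * (P * D)) = a * (1 / (P * D * D)) - b * (1 / (P * D))"
        if "P \<noteq> 0" "D \<noteq> 0" for a b P D :: complex
      proof -
        have "(a * P - b * (P * D)) / (P * D * (P * D)) = a * P / (P * D * (P * D)) - b * (P * D) / (P * D * (P * D))"
          by (rule diff_divide_distrib)
        then show ?thesis using that by simp
      qed
      have e1: "?D ^ (j + 1) = ?D ^ j * ?D" by simp
      have e2: "?D ^ (Suc j + 1) = ?D ^ j * ?D * ?D" by simp
      show ?thesis unfolding e1 e2 by (rule alg2) (use D0 in auto)
    qed
    finally have "(?F has_field_derivative ?d t) (at (of_real t))" .
    from has_vector_derivative_real_field[OF this] show "((\<lambda>t. ?F (of_real t)) has_vector_derivative ?d t) (at t)" .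
  next
    show "isCont ?d t" for t
      by (intro continuous_intros) (auto simp: Dq_nonzero)
    show "set_integrable lborel {0<..} ?d"
      by (intro set_integral_diff set_integrable_mult_right Iq_integrable)
    show "((\<lambda>t. ?F (of_real t)) \<longlongrightarrow> 0) at_top"
    proof (rule Lim_null_comparison)
      show "((\<lambda>t. (t + \<bar>y\<bar>) / (1 + t\<^sup>2)) \<longlongrightarrow> 0) at_top" by real_asymp
      show "\<forall>\<^sub>F t in at_top. norm (?F (of_real t)) \<le> (t + \<bar>y\<bar>) / (1 + t\<^sup>2)"
        using eventually_ge_at_top[of 0]
      proof eventually_elim
        case (elim t)
        have "(1 + t\<^sup>2) ^ 1 \<le> (1 + t\<^sup>2) ^ (j + 1)" by (rule power_increasing) auto
        also have "\<dots> \<le> norm (Dq y (of_real t)) ^ (j + 1)" by (intro power_mono norm_Dq_ge) simp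
        finally have "1 + t\<^sup>2 \<le> norm (Dq y (of_real t)) ^ (j + 1)" by simp
        moreover have "norm (of_real t - \<i> * of_real y) \<le> t + \<bar>y\<bar>"
          using norm_triangle_ineq4[of "of_real t" "\<i> * of_real y"] elim by (simp add: norm_mult)
        ultimately show ?case
          unfolding norm_divide norm_power using elim by (intro frac_le) (auto simp: add_pos_nonneg)
      qed
    qed
  qed
  also have "?F (of_real 0) = - \<i> * of_real y" by (simp add: Dq_def)
  also have "(LBINT t:{0<..}. ?d t) = of_nat (2 * j + 2) * of_real (1 + y\<^sup>2) * Iq (Suc j) y - of_nat (2 * j + 1) * Iq j y"
  proof -
    have "set_integrable lborel {0<..} (\<lambda>t. of_nat (2 * j + 2) * of_real (1 + y\<^sup>2) * (1 / Dq y (of_real t) ^ (Suc j + 1)))"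
      "set_integrable lborel {0<..} (\<lambda>t. of_nat (2 * j + 1) * (1 / Dq y (of_real t) ^ (j + 1)))"
      by (intro set_integrable_mult_right Iq_integrable)+
    from set_integral_diff(2)[OF this] show ?thesis
      unfolding Iq_def by (simp only: set_integral_mult_right)
  qed
  finally show ?thesis by (simp add: algebra_simps)
qed

text \<open>Since 1 + sinh^2 = cosh^2, the recursion for \<open>Iq\<close> becomes that for
  \<open>Sf\<close>: at pi / 2 + \<open>\<i>\<close> x the term - cos sin^(2 j + 1) equals
  \<open>\<i>\<close> sinh x cosh^(2 j + 1) x.\<close>

lemma Iq_sinh: "Iq j (sinh x) = Sf j (Complex (pi / 2) x) / of_real (cosh x ^ (2 * j + 1))"
proof (induction j)
  case 0
  show ?case by (simp add: Iq_0)
next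
  case (Suc j)
  have c0: "complex_of_real (cosh x) \<noteq> 0" using cosh_real_pos[of x] by auto
  have cs: "1 + (sinh x)\<^sup>2 = cosh x ^ 2" by (simp add: cosh_square_eq)
  have n0: "of_nat (2 * j + 2) \<noteq> (0 :: complex)" by (simp only: of_nat_eq_0_iff)
  have "of_nat (2 * j + 2) * (of_real (cosh x) ^ 2 * Iq (Suc j) (sinh x)) = \<i> * of_real (sinh x) + of_nat (2 * j + 1) * (Sf j (Complex (pi / 2) x) / of_real (cosh x ^ (2 * j + 1)))"
    using Iq_Suc[of j "sinh x"] unfolding Suc.IH cs by (simp only: of_real_power mult.assoc)
  also have "\<dots> = (of_nat (2 * j + 1) * Sf j (Complex (pi / 2) x) + \<i> * of_real (sinh x) * of_real (cosh x) ^ (2 * j + 1)) / of_real (cosh x) ^ (2 * j + 1)"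
    using c0 by (simp add: add_divide_distrib)
  also have "of_nat (2 * j + 1) * Sf j (Complex (pi / 2) x) + \<i> * of_real (sinh x) * of_real (cosh x) ^ (2 * j + 1) = of_nat (2 * j + 2) * Sf (Suc j) (Complex (pi / 2) x)"
    using n0 unfolding Sf.simps sin_cos_half_pi by simp
  finally have "of_nat (2 * j + 2) * (of_real (cosh x) ^ 2 * Iq (Suc j) (sinh x)) = of_nat (2 * j + 2) * (Sf (Suc j) (Complex (pi / 2) x) / of_real (cosh x) ^ (2 * j + 1))"
    by simp
  then have "of_real (cosh x) ^ 2 * Iq (Suc j) (sinh x) = Sf (Suc j) (Complex (pi / 2) x) / of_real (cosh x) ^ (2 * j + 1)"
    using n0 mult_left_cancel by blast
  then have "Iq (Suc j) (sinh x) = Sf (Suc j) (Complex (pi / 2) x) / of_real (cosh x) ^ (2 * j + 1) / of_real (cosh x) ^ 2"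
  proof -
    have "X = Y / c\<^sup>2" if "c \<noteq> 0" "c\<^sup>2 * X = Y" for X Y c :: complex using that by auto
    from this[OF c0] \<open>of_real (cosh x) ^ 2 * Iq (Suc j) (sinh x) = _\<close> show ?thesis .
  qed
  moreover have "complex_of_real (cosh x ^ (2 * Suc j + 1)) = of_real (cosh x) ^ (2 * j + 1) * of_real (cosh x) ^ 2"
    unfolding of_real_power power_add[symmetric] by (rule arg_cong[of _ _ "power _"]) simp
  ultimately show ?case by (simp only: divide_divide_eq_left)
qed

section \<open>The one-coordinate factor psi\<close>

lemma pair_integrableI:
  fixes f :: "'a::euclidean_space \<Rightarrow> 'b::euclidean_space \<Rightarrow> 'c::{banach, second_countable_topology}"
  assumes m: "case_prod f \<in> borel_measurable (lborel \<Otimes>\<^sub>M lborel)"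
    and i1: "\<And>x. integrable lborel (f x)" and i2: "integrable lborel (\<lambda>x. \<integral>y. norm (f x y) \<partial>lborel)"
  shows "integrable (lborel \<Otimes>\<^sub>M lborel) (case_prod f)"
proof (rule lborel_pair.Fubini_integrable)
  show "integrable lborel (\<lambda>x. \<integral>y. norm (case_prod f (x, y)) \<partial>lborel)" using i2 by simp
  show "AE x in lborel. integrable lborel (\<lambda>y. case_prod f (x, y))" by (rule AE_I2) (simp add: i1)
qed (use m in simp)

lemma norm_of_real_cis: "norm (complex_of_real a * cis b) = \<bar>a\<bar>"
  by (simp add: norm_mult)

text \<open>The weight of one coordinate of y in \<open>Yint\<close>; \<open>gb\<close> is that of
  one coordinate of b.\<close>

definition ga :: "nat \<Rightarrow> real \<Rightarrow> real" where "ga m y = pw m y * exp (- y\<^sup>2 / 2)"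

definition gb :: "bool \<Rightarrow> real \<Rightarrow> real" where "gb P b = (if P then indicator {0<..} b else 1) * exp (- b\<^sup>2 / 2)"

definition phi :: "nat \<Rightarrow> real \<Rightarrow> complex" where
  "phi m s = (\<integral>y. of_real (ga m y) * cis (s * y) \<partial>lborel)"

text \<open>The flag tells whether the index belongs to the set \<open>J\<close>, that is, whether \<open>b\<close> is restricted to
  the positive half-line.\<close>

definition psi :: "nat \<Rightarrow> bool \<Rightarrow> real \<Rightarrow> complex" where
  "psi m P t = (\<integral>b. of_real (gb P b) * phi m (t * b) \<partial>lborel)"

lemma cis_measurable [measurable (raw)]:
  assumes [measurable]: "f \<in> borel_measurable M"
  shows "(\<lambda>x. cis (f x)) \<in> borel_measurable M"
  unfolding cis_conv_exp by measurable

lemma ga_measurable [measurable]: "ga m \<in> borel_measurable borel" unfolding ga_def by measurable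

lemma gb_measurable [measurable]: "gb P \<in> borel_measurable borel" unfolding gb_def by (cases P) simp_all

lemma ga_nonneg: "ga m y \<ge> 0" by (simp add: ga_def pw_nonneg)

lemma gb_nonneg: "gb P y \<ge> 0" by (simp add: gb_def)

lemma ga_integrable: "integrable lborel (ga m)"
proof (rule integrableI_nonneg)
  have "ga m x = indicator {0<..} x * x ^ m * exp (- x\<^sup>2 / 2)" for x by (simp add: ga_def pw_def)
  then show "(\<integral>\<^sup>+x. ennreal (ga m x) \<partial>lborel) < \<infinity>" using nn_integral_moment_finite[of m] by simp
qed (auto simp: ga_nonneg)

lemma gauss_1_integrable: "integrable lborel (\<lambda>x::real. exp (- x\<^sup>2 / 2))"
  by (rule integrableI_nonneg) (use nn_integral_gauss_1 in \<open>auto simp: less_top[symmetric]\<close>)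

lemma gb_integrable: "integrable lborel (gb P)"
proof (rule Bochner_Integration.integrable_bound[OF gauss_1_integrable])
  show "AE x in lborel. norm (gb P x) \<le> norm (exp (- x\<^sup>2 / 2))"
    by (rule AE_I2) (auto simp: gb_def indicator_def)
qed simp

lemma phi_integrable: "integrable lborel (\<lambda>y. of_real (ga m y) * cis (s * y))"
proof (rule Bochner_Integration.integrable_bound[OF ga_integrable[of m]])
  show "AE x in lborel. norm (of_real (ga m x) * cis (s * x)) \<le> norm (ga m x)"
    by (rule AE_I2) (simp add: norm_of_real_cis)
qed measurable

lemma phi_bound: "norm (phi m s) \<le> (\<integral>y. ga m y \<partial>lborel)"
proof -
  have "norm (phi m s) \<le> (\<integral>y. norm (of_real (ga m y) * cis (s * y)) \<partial>lborel)"
    unfolding phi_def by (rule integral_norm_bound)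
  then show ?thesis by (simp add: norm_of_real_cis ga_nonneg)
qed

lemma phi_measurable [measurable]: "phi m \<in> borel_measurable borel"
  unfolding phi_def[abs_def] by measurable

lemma psi_integrable: "integrable lborel (\<lambda>b. of_real (gb P b) * phi m (t * b))"
proof (rule Bochner_Integration.integrable_bound[OF integrable_mult_left[OF gb_integrable[of P], of "\<integral>y. ga m y \<partial>lborel"]])
  show "AE x in lborel. norm (of_real (gb P x) * phi m (t * x)) \<le> norm (gb P x * (\<integral>y. ga m y \<partial>lborel))"
  proof (rule AE_I2)
    fix x
    have "norm (of_real (gb P x) * phi m (t * x)) = gb P x * norm (phi m (t * x))"
      by (simp add: norm_mult gb_nonneg)
    also have "\<dots> \<le> gb P x * (\<integral>y. ga m y \<partial>lborel)"
      by (intro mult_left_mono phi_bound gb_nonneg)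
    finally show "norm (of_real (gb P x) * phi m (t * x)) \<le> norm (gb P x * (\<integral>y. ga m y \<partial>lborel))" by simp
  qed
qed measurable

text \<open>The line is cut at b = 0, and reflecting the negative half changes the sign of
  t.\<close>

lemma psi_False: "psi m False t = psi m True t + psi m True (- t)"
proof -
  have "psi m True (- t) = (\<integral>b. of_real (gb True (- b)) * phi m (t * b) \<partial>lborel)"
    unfolding psi_def by (subst lborel_integral_real_affine[of "-1" _ 0]) simp_all
  moreover have "integrable lborel (\<lambda>b. of_real (gb True (- b)) * phi m (t * b))"
    using lborel_integrable_real_affine[OF psi_integrable[of True m "- t"], of "-1" 0] by simp
  ultimately have "psi m True t + psi m True (- t) = (\<integral>b. of_real (gb True b) * phi m (t * b) + of_real (gb True (- b)) * phi m (t * b) \<partial>lborel)"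
    unfolding psi_def[of m True t] by (subst Bochner_Integration.integral_add) (auto simp: psi_integrable)
  also have "\<dots> = psi m False t"
    unfolding psi_def
  proof (rule integral_cong_AE)
    show "AE b in lborel. of_real (gb True b) * phi m (t * b) + of_real (gb True (- b)) * phi m (t * b) = of_real (gb False b) * phi m (t * b)"
      using AE_lborel_singleton[of "0::real"]
      by eventually_elim (auto simp: gb_def indicator_def)
  qed measurable
  finally show ?thesis by simp
qed

text \<open>The substitution b = y \<tau> brings in a Jacobian y and makes the exponent - y^2
  \<open>Dq t\<close> / 2 at \<tau>. Integrating y first is then an odd moment of order 2 j + 1,
  which leaves 1 / Dq^(j + 1) to be integrated over \<tau>.\<close>

lemma psi_True: "psi (2 * j) True t = 2 ^ j * fact j * Iq j t"
proof -
  define f where "f b y = complex_of_real (gb True b * ga (2 * j) y) * cis (t * b * y)" for b y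
  have i1: "integrable (lborel \<Otimes>\<^sub>M lborel) (case_prod f)"
  proof (rule pair_integrableI)
    show "case_prod f \<in> borel_measurable (lborel \<Otimes>\<^sub>M lborel)" unfolding f_def by measurable
    show "integrable lborel (f b)" for b
      using integrable_mult_right[OF phi_integrable[of "2 * j" "t * b"], of "of_real (gb True b)"]
      by (simp add: f_def[abs_def] mult_ac)
    show "integrable lborel (\<lambda>b. \<integral>y. norm (f b y) \<partial>lborel)"
      unfolding f_def norm_of_real_cis abs_mult
      using gb_integrable[of True] by (simp add: gb_nonneg)
  qed
  have "psi (2 * j) True t = (\<integral>b. (\<integral>y. f b y \<partial>lborel) \<partial>lborel)"
    unfolding psi_def phi_def f_def by (simp add: mult.assoc)
  also have "\<dots> = (\<integral>y. (\<integral>b. f b y \<partial>lborel) \<partial>lborel)"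
    using lborel_pair.Fubini_integral[OF i1] by simp
  also have "\<dots> = (\<integral>y. (\<integral>\<tau>. of_real \<bar>y\<bar> * f (y * \<tau>) y \<partial>lborel) \<partial>lborel)"
  proof (rule integral_cong_AE)
    show "AE y in lborel. (\<integral>b. f b y \<partial>lborel) = (\<integral>\<tau>. of_real \<bar>y\<bar> * f (y * \<tau>) y \<partial>lborel)"
      using AE_lborel_singleton[of "0::real"]
    proof eventually_elim
      case (elim y)
      show ?case by (subst lborel_integral_real_affine[of y _ 0]) (use elim in \<open>simp_all add: scaleR_conv_of_real\<close>)
    qed
  qed (unfold f_def, measurable)
  also have "\<dots> = (\<integral>y. (\<integral>\<tau>. indicator {0<..} \<tau> *\<^sub>R (indicator {0<..} y *\<^sub>R (of_real (y ^ (2 * j + 1)) * exp (- (of_real (y\<^sup>2) * Dq t (of_real \<tau>) / 2)))) \<partial>lborel) \<partial>lborel)"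
  proof (intro Bochner_Integration.integral_cong refl)
    fix y \<tau> :: real
    show "of_real \<bar>y\<bar> * f (y * \<tau>) y = indicator {0<..} \<tau> *\<^sub>R (indicator {0<..} y *\<^sub>R (of_real (y ^ (2 * j + 1)) * exp (- (of_real (y\<^sup>2) * Dq t (of_real \<tau>) / 2))))"
    proof (cases "y > 0 \<and> \<tau> > 0")
      case True
      have "exp (- (of_real (y\<^sup>2) * Dq t (of_real \<tau>) / 2)) = exp (complex_of_real (- (y * \<tau>)\<^sup>2 / 2)) * exp (complex_of_real (- y\<^sup>2 / 2)) * exp (\<i> * of_real (t * (y * \<tau>) * y))"
        unfolding exp_add[symmetric] by (rule arg_cong[of _ _ exp]) (simp add: Dq_def algebra_simps power2_eq_square add_divide_distrib diff_divide_distrib)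
      also have "\<dots> = of_real (exp (- (y * \<tau>)\<^sup>2 / 2) * exp (- y\<^sup>2 / 2)) * cis (t * (y * \<tau>) * y)"
        by (simp only: of_real_mult exp_of_real cis_conv_exp)
      finally show ?thesis using True by (simp add: f_def gb_def ga_def pw_def zero_less_mult_iff)
    next
      case False
      then show ?thesis by (auto simp: f_def gb_def ga_def pw_def indicator_def zero_less_mult_iff)
    qed
  qed
  also have "\<dots> = (\<integral>\<tau>. (\<integral>y. indicator {0<..} \<tau> *\<^sub>R (indicator {0<..} y *\<^sub>R (of_real (y ^ (2 * j + 1)) * exp (- (of_real (y\<^sup>2) * Dq t (of_real \<tau>) / 2)))) \<partial>lborel) \<partial>lborel)"
  proof -
    define g where "g \<tau> y = indicator {0<..} \<tau> *\<^sub>R (indicator {0<..} y *\<^sub>R (of_real (y ^ (2 * j + 1)) * exp (- (of_real (y\<^sup>2) * Dq t (of_real \<tau>) / 2))))" for \<tau> y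
    have mom: "set_integrable lborel {0<..} (\<lambda>y. of_real (y ^ (2 * j + 1)) * exp (- (of_real (y\<^sup>2) * Dq u (of_real \<tau>) / 2)))" for u \<tau>
      by (rule moment_integrable) (simp add: Re_Dq)
    have ng: "norm (g \<tau> y) = indicator {0<..} \<tau> * (indicator {0<..} y * (y ^ (2 * j + 1) * exp (- (y\<^sup>2 * (1 + \<tau>\<^sup>2) / 2))))" for \<tau> y
    proof -
      have "norm (exp (- (of_real (y\<^sup>2) * Dq t (of_real \<tau>) / 2))) = exp (- (y\<^sup>2 * (1 + \<tau>\<^sup>2) / 2))"
        unfolding norm_exp_eq_Re by (simp add: Re_Dq del: of_real_power)
      then show ?thesis by (auto simp: g_def norm_mult norm_power indicator_def)
    qed
    \<comment> \<open>Taking norms replaces \<open>Dq\<close> by its real part 1 + \<tau>^2, so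
      absolute integrability is the odd moment at a real argument.\<close>
    have nint: "(\<integral>y. norm (g \<tau> y) \<partial>lborel) = indicator {0<..} \<tau> * (2 ^ j * fact j / (1 + \<tau>\<^sup>2) ^ (j + 1))" for \<tau>
    proof -
      have "complex_of_real (\<integral>y. norm (g \<tau> y) \<partial>lborel) = (\<integral>y. complex_of_real (norm (g \<tau> y)) \<partial>lborel)" by simp
      also have "\<dots> = indicator {0<..} \<tau> * (LBINT y:{0<..}. of_real (y ^ (2 * j + 1)) * exp (- (of_real (y\<^sup>2) * complex_of_real (1 + \<tau>\<^sup>2) / 2)))"
        unfolding ng set_lebesgue_integral_def
        by (subst integral_mult_right_zero[symmetric], rule Bochner_Integration.integral_cong)
          (auto simp: indicator_def exp_of_real[symmetric])
      also have "\<dots> = indicator {0<..} \<tau> * (2 ^ j * fact j / complex_of_real (1 + \<tau>\<^sup>2) ^ (j + 1))"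
        by (subst odd_moment) simp_all
      also have "\<dots> = complex_of_real (indicator {0<..} \<tau> * (2 ^ j * fact j / (1 + \<tau>\<^sup>2) ^ (j + 1)))"
        by (simp add: indicator_def)
      finally show ?thesis by (simp only: of_real_eq_iff)
    qed
    have "integrable (lborel \<Otimes>\<^sub>M lborel) (case_prod g)"
    proof (rule pair_integrableI)
      have [measurable]: "(\<lambda>x. Dq t (complex_of_real (fst x))) \<in> borel_measurable ((lborel :: real measure) \<Otimes>\<^sub>M (lborel :: real measure))"
        unfolding Dq_def by measurable
      show "case_prod g \<in> borel_measurable (lborel \<Otimes>\<^sub>M lborel)"
        unfolding g_def split_beta' by measurable
      show "integrable lborel (g \<tau>)" for \<tau>
        using integrable_scaleR_right[OF mom[of t \<tau>, unfolded set_integrable_def], of "indicator {0<..} \<tau>"]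
        by (simp add: g_def[abs_def])
      have "integrable lborel (\<lambda>\<tau>. indicator {0<..} \<tau> * (2 ^ j * fact j / (1 + \<tau>\<^sup>2) ^ (j + 1)) :: real)"
      proof (rule Bochner_Integration.integrable_bound[OF integrable_mult_right[OF inverse_1_plus_square_integrable, of "2 ^ j * fact j"]])
        show "AE \<tau> in lborel. norm (indicator {0<..} \<tau> * (2 ^ j * fact j / (1 + \<tau>\<^sup>2) ^ (j + 1)) :: real) \<le> norm (2 ^ j * fact j * (1 / (1 + \<tau>\<^sup>2)) :: real)"
        proof (rule AE_I2)
          fix \<tau> :: real
          have "(1 + \<tau>\<^sup>2) ^ 1 \<le> (1 + \<tau>\<^sup>2) ^ (j + 1)" by (rule power_increasing) auto
          then have "1 / (1 + \<tau>\<^sup>2) ^ (j + 1) \<le> 1 / (1 + \<tau>\<^sup>2)"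
            by (intro divide_left_mono) (auto intro!: mult_pos_pos simp: add_pos_nonneg)
          then have "2 ^ j * fact j * (1 / (1 + \<tau>\<^sup>2) ^ (j + 1)) \<le> 2 ^ j * fact j * (1 / (1 + \<tau>\<^sup>2))"
            by (rule mult_left_mono) simp
          then show "norm (indicator {0<..} \<tau> * (2 ^ j * fact j / (1 + \<tau>\<^sup>2) ^ (j + 1)) :: real) \<le> norm (2 ^ j * fact j * (1 / (1 + \<tau>\<^sup>2)) :: real)"
            by (auto simp: indicator_def add_nonneg_nonneg)
        qed
      qed measurable
      then show "integrable lborel (\<lambda>\<tau>. \<integral>y. norm (g \<tau> y) \<partial>lborel)" unfolding nint .
    qed
    from lborel_pair.Fubini_integral[OF this] show ?thesis unfolding g_def by simp
  qed
  also have "\<dots> = (\<integral>\<tau>. indicator {0<..} \<tau> *\<^sub>R (2 ^ j * fact j / Dq t (of_real \<tau>) ^ (j + 1)) \<partial>lborel)"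
  proof (intro Bochner_Integration.integral_cong refl)
    fix \<tau> :: real
    show "(\<integral>y. indicator {0<..} \<tau> *\<^sub>R (indicator {0<..} y *\<^sub>R (of_real (y ^ (2 * j + 1)) * exp (- (of_real (y\<^sup>2) * Dq t (of_real \<tau>) / 2)))) \<partial>lborel) = indicator {0<..} \<tau> *\<^sub>R (2 ^ j * fact j / Dq t (of_real \<tau>) ^ (j + 1))"
      unfolding integral_scaleR_right
      using odd_moment[of "Dq t (of_real \<tau>)" j] by (simp add: set_lebesgue_integral_def Re_Dq)
  qed
  also have "\<dots> = 2 ^ j * fact j * Iq j t"
    unfolding Iq_def set_lebesgue_integral_def
    by (subst integral_mult_right_zero[symmetric]) (simp add: scaleR_conv_of_real mult_ac)
  finally show ?thesis .
qed

section \<open>Fourier decoupling of the coordinates\<close>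

lemma vec_integrable_prod:
  fixes f :: "'n::finite \<Rightarrow> real \<Rightarrow> 'a::{real_normed_field,banach,second_countable_topology}"
  assumes "\<And>i. integrable lborel (f i)"
  shows "integrable (lborel :: (real ^ 'n) measure) (\<lambda>x. \<Prod>i\<in>UNIV. f i (x $ i))"
    and "(\<integral>x. (\<Prod>i\<in>UNIV. f i (x $ i)) \<partial>(lborel :: (real ^ 'n) measure)) = (\<Prod>i\<in>UNIV. \<integral>y. f i y \<partial>lborel)"
proof -
  have [measurable]: "f i \<in> borel_measurable borel" for i using borel_measurable_integrable[OF assms[of i]] by simp
  have m: "(\<lambda>x :: real ^ 'n. \<Prod>i\<in>UNIV. f i (x $ i)) \<in> borel_measurable borel" by measurable
  show "integrable (lborel :: (real ^ 'n) measure) (\<lambda>x. \<Prod>i\<in>UNIV. f i (x $ i))"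
    unfolding lborel_vec_eq_distr
    by (subst integrable_distr_eq[OF _ m]) (use lborel_fin.product_integrable_prod[of UNIV f] assms in simp_all)
  show "(\<integral>x. (\<Prod>i\<in>UNIV. f i (x $ i)) \<partial>(lborel :: (real ^ 'n) measure)) = (\<Prod>i\<in>UNIV. \<integral>y. f i y \<partial>lborel)"
    unfolding lborel_vec_eq_distr[where 'a = real and 'n = 'n]
    by (subst integral_distr[OF _ m]) (use lborel_fin.product_integral_prod[of UNIV f] assms in simp_all)
qed

text \<open>\<open>Kr c\<close> is a multiple of \<open>exp (- \<bar>c\<bar>)\<close>, and \<open>Kr_formula\<close> is its Fourier representation. It
  turns the coupling through \<open>b \<bullet> y\<close> in \<open>Yint\<close> into a product over the coordinates.\<close>

definition Kr :: "real \<Rightarrow> real" where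
  "Kr c = (\<integral>s. indicator {0<..} s * (exp (- s\<^sup>2 / 2) * exp (- c\<^sup>2 / (2 * s\<^sup>2))) \<partial>lborel)"

lemma Kr_integrand_integrable:
  fixes c :: real
  shows "integrable lborel (\<lambda>s. indicator {0<..} s * (exp (- s\<^sup>2 / 2) * exp (- c\<^sup>2 / (2 * s\<^sup>2)) :: real))"
proof (rule Bochner_Integration.integrable_bound[OF gauss_1_integrable])
  show "AE s in lborel. norm (indicator {0<..} s * (exp (- s\<^sup>2 / 2) * exp (- c\<^sup>2 / (2 * s\<^sup>2)))) \<le> norm (exp (- s\<^sup>2 / 2))"
    by (rule AE_I2) (auto simp: indicator_def)
qed measurable

lemma Kr_measurable [measurable]: "Kr \<in> borel_measurable borel"
  unfolding Kr_def[abs_def] by measurable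

lemma Kr_nonneg: "Kr c \<ge> 0"
  unfolding Kr_def by (rule Bochner_Integration.integral_nonneg) simp

lemma normal_fourier:
  assumes s: "s > 0"
  shows "(\<integral>t. of_real (s / sqrt (2 * pi) * exp (- (s * t)\<^sup>2 / 2)) * cis (c * t) \<partial>lborel) = of_real (exp (- c\<^sup>2 / (2 * s\<^sup>2)))"
proof -
  have "complex_of_real (exp (- (c / s)\<^sup>2 / 2)) = char std_normal_distribution (c / s)"
    by (simp add: char_std_normal_distribution)
  also have "\<dots> = (\<integral>x. std_normal_density x *\<^sub>R iexp (c / s * x) \<partial>lborel)"
    unfolding char_def by (subst integral_density) auto
  also have "\<dots> = \<bar>s\<bar> *\<^sub>R (\<integral>t. std_normal_density (0 + s * t) *\<^sub>R iexp (c / s * (0 + s * t)) \<partial>lborel)"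
    by (rule lborel_integral_real_affine) (use s in simp)
  also have "\<dots> = (\<integral>t. of_real (s / sqrt (2 * pi) * exp (- (s * t)\<^sup>2 / 2)) * cis (c * t) \<partial>lborel)"
    using s by (simp add: std_normal_density_def integral_scaleR_right[symmetric] scaleR_conv_of_real cis_conv_exp mult_ac del: integral_scaleR_right)
  finally show ?thesis using s by (simp add: power_divide mult.commute)
qed

text \<open>The origin of the density 1 / (1 + t^2): the factor s is the normalization of a normal
  density with standard deviation 1 / s, and one exponential in s^2 absorbs both Gaussians.\<close>

lemma half_line_exp_square:
  fixes t :: real
  shows "(\<integral>s. indicator {0<..} s * (s * exp (- s\<^sup>2 * (1 + t\<^sup>2) / 2)) \<partial>lborel) = 1 / (1 + t\<^sup>2)"
    and "integrable lborel (\<lambda>s. indicator {0<..} s * (s * exp (- s\<^sup>2 * (1 + t\<^sup>2) / 2)))"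
proof -
  have e: "indicator {0<..} s *\<^sub>R (complex_of_real (s ^ (2 * 0 + 1)) * exp (- (of_real (s\<^sup>2) * complex_of_real (1 + t\<^sup>2) / 2)))
     = complex_of_real (indicator {0<..} s * (s * exp (- s\<^sup>2 * (1 + t\<^sup>2) / 2)))" for s :: real
    by (auto simp: indicator_def exp_of_real[symmetric])
  have "complex_of_real (\<integral>s. indicator {0<..} s * (s * exp (- s\<^sup>2 * (1 + t\<^sup>2) / 2)) \<partial>lborel) = complex_of_real (1 / (1 + t\<^sup>2))"
    using odd_moment[of "complex_of_real (1 + t\<^sup>2)" 0] unfolding set_lebesgue_integral_def e integral_complex_of_real by simp
  then show "(\<integral>s. indicator {0<..} s * (s * exp (- s\<^sup>2 * (1 + t\<^sup>2) / 2)) \<partial>lborel) = 1 / (1 + t\<^sup>2)"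
    by (simp only: of_real_eq_iff)
  have "integrable lborel (\<lambda>s. complex_of_real (indicator {0<..} s * (s * exp (- s\<^sup>2 * (1 + t\<^sup>2) / 2))))"
    using moment_integrable[of "complex_of_real (1 + t\<^sup>2)" "2 * 0 + 1"] unfolding set_integrable_def e by simp
  then show "integrable lborel (\<lambda>s. indicator {0<..} s * (s * exp (- s\<^sup>2 * (1 + t\<^sup>2) / 2)))"
    using complex_of_real_integrable_eq by blast
qed

lemma Kr_formula: "of_real (Kr c) = (\<integral>t. of_real (1 / sqrt (2 * pi) * (1 / (1 + t\<^sup>2))) * cis (c * t) \<partial>lborel)"
proof -
  define f where "f t s = complex_of_real (indicator {0<..} s * (s * exp (- s\<^sup>2 * (1 + t\<^sup>2) / 2))) * (of_real (1 / sqrt (2 * pi)) * cis (c * t))" for t s :: real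
  have i: "integrable (lborel \<Otimes>\<^sub>M lborel) (case_prod f)"
  proof (rule pair_integrableI)
    show "case_prod f \<in> borel_measurable (lborel \<Otimes>\<^sub>M lborel)" unfolding f_def split_beta' by measurable
    show "integrable lborel (f t)" for t
      unfolding f_def by (intro integrable_mult_left integrable_of_real half_line_exp_square(2))
    have n: "norm (f t s) = 1 / sqrt (2 * pi) * (indicator {0<..} s * (s * exp (- s\<^sup>2 * (1 + t\<^sup>2) / 2)))" for t s
      by (auto simp: f_def norm_mult norm_divide indicator_def)
    show "integrable lborel (\<lambda>t. \<integral>s. norm (f t s) \<partial>lborel)"
      unfolding n integral_mult_right_zero half_line_exp_square(1)
      by (intro integrable_mult_right inverse_1_plus_square_integrable)
  qed
  have "of_real (Kr c) = (\<integral>s. complex_of_real (indicator {0<..} s * (exp (- s\<^sup>2 / 2) * exp (- c\<^sup>2 / (2 * s\<^sup>2)))) \<partial>lborel)"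
    unfolding Kr_def by (rule integral_complex_of_real[symmetric])
  also have "\<dots> = (\<integral>s. (\<integral>t. f t s \<partial>lborel) \<partial>lborel)"
  proof (rule Bochner_Integration.integral_cong[OF refl])
    fix s :: real
    show "complex_of_real (indicator {0<..} s * (exp (- s\<^sup>2 / 2) * exp (- c\<^sup>2 / (2 * s\<^sup>2)))) = (\<integral>t. f t s \<partial>lborel)"
    proof (cases "s > 0")
      case True
      have fs: "f t s = of_real (exp (- s\<^sup>2 / 2)) * (of_real (s / sqrt (2 * pi) * exp (- (s * t)\<^sup>2 / 2)) * cis (c * t))" for t
      proof -
        have "exp (- s\<^sup>2 * (1 + t\<^sup>2) / 2) = exp (- s\<^sup>2 / 2) * exp (- (s * t)\<^sup>2 / 2)"
          unfolding exp_add[symmetric] by (rule arg_cong[of _ _ exp]) (simp add: field_simps)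
        then show ?thesis using True by (simp add: f_def)
      qed
      show ?thesis unfolding fs integral_mult_right_zero normal_fourier[OF True] using True by simp
    qed (simp add: f_def)
  qed
  also have "\<dots> = (\<integral>t. (\<integral>s. f t s \<partial>lborel) \<partial>lborel)" by (rule lborel_pair.Fubini_integral[OF i])
  also have "\<dots> = (\<integral>t. of_real (1 / sqrt (2 * pi) * (1 / (1 + t\<^sup>2))) * cis (c * t) \<partial>lborel)"
  proof (rule Bochner_Integration.integral_cong[OF refl])
    fix t :: real
    have "(\<integral>s. f t s \<partial>lborel) = complex_of_real (1 / (1 + t\<^sup>2)) * (of_real (1 / sqrt (2 * pi)) * cis (c * t))"
      unfolding f_def integral_mult_left_zero integral_complex_of_real half_line_exp_square(1) ..
    then show "(\<integral>s. f t s \<partial>lborel) = of_real (1 / sqrt (2 * pi) * (1 / (1 + t\<^sup>2))) * cis (c * t)" by simp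
  qed
  finally show ?thesis .
qed

lemma Kr_bounded: "Kr c \<le> (\<integral>s. exp (- (s::real)\<^sup>2 / 2) \<partial>lborel)"
  unfolding Kr_def
  by (rule integral_mono[OF Kr_integrand_integrable gauss_1_integrable]) (auto simp: indicator_def)

definition WB :: "'d::finite set \<Rightarrow> real ^ 'd \<Rightarrow> real" where "WB J b = (\<Prod>i\<in>UNIV. gb (i \<in> J) (b $ i))"

definition WY :: "real ^ 'd::finite \<Rightarrow> real" where "WY y = (\<Prod>i\<in>UNIV. ga (CARD('d) - 1) (y $ i))"

lemma WB_nonneg: "WB J b \<ge> 0" by (simp add: WB_def prod_nonneg gb_nonneg)

lemma WY_nonneg: "WY y \<ge> 0" by (simp add: WY_def prod_nonneg ga_nonneg)

lemma WB_measurable [measurable]: "WB J \<in> borel_measurable borel" unfolding WB_def by measurable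

lemma WY_measurable [measurable]: "WY \<in> borel_measurable borel" unfolding WY_def by measurable

lemma WB_integrable: "integrable lborel (WB J)"
  unfolding WB_def by (intro vec_integrable_prod gb_integrable)

lemma WY_integrable: "integrable lborel WY"
  unfolding WY_def by (intro vec_integrable_prod ga_integrable)

lemma WB_eq: "WB J b = indicator {b. \<forall>i\<in>J. b $ i > 0} b * gauss b"
proof -
  have "WB J b = (\<Prod>i\<in>UNIV. if i \<in> J then indicator {0<..} (b $ i) else 1) * (\<Prod>i\<in>UNIV. exp (- (b $ i)\<^sup>2 / 2))"
    by (simp add: WB_def gb_def prod.distrib)
  also have "(\<Prod>i\<in>UNIV. exp (- (b $ i)\<^sup>2 / 2)) = gauss b"
    by (simp add: gauss_def inner_vec_def exp_sum[symmetric] sum_divide_distrib sum_negf power2_eq_square)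
  also have "(\<Prod>i\<in>UNIV. if i \<in> J then indicator {0<..} (b $ i) else 1) = (indicator {b. \<forall>i\<in>J. b $ i > 0} b :: real)"
  proof (cases "\<forall>i\<in>J. b $ i > 0")
    case True
    then show ?thesis by (auto intro!: prod.neutral)
  next
    case False
    then obtain i where i: "i \<in> J" "\<not> b $ i > 0" by blast
    have "\<exists>i\<in>UNIV. (if i \<in> J then indicator {0<..} (b $ i) else (1 :: real)) = 0"
      by (rule bexI[of _ i]) (use i in auto)
    then have "(\<Prod>i\<in>UNIV. if i \<in> J then indicator {0<..} (b $ i) else (1 :: real)) = 0"
      by (intro prod_zero) auto
    moreover have "indicator {b. \<forall>i\<in>J. b $ i > 0} b = (0 :: real)" using False by (simp add: indicator_def)
    ultimately show ?thesis by (simp only:)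
  qed
  finally show ?thesis .
qed

lemma WY_eq: "WY y = pwp y * gauss y"
proof -
  have "(\<Prod>i\<in>UNIV. exp (- (y $ i)\<^sup>2 / 2)) = gauss y"
    by (simp add: gauss_def inner_vec_def exp_sum[symmetric] sum_divide_distrib sum_negf power2_eq_square)
  then show ?thesis by (simp add: WY_def ga_def prod.distrib pwp_def)
qed

lemma WBWY_integrable: "integrable (lborel \<Otimes>\<^sub>M lborel) (\<lambda>(b, y). WB J b * WY y)"
  by (rule pair_integrableI)
    (auto simp: abs_mult WB_nonneg WY_nonneg intro!: WB_integrable WY_integrable)

lemma pair_measurable [measurable]:
  "(\<lambda>z :: (real ^ 'd::finite) \<times> (real ^ 'd). fst z \<bullet> snd z) \<in> borel_measurable borel"
  "(\<lambda>z. WB J (fst z) :: real) \<in> borel_measurable (borel :: ((real ^ 'd) \<times> (real ^ 'd)) measure)"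
  "(\<lambda>z. WY (snd z) :: real) \<in> borel_measurable (borel :: ((real ^ 'd) \<times> (real ^ 'd)) measure)"
  by (intro borel_measurable_continuous_onI continuous_intros measurable_compose[OF _ WB_measurable]
      measurable_compose[OF _ WY_measurable])+

text \<open>By Tonelli the s-integral can be taken innermost, where it is \<open>Kr\<close> of the
  inner product. Since \<open>Kr\<close> is bounded and the weights are integrable, everything is
  finite and can be continued with complex-valued integrals.\<close>

lemma Yint_Kr:
  fixes J :: "'d::finite set"
  shows "Yint J = ennreal (\<integral>z. WB J (fst z) * WY (snd z) * Kr (fst z \<bullet> snd z) \<partial>(lborel :: ((real^'d) \<times> (real^'d)) measure))"
proof -
  define A where "A s = indicator {0<..} s * exp (- s\<^sup>2 / 2)" for s :: real
  have A0: "A s \<ge> 0" for s by (simp add: A_def)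
  have [measurable]: "A \<in> borel_measurable borel" unfolding A_def by measurable
  have "Yint J = (\<integral>\<^sup>+s. (\<integral>\<^sup>+b. (\<integral>\<^sup>+y. ennreal (WB J b * WY y * (A s * exp (- (b \<bullet> y)\<^sup>2 / (2 * s\<^sup>2)))) \<partial>lborel) \<partial>lborel) \<partial>lborel)"
    unfolding Yint_def
  proof (intro nn_integral_cong)
    fix s :: real
    have "ennreal (A s) * (\<integral>\<^sup>+b. ennreal (WB J b) * (\<integral>\<^sup>+y. ennreal (WY y * exp (- (b \<bullet> y)\<^sup>2 / (2 * s\<^sup>2))) \<partial>lborel) \<partial>lborel)
        = (\<integral>\<^sup>+b. (\<integral>\<^sup>+y. ennreal (A s) * (ennreal (WB J b) * ennreal (WY y * exp (- (b \<bullet> y)\<^sup>2 / (2 * s\<^sup>2)))) \<partial>lborel) \<partial>lborel)"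
      by (subst nn_integral_cmult[symmetric], measurable, intro nn_integral_cong)
         (simp add: nn_integral_cmult)
    also have "\<dots> = (\<integral>\<^sup>+b. (\<integral>\<^sup>+y. ennreal (WB J b * WY y * (A s * exp (- (b \<bullet> y)\<^sup>2 / (2 * s\<^sup>2)))) \<partial>lborel) \<partial>lborel)"
      by (intro nn_integral_cong)
         (simp only: ennreal_mult[symmetric] A0 WB_nonneg WY_nonneg exp_ge_zero mult_nonneg_nonneg mult_ac)
    finally show "ennreal (indicator {0<..} s * exp (- s\<^sup>2 / 2)) * (\<integral>\<^sup>+b. ennreal (indicator {b. \<forall>i\<in>J. b $ i > 0} b * gauss b) *
        (\<integral>\<^sup>+y. ennreal (pwp y * gauss y * exp (- (b \<bullet> y)\<^sup>2 / (2 * s\<^sup>2))) \<partial>lborel) \<partial>lborel)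
      = (\<integral>\<^sup>+b. (\<integral>\<^sup>+y. ennreal (WB J b * WY y * (A s * exp (- (b \<bullet> y)\<^sup>2 / (2 * s\<^sup>2)))) \<partial>lborel) \<partial>lborel)"
      unfolding A_def WB_eq WY_eq .
  qed
  also have "\<dots> = (\<integral>\<^sup>+b. (\<integral>\<^sup>+s. (\<integral>\<^sup>+y. ennreal (WB J b * WY y * (A s * exp (- (b \<bullet> y)\<^sup>2 / (2 * s\<^sup>2)))) \<partial>lborel) \<partial>lborel) \<partial>lborel)"
    by (rule lborel_pair.Fubini') measurable
  also have "\<dots> = (\<integral>\<^sup>+b. (\<integral>\<^sup>+y. (\<integral>\<^sup>+s. ennreal (WB J b * WY y * (A s * exp (- (b \<bullet> y)\<^sup>2 / (2 * s\<^sup>2)))) \<partial>lborel) \<partial>lborel) \<partial>lborel)"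
    by (intro nn_integral_cong lborel_pair.Fubini') measurable
  also have "\<dots> = (\<integral>\<^sup>+b. (\<integral>\<^sup>+y. ennreal (WB J b * WY y * Kr (b \<bullet> y)) \<partial>lborel) \<partial>lborel)"
  proof (intro nn_integral_cong)
    fix b y :: "real ^ 'd"
    have "(\<integral>\<^sup>+s. ennreal (WB J b * WY y * (A s * exp (- (b \<bullet> y)\<^sup>2 / (2 * s\<^sup>2)))) \<partial>lborel)
      = ennreal (\<integral>s. WB J b * WY y * (A s * exp (- (b \<bullet> y)\<^sup>2 / (2 * s\<^sup>2))) \<partial>lborel)"
    proof (rule nn_integral_eq_integral)
      show "integrable lborel (\<lambda>s. WB J b * WY y * (A s * exp (- (b \<bullet> y)\<^sup>2 / (2 * s\<^sup>2))))"
        using integrable_mult_right[OF Kr_integrand_integrable[of "b \<bullet> y"], of "WB J b * WY y"] by (simp add: A_def mult.assoc)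
    qed (simp add: A0 WB_nonneg WY_nonneg)
    also have "(\<integral>s. WB J b * WY y * (A s * exp (- (b \<bullet> y)\<^sup>2 / (2 * s\<^sup>2))) \<partial>lborel) = WB J b * WY y * Kr (b \<bullet> y)"
      unfolding Kr_def by (subst integral_mult_right_zero) (simp add: A_def mult.assoc)
    finally show "(\<integral>\<^sup>+s. ennreal (WB J b * WY y * (A s * exp (- (b \<bullet> y)\<^sup>2 / (2 * s\<^sup>2)))) \<partial>lborel) = ennreal (WB J b * WY y * Kr (b \<bullet> y))" .
  qed
  also have "\<dots> = (\<integral>\<^sup>+z. ennreal (WB J (fst z) * WY (snd z) * Kr (fst z \<bullet> snd z)) \<partial>(lborel \<Otimes>\<^sub>M lborel))"
    by (subst lborel.nn_integral_fst[symmetric]) (simp_all, measurable)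
  also have "\<dots> = (\<integral>\<^sup>+z. ennreal (WB J (fst z) * WY (snd z) * Kr (fst z \<bullet> snd z)) \<partial>lborel)" by (simp only: lborel_prod)
  also have "\<dots> = ennreal (\<integral>z. WB J (fst z) * WY (snd z) * Kr (fst z \<bullet> snd z) \<partial>lborel)"
  proof (rule nn_integral_eq_integral)
    have "integrable lborel (\<lambda>(b, y). WB J b * WY y)" using WBWY_integrable[of J] by (simp only: lborel_prod)
    from integrable_mult_left[OF this, of "\<integral>s. exp (- (s::real)\<^sup>2 / 2) \<partial>lborel"]
    show "integrable lborel (\<lambda>z. WB J (fst z) * WY (snd z) * Kr (fst z \<bullet> snd z))"
    proof (rule Bochner_Integration.integrable_bound)
      show "AE z in lborel. norm (WB J (fst z) * WY (snd z) * Kr (fst z \<bullet> snd z)) \<le> norm ((case z of (b, y) \<Rightarrow> WB J b * WY y) * (\<integral>s. exp (- (s::real)\<^sup>2 / 2) \<partial>lborel))"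
      proof (rule AE_I2)
        fix z :: "(real ^ 'd) \<times> (real ^ 'd)"
        have "WB J (fst z) * WY (snd z) * Kr (fst z \<bullet> snd z) \<le> WB J (fst z) * WY (snd z) * (\<integral>s. exp (- (s::real)\<^sup>2 / 2) \<partial>lborel)"
          by (intro mult_left_mono Kr_bounded) (simp add: WB_nonneg WY_nonneg)
        then show "norm (WB J (fst z) * WY (snd z) * Kr (fst z \<bullet> snd z)) \<le> norm ((case z of (b, y) \<Rightarrow> WB J b * WY y) * (\<integral>s. exp (- (s::real)\<^sup>2 / 2) \<partial>lborel))"
          by (simp add: split_beta WB_nonneg WY_nonneg Kr_nonneg abs_mult)
      qed
    next
      have "(\<lambda>z :: (real ^ 'd) \<times> (real ^ 'd). Kr (fst z \<bullet> snd z)) \<in> borel_measurable borel"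
        by (rule measurable_compose[OF pair_measurable(1) Kr_measurable])
      then show "(\<lambda>z. WB J (fst z) * WY (snd z) * Kr (fst z \<bullet> snd z)) \<in> borel_measurable lborel"
        by (simp add: pair_measurable borel_measurable_times)
    qed
  qed (simp add: WB_nonneg WY_nonneg Kr_nonneg)
  finally show ?thesis .
qed

definition Psi :: "'d::finite set \<Rightarrow> real \<Rightarrow> complex" where
  "Psi J t = of_real (1 / sqrt (2 * pi) * (1 / (1 + t\<^sup>2))) * (\<Prod>i\<in>UNIV. psi (CARD('d) - 1) (i \<in> J) t)"

lemma cis_sum: "finite A \<Longrightarrow> cis (\<Sum>i\<in>A. f i) = (\<Prod>i\<in>A. cis (f i))"
  by (induction A rule: finite_induct) (auto simp: cis_mult[symmetric])

text \<open>The phase of an inner product is the product of the phases of its terms, so the integral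
  over y and then that over b factorize into one-dimensional integrals.\<close>

lemma vec_fourier:
  fixes J :: "'d::finite set"
  shows "(\<integral>b. (\<integral>y. of_real (WB J b * WY y) * cis ((b \<bullet> y) * t) \<partial>lborel) \<partial>lborel) = (\<Prod>i\<in>UNIV. psi (CARD('d) - 1) (i \<in> J) t)"
proof -
  let ?m = "CARD('d) - 1"
  have "(\<integral>y. of_real (WB J b * WY y) * cis ((b \<bullet> y) * t) \<partial>lborel) = (\<Prod>i\<in>UNIV. of_real (gb (i \<in> J) (b $ i)) * phi ?m (t * b $ i))" for b
  proof -
    have "(\<integral>y. of_real (WB J b * WY y) * cis ((b \<bullet> y) * t) \<partial>lborel)
      = (\<integral>y. of_real (WB J b) * (\<Prod>i\<in>UNIV. of_real (ga ?m (y $ i)) * cis (t * b $ i * y $ i)) \<partial>lborel)"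
    proof (rule Bochner_Integration.integral_cong[OF refl])
      fix y :: "real ^ 'd"
      have "cis ((b \<bullet> y) * t) = (\<Prod>i\<in>UNIV. cis (t * b $ i * y $ i))"
        by (subst cis_sum[symmetric]) (simp_all add: inner_vec_def sum_distrib_left mult_ac)
      then show "of_real (WB J b * WY y) * cis ((b \<bullet> y) * t) = of_real (WB J b) * (\<Prod>i\<in>UNIV. of_real (ga ?m (y $ i)) * cis (t * b $ i * y $ i))"
        by (simp add: WY_def prod.distrib mult.assoc)
    qed
    also have "\<dots> = of_real (WB J b) * (\<Prod>i\<in>UNIV. phi ?m (t * b $ i))"
      unfolding integral_mult_right_zero phi_def
      by (subst vec_integrable_prod(2)) (auto intro!: phi_integrable)
    also have "\<dots> = (\<Prod>i\<in>UNIV. of_real (gb (i \<in> J) (b $ i)) * phi ?m (t * b $ i))"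
      by (simp add: WB_def prod.distrib)
    finally show ?thesis .
  qed
  then have "(\<integral>b. (\<integral>y. of_real (WB J b * WY y) * cis ((b \<bullet> y) * t) \<partial>lborel) \<partial>lborel)
    = (\<integral>b. (\<Prod>i\<in>UNIV. of_real (gb (i \<in> J) (b $ i)) * phi ?m (t * b $ i)) \<partial>lborel)" by simp
  also have "\<dots> = (\<Prod>i\<in>UNIV. psi ?m (i \<in> J) t)"
    unfolding psi_def by (subst vec_integrable_prod(2)) (auto intro!: psi_integrable)
  finally show ?thesis .
qed

text \<open>Fubini for the Fourier representation of \<open>Kr\<close>. The phase has modulus 1, so
  the norm of the integrand is the product of an integrable function of (b, y) and one of t.
  Comparing with the real integral in \<open>Yint_Kr\<close> justifies \<open>Re\<close>.\<close>

lemma Yint_Psi: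
  fixes J :: "'d::finite set"
  shows "integrable lborel (Psi J)" and "Yint J = ennreal (Re (\<integral>t. Psi J t \<partial>lborel))"
proof -
  define w where "w z = WB J (fst z) * WY (snd z)" for z :: "(real ^ 'd) \<times> (real ^ 'd)"
  define k where "k t = 1 / sqrt (2 * pi) * (1 / (1 + t\<^sup>2))" for t :: real
  have k0: "k t \<ge> 0" for t by (simp add: k_def add_nonneg_nonneg)
  have w0: "w z \<ge> 0" for z by (simp add: w_def WB_nonneg WY_nonneg)
  have [measurable]: "w \<in> borel_measurable borel" unfolding w_def by (intro borel_measurable_times pair_measurable)
  have [measurable]: "k \<in> borel_measurable borel" unfolding k_def by measurable
  have ki: "integrable lborel k" unfolding k_def by (intro integrable_mult_right inverse_1_plus_square_integrable)
  have wi: "integrable lborel w"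
    using WBWY_integrable[of J] by (simp add: w_def[abs_def] lborel_prod split_beta')
  define f where "f z t = complex_of_real (w z * k t) * cis ((fst z \<bullet> snd z) * t)" for z t
  have nf: "norm (f z t) = w z * k t" for z t by (simp add: f_def norm_mult w0 k0)
  have fi: "integrable (lborel \<Otimes>\<^sub>M lborel) (case_prod f)"
  proof (rule pair_integrableI)
    define q where "q z = fst z \<bullet> snd z" for z :: "(real ^ 'd) \<times> (real ^ 'd)"
    have [measurable]: "q \<in> borel_measurable borel" unfolding q_def by (rule pair_measurable)
    show "case_prod f \<in> borel_measurable (lborel \<Otimes>\<^sub>M lborel)"
      unfolding f_def split_beta' q_def[symmetric] by measurable
    show "integrable lborel (f z)" for z
    proof (rule Bochner_Integration.integrable_bound[OF integrable_mult_right[OF ki, of "w z"]])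
      show "f z \<in> borel_measurable lborel" unfolding f_def by measurable
      show "AE t in lborel. norm (f z t) \<le> norm (w z * k t)" by (rule AE_I2) (simp add: nf)
    qed
    show "integrable lborel (\<lambda>z. \<integral>t. norm (f z t) \<partial>lborel)"
      unfolding nf integral_mult_right_zero by (intro integrable_mult_left wi)
  qed
  have inner: "(\<integral>z. f z t \<partial>lborel) = Psi J t" for t
  proof -
    have g: "integrable (lborel \<Otimes>\<^sub>M lborel) (\<lambda>z. of_real (WB J (fst z) * WY (snd z)) * cis ((fst z \<bullet> snd z) * t))"
    proof (rule Bochner_Integration.integrable_bound[OF WBWY_integrable[of J]])
      show "AE z in lborel \<Otimes>\<^sub>M lborel. norm (of_real (WB J (fst z) * WY (snd z)) * cis ((fst z \<bullet> snd z) * t)) \<le> norm (case z of (b, y) \<Rightarrow> WB J b * WY y)"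
        by (rule AE_I2) (simp add: split_beta norm_of_real_cis del: of_real_mult)
    qed measurable
    have "(\<integral>z. f z t \<partial>lborel) = (\<integral>z. of_real (k t) * (of_real (WB J (fst z) * WY (snd z)) * cis ((fst z \<bullet> snd z) * t)) \<partial>lborel)"
      by (rule Bochner_Integration.integral_cong) (simp_all add: f_def w_def mult_ac)
    also have "\<dots> = of_real (k t) * (\<integral>z. (of_real (WB J (fst z) * WY (snd z)) * cis ((fst z \<bullet> snd z) * t)) \<partial>(lborel \<Otimes>\<^sub>M lborel))"
      by (simp only: integral_mult_right_zero lborel_prod)
    also have "(\<integral>z. (of_real (WB J (fst z) * WY (snd z)) * cis ((fst z \<bullet> snd z) * t)) \<partial>(lborel \<Otimes>\<^sub>M lborel))
      = (\<integral>b. (\<integral>y. of_real (WB J b * WY y) * cis ((b \<bullet> y) * t) \<partial>lborel) \<partial>lborel)"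
      using lborel_pair.integral_fst'[OF g] by simp
    finally show ?thesis unfolding vec_fourier by (simp only: Psi_def k_def)
  qed
  show "integrable lborel (Psi J)"
  proof -
    have "integrable (lborel \<Otimes>\<^sub>M lborel) (\<lambda>(t, z). case_prod f (z, t))"
      using lborel_pair.integrable_product_swap[OF fi] .
    from lborel_pair.integrable_fst'[OF this] show ?thesis by (simp add: inner)
  qed
  have "complex_of_real (\<integral>z. w z * Kr (fst z \<bullet> snd z) \<partial>lborel) = (\<integral>z. complex_of_real (w z * Kr (fst z \<bullet> snd z)) \<partial>lborel)"
    by (rule integral_complex_of_real[symmetric])
  also have "\<dots> = (\<integral>z. (\<integral>t. f z t \<partial>lborel) \<partial>lborel)"
  proof (rule Bochner_Integration.integral_cong[OF refl])
    fix z :: "(real ^ 'd) \<times> (real ^ 'd)"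
    have "complex_of_real (w z * Kr (fst z \<bullet> snd z)) = of_real (w z) * (\<integral>t. of_real (k t) * cis ((fst z \<bullet> snd z) * t) \<partial>lborel)"
      by (simp only: of_real_mult Kr_formula k_def)
    also have "\<dots> = (\<integral>t. f z t \<partial>lborel)"
      unfolding f_def by (subst integral_mult_right_zero[symmetric]) (simp add: mult.assoc)
    finally show "complex_of_real (w z * Kr (fst z \<bullet> snd z)) = (\<integral>t. f z t \<partial>lborel)" .
  qed
  also have "\<dots> = (\<integral>t. (\<integral>z. f z t \<partial>lborel) \<partial>lborel)"
    by (rule lborel_pair.Fubini_integral[OF fi, symmetric])
  also have "\<dots> = (\<integral>t. Psi J t \<partial>lborel)" by (simp only: inner)
  finally have "(\<integral>z. w z * Kr (fst z \<bullet> snd z) \<partial>lborel) = Re (\<integral>t. Psi J t \<partial>lborel)" by (metis Re_complex_of_real)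
  then show "Yint J = ennreal (Re (\<integral>t. Psi J t \<partial>lborel))" unfolding Yint_Kr w_def by simp
qed

section \<open>Evaluation with t = sinh x\<close>

lemma prod_member_cases:
  fixes g :: "bool \<Rightarrow> 'a::comm_monoid_mult" and J :: "'d::finite set"
  shows "(\<Prod>i\<in>UNIV. g (i \<in> J)) = g True ^ card J * g False ^ (CARD('d) - card J)"
proof -
  have "(\<Prod>i\<in>UNIV. g (i \<in> J)) = (\<Prod>i\<in>UNIV - J. g (i \<in> J)) * (\<Prod>i\<in>J. g (i \<in> J))"
    by (rule prod.subset_diff) auto
  also have "(\<Prod>i\<in>UNIV - J. g (i \<in> J)) = g False ^ (CARD('d) - card J)"
    by (simp add: card_Diff_subset)
  also have "(\<Prod>i\<in>J. g (i \<in> J)) = g True ^ card J" by simp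
  finally show ?thesis by (simp add: mult.commute)
qed

lemma psi_sinh:
  "psi (2 * j) True (sinh x) = 2 ^ j * fact j * Sf j (Complex (pi / 2) x) / of_real (cosh x ^ (2 * j + 1))"
  "psi (2 * j) False (sinh x) = 2 ^ j * fact j * of_real (2 * Wr j) / of_real (cosh x ^ (2 * j + 1))"
proof -
  show "psi (2 * j) True (sinh x) = 2 ^ j * fact j * Sf j (Complex (pi / 2) x) / of_real (cosh x ^ (2 * j + 1))"
    unfolding psi_True Iq_sinh by (simp only: times_divide_eq_right)
  have c: "Complex (pi / 2) y = pi / 2 + \<i> * of_real y" for y by (simp add: complex_eq_iff)
  have "Iq j (- sinh x) = Sf j (Complex (pi / 2) (- x)) / of_real (cosh x ^ (2 * j + 1))"
    using Iq_sinh[of j "- x"] by simp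
  then have "Iq j (sinh x) + Iq j (- sinh x) = (Sf j (Complex (pi / 2) x) + Sf j (Complex (pi / 2) (- x))) / of_real (cosh x ^ (2 * j + 1))"
    unfolding Iq_sinh by (simp only: add_divide_distrib)
  also have "Sf j (Complex (pi / 2) x) + Sf j (Complex (pi / 2) (- x)) = of_real (2 * Wr j)"
    using Sf_reflect[of j "\<i> * of_real x"] unfolding c by simp
  finally have "Iq j (sinh x) + Iq j (- sinh x) = of_real (2 * Wr j) / of_real (cosh x ^ (2 * j + 1))" .
  moreover have "psi (2 * j) False (sinh x) = 2 ^ j * fact j * (Iq j (sinh x) + Iq j (- sinh x))"
    unfolding psi_False psi_True by (simp only: distrib_left)
  ultimately show "psi (2 * j) False (sinh x) = 2 ^ j * fact j * of_real (2 * Wr j) / of_real (cosh x ^ (2 * j + 1))"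
    by (simp only: times_divide_eq_right)
qed

text \<open>Continuity is read off from the closed form through t = sinh (arsinh t); the
  substitution rule applied to \<open>Psi\<close> asks for it.\<close>

lemma Iq_isCont: "isCont (Iq j) t"
proof -
  have "Iq j = (\<lambda>t. Sf j (Complex (pi / 2) (arsinh t)) / of_real (cosh (arsinh t) ^ (2 * j + 1)))"
  proof (rule HOL.ext)
    fix t :: real
    show "Iq j t = Sf j (Complex (pi / 2) (arsinh t)) / of_real (cosh (arsinh t) ^ (2 * j + 1))"
      unfolding Iq_sinh[symmetric] sinh_arsinh_real ..
  qed
  moreover have "continuous_on UNIV (\<lambda>t. Sf j (Complex (pi / 2) (arsinh t)) / complex_of_real (cosh (arsinh t) ^ (2 * j + 1)))"
    unfolding Complex_eq by (intro continuous_intros) auto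
  ultimately show ?thesis by (simp add: continuous_on_eq_continuous_at)
qed

lemma Psi_isCont:
  fixes J :: "'d::finite set"
  assumes d: "CARD('d) = 2 * j + 1"
  shows "isCont (Psi J) t"
proof -
  have "(1 :: real) + t\<^sup>2 \<noteq> 0" for t using add_pos_nonneg[of 1 "t\<^sup>2"] by auto
  moreover have "isCont (psi (2 * j) P) t" for P t
  proof -
    have T: "isCont (psi (2 * j) True) t" for t
      unfolding psi_True[abs_def] by (intro continuous_intros Iq_isCont)
    have F: "psi (2 * j) False = (\<lambda>t. psi (2 * j) True t + psi (2 * j) True (- t))"
      by (rule HOL.ext) (rule psi_False)
    have "isCont (psi (2 * j) False) t"
      unfolding F by (intro continuous_intros T isCont_o2[OF _ T])
    then show ?thesis using T by (cases P) auto
  qed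
  ultimately show ?thesis unfolding Psi_def[abs_def] d by (intro continuous_intros) auto
qed

text \<open>The exponent of cosh: d from each of the d factors psi, 2 from 1 + t^2, and minus 1 from
  dt = cosh x dx, together d^2 + 1.\<close>

lemma Psi_sinh:
  fixes J :: "'d::finite set"
  assumes d: "CARD('d) = 2 * j + 1"
  shows "of_real (cosh x) * Psi J (sinh x) = of_real (1 / sqrt (2 * pi) * (2 ^ j * fact j) ^ CARD('d) * (2 * Wr j) ^ (CARD('d) - card J))
    * (Sf j (Complex (pi / 2) x) ^ card J / of_real (cosh x ^ (CARD('d) * CARD('d) + 1)))"
proof -
  let ?d = "CARD('d)" let ?l = "card J"
  define c where "c = complex_of_real (cosh x)"
  define k where "k = (2 ^ j * fact j :: complex)"
  define S where "S = Sf j (Complex (pi / 2) x)"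
  define W where "W = complex_of_real (2 * Wr j)"
  have c0: "c \<noteq> 0" unfolding c_def using cosh_real_pos[of x] by auto
  have ld: "?l + (?d - ?l) = ?d" by (simp add: card_mono)
  have m: "?d - 1 = 2 * j" using d by simp
  have "(\<Prod>i\<in>UNIV. psi (?d - 1) (i \<in> J) (sinh x)) = (k * S / c ^ ?d) ^ ?l * (k * W / c ^ ?d) ^ (?d - ?l)"
    unfolding m by (subst prod_member_cases[of "\<lambda>b. psi (2 * j) b (sinh x)" J])
      (simp only: psi_sinh d k_def S_def W_def c_def of_real_power)
  also have "\<dots> = (k ^ ?l * k ^ (?d - ?l)) * W ^ (?d - ?l) * S ^ ?l / ((c ^ ?d) ^ ?l * (c ^ ?d) ^ (?d - ?l))"
    by (simp add: power_divide power_mult_distrib)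
  also have "k ^ ?l * k ^ (?d - ?l) = k ^ ?d" by (simp only: power_add[symmetric] ld)
  also have "(c ^ ?d) ^ ?l * (c ^ ?d) ^ (?d - ?l) = c ^ (?d * ?d)" by (simp only: power_add[symmetric] ld power_mult)
  finally have P: "(\<Prod>i\<in>UNIV. psi (?d - 1) (i \<in> J) (sinh x)) = k ^ ?d * W ^ (?d - ?l) * S ^ ?l / c ^ (?d * ?d)" .
  have cs: "1 + (sinh x)\<^sup>2 = cosh x ^ 2" by (simp add: cosh_square_eq)
  have "of_real (cosh x) * Psi J (sinh x) = c * (of_real (1 / sqrt (2 * pi)) * (1 / c\<^sup>2)) * (k ^ ?d * W ^ (?d - ?l) * S ^ ?l / c ^ (?d * ?d))"
    unfolding Psi_def P cs by (simp add: c_def)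
  also have "\<dots> = of_real (1 / sqrt (2 * pi)) * k ^ ?d * W ^ (?d - ?l) * (S ^ ?l / c ^ (?d * ?d + 1))"
    using c0 by (simp add: power2_eq_square)
  also have "\<dots> = of_real (1 / sqrt (2 * pi) * (2 ^ j * fact j) ^ ?d * (2 * Wr j) ^ (?d - ?l)) * (S ^ ?l / c ^ (?d * ?d + 1))"
    by (simp add: k_def W_def)
  finally show ?thesis by (simp only: S_def c_def of_real_power)
qed

text \<open>For odd d the exponent d^2 + 1 is even, and 2 j l \<le> d^2 gives the decay that the
  contour integral requires. The number q is found before J is fixed, because the integral depends
  on J only through its cardinality.\<close>

lemma Yint_value:
  assumes d: "CARD('d::finite) = 2 * j + 1" and l: "odd l" "l \<le> CARD('d)"
  shows "\<exists>q\<in>\<rat>. \<forall>J :: 'd set. card J = l \<longrightarrow>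
    Yint J = ennreal (1 / sqrt (2 * pi) * (2 ^ j * fact j) ^ CARD('d) * (2 * Wr j) ^ (CARD('d) - l) * (q * pi))"
proof -
  let ?n = "CARD('d) * CARD('d) + 1"
  define F where "F x = Sf j (Complex (pi / 2) x) ^ l / complex_of_real (cosh x ^ ?n)" for x
  have n: "even ?n" using d by simp
  have ln: "2 * j * l < ?n"
  proof -
    have "2 * j * l \<le> CARD('d) * CARD('d)" using d l(2) by (intro mult_mono) auto
    then show ?thesis by simp
  qed
  have Fi: "integrable lborel F" and "\<exists>q\<in>\<rat>. (\<integral>x. F x \<partial>lborel) = complex_of_real (q * pi)"
    using Sf_over_cosh_integral[OF l(1) n ln] unfolding F_def[abs_def] by blast+
  then obtain q where q: "q \<in> \<rat>" "(\<integral>x. F x \<partial>lborel) = complex_of_real (q * pi)" by blast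
  define C where "C = 1 / sqrt (2 * pi) * (2 ^ j * fact j) ^ CARD('d) * (2 * Wr j) ^ (CARD('d) - l)"
  have e: "einterval (- \<infinity>) \<infinity> = UNIV" by (auto simp: einterval_def)
  have "Yint J = ennreal (C * (q * pi))" if J: "card J = l" for J :: "'d set"
  proof -
    have sub: "cosh x *\<^sub>R Psi J (sinh x) = of_real C * F x" for x
      using Psi_sinh[OF d, of x J] by (simp only: scaleR_conv_of_real C_def F_def J)
    have "(LBINT x=-\<infinity>..\<infinity>. Psi J x) = (LBINT x=-\<infinity>..\<infinity>. cosh x *\<^sub>R Psi J (sinh x))"
    proof (rule interval_integral_substitution_integrable)
      show "DERIV sinh x :> cosh x" for x :: real by (auto intro!: derivative_eq_intros)
      show "isCont (Psi J) (sinh x)" for x by (rule Psi_isCont[OF d])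
      show "isCont cosh x" for x :: real by (intro continuous_intros)
      show "((ereal \<circ> sinh \<circ> real_of_ereal) \<longlongrightarrow> - \<infinity>) (at_right (- \<infinity>))"
        unfolding ereal_tendsto_simps by (rule sinh_real_at_bot)
      show "((ereal \<circ> sinh \<circ> real_of_ereal) \<longlongrightarrow> \<infinity>) (at_left \<infinity>)"
        unfolding ereal_tendsto_simps by (rule sinh_real_at_top)
      show "set_integrable lborel (einterval (- \<infinity>) \<infinity>) (\<lambda>x. cosh x *\<^sub>R Psi J (sinh x))"
        unfolding sub e set_integrable_def using integrable_mult_right[OF Fi, of "of_real C"] by simp
      show "set_integrable lborel (einterval (- \<infinity>) \<infinity>) (Psi J)"
        unfolding e set_integrable_def using Yint_Psi(1)[of J] by simp
    qed auto
    then have "(\<integral>t. Psi J t \<partial>lborel) = (\<integral>x. of_real C * F x \<partial>lborel)"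
      unfolding sub by (simp add: interval_lebesgue_integral_def e set_lebesgue_integral_def)
    also have "\<dots> = of_real C * of_real (q * pi)" unfolding integral_mult_right_zero q(2) ..
    finally have "Re (\<integral>t. Psi J t \<partial>lborel) = C * (q * pi)" by (simp only: of_real_mult[symmetric] Re_complex_of_real)
    then show ?thesis using Yint_Psi(2)[of J] by simp
  qed
  then show ?thesis using q(1) unfolding C_def by blast
qed

section \<open>Expected face numbers\<close>

text \<open>The points keep a positive distance from the origin, so the cell contains a ball and has
  full dimension; a proper face has smaller dimension.\<close>

lemma num_faces_full_dim:
  fixes X :: "(real ^ 'd::finite) set"
  assumes lf: "finite (X \<inter> cball 0 1)" and 0: "0 \<notin> X"
  shows "num_faces CARD('d) (voronoi_cell0 X) = 1"
proof -
  let ?Z = "voronoi_cell0 X"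
  have conv: "convex ?Z"
  proof -
    have "?Z = (\<Inter>p\<in>X. {x. norm x \<le> norm (x - p)})" by (auto simp: voronoi_cell0_def)
    moreover have "{x. norm x \<le> norm (x - p)} = {x. p \<bullet> x \<le> (p \<bullet> p) / 2}" for p :: "real ^ 'd"
    proof -
      have "norm x \<le> norm (x - p) \<longleftrightarrow> x \<bullet> x \<le> (x - p) \<bullet> (x - p)" for x
        by (simp add: norm_eq_sqrt_inner)
      moreover have "(x - p) \<bullet> (x - p) = x \<bullet> x - 2 * (p \<bullet> x) + p \<bullet> p" for x
        by (simp add: inner_diff_left inner_diff_right inner_commute[of x p])
      ultimately show ?thesis by auto
    qed
    ultimately show ?thesis by (simp only:) (intro convex_INT convex_halfspace_le)
  qed
  \<comment> \<open>The entry 1 covers the case that no point lies in the unit ball, and it also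
    bounds r for the points outside.\<close>
  define r where "r = Min (insert 1 (norm ` (X \<inter> cball 0 1)))"
  have fin: "finite (insert 1 (norm ` (X \<inter> cball 0 1)))" using lf by simp
  have r0: "r > 0" unfolding r_def using fin 0 by (subst Min_gr_iff) auto
  have r1: "norm p \<ge> r" if "p \<in> X" for p
  proof (cases "norm p \<le> 1")
    case True
    then show ?thesis unfolding r_def using that by (intro Min_le[OF fin]) auto
  next
    case False
    have "r \<le> 1" unfolding r_def by (intro Min_le[OF fin]) auto
    then show ?thesis using False by simp
  qed
  have "ball 0 (r / 2) \<subseteq> ?Z"
  proof (rule subsetI)
    fix x :: "real ^ 'd" assume "x \<in> ball 0 (r / 2)"
    then have x: "norm x < r / 2" by simp
    have "norm x \<le> norm (x - p)" if "p \<in> X" for p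
      using r1[OF that] x norm_triangle_ineq2[of p x] by (simp add: norm_minus_commute)
    then show "x \<in> ?Z" by (simp add: voronoi_cell0_def)
  qed
  then have dim: "aff_dim ?Z = int CARD('d)"
    using aff_dim_subset[of "ball 0 (r / 2)" ?Z] aff_dim_open[of "ball (0 :: real ^ 'd) (r / 2)"] r0 aff_dim_le_DIM[of ?Z] by simp
  have "{F. F face_of ?Z \<and> aff_dim F = int CARD('d)} = {?Z}"
  proof (intro set_eqI iffI)
    fix F assume "F \<in> {F. F face_of ?Z \<and> aff_dim F = int CARD('d)}"
    then have F: "F face_of ?Z" "aff_dim F = aff_dim ?Z" using dim by auto
    then show "F \<in> {?Z}" using face_of_aff_dim_lt[OF conv F(1)] by (cases "F = ?Z") auto
  next
    fix F assume "F \<in> {?Z}"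
    then show "F \<in> {F. F face_of ?Z \<and> aff_dim F = int CARD('d)}" using dim face_of_refl[OF conv] by auto
  qed
  then show ?thesis by (simp add: num_faces_def)
qed

lemma (in poisson) AE_zero_notin: "AE w in M. 0 \<notin> Phi w"
proof -
  have "prob {w \<in> space M. Phi w \<inter> {0} = {}} = 1" by (subst prob_void) auto
  then have "AE w in M. w \<in> {w \<in> space M. Phi w \<inter> {0} = {}}"
    using sets_void[of "{0}"] by (subst AE_in_set_eq_1) (simp_all del: Int_insert_right)
  then show ?thesis by eventually_elim auto
qed

context poisson_vec
begin

definition mean_faces :: "nat \<Rightarrow> ennreal" where
  "mean_faces l = (\<integral>\<^sup>+ w. ennreal (real (num_faces l (voronoi_cell0 (Phi w)))) \<partial>M)"

lemma mean_faces_full: "mean_faces CARD('d) = 1"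
proof -
  have "mean_faces CARD('d) = (\<integral>\<^sup>+ w. 1 \<partial>M)"
    unfolding mean_faces_def
  proof (rule nn_integral_cong_AE)
    show "AE w in M. ennreal (real (num_faces CARD('d) (voronoi_cell0 (Phi w)))) = 1"
      using AE_zero_notin AE_space
    proof eventually_elim
      case (elim w)
      then show ?case by (subst num_faces_full_dim) (auto intro: finite_Phi)
    qed
  qed
  then show ?thesis by (simp add: emeasure_space_1)
qed

text \<open>The mean does not depend on u, so integrating it against the Gaussian multiplies it by a
  known positive constant. Almost every u has only nonzero coordinates, as the formula for a fixed
  direction demands.\<close>

lemma mean_faces_proportional:
  obtains a K :: ennreal where "a \<noteq> 0" "a < \<infinity>"
    "\<And>l. l \<le> CARD('d) \<Longrightarrow> a * mean_faces l = K * (\<Sum>J\<in>{J :: 'd set. card J = l}. Yint J)"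
proof -
  have Wm: "(Wvoid :: real ^ 'd \<Rightarrow> ennreal) \<in> borel_measurable borel"
    unfolding Wvoid_def[abs_def] by (subst content_ball) auto
  from proportional_to_Yint[OF this] obtain K1 :: real and K2 :: ennreal where K1: "K1 > 0"
    and K: "\<And>J :: 'd set. ennreal K1 * (\<integral>\<^sup>+u. ennreal (gauss u) * (\<integral>\<^sup>+P. indicator (pos_tuples u J) P * Wvoid (ctr P) \<partial>lborel) \<partial>lborel) = K2 * Yint J"
    by blast
  define T where "T u J = (\<integral>\<^sup>+P. indicator (pos_tuples u J) P * Wvoid (ctr P) \<partial>lborel)" for u :: "real ^ 'd" and J
  have [measurable]: "(\<lambda>u. T u J) \<in> borel_measurable borel" for J
  proof -
    have "(\<lambda>z :: (real ^ 'd) \<times> (real ^ 'd ^ 'd). if snd z \<in> pos_tuples (fst z) J then Wvoid (ctr (snd z)) else 0) \<in> borel_measurable (borel \<Otimes>\<^sub>M borel)"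
      using measurable_compose[OF measurable_snd measurable_compose[OF ctr_measurable Wm]] by measurable
    then have "(\<lambda>u. \<integral>\<^sup>+P. (if P \<in> pos_tuples u J then Wvoid (ctr P) else 0) \<partial>lborel) \<in> borel_measurable borel"
      by (intro lborel.borel_measurable_nn_integral) (simp add: split_beta' measurable_cong_sets[OF sets_pair_measure_cong[OF refl sets_lborel] refl])
    moreover have "(\<lambda>u. T u J) = (\<lambda>u. \<integral>\<^sup>+P. (if P \<in> pos_tuples u J then Wvoid (ctr P) else 0) \<partial>lborel)"
      unfolding T_def by (intro HOL.ext nn_integral_cong) (simp add: indicator_def)
    ultimately show ?thesis by simp
  qed
  let ?c = "ennreal (sqrt (2 * pi) ^ CARD('d))" let ?f = "ennreal (1 / fact CARD('d))"
  have main: "ennreal K1 * ?c * mean_faces l = (?f * K2) * (\<Sum>J\<in>{J :: 'd set. card J = l}. Yint J)" if l: "l \<le> CARD('d)" for l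
  proof -
    have "?c * mean_faces l = (\<integral>\<^sup>+u. ennreal (gauss (u :: real ^ 'd)) * mean_faces l \<partial>lborel)"
      by (subst nn_integral_multc) (simp_all add: nn_integral_gauss)
    also have "\<dots> = (\<integral>\<^sup>+u. ennreal (gauss u) * (?f * (\<Sum>J\<in>{J. card J = l}. T u J)) \<partial>lborel)"
    proof (rule nn_integral_cong_AE)
      have "AE u :: real ^ 'd in lborel. \<forall>i. u $ i \<noteq> 0" 
      proof -
        have "AE u :: real ^ 'd in lborel. u $ i \<noteq> 0" for i
        proof -
          have "{u :: real ^ 'd. u $ i = 0} \<in> null_sets lborel"
          proof (rule null_sets_if_lines_countable[where v = "axis i 1"])
            fix x :: "real ^ 'd"
            have "{t. x + t *\<^sub>R axis i 1 \<in> {u. u $ i = 0}} \<subseteq> {- x $ i}" by auto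
            then show "countable {t. x + t *\<^sub>R axis i 1 \<in> {u. u $ i = 0}}" by (rule countable_subset) simp
          qed measurable
          then show ?thesis by (auto dest: AE_not_in)
        qed
        then show ?thesis by (subst AE_all_countable) simp
      qed
      then show "AE u in lborel. ennreal (gauss u) * mean_faces l = ennreal (gauss u) * (?f * (\<Sum>J\<in>{J. card J = l}. T u J))"
      proof eventually_elim
        case (elim u)
        then show ?case using mean_num_faces[of u l] l unfolding mean_faces_def T_def by simp
      qed
    qed
    also have "\<dots> = (\<integral>\<^sup>+u. ?f * (\<Sum>J\<in>{J. card J = l}. ennreal (gauss u) * T u J) \<partial>lborel)"
      by (intro nn_integral_cong) (simp add: sum_distrib_left mult.left_commute)
    also have "\<dots> = ?f * (\<Sum>J\<in>{J. card J = l}. \<integral>\<^sup>+u. ennreal (gauss u) * T u J \<partial>lborel)"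
      by (subst nn_integral_cmult) (simp_all add: nn_integral_sum)
    finally have "ennreal K1 * (?c * mean_faces l) = ennreal K1 * (?f * (\<Sum>J\<in>{J. card J = l}. \<integral>\<^sup>+u. ennreal (gauss u) * T u J \<partial>lborel))"
      by simp
    also have "\<dots> = ?f * (\<Sum>J\<in>{J. card J = l}. ennreal K1 * (\<integral>\<^sup>+u. ennreal (gauss u) * T u J \<partial>lborel))"
      by (simp only: sum_distrib_left mult.left_commute)
    also have "\<dots> = ?f * (\<Sum>J\<in>{J :: 'd set. card J = l}. K2 * Yint J)" unfolding T_def K ..
    finally show ?thesis by (simp only: sum_distrib_left mult.assoc)
  qed
  show ?thesis
  proof (rule that[of "ennreal K1 * ?c" "?f * K2"])
    show "ennreal K1 * ?c \<noteq> 0" using K1 by simp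
    show "ennreal K1 * ?c < \<infinity>" by (simp add: ennreal_mult_less_top)
  qed (use main in simp)
qed

text \<open>Comparing the identities for l and for d cancels K, the constant C and the pi of the
  residues. The binomial coefficient counts the sets J, and each of the d - l indices outside J
  contributes a rational multiple of pi through \<open>Wr\<close>.\<close>

lemma mean_faces_odd:
  assumes d: "odd CARD('d)" and l: "odd l" "l \<le> CARD('d)"
  shows "\<exists>q\<in>\<rat>. mean_faces l = ennreal (q * pi ^ (CARD('d) - l))"
proof -
  let ?d = "CARD('d)"
  obtain j where j: "?d = 2 * j + 1" using d by (blast elim: oddE)
  obtain a K where a: "a \<noteq> 0" "a < \<infinity>" and aK: "\<And>l. l \<le> ?d \<Longrightarrow> a * mean_faces l = K * (\<Sum>J\<in>{J :: 'd set. card J = l}. Yint J)"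
    using mean_faces_proportional by blast
  define C where "C = 1 / sqrt (2 * pi) * (2 ^ j * fact j) ^ ?d"
  have C0: "C > 0" by (simp add: C_def)
  obtain q where q: "q \<in> \<rat>" "\<And>J :: 'd set. card J = l \<Longrightarrow> Yint J = ennreal (C * (2 * Wr j) ^ (?d - l) * (q * pi))"
    using Yint_value[OF j l] unfolding C_def by blast
  obtain q' where q': "q' \<in> \<rat>" "\<And>J :: 'd set. card J = ?d \<Longrightarrow> Yint J = ennreal (C * (2 * Wr j) ^ (?d - ?d) * (q' * pi))"
    using Yint_value[OF j d order_refl] unfolding C_def by blast
  have su: "(\<Sum>J\<in>{J :: 'd set. card J = l}. Yint J) = of_nat (?d choose l) * ennreal (C * (2 * Wr j) ^ (?d - l) * (q * pi))" if q: "\<And>J :: 'd set. card J = l \<Longrightarrow> Yint J = ennreal (C * (2 * Wr j) ^ (?d - l) * (q * pi))" for l q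
  proof -
    have "card {J :: 'd set. card J = l} = ?d choose l" using n_subsets[of "UNIV :: 'd set" l] by simp
    moreover have "(\<Sum>J\<in>{J :: 'd set. card J = l}. Yint J) = (\<Sum>J\<in>{J :: 'd set. card J = l}. ennreal (C * (2 * Wr j) ^ (?d - l) * (q * pi)))"
      by (rule sum.cong) (use q in auto)
    ultimately show ?thesis by (simp only: sum_constant)
  qed
  have "a = K * ennreal (C * (q' * pi))"
    using aK[OF order_refl] su[OF q'(2)] by (simp add: mean_faces_full)
  \<comment> \<open>Positivity of q' follows from the mean 1 at l = d: otherwise the right-hand
    side, even with an infinite K, would be 0, while a is nonzero.\<close>
  have q'0: "q' > 0"
  proof (rule ccontr)
    assume "\<not> q' > 0"
    then have "C * (q' * pi) \<le> 0" using C0 by (intro mult_nonneg_nonpos mult_nonpos_nonneg) auto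
    then have "ennreal (C * (q' * pi)) = 0" by (rule ennreal_neg)
    then show False using a(1) \<open>a = _\<close> by simp
  qed
  obtain p where p: "p \<in> \<rat>" "Wr j = p * pi" using Wr_rational by blast
  define r where "r = real (?d choose l) * (2 * p) ^ (?d - l) * q / q'"
  have rr: "r \<in> \<rat>" unfolding r_def by (intro Rats_divide Rats_mult Rats_power Rats_of_nat p q q') simp
  have "real (?d choose l) * (C * (2 * Wr j) ^ (?d - l) * (q * pi)) = (C * (q' * pi)) * (r * pi ^ (?d - l))"
    using q'0 by (simp add: r_def p(2) power_mult_distrib)
  then have "of_nat (?d choose l) * ennreal (C * (2 * Wr j) ^ (?d - l) * (q * pi)) = ennreal (C * (q' * pi)) * ennreal (r * pi ^ (?d - l))"
  proof -
    assume e: "real (?d choose l) * (C * (2 * Wr j) ^ (?d - l) * (q * pi)) = (C * (q' * pi)) * (r * pi ^ (?d - l))"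
    have "of_nat (?d choose l) * ennreal (C * (2 * Wr j) ^ (?d - l) * (q * pi)) = ennreal (real (?d choose l) * (C * (2 * Wr j) ^ (?d - l) * (q * pi)))"
      unfolding ennreal_of_nat_eq_real_of_nat by (rule ennreal_mult'[symmetric]) simp
    also have "\<dots> = ennreal ((C * (q' * pi)) * (r * pi ^ (?d - l)))" by (rule arg_cong[OF e])
    also have "\<dots> = ennreal (C * (q' * pi)) * ennreal (r * pi ^ (?d - l))"
      by (rule ennreal_mult') (use C0 q'0 in simp)
    finally show ?thesis .
  qed
  then have "K * (of_nat (?d choose l) * ennreal (C * (2 * Wr j) ^ (?d - l) * (q * pi))) = K * ennreal (C * (q' * pi)) * ennreal (r * pi ^ (?d - l))"
    by (simp only: mult.assoc)
  then have "a * mean_faces l = a * ennreal (r * pi ^ (?d - l))"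
    using aK[OF l(2)] su[OF q(2)] \<open>a = K * _\<close> by metis
  then have "mean_faces l = ennreal (r * pi ^ (?d - l))"
    using a by (auto simp: ennreal_mult_cancel_left)
  then show ?thesis using rr by blast
qed

end

theorem theorem2p7:
  fixes M :: "'w measure" and Phi :: "'w \<Rightarrow> (real ^ 'd) set" and l :: nat
  assumes "poisson_process M Phi"
    and "odd CARD('d)" and "odd l" and "l < CARD('d)"
  shows "\<exists>q \<in> \<rat>. (\<integral>\<^sup>+ w. ennreal (real (num_faces l (voronoi_cell0 (Phi w)))) \<partial>M)
                   = ennreal (q * pi ^ (CARD('d) - l))"
proof -
  interpret poisson_vec M Phi by unfold_locales (rule assms(1))
  show ?thesis using mean_faces_odd[OF assms(2,3)] assms(4) by (simp add: mean_faces_def)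
qed

end
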